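(* Let $K$ be a field. For a finite dimensional $K$-algebra $A$ given by a quiver (with relations), with $n$ isomorphism classes of simple modules, and for two $\tau$-tilting $A$-modules $X=\bigoplus_{i=1}^{n}X_i$ and $Y=\bigoplus_{i=1}^{n}Y_i$ with all $X_i$ and $Y_i$ indecomposable, let $( * )$ denote the following property of the pair $(X,Y)$: there is a permutation $s$ of $\{1,\ldots,n\}$ such that, for every $i$, either $X_i\simeq Y_{s(i)}$ or $\mathrm{Ext}^1_A(X_i,Y_{s(i)})\oplus \mathrm{Ext}^1_A(Y_{s(i)},X_i)\neq 0$. Then the following hold. (i) For every such $A$, $X$ and $Y$: if $X$ and $Y$ are faithful modules (that is, tilting modules), then $( * )$ holds. (ii) If $( * )$ holds and $X$ is faithful, then $Y$ is not necessarily faithful; that is, there exist such an algebra $A$ and $\tau$-tilting $A$-modules $X$ and $Y$ such that $( * )$ holds and $X$ is faithful, but $Y$ is not faithful. (iii) There is such an algebra $A$ with the following property: for all $\tau$-tilting $A$-modules $X$ and $Y$, if $( * )$ holds, then $X$ and $Y$ are both faithful.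
   Context: All modules are finite dimensional left modules. An algebra given by a quiver (with relations) is the quotient of the path algebra $KQ$ of a finite quiver $Q$ by an ideal generated by relations. Let $A$ be a finite dimensional $K$-algebra with $n$ isomorphism classes of simple modules, and let $\tau$ be the Auslander-Reiten translation of $A$. A module $T$ is $\tau$-rigid if $\mathrm{Hom}_A(T,\tau(T))=0$. It is $\tau$-tilting if it is $\tau$-rigid and is the direct sum of $n$ pairwise non-isomorphic indecomposable modules. A module $T$ is partial tilting if its projective dimension is at most one and $\mathrm{Ext}^1_A(T,T)=0$. It is tilting if it is partial tilting and the number of isomorphism classes of its indecomposable summands equals $n$. A module is faithful if its annihilator in $A$ is zero. Here $\mathrm{Ext}^1_A(X_i,Y_{s(i)})\oplus \mathrm{Ext}^1_A(Y_{s(i)},X_i)\neq 0$ means that at least one of the two Ext groups is nonzero. *)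

theory Defs
  imports
    "Graph_Theory.Arc_Walk"
    "Jordan_Normal_Form.Missing_VectorSpace"
    "HOL-Algebra.QuotRing"
    "HOL-Combinatorics.Permutations"
begin

section \<open>Algebras given by a quiver with relations\<close>

text \<open>
  A quiver is a directed multigraph (loops allowed), i.e. a \<^typ>\<open>('v, 'e) pre_digraph\<close>; a finite
  quiver is one satisfying \<^locale>\<open>fin_digraph\<close>. A path is stored as
  \<open>(source, list of arrows in the order in which they are traversed, target)\<close>, so that
  \<open>(u, [], u)\<close> is the trivial path at the vertex \<open>u\<close>.
\<close>

type_synonym ('v, 'e) qpath = "'v \<times> 'e list \<times> 'v"

definition psource :: "('v, 'e) qpath \<Rightarrow> 'v" where
  "psource p = fst p"

definition parrows :: "('v, 'e) qpath \<Rightarrow> 'e list" where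
  "parrows p = fst (snd p)"

definition ptarget :: "('v, 'e) qpath \<Rightarrow> 'v" where
  "ptarget p = snd (snd p)"

definition qpaths :: "('v, 'e) pre_digraph \<Rightarrow> ('v, 'e) qpath set" where
  "qpaths Q = {p. pre_digraph.awalk Q (psource p) (parrows p) (ptarget p)}"

text \<open>
  A \<open>K\<close>-algebra is a \<^typ>\<open>('k, 'a) module\<close> record: the ring fields carry the (noncommutative)
  ring and \<^const>\<open>smult\<close> is the action of \<open>K\<close>. An element of the path algebra is a
  finitely supported family of coefficients. The product \<open>p * q\<close> of two paths is
  ``first \<open>q\<close>, then \<open>p\<close>'' if \<open>q\<close> ends where \<open>p\<close> starts, and zero otherwise; with this order
  left modules are representations of the quiver (rather than of its opposite).
\<close>

definition path_algebra ::
    "'k ring \<Rightarrow> ('v, 'e) pre_digraph \<Rightarrow> ('k, ('v, 'e) qpath \<Rightarrow> 'k) module" where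
  "path_algebra K Q =
    \<lparr>carrier = {f. (\<forall>p. f p \<in> carrier K) \<and> finite {p. f p \<noteq> \<zero>\<^bsub>K\<^esub>}
                  \<and> (\<forall>p. p \<notin> qpaths Q \<longrightarrow> f p = \<zero>\<^bsub>K\<^esub>)},
     mult = (\<lambda>f g z. finsum K (\<lambda>(p, q). f p \<otimes>\<^bsub>K\<^esub> g q)
               {(p, q). p \<in> qpaths Q \<and> q \<in> qpaths Q \<and> ptarget q = psource p
                  \<and> z = (psource q, parrows q @ parrows p, ptarget p)}),
     one = (\<lambda>p. if p \<in> qpaths Q \<and> parrows p = [] then \<one>\<^bsub>K\<^esub> else \<zero>\<^bsub>K\<^esub>),
     zero = (\<lambda>p. \<zero>\<^bsub>K\<^esub>),
     add = (\<lambda>f g p. f p \<oplus>\<^bsub>K\<^esub> g p),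
     smult = (\<lambda>c f p. c \<otimes>\<^bsub>K\<^esub> f p)\<rparr>"

text \<open>
  A relation is a linear combination of paths of length at least two with a common source and a
  common target.
\<close>

definition quiver_relations ::
    "'k ring \<Rightarrow> ('v, 'e) pre_digraph \<Rightarrow> (('v, 'e) qpath \<Rightarrow> 'k) set" where
  "quiver_relations K Q =
    {r \<in> carrier (path_algebra K Q).
       \<exists>u v. \<forall>p. r p \<noteq> \<zero>\<^bsub>K\<^esub> \<longrightarrow>
         psource p = u \<and> ptarget p = v \<and> 2 \<le> length (parrows p)}"

text \<open>The ring \<open>R Quot I\<close> together with the induced action of \<open>K\<close>.\<close>

definition quot_algebra :: "('k, 'r) module \<Rightarrow> 'r set \<Rightarrow> ('k, 'r set) module" where
  "quot_algebra R I =
    \<lparr>carrier = carrier (R Quot I), mult = mult (R Quot I), one = one (R Quot I),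
     zero = zero (R Quot I), add = add (R Quot I),
     smult = (\<lambda>c X. \<Union>x\<in>X. I +>\<^bsub>R\<^esub> (c \<odot>\<^bsub>R\<^esub> x))\<rparr>"

definition fin_dim_space :: "'k ring \<Rightarrow> ('k, 'v) module \<Rightarrow> bool" where
  "fin_dim_space K V \<longleftrightarrow> vectorspace K V \<and> vectorspace.fin_dim K V"

type_synonym ('k, 'v, 'e) qalgebra = "('k, (('v, 'e) qpath \<Rightarrow> 'k) set) module"

definition quiver_algebra :: "'k ring \<Rightarrow> ('k, 'v, 'e) qalgebra \<Rightarrow> bool" where
  "quiver_algebra K A \<longleftrightarrow>
    (\<exists>Q \<rho>. fin_digraph Q \<and> verts Q \<noteq> {} \<and> \<rho> \<subseteq> quiver_relations K Q
       \<and> A = quot_algebra (path_algebra K Q) (genideal (path_algebra K Q) \<rho>)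
       \<and> fin_dim_space K A)"


section \<open>Modules\<close>

text \<open>
  The library locale \<^locale>\<open>module\<close> requires a commutative ring of scalars; here is its verbatim
  analogue for left modules over an arbitrary ring. As for the library's modules, the fields
  \<^const>\<open>mult\<close> and \<^const>\<open>one\<close> of the record \<open>M\<close> are irrelevant.
\<close>

locale left_module = R?: ring R + M?: abelian_group M
  for R :: "('a, 'c) ring_scheme" and M :: "('a, 'm, 'd) module_scheme" +
  assumes smult_closed:
      "\<lbrakk>a \<in> carrier R; x \<in> carrier M\<rbrakk> \<Longrightarrow> a \<odot>\<^bsub>M\<^esub> x \<in> carrier M"
    and smult_l_distr:
      "\<lbrakk>a \<in> carrier R; b \<in> carrier R; x \<in> carrier M\<rbrakk> \<Longrightarrow>
        (a \<oplus>\<^bsub>R\<^esub> b) \<odot>\<^bsub>M\<^esub> x = a \<odot>\<^bsub>M\<^esub> x \<oplus>\<^bsub>M\<^esub> b \<odot>\<^bsub>M\<^esub> x"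
    and smult_r_distr:
      "\<lbrakk>a \<in> carrier R; x \<in> carrier M; y \<in> carrier M\<rbrakk> \<Longrightarrow>
        a \<odot>\<^bsub>M\<^esub> (x \<oplus>\<^bsub>M\<^esub> y) = a \<odot>\<^bsub>M\<^esub> x \<oplus>\<^bsub>M\<^esub> a \<odot>\<^bsub>M\<^esub> y"
    and smult_assoc1:
      "\<lbrakk>a \<in> carrier R; b \<in> carrier R; x \<in> carrier M\<rbrakk> \<Longrightarrow>
        (a \<otimes>\<^bsub>R\<^esub> b) \<odot>\<^bsub>M\<^esub> x = a \<odot>\<^bsub>M\<^esub> (b \<odot>\<^bsub>M\<^esub> x)"
    and smult_one:
      "x \<in> carrier M \<Longrightarrow> \<one>\<^bsub>R\<^esub> \<odot>\<^bsub>M\<^esub> x = x"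

text \<open>The \<open>K\<close>-space underlying a module over the \<open>K\<close>-algebra \<open>A\<close>: \<open>c\<close> acts as \<open>c \<cdot> 1\<close>.\<close>

definition restrict_scalars :: "('k, 'a) module \<Rightarrow> ('a, 'm) module \<Rightarrow> ('k, 'm) module" where
  "restrict_scalars A M =
    \<lparr>carrier = carrier M, mult = mult M, one = one M, zero = zero M, add = add M,
     smult = (\<lambda>c x. (c \<odot>\<^bsub>A\<^esub> \<one>\<^bsub>A\<^esub>) \<odot>\<^bsub>M\<^esub> x)\<rparr>"

definition fd_module :: "'k ring \<Rightarrow> ('k, 'a) module \<Rightarrow> ('a, 'm) module \<Rightarrow> bool" where
  "fd_module K A M \<longleftrightarrow> left_module A M \<and> fin_dim_space K (restrict_scalars A M)"

text \<open>
  The definitions below are polymorphic in the type of module elements, but whenever one of them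
  quantifies over modules (or chooses one), the module has its elements in \<^typ>\<open>nat \<Rightarrow> 'k\<close>. This
  is no restriction: every finite dimensional \<open>K\<close>-space is isomorphic to the space of functions
  from \<open>{0..<d}\<close> to \<open>K\<close>, so every finite dimensional module has an isomorphic copy of this type.
\<close>

type_synonym ('k, 'a) std_module = "('a, nat \<Rightarrow> 'k) module"

text \<open>Homomorphisms are extensional, so that \<open>mod_Hom A M N\<close> is the honest Hom-set.\<close>

definition mod_Hom :: "('k, 'a) module \<Rightarrow> ('a, 'm) module \<Rightarrow> ('a, 'n) module \<Rightarrow> ('m \<Rightarrow> 'n) set" where
  "mod_Hom A M N = module_hom A M N \<inter> extensional (carrier M)"

definition zero_map :: "('a, 'm) module \<Rightarrow> ('a, 'n) module \<Rightarrow> 'm \<Rightarrow> 'n" where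
  "zero_map M N = (\<lambda>x\<in>carrier M. \<zero>\<^bsub>N\<^esub>)"

definition mod_iso :: "('k, 'a) module \<Rightarrow> ('a, 'm) module \<Rightarrow> ('a, 'n) module \<Rightarrow> bool" where
  "mod_iso A M N \<longleftrightarrow> (\<exists>f\<in>mod_Hom A M N. bij_betw f (carrier M) (carrier N))"

definition mod_epi ::
    "('k, 'a) module \<Rightarrow> ('a, 'm) module \<Rightarrow> ('a, 'n) module \<Rightarrow> ('m \<Rightarrow> 'n) \<Rightarrow> bool" where
  "mod_epi A M N f \<longleftrightarrow> f \<in> mod_Hom A M N \<and> f ` carrier M = carrier N"

text \<open>
  \<^const>\<open>Module.submodule\<close> does not presuppose that \<open>A\<close> is commutative, unlike its namesake
  \<^const>\<open>LinearCombinations.submodule\<close>.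
\<close>

abbreviation submod :: "('k, 'a) module \<Rightarrow> ('a, 'm) module \<Rightarrow> 'm set \<Rightarrow> bool" where
  "submod A M U \<equiv> Module.submodule U A M"

definition internal_direct_sum ::
    "('k, 'a) module \<Rightarrow> ('a, 'm) module \<Rightarrow> 'm set \<Rightarrow> 'm set \<Rightarrow> bool" where
  "internal_direct_sum A M U V \<longleftrightarrow>
     submod A M U \<and> submod A M V \<and> U <+>\<^bsub>M\<^esub> V = carrier M \<and> U \<inter> V = {\<zero>\<^bsub>M\<^esub>}"

definition simple_module :: "'k ring \<Rightarrow> ('k, 'a) module \<Rightarrow> ('a, 'm) module \<Rightarrow> bool" where
  "simple_module K A M \<longleftrightarrow> fd_module K A M \<and> carrier M \<noteq> {\<zero>\<^bsub>M\<^esub>}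
     \<and> (\<forall>U. submod A M U \<longrightarrow> U = {\<zero>\<^bsub>M\<^esub>} \<or> U = carrier M)"

definition indecomposable :: "'k ring \<Rightarrow> ('k, 'a) module \<Rightarrow> ('a, 'm) module \<Rightarrow> bool" where
  "indecomposable K A M \<longleftrightarrow> fd_module K A M \<and> carrier M \<noteq> {\<zero>\<^bsub>M\<^esub>}
     \<and> (\<forall>U V. internal_direct_sum A M U V \<longrightarrow> U = {\<zero>\<^bsub>M\<^esub>} \<or> V = {\<zero>\<^bsub>M\<^esub>})"

definition direct_sum :: "'i set \<Rightarrow> ('i \<Rightarrow> ('a, 'm) module) \<Rightarrow> ('a, 'i \<Rightarrow> 'm) module" where
  "direct_sum I M =
    \<lparr>carrier = (\<Pi>\<^sub>E i\<in>I. carrier (M i)), mult = undefined, one = undefined,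
     zero = (\<lambda>i\<in>I. \<zero>\<^bsub>M i\<^esub>),
     add = (\<lambda>x y. \<lambda>i\<in>I. x i \<oplus>\<^bsub>M i\<^esub> y i),
     smult = (\<lambda>a x. \<lambda>i\<in>I. a \<odot>\<^bsub>M i\<^esub> x i)\<rparr>"

definition direct_summand ::
    "('k, 'a) module \<Rightarrow> ('a, 'm) module \<Rightarrow> ('a, 'n) module \<Rightarrow> bool" where
  "direct_summand A S M \<longleftrightarrow>
     (\<exists>U V. internal_direct_sum A M U V \<and> mod_iso A S (M\<lparr>carrier := U\<rparr>))"

definition iso_classes :: "('k, 'a) module \<Rightarrow> ('a, 'm) module set \<Rightarrow> ('a, 'm) module set set" where
  "iso_classes A C = C // {(M, N). M \<in> C \<and> N \<in> C \<and> mod_iso A M N}"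

definition num_simples :: "'k ring \<Rightarrow> ('k, 'a) module \<Rightarrow> nat" where
  "num_simples K A = card (iso_classes A {S :: ('k, 'a) std_module. simple_module K A S})"

definition annihilator :: "('k, 'a) module \<Rightarrow> ('a, 'm) module \<Rightarrow> 'a set" where
  "annihilator A M = {a \<in> carrier A. \<forall>x\<in>carrier M. a \<odot>\<^bsub>M\<^esub> x = \<zero>\<^bsub>M\<^esub>}"

definition faithful :: "('k, 'a) module \<Rightarrow> ('a, 'm) module \<Rightarrow> bool" where
  "faithful A M \<longleftrightarrow> annihilator A M = {\<zero>\<^bsub>A\<^esub>}"

definition quot_module :: "('a, 'm) module \<Rightarrow> 'm set \<Rightarrow> ('a, 'm set) module" where
  "quot_module M U =
    \<lparr>carrier = a_rcosets\<^bsub>M\<^esub> U, mult = undefined, one = undefined,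
     zero = U, add = set_add M,
     smult = (\<lambda>a X. \<Union>x\<in>X. U +>\<^bsub>M\<^esub> (a \<odot>\<^bsub>M\<^esub> x))\<rparr>"


section \<open>Projective modules and the Ext group\<close>

text \<open>Projectivity in the category of finite dimensional left modules.\<close>

definition projective :: "'k ring \<Rightarrow> ('k, 'a) module \<Rightarrow> ('a, 'm) module \<Rightarrow> bool" where
  "projective K A P \<longleftrightarrow> fd_module K A P
     \<and> (\<forall>(M :: ('k, 'a) std_module) (N :: ('k, 'a) std_module) f g.
          fd_module K A M \<and> fd_module K A N \<and> mod_epi A M N f \<and> g \<in> mod_Hom A P N \<longrightarrow>
          (\<exists>h\<in>mod_Hom A P M. compose (carrier P) f h = g))"

text \<open>An exact sequence \<open>P2 \<rightarrow> P1 \<rightarrow> P0 \<rightarrow> M \<rightarrow> 0\<close> with maps \<open>d2, d1, d0\<close> and projective \<open>Pi\<close>.\<close>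

definition proj_resolution ::
    "'k ring \<Rightarrow> ('k, 'a) module \<Rightarrow> ('a, 'm) module \<Rightarrow>
     ('a, 'p) module \<times> ('p \<Rightarrow> 'p) \<times> ('a, 'p) module \<times> ('p \<Rightarrow> 'p) \<times> ('a, 'p) module \<times> ('p \<Rightarrow> 'm)
     \<Rightarrow> bool" where
  "proj_resolution K A M = (\<lambda>(P2, d2, P1, d1, P0, d0).
     projective K A P2 \<and> projective K A P1 \<and> projective K A P0
     \<and> mod_epi A P0 M d0
     \<and> d1 \<in> mod_Hom A P1 P0 \<and> d1 ` carrier P1 = a_kernel P0 M d0
     \<and> d2 \<in> mod_Hom A P2 P1 \<and> d2 ` carrier P2 = a_kernel P1 P0 d1)"

definition Hom_group ::
    "('k, 'a) module \<Rightarrow> ('a, 'm) module \<Rightarrow> ('a, 'n) module \<Rightarrow> ('m \<Rightarrow> 'n) monoid" where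
  "Hom_group A M N =
    \<lparr>carrier = mod_Hom A M N,
     mult = (\<lambda>f g. \<lambda>x\<in>carrier M. f x \<oplus>\<^bsub>N\<^esub> g x),
     one = zero_map M N\<rparr>"

text \<open>
  \<open>Ext\<^sup>1(M, N)\<close> is the cohomology at the middle term of
  \<open>Hom(P0, N) \<rightarrow> Hom(P1, N) \<rightarrow> Hom(P2, N)\<close>, written as a (multiplicatively denoted) group, for the
  beginning \<open>P2 \<rightarrow> P1 \<rightarrow> P0 \<rightarrow> M \<rightarrow> 0\<close> of some projective resolution of \<open>M\<close>.
\<close>

definition Ext1 ::
    "'k ring \<Rightarrow> ('k, 'a) module \<Rightarrow> ('a, 'm) module \<Rightarrow> ('a, 'n) module
     \<Rightarrow> ((nat \<Rightarrow> 'k) \<Rightarrow> 'n) set monoid" where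
  "Ext1 K A M N =
    (case (SOME r. proj_resolution K A M r) of
       (P2 :: ('k, 'a) std_module, d2, P1 :: ('k, 'a) std_module, d1, P0 :: ('k, 'a) std_module, d0) \<Rightarrow>
         (Hom_group A P1 N)
             \<lparr>carrier := kernel (Hom_group A P1 N) (Hom_group A P2 N) (\<lambda>f. compose (carrier P2) f d2)\<rparr>
           Mod ((\<lambda>f. compose (carrier P1) f d1) ` mod_Hom A P0 N))"

definition Ext1_zero :: "'k ring \<Rightarrow> ('k, 'a) module \<Rightarrow> ('a, 'm) module \<Rightarrow> ('a, 'n) module \<Rightarrow> bool" where
  "Ext1_zero K A M N \<longleftrightarrow> carrier (Ext1 K A M N) = {\<one>\<^bsub>Ext1 K A M N\<^esub>}"

text \<open>
  Projective dimension at most one: there is an exact sequence \<open>0 \<rightarrow> P1 \<rightarrow> P0 \<rightarrow> M \<rightarrow> 0\<close> with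
  \<open>P1\<close> and \<open>P0\<close> projective.
\<close>

definition proj_dim_le_one :: "'k ring \<Rightarrow> ('k, 'a) module \<Rightarrow> ('a, 'm) module \<Rightarrow> bool" where
  "proj_dim_le_one K A M \<longleftrightarrow>
    (\<exists>(P1 :: ('k, 'a) std_module) (P0 :: ('k, 'a) std_module) d1 d0.
       projective K A P1 \<and> projective K A P0 \<and> mod_epi A P0 M d0
       \<and> d1 \<in> mod_Hom A P1 P0 \<and> d1 ` carrier P1 = a_kernel P0 M d0
       \<and> inj_on d1 (carrier P1))"

definition partial_tilting :: "'k ring \<Rightarrow> ('k, 'a) module \<Rightarrow> ('a, 'm) module \<Rightarrow> bool" where
  "partial_tilting K A T \<longleftrightarrow> fd_module K A T \<and> proj_dim_le_one K A T \<and> Ext1_zero K A T T"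

definition tilting :: "'k ring \<Rightarrow> ('k, 'a) module \<Rightarrow> ('a, 'm) module \<Rightarrow> bool" where
  "tilting K A T \<longleftrightarrow> partial_tilting K A T
     \<and> card (iso_classes A {S :: ('k, 'a) std_module. indecomposable K A S \<and> direct_summand A S T})
       = num_simples K A"


section \<open>The Auslander-Reiten translation\<close>

definition superfluous :: "('k, 'a) module \<Rightarrow> ('a, 'm) module \<Rightarrow> 'm set \<Rightarrow> bool" where
  "superfluous A M L \<longleftrightarrow>
     (\<forall>U. submod A M U \<and> U <+>\<^bsub>M\<^esub> L = carrier M \<longrightarrow> U = carrier M)"

text \<open>
  A minimal projective presentation \<open>P1 \<rightarrow> P0 \<rightarrow> M \<rightarrow> 0\<close>: both \<open>P0 \<rightarrow> M\<close> and \<open>P1 \<rightarrow> ker d0\<close> are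
  projective covers, i.e. epimorphisms from projectives with superfluous kernel.
\<close>

definition min_proj_presentation ::
    "'k ring \<Rightarrow> ('k, 'a) module \<Rightarrow> ('a, 'm) module \<Rightarrow>
     ('a, 'p) module \<times> ('p \<Rightarrow> 'p) \<times> ('a, 'p) module \<times> ('p \<Rightarrow> 'm) \<Rightarrow> bool" where
  "min_proj_presentation K A M = (\<lambda>(P1, d1, P0, d0).
     projective K A P1 \<and> projective K A P0
     \<and> mod_epi A P0 M d0 \<and> superfluous A P0 (a_kernel P0 M d0)
     \<and> d1 \<in> mod_Hom A P1 P0 \<and> d1 ` carrier P1 = a_kernel P0 M d0
     \<and> superfluous A P1 (a_kernel P1 P0 d1))"

definition regular_module :: "('a, 'z) ring_scheme \<Rightarrow> ('a, 'a) module" where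
  "regular_module R =
    \<lparr>carrier = carrier R, mult = undefined, one = undefined,
     zero = \<zero>\<^bsub>R\<^esub>, add = add R, smult = mult R\<rparr>"

text \<open>
  Right \<open>A\<close>-modules are left modules over the opposite algebra, so the action \<open>x a\<close> of a right module
  \<open>N\<close> is written \<open>a \<odot>\<^bsub>N\<^esub> x\<close>. The right module \<open>Hom\<^sub>A(P, A)\<close> carries the
  action \<open>(f a)(x) = f(x) a\<close>.
\<close>

definition A_dual :: "('k, 'a) module \<Rightarrow> ('a, 'm) module \<Rightarrow> ('a, 'm \<Rightarrow> 'a) module" where
  "A_dual A P =
    \<lparr>carrier = mod_Hom A P (regular_module A), mult = undefined, one = undefined,
     zero = zero_map P (regular_module A),
     add = (\<lambda>f g. \<lambda>x\<in>carrier P. f x \<oplus>\<^bsub>A\<^esub> g x),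
     smult = (\<lambda>a f. \<lambda>x\<in>carrier P. f x \<otimes>\<^bsub>A\<^esub> a)\<rparr>"

text \<open>
  The \<open>K\<close>-dual \<open>D N = Hom\<^sub>K(N, K)\<close> of a right \<open>A\<close>-module \<open>N\<close>, a left \<open>A\<close>-module via
  \<open>(a \<phi>)(x) = \<phi>(x a)\<close>.
\<close>

definition K_dual :: "'k ring \<Rightarrow> ('k, 'a) module \<Rightarrow> ('a, 'm) module \<Rightarrow> ('a, 'm \<Rightarrow> 'k) module" where
  "K_dual K A N =
    \<lparr>carrier = module_hom K (restrict_scalars A N) (regular_module K) \<inter> extensional (carrier N),
     mult = undefined, one = undefined,
     zero = (\<lambda>x\<in>carrier N. \<zero>\<^bsub>K\<^esub>),
     add = (\<lambda>\<phi> \<psi>. \<lambda>x\<in>carrier N. \<phi> x \<oplus>\<^bsub>K\<^esub> \<psi> x),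
     smult = (\<lambda>a \<phi>. \<lambda>x\<in>carrier N. \<phi> (a \<odot>\<^bsub>N\<^esub> x))\<rparr>"

text \<open>The cokernel of \<open>Hom\<^sub>A(d, A) : Hom\<^sub>A(P0, A) \<rightarrow> Hom\<^sub>A(P1, A)\<close> for \<open>d : P1 \<rightarrow> P0\<close>, a right module.\<close>

definition transpose_of ::
    "('k, 'a) module \<Rightarrow> ('a, 'p) module \<Rightarrow> ('p \<Rightarrow> 'p) \<Rightarrow> ('a, 'p) module
     \<Rightarrow> ('a, ('p \<Rightarrow> 'a) set) module" where
  "transpose_of A P1 d P0 =
     quot_module (A_dual A P1) ((\<lambda>f. compose (carrier P1) f d) ` carrier (A_dual A P0))"

text \<open>\<open>\<tau> M = D Tr M\<close>, computed from some minimal projective presentation of \<open>M\<close>.\<close>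

definition AR_translate ::
    "'k ring \<Rightarrow> ('k, 'a) module \<Rightarrow> ('a, 'm) module
     \<Rightarrow> ('a, ((nat \<Rightarrow> 'k) \<Rightarrow> 'a) set \<Rightarrow> 'k) module" where
  "AR_translate K A M =
    (case (SOME r. min_proj_presentation K A M r) of
       (P1 :: ('k, 'a) std_module, d1, P0 :: ('k, 'a) std_module, d0) \<Rightarrow>
         K_dual K A (transpose_of A P1 d1 P0))"

definition tau_rigid :: "'k ring \<Rightarrow> ('k, 'a) module \<Rightarrow> ('a, 'm) module \<Rightarrow> bool" where
  "tau_rigid K A T \<longleftrightarrow> fd_module K A T
     \<and> mod_Hom A T (AR_translate K A T) = {zero_map T (AR_translate K A T)}"

definition tau_tilting :: "'k ring \<Rightarrow> ('k, 'a) module \<Rightarrow> ('a, 'm) module \<Rightarrow> bool" where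
  "tau_tilting K A T \<longleftrightarrow> tau_rigid K A T
     \<and> (\<exists>X :: nat \<Rightarrow> ('k, 'a) std_module.
          (\<forall>i\<in>{1..num_simples K A}. indecomposable K A (X i))
          \<and> (\<forall>i\<in>{1..num_simples K A}. \<forall>j\<in>{1..num_simples K A}. i \<noteq> j \<longrightarrow> \<not> mod_iso A (X i) (X j))
          \<and> mod_iso A T (direct_sum {1..num_simples K A} X))"


section \<open>The property of a pair of tau-tilting modules\<close>

definition total_sum ::
    "'k ring \<Rightarrow> ('k, 'a) module \<Rightarrow> (nat \<Rightarrow> ('a, 'm) module) \<Rightarrow> ('a, nat \<Rightarrow> 'm) module" where
  "total_sum K A X = direct_sum {1..num_simples K A} X"

definition tau_tilting_family ::
    "'k ring \<Rightarrow> ('k, 'a) module \<Rightarrow> (nat \<Rightarrow> ('k, 'a) std_module) \<Rightarrow> bool" where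
  "tau_tilting_family K A X \<longleftrightarrow>
     (\<forall>i\<in>{1..num_simples K A}. indecomposable K A (X i)) \<and> tau_tilting K A (total_sum K A X)"

definition ext_matched ::
    "'k ring \<Rightarrow> ('k, 'a) module
     \<Rightarrow> (nat \<Rightarrow> ('k, 'a) std_module) \<Rightarrow> (nat \<Rightarrow> ('k, 'a) std_module) \<Rightarrow> bool" where
  "ext_matched K A X Y \<longleftrightarrow>
     (\<exists>s. s permutes {1..num_simples K A}
        \<and> (\<forall>i\<in>{1..num_simples K A}. mod_iso A (X i) (Y (s i))
             \<or> \<not> Ext1_zero K A (X i) (Y (s i)) \<or> \<not> Ext1_zero K A (Y (s i)) (X i)))"

end

theory Submission
  imports Defs
begin

text \<open>
  Let \<open>d : P1 \<rightarrow> P0\<close> present \<open>M\<close> minimally. Then \<open>Hom(N, \<tau> M) = 0\<close> says that every map \<open>P1 \<rightarrow> N\<close>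
  factors through \<open>d\<close>. If indecomposables \<open>T_j\<close> are pairwise non-isomorphic and orthogonal in this sense, the
  forms \<open>N \<mapsto> dim Hom(P0_j, N) - dim Hom(P1_j, N)\<close> are linearly independent (approximate \<open>T_i\<close> by the
  other \<open>T_j\<close> and look at the cokernel, or at the torsionfree part of the kernel), and they only depend on the
  composition factors of \<open>N\<close>; so there are at most \<open>n\<close> of them. If \<open>X\<close> is faithful, or tilting, then \<open>d\<close> is injective
  for its summands, and the vanishing of \<open>Ext\<close> gives the factorisation property. If no matching existed, Hall's
  theorem would yield more than \<open>n\<close> summands of \<open>X\<close> and \<open>Y\<close> which are orthogonal.

  For (ii), take the quiver with an arrow from 1 to 2 and a loop at 2, with all paths of length two equal to zero, and
  \<open>X = P_1 + P_2\<close>, \<open>Y = P_1 + S_1\<close>. For (iii), take \<open>A = K\<close>.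
\<close>

text \<open>A map from N to tau M = D Tr M is the same as a K-valued balanced pairing of N with
  Hom(P1, A) that vanishes on the maps factoring through d. As P1 is projective, the maps p |-> f(p)
  y generate Hom(P1, N), so such pairings are functionals on the cokernel of Hom(d, N). Hence Hom(N,
  tau M) = 0 becomes the predicate \<open>lifts\<close>, which makes sense for every presentation,
  whereas tau refers to a chosen minimal one; comparison of presentations bridges the gap.
  Faithfulness enters through the same generators: if p |-> f(p) y factors through d, it kills the
  kernel of d, so f(x) annihilates y for every x in the kernel. Injectivity of d is what turns
  vanishing of Ext^1(M, N) into \<open>lifts\<close>, because then P1 is the whole kernel of P0 ->
  M. A technical obstacle is that the definitions quantify over modules with elements in
  \<open>nat => 'k\<close> only. Lifting properties are therefore first extended to arbitrary
  element types, direct sums are handled through inclusions and projections, and quotients are built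
  on representatives.\<close>

type_synonym ('k, 'a) smod = "('k, 'a) std_module"

abbreviation "car \<equiv> carrier"

section \<open>Finite dimensional modules\<close>

abbreviation vdim :: "'k ring => ('k, 'v) module => nat" where
 "vdim K V \<equiv> vectorspace.dim K V"

lemma fdsD:
 assumes "fin_dim_space K V"
 shows "vectorspace K V" "vectorspace.fin_dim K V"
 using assms unfolding fin_dim_space_def by auto

lemma linear_mapI:
 assumes "vectorspace K V" "vectorspace K W" "f : module_hom K V W"
 shows "linear_map K V W f"
 using assms unfolding linear_map_def mod_hom_def mod_hom_axioms_def vectorspace_def by auto

lemma fin_dim_space_surj:
 assumes "fin_dim_space K V" "vectorspace K W" "f : module_hom K V W" "f ` car V = car W"
 shows "fin_dim_space K W"
 using linear_map.surj_fin_dim[OF linear_mapI[OF fdsD(1)[OF assms(1)] assms(2,3)]]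
  fdsD[OF assms(1)] assms unfolding fin_dim_space_def by auto

lemma vdim_rank_nullity:
 assumes "fin_dim_space K V" "vectorspace K W" "f : module_hom K V W"
 shows "vdim K V = vdim K (W(|carrier := f ` car V|)) + vdim K (V(|carrier := {v : car V. f v = \<zero>\<^bsub>W\<^esub>}|))"
proof -
 interpret linear_map K V W f
  using assms fdsD linear_mapI by blast
 show ?thesis
  using rank_nullity[OF fdsD(2)[OF assms(1)]] unfolding im_def ker_def by simp
qed

text \<open>An independent subset of U is independent in V, so it has at most \<open>V.dim\<close>
  elements and a maximal one exists; it is a basis of U. If the dimensions agree, the same set is a
  basis of V.\<close>

lemma fin_dim_space_subspace:
 assumes V: "fin_dim_space K V" and U: "subspace K U V"
 shows "fin_dim_space K (V(|carrier := U|))" "vdim K (V(|carrier := U|)) \<le> vdim K V"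
  "vdim K (V(|carrier := U|)) = vdim K V ==> U = car V"
proof -
 interpret V: vectorspace K V using fdsD[OF V] by auto
 have fd: "V.fin_dim" using fdsD[OF V] by auto
 have sub: "LinearCombinations.submodule K U V" using U by simp
 have UV: "U <= car V" using sub by (simp add: LinearCombinations.submodule_def)
 interpret U: vectorspace K "V(|carrier := U|)" using V.subspace_is_vs[OF U] .
 have small: "finite A & card A \<le> V.dim" if "A <= U & U.lin_indpt A" for A
  using V.li_le_dim[OF fd, of A] V.module.span_li_not_depend(2)[OF _ sub, of A] that UV by auto
 have "EX A. finite A & maximal A (%S. S <= car (V(|carrier := U|)) & U.lin_indpt S)"
 proof (rule maximal_exists[where N = "V.dim" and B = "{}"])
  fix A assume "A <= car (V(|carrier := U|)) & U.lin_indpt A"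
  then show "finite A & card A \<le> V.dim" using small[of A] by simp
 qed (simp add: U.lin_dep_def)
 then obtain A where fA: "finite A"
  and mA: "maximal A (%S. S <= car (V(|carrier := U|)) & U.lin_indpt S)" by blast
 have bA: "U.basis A" by (rule U.max_li_is_basis[OF mA])
 have AU: "A <= U" and lA: "U.lin_indpt A" and gA: "U.span A = U"
  using bA unfolding U.basis_def by auto
 have "U.fin_dim" unfolding U.fin_dim_def using fA AU gA by auto
 then show fU: "fin_dim_space K (V(|carrier := U|))"
  unfolding fin_dim_space_def using U.vectorspace_axioms by auto
 have dU: "U.dim = card A" using U.dim_basis[OF fA bA] .
 then show "U.dim \<le> V.dim" using small[of A] AU lA by auto
 assume "U.dim = V.dim"
 then have "V.basis A"
  using V.dim_li_is_basis[OF fd fA] AU UV lA dU V.module.span_li_not_depend(2)[OF AU sub] by auto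
 then have "V.span A = car V" unfolding V.basis_def by auto
 then show "U = car V" using gA V.module.span_li_not_depend(1)[OF AU sub] by auto
qed

lemma fin_dim_space_sum:
 assumes V: "vectorspace K V" and U: "subspace K U V" and W: "subspace K W V"
  and fU: "fin_dim_space K (V(|carrier := U|))" and fW: "fin_dim_space K (V(|carrier := W|))"
  and sum: "!!v. v : car V ==> EX u:U. EX w:W. v = u \<oplus>\<^bsub>V\<^esub> w"
 shows "fin_dim_space K V"
proof -
 interpret V: vectorspace K V by fact
 have subU: "LinearCombinations.submodule K U V" and subW: "LinearCombinations.submodule K W V"
  using U W by simp_all
 interpret U: vectorspace K "V(|carrier := U|)" using V.subspace_is_vs[OF U] .
 interpret W: vectorspace K "V(|carrier := W|)" using V.subspace_is_vs[OF W] .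
 obtain A where A: "finite A" "A <= U" "U.span A = U"
  using fdsD(2)[OF fU] unfolding U.fin_dim_def by auto
 obtain B where B: "finite B" "B <= W" "W.span B = W"
  using fdsD(2)[OF fW] unfolding W.fin_dim_def by auto
 have UV: "U <= car V" and WV: "W <= car V"
  using subU subW by (simp_all add: LinearCombinations.submodule_def)
 have ABV: "A \<union> B <= car V" using A B UV WV by auto
 have sp: "LinearCombinations.submodule K (V.span (A \<union> B)) V" by (rule V.span_is_submodule[OF ABV])
 have "U <= V.span (A \<union> B)"
  using A V.module.span_li_not_depend(1)[OF A(2) subU] V.span_is_monotone[of A "A \<union> B"] by auto
 moreover have "W <= V.span (A \<union> B)"
  using B V.module.span_li_not_depend(1)[OF B(2) subW] V.span_is_monotone[of B "A \<union> B"] by auto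
 ultimately have "v : V.span (A \<union> B)" if "v : car V" for v
  using sum[OF that] LinearCombinations.submodule.m_closed[OF sp] by blast
 then have "V.span (A \<union> B) = car V" using V.span_is_subset2[OF ABV] by blast
 then have "V.fin_dim" unfolding V.fin_dim_def using A B ABV by auto
 then show ?thesis unfolding fin_dim_space_def using V by auto
qed

text \<open>V is the image of the subspace f(V) of W under the inverse of f, and finite dimension
  passes to subspaces and to images.\<close>

lemma fin_dim_space_inj:
 assumes V: "vectorspace K V" and W: "fin_dim_space K W" and f: "f : module_hom K V W"
  and inj: "inj_on f (car V)"
 shows "fin_dim_space K V"
proof -
 interpret linear_map K V W f
  using assms fdsD linear_mapI by blast
 have fI: "fin_dim_space K (W(|carrier := f ` car V|))"
  using fin_dim_space_subspace(1)[OF W] imT_is_subspace unfolding im_def .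
 define g where "g = inv_into (car V) f"
 have gf: "g (f x) = x" if "x : car V" for x
  using that inj unfolding g_def by simp
 have "g : module_hom K (W(|carrier := f ` car V|)) V"
  unfolding module_hom_def
 proof (safe)
  fix x y assume "x : car (W(|carrier := f ` car V|))" "y : car (W(|carrier := f ` car V|))"
  then obtain u v where uv: "u : car V" "v : car V" "x = f u" "y = f v" by auto
  then have "x \<oplus>\<^bsub>W\<^esub> y = f (u \<oplus>\<^bsub>V\<^esub> v)" by simp
  then show "g (x \<oplus>\<^bsub>W(|carrier := f ` car V|)\<^esub> y) = g x \<oplus>\<^bsub>V\<^esub> g y"
   using uv gf[of "u \<oplus>\<^bsub>V\<^esub> v"] gf by simp
 next
  fix r x assume r: "r : car K" and "x : car (W(|carrier := f ` car V|))"
  then obtain u where u: "u : car V" "x = f u" by auto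
  then have "r \<odot>\<^bsub>W\<^esub> x = f (r \<odot>\<^bsub>V\<^esub> u)" using r by simp
  then show "g (r \<odot>\<^bsub>W(|carrier := f ` car V|)\<^esub> x) = r \<odot>\<^bsub>V\<^esub> g x"
   using u r gf[of "r \<odot>\<^bsub>V\<^esub> u"] gf by simp
 next
  fix x assume "x : car (W(|carrier := f ` car V|))"
  then show "g x : car V" using gf by auto
 qed
 moreover have "g ` car (W(|carrier := f ` car V|)) = car V"
  using gf by (auto simp: image_image)
 ultimately show ?thesis using fin_dim_space_surj[OF fI V] by blast
qed

lemma vdim_zero:
 assumes "fin_dim_space K V"
 shows "vdim K V = 0 \<longleftrightarrow> car V = {\<zero>\<^bsub>V\<^esub>}"
proof -
 interpret V: vectorspace K V using fdsD[OF assms] by auto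
 have z: "LinearCombinations.submodule K {\<zero>\<^bsub>V\<^esub>} V"
  by (auto simp: LinearCombinations.submodule_def V.module_axioms)
 have sz: "subspace K {\<zero>\<^bsub>V\<^esub>} V" by (simp add: subspace_def z V.vectorspace_axioms)
 interpret Z: vectorspace K "V(|carrier := {\<zero>\<^bsub>V\<^esub>}|)" by (rule V.subspace_is_vs[OF sz])
 have "Z.gen_set {}" by (simp add: Z.span_empty)
 then have d0: "Z.dim = 0" using Z.gen_ge_dim[of "{}"] by auto
 show ?thesis
 proof
  assume "V.dim = 0"
  then show "car V = {\<zero>\<^bsub>V\<^esub>}"
   using fin_dim_space_subspace(3)[OF assms sz] d0 by auto
 next
  assume "car V = {\<zero>\<^bsub>V\<^esub>}"
  then have "V = V(|carrier := {\<zero>\<^bsub>V\<^esub>}|)" by auto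
  then show "V.dim = 0" using d0 by simp
 qed
qed

text \<open>Among the subspaces that contain U and avoid g, one of maximal dimension, W, is a
  complement of the line through g. The functional is, up to sign, the coordinate along g modulo
  W.\<close>

lemma separating_functional:
 assumes V: "fin_dim_space K V" and U: "subspace K U V" and g: "g : car V" "g \<notin> U"
 shows "EX ph : module_hom K V (regular_module K). (ALL u:U. ph u = \<zero>\<^bsub>K\<^esub>) & ph g ~= \<zero>\<^bsub>K\<^esub>"
proof -
 interpret V: vectorspace K V using fdsD[OF V] by auto
 define P where "P W \<longleftrightarrow> subspace K W V & U <= W & g \<notin> W" for W
 have "EX W. P W & (ALL W'. P W' --> vdim K (V(|carrier := W'|)) \<le> vdim K (V(|carrier := W|)))"
  apply (rule ex_has_greatest_nat[of P U _ "Suc (vdim K V)"])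
  using fin_dim_space_subspace(2)[OF V] U g by (auto simp: P_def less_Suc_eq_le)
 then obtain W where W: "subspace K W V" "U <= W" "g \<notin> W"
  and max: "!!W'. P W' ==> vdim K (V(|carrier := W'|)) \<le> vdim K (V(|carrier := W|))"
  unfolding P_def by blast
 have sW: "LinearCombinations.submodule K W V" using W by simp
 have WV: "W <= car V" and W0: "\<zero>\<^bsub>V\<^esub> : W" 
  and Wadd: "!!x y. x : W ==> y : W ==> x \<oplus>\<^bsub>V\<^esub> y : W"
  and Wsm: "!!c x. c : car K ==> x : W ==> c \<odot>\<^bsub>V\<^esub> x : W"
  using sW by (auto simp: LinearCombinations.submodule_def)
 have Wneg: "\<ominus>\<^bsub>V\<^esub> x : W" if "x : W" for x
  using Wsm[of "\<ominus>\<^bsub>K\<^esub> \<one>\<^bsub>K\<^esub>" x] that WV V.smult_minus_1[of x] by auto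
 \<comment> \<open>If v is outside W, maximality forces g into W + K v, and the coefficient of v in
   g is invertible because g is not in W. Solving for v gives the scalar.\<close>
 have ex: "EX c:car K. v \<oplus>\<^bsub>V\<^esub> c \<odot>\<^bsub>V\<^esub> g : W" if v: "v : car V" for v
 proof (cases "v : W")
  case True
  then show ?thesis using v g by (intro bexI[of _ "\<zero>\<^bsub>K\<^esub>"]) auto
 next
  case False
  define W' where "W' = {w \<oplus>\<^bsub>V\<^esub> c \<odot>\<^bsub>V\<^esub> v | w c. w : W & c : car K}"
  have W'V: "W' <= car V" using WV v by (auto simp: W'_def)
  have sW': "subspace K W' V"
   unfolding subspace_def LinearCombinations.submodule_def
  proof (intro conjI allI impI)
   show "vectorspace K V" "module K V" by (auto simp: V.vectorspace_axioms V.module_axioms)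
   show "W' <= car V" by fact
   show "\<zero>\<^bsub>V\<^esub> : W'" unfolding W'_def using W0 v
    by (auto intro!: exI[of _ "\<zero>\<^bsub>V\<^esub>"] exI[of _ "\<zero>\<^bsub>K\<^esub>"])
  next
   fix x y assume "x : W'" "y : W'"
   then obtain w c w' c' where *: "x = w \<oplus>\<^bsub>V\<^esub> c \<odot>\<^bsub>V\<^esub> v" "y = w' \<oplus>\<^bsub>V\<^esub> c' \<odot>\<^bsub>V\<^esub> v"
    "w : W" "w' : W" "c : car K" "c' : car K" unfolding W'_def by auto
   moreover have "w : car V" "w' : car V" using * WV by auto
   ultimately have "x \<oplus>\<^bsub>V\<^esub> y = (w \<oplus>\<^bsub>V\<^esub> w') \<oplus>\<^bsub>V\<^esub> (c \<oplus>\<^bsub>K\<^esub> c') \<odot>\<^bsub>V\<^esub> v"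
    using v by (simp add: V.smult_l_distr V.M.add.m_ac)
   then show "x \<oplus>\<^bsub>V\<^esub> y : W'" unfolding W'_def using * Wadd by blast
  next
   fix d x assume d: "d : car K" and "x : W'"
   then obtain w c where *: "x = w \<oplus>\<^bsub>V\<^esub> c \<odot>\<^bsub>V\<^esub> v" "w : W" "c : car K"
    unfolding W'_def by auto
   moreover have "w : car V" using * WV by auto
   ultimately have "d \<odot>\<^bsub>V\<^esub> x = d \<odot>\<^bsub>V\<^esub> w \<oplus>\<^bsub>V\<^esub> (d \<otimes>\<^bsub>K\<^esub> c) \<odot>\<^bsub>V\<^esub> v"
    using v d by (simp add: V.smult_r_distr V.smult_assoc1)
   then show "d \<odot>\<^bsub>V\<^esub> x : W'" unfolding W'_def using * d Wsm V.R.m_closed by blast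
  qed
  have WW': "W <= W'"
  proof
   fix w assume "w : W"
   then show "w : W'" unfolding W'_def using v WV
    by (auto intro!: exI[of _ w] exI[of _ "\<zero>\<^bsub>K\<^esub>"])
  qed
  have vW': "v : W'" unfolding W'_def using v W0
   by (auto intro!: exI[of _ "\<zero>\<^bsub>V\<^esub>"] exI[of _ "\<one>\<^bsub>K\<^esub>"])
  have "g : W'"
  proof (rule ccontr)
   assume "g \<notin> W'"
   then have le: "vdim K (V(|carrier := W'|)) \<le> vdim K (V(|carrier := W|))"
    using max[of W'] sW' WW' W by (auto simp: P_def)
   have fW': "fin_dim_space K (V(|carrier := W'|))" by (rule fin_dim_space_subspace(1)[OF V sW'])
   have "subspace K W (V(|carrier := W'|))"
    unfolding subspace_def LinearCombinations.submodule_def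
    using fdsD(1)[OF fW'] WW' Wadd Wsm W0 by (auto simp: vectorspace_def)
   from fin_dim_space_subspace(2,3)[OF fW' this] le have "W = W'" by simp
   then show False using vW' False by simp
  qed
  then obtain w c where wc: "g = w \<oplus>\<^bsub>V\<^esub> c \<odot>\<^bsub>V\<^esub> v" "w : W" "c : car K"
   unfolding W'_def by auto
  have c0: "c ~= \<zero>\<^bsub>K\<^esub>" using wc v g W WV by auto
  have cU: "c : Units K" using wc c0 V.field_Units by auto
  have wV: "w : car V" using wc WV by auto
  define d where "d = inv\<^bsub>K\<^esub> c"
  have d: "d : car K" "d \<otimes>\<^bsub>K\<^esub> c = \<one>\<^bsub>K\<^esub>" using cU unfolding d_def by auto
  have "d \<odot>\<^bsub>V\<^esub> g = d \<odot>\<^bsub>V\<^esub> w \<oplus>\<^bsub>V\<^esub> (d \<otimes>\<^bsub>K\<^esub> c) \<odot>\<^bsub>V\<^esub> v"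
   using wc wV d(1) v by (simp add: V.smult_r_distr V.smult_assoc1)
  then have dg: "d \<odot>\<^bsub>V\<^esub> g = d \<odot>\<^bsub>V\<^esub> w \<oplus>\<^bsub>V\<^esub> v" using v by (simp only: d(2) V.smult_one)
  have "(\<ominus>\<^bsub>K\<^esub> d) \<odot>\<^bsub>V\<^esub> g = \<ominus>\<^bsub>V\<^esub> (d \<odot>\<^bsub>V\<^esub> g)" using d g by (simp add: V.smult_l_minus)
  then have "v \<oplus>\<^bsub>V\<^esub> (\<ominus>\<^bsub>K\<^esub> d) \<odot>\<^bsub>V\<^esub> g = v \<oplus>\<^bsub>V\<^esub> \<ominus>\<^bsub>V\<^esub> (d \<odot>\<^bsub>V\<^esub> w \<oplus>\<^bsub>V\<^esub> v)" using dg by simp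
  also have "\<dots> = \<ominus>\<^bsub>V\<^esub> (d \<odot>\<^bsub>V\<^esub> w)" using v d wV
   by (simp add: V.M.minus_add, subst V.M.a_lcomm, simp_all add: V.M.r_neg)
  finally show ?thesis using Wneg[OF Wsm[OF d(1) wc(2)]] d by (intro bexI[of _ "\<ominus>\<^bsub>K\<^esub> d"]) auto
 qed
 have uniq: "c = c'" if v: "v : car V" and c: "c : car K" "v \<oplus>\<^bsub>V\<^esub> c \<odot>\<^bsub>V\<^esub> g : W"
  and c': "c' : car K" "v \<oplus>\<^bsub>V\<^esub> c' \<odot>\<^bsub>V\<^esub> g : W" for v c c'
 proof (rule ccontr)
  assume "c ~= c'"
  define e where "e = c \<ominus>\<^bsub>K\<^esub> c'"
  have e: "e : car K" "e ~= \<zero>\<^bsub>K\<^esub>" using \<open>c ~= c'\<close> c c' unfolding e_def by auto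
  have "e \<odot>\<^bsub>V\<^esub> g = c \<odot>\<^bsub>V\<^esub> g \<oplus>\<^bsub>V\<^esub> \<ominus>\<^bsub>V\<^esub> (c' \<odot>\<^bsub>V\<^esub> g)"
   unfolding e_def a_minus_def using c c' g by (simp add: V.smult_l_distr V.smult_l_minus)
  also have "\<dots> = (v \<oplus>\<^bsub>V\<^esub> c \<odot>\<^bsub>V\<^esub> g) \<oplus>\<^bsub>V\<^esub> \<ominus>\<^bsub>V\<^esub> (v \<oplus>\<^bsub>V\<^esub> c' \<odot>\<^bsub>V\<^esub> g)"
  proof -
   have "(v \<oplus>\<^bsub>V\<^esub> x) \<oplus>\<^bsub>V\<^esub> \<ominus>\<^bsub>V\<^esub> (v \<oplus>\<^bsub>V\<^esub> y) = (v \<oplus>\<^bsub>V\<^esub> \<ominus>\<^bsub>V\<^esub> v) \<oplus>\<^bsub>V\<^esub> (x \<oplus>\<^bsub>V\<^esub> \<ominus>\<^bsub>V\<^esub> y)"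
    if "x : car V" "y : car V" for x y
   proof -
    have m: "\<ominus>\<^bsub>V\<^esub> v : car V" "\<ominus>\<^bsub>V\<^esub> y : car V" using that v by auto
    have "\<ominus>\<^bsub>V\<^esub> (v \<oplus>\<^bsub>V\<^esub> y) = \<ominus>\<^bsub>V\<^esub> v \<oplus>\<^bsub>V\<^esub> \<ominus>\<^bsub>V\<^esub> y" using that v by (simp add: V.M.minus_add)
    then show ?thesis using that(1) v m
     by (simp only: V.M.a_ac V.M.add.m_closed)
   qed
   then show ?thesis using c c' g v by (simp add: V.M.r_neg)
  qed
  finally have eg: "e \<odot>\<^bsub>V\<^esub> g : W" using Wadd[OF c(2) Wneg[OF c'(2)]] by simp
  have eU: "e : Units K" using e V.field_Units by auto
  have "inv\<^bsub>K\<^esub> e \<odot>\<^bsub>V\<^esub> (e \<odot>\<^bsub>V\<^esub> g) = (inv\<^bsub>K\<^esub> e \<otimes>\<^bsub>K\<^esub> e) \<odot>\<^bsub>V\<^esub> g" 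
   using e eU g by (simp only: V.smult_assoc1 V.R.Units_inv_closed)
  then have "inv\<^bsub>K\<^esub> e \<odot>\<^bsub>V\<^esub> (e \<odot>\<^bsub>V\<^esub> g) = g" using e eU g by simp
  then show False using Wsm[OF _ eg] eU W by (metis V.R.Units_inv_closed)
 qed
 define ph where "ph v = (THE c. c : car K & v \<oplus>\<^bsub>V\<^esub> c \<odot>\<^bsub>V\<^esub> g : W)" for v
 have ph1: "ph v = c" if "v : car V" "c : car K" "v \<oplus>\<^bsub>V\<^esub> c \<odot>\<^bsub>V\<^esub> g : W" for v c
  unfolding ph_def using that uniq by (intro the_equality) auto
 have ph2: "ph v : car K" "v \<oplus>\<^bsub>V\<^esub> ph v \<odot>\<^bsub>V\<^esub> g : W" if v: "v : car V" for v
  using ex[OF v] ph1[OF v] by auto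
 have hom: "ph : module_hom K V (regular_module K)"
  unfolding module_hom_def regular_module_def
 proof (safe; simp)
  fix x assume "x : car V" then show "ph x : car K" using ph2 by auto
 next
  fix x y assume x: "x : car V" and y: "y : car V"
  have "(x \<oplus>\<^bsub>V\<^esub> y) \<oplus>\<^bsub>V\<^esub> (ph x \<oplus>\<^bsub>K\<^esub> ph y) \<odot>\<^bsub>V\<^esub> g = (x \<oplus>\<^bsub>V\<^esub> ph x \<odot>\<^bsub>V\<^esub> g) \<oplus>\<^bsub>V\<^esub> (y \<oplus>\<^bsub>V\<^esub> ph y \<odot>\<^bsub>V\<^esub> g)"
   using x y g ph2(1) by (simp add: V.smult_l_distr V.M.add.m_ac)
  then show "ph (x \<oplus>\<^bsub>V\<^esub> y) = ph x \<oplus>\<^bsub>K\<^esub> ph y"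
   using x y ph2 Wadd by (intro ph1) auto
 next
  fix r x assume r: "r : car K" and x: "x : car V"
  have "r \<odot>\<^bsub>V\<^esub> x \<oplus>\<^bsub>V\<^esub> (r \<otimes>\<^bsub>K\<^esub> ph x) \<odot>\<^bsub>V\<^esub> g = r \<odot>\<^bsub>V\<^esub> (x \<oplus>\<^bsub>V\<^esub> ph x \<odot>\<^bsub>V\<^esub> g)"
   using x r g ph2(1) by (simp add: V.smult_r_distr V.smult_assoc1)
  then show "ph (r \<odot>\<^bsub>V\<^esub> x) = r \<otimes>\<^bsub>K\<^esub> ph x"
   using x r ph2 Wsm by (intro ph1) auto
 qed
 have "ph u = \<zero>\<^bsub>K\<^esub>" if "u : U" for u
  using that W WV g ph1[of u "\<zero>\<^bsub>K\<^esub>"] V.R.zero_closed V.smult_l_null[OF g(1)] V.M.r_zero[of u] by (metis subset_iff)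
 moreover have "ph g ~= \<zero>\<^bsub>K\<^esub>" using ph2[OF g(1)] g W by auto
 ultimately show ?thesis using hom by blast
qed

text \<open>Only the elements \<open>c \<odot> \<one>\<close> are axiomatised, since
  \<open>restrict_scalars\<close> lets K act on every module through them. For the same reason
  finite dimension is stated for the left regular module.\<close>

locale kalg =
 fixes K :: "'k ring" and A :: "('k, 'a) module"
 assumes field_K: "field K"
  and ring_A: "ring A"
  and scal_closed: "c : car K ==> c \<odot>\<^bsub>A\<^esub> \<one>\<^bsub>A\<^esub> : car A"
  and scal_add: "c : car K ==> d : car K ==>
   (c \<oplus>\<^bsub>K\<^esub> d) \<odot>\<^bsub>A\<^esub> \<one>\<^bsub>A\<^esub> = c \<odot>\<^bsub>A\<^esub> \<one>\<^bsub>A\<^esub> \<oplus>\<^bsub>A\<^esub> d \<odot>\<^bsub>A\<^esub> \<one>\<^bsub>A\<^esub>"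
  and scal_mult: "c : car K ==> d : car K ==>
   (c \<otimes>\<^bsub>K\<^esub> d) \<odot>\<^bsub>A\<^esub> \<one>\<^bsub>A\<^esub> = (c \<odot>\<^bsub>A\<^esub> \<one>\<^bsub>A\<^esub>) \<otimes>\<^bsub>A\<^esub> (d \<odot>\<^bsub>A\<^esub> \<one>\<^bsub>A\<^esub>)"
  and scal_one: "\<one>\<^bsub>K\<^esub> \<odot>\<^bsub>A\<^esub> \<one>\<^bsub>A\<^esub> = \<one>\<^bsub>A\<^esub>"
  and scal_central: "c : car K ==> a : car A ==>
   (c \<odot>\<^bsub>A\<^esub> \<one>\<^bsub>A\<^esub>) \<otimes>\<^bsub>A\<^esub> a = a \<otimes>\<^bsub>A\<^esub> (c \<odot>\<^bsub>A\<^esub> \<one>\<^bsub>A\<^esub>)"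
  and fin_dim_regular: "fin_dim_space K (restrict_scalars A (regular_module A))"

sublocale kalg \<subseteq> K: field K by (rule field_K)
sublocale kalg \<subseteq> A: ring A by (rule ring_A)

abbreviation ker_of :: "('a, 'm) module => ('a, 'n) module => ('m => 'n) => 'm set" where
 "ker_of M N f \<equiv> {x : car M. f x = \<zero>\<^bsub>N\<^esub>}"

lemma a_kernel_eq: "a_kernel M N f = ker_of M N f"
 by (simp add: a_kernel_def')

lemma restrict_scalars_simps [simp]:
 "car (restrict_scalars A M) = car M" "\<zero>\<^bsub>restrict_scalars A M\<^esub> = \<zero>\<^bsub>M\<^esub>"
 "x \<oplus>\<^bsub>restrict_scalars A M\<^esub> y = x \<oplus>\<^bsub>M\<^esub> y"
 "c \<odot>\<^bsub>restrict_scalars A M\<^esub> x = (c \<odot>\<^bsub>A\<^esub> \<one>\<^bsub>A\<^esub>) \<odot>\<^bsub>M\<^esub> x"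
 by (simp_all add: restrict_scalars_def)

lemma restrict_scalars_sub:
 "restrict_scalars A (M(|carrier := U|)) = (restrict_scalars A M)(|carrier := U|)"
 by (simp add: restrict_scalars_def)

lemma regular_module_simps [simp]:
 "car (regular_module R) = car R" "\<zero>\<^bsub>regular_module R\<^esub> = \<zero>\<^bsub>R\<^esub>"
 "x \<oplus>\<^bsub>regular_module R\<^esub> y = x \<oplus>\<^bsub>R\<^esub> y" "a \<odot>\<^bsub>regular_module R\<^esub> x = a \<otimes>\<^bsub>R\<^esub> x"
 by (simp_all add: regular_module_def)

lemma homI:
 assumes "!!x. x : car M ==> f x : car N"
  and "!!x y. x : car M ==> y : car M ==> f (x \<oplus>\<^bsub>M\<^esub> y) = f x \<oplus>\<^bsub>N\<^esub> f y"
  and "!!a x. a : car R ==> x : car M ==> f (a \<odot>\<^bsub>M\<^esub> x) = a \<odot>\<^bsub>N\<^esub> f x"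
 shows "f : module_hom R M N"
 using assms unfolding module_hom_def by auto

lemma homD:
 assumes "f : module_hom R M N"
 shows "x : car M ==> f x : car N"
  and "x : car M ==> y : car M ==> f (x \<oplus>\<^bsub>M\<^esub> y) = f x \<oplus>\<^bsub>N\<^esub> f y"
  and "a : car R ==> x : car M ==> f (a \<odot>\<^bsub>M\<^esub> x) = a \<odot>\<^bsub>N\<^esub> f x"
 using assms unfolding module_hom_def by auto

lemma left_moduleI:
 assumes "ring R"
  "!!x y. x : car M ==> y : car M ==> x \<oplus>\<^bsub>M\<^esub> y : car M"
  "\<zero>\<^bsub>M\<^esub> : car M"
  "!!x y z. x : car M ==> y : car M ==> z : car M ==>
   (x \<oplus>\<^bsub>M\<^esub> y) \<oplus>\<^bsub>M\<^esub> z = x \<oplus>\<^bsub>M\<^esub> (y \<oplus>\<^bsub>M\<^esub> z)"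
  "!!x y. x : car M ==> y : car M ==> x \<oplus>\<^bsub>M\<^esub> y = y \<oplus>\<^bsub>M\<^esub> x"
  "!!x. x : car M ==> \<zero>\<^bsub>M\<^esub> \<oplus>\<^bsub>M\<^esub> x = x"
  "!!x. x : car M ==> EX y:car M. y \<oplus>\<^bsub>M\<^esub> x = \<zero>\<^bsub>M\<^esub>"
  "!!a x. a : car R ==> x : car M ==> a \<odot>\<^bsub>M\<^esub> x : car M"
  "!!a b x. a : car R ==> b : car R ==> x : car M ==>
   (a \<oplus>\<^bsub>R\<^esub> b) \<odot>\<^bsub>M\<^esub> x = a \<odot>\<^bsub>M\<^esub> x \<oplus>\<^bsub>M\<^esub> b \<odot>\<^bsub>M\<^esub> x"
  "!!a x y. a : car R ==> x : car M ==> y : car M ==>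
   a \<odot>\<^bsub>M\<^esub> (x \<oplus>\<^bsub>M\<^esub> y) = a \<odot>\<^bsub>M\<^esub> x \<oplus>\<^bsub>M\<^esub> a \<odot>\<^bsub>M\<^esub> y"
  "!!a b x. a : car R ==> b : car R ==> x : car M ==>
   (a \<otimes>\<^bsub>R\<^esub> b) \<odot>\<^bsub>M\<^esub> x = a \<odot>\<^bsub>M\<^esub> (b \<odot>\<^bsub>M\<^esub> x)"
  "!!x. x : car M ==> \<one>\<^bsub>R\<^esub> \<odot>\<^bsub>M\<^esub> x = x"
 shows "left_module R M"
 unfolding left_module_def left_module_axioms_def
 using assms by (auto intro!: abelian_groupI)

context left_module
begin

lemma smult_zero_right [simp]: "a : car R ==> a \<odot>\<^bsub>M\<^esub> \<zero>\<^bsub>M\<^esub> = \<zero>\<^bsub>M\<^esub>"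
 by (metis M.add.r_cancel_one' M.r_zero M.zero_closed smult_closed smult_r_distr)

lemma smult_zero_left [simp]: "x : car M ==> \<zero>\<^bsub>R\<^esub> \<odot>\<^bsub>M\<^esub> x = \<zero>\<^bsub>M\<^esub>"
 by (metis M.add.r_cancel_one' R.r_zero R.zero_closed smult_closed smult_l_distr)

lemma smult_minus_right:
 assumes "a : car R" "x : car M" shows "a \<odot>\<^bsub>M\<^esub> (\<ominus>\<^bsub>M\<^esub> x) = \<ominus>\<^bsub>M\<^esub> (a \<odot>\<^bsub>M\<^esub> x)"
 by (rule M.minus_equality[symmetric])
  (use assms in \<open>simp_all add: smult_closed smult_r_distr[symmetric] M.l_neg\<close>)

lemma smult_minus_left:
 assumes "a : car R" "x : car M" shows "(\<ominus>\<^bsub>R\<^esub> a) \<odot>\<^bsub>M\<^esub> x = \<ominus>\<^bsub>M\<^esub> (a \<odot>\<^bsub>M\<^esub> x)"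
 by (rule M.minus_equality[symmetric])
  (use assms in \<open>simp_all add: smult_closed smult_l_distr[symmetric] R.l_neg\<close>)

lemma hom_zero:
 assumes "left_module R N" "f : module_hom R M N" shows "f \<zero>\<^bsub>M\<^esub> = \<zero>\<^bsub>N\<^esub>"
proof -
 interpret N: left_module R N by fact
 have "f (\<zero>\<^bsub>R\<^esub> \<odot>\<^bsub>M\<^esub> \<zero>\<^bsub>M\<^esub>) = \<zero>\<^bsub>R\<^esub> \<odot>\<^bsub>N\<^esub> f \<zero>\<^bsub>M\<^esub>" by (rule homD(3)[OF assms(2)]) auto
 then show ?thesis using homD(1)[OF assms(2)] by simp
qed

lemma hom_neg:
 assumes N: "left_module R N" and f: "f : module_hom R M N" and x: "x : car M"
 shows "f (\<ominus>\<^bsub>M\<^esub> x) = \<ominus>\<^bsub>N\<^esub> f x"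
proof -
 interpret N: left_module R N by fact
 have "f (\<ominus>\<^bsub>M\<^esub> x) \<oplus>\<^bsub>N\<^esub> f x = f (\<ominus>\<^bsub>M\<^esub> x \<oplus>\<^bsub>M\<^esub> x)" using homD(2)[OF f] x by simp
 then show ?thesis using N.M.minus_equality[of "f (\<ominus>\<^bsub>M\<^esub> x)" "f x"] homD(1)[OF f] x hom_zero[OF N f]
  by (simp add: M.l_neg)
qed

lemma hom_minus:
 assumes N: "left_module R N" and f: "f : module_hom R M N" and x: "x : car M" "y : car M"
 shows "f (x \<ominus>\<^bsub>M\<^esub> y) = f x \<ominus>\<^bsub>N\<^esub> f y"
 using x by (simp add: a_minus_def homD(2)[OF f] hom_neg[OF N f])

end

lemma (in abelian_group) minus_eq_zero_iff:
 assumes "x : car G" "y : car G" shows "x \<ominus> y = \<zero> \<longleftrightarrow> x = y"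
 by (metis assms a_minus_def minus_equality minus_minus r_neg add.inv_closed)

lemma (in abelian_group) minus_add_cancel:
 assumes "x : car G" "y : car G" shows "(x \<ominus> y) \<oplus> y = x"
 using assms by (simp add: a_minus_def a_assoc l_neg)

lemma (in abelian_group) add_minus_cancel_left:
 assumes "x : car G" "y : car G" shows "y \<oplus> (x \<ominus> y) = x"
 using assms minus_add_cancel a_comm by auto

text \<open>All module axioms are equations or closure statements, so they pass along a surjection
  that respects the operations. Both isomorphic copies and quotients are obtained this way.\<close>

lemma left_module_hom_image:
 assumes M: "left_module R M" and car: "car N = q ` car M" and zero: "\<zero>\<^bsub>N\<^esub> = q \<zero>\<^bsub>M\<^esub>"
  and add: "!!x y. x : car M ==> y : car M ==> q (x \<oplus>\<^bsub>M\<^esub> y) = q x \<oplus>\<^bsub>N\<^esub> q y"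
  and smult: "!!a x. a : car R ==> x : car M ==> q (a \<odot>\<^bsub>M\<^esub> x) = a \<odot>\<^bsub>N\<^esub> q x"
 shows "left_module R N" "q : module_hom R M N"
proof -
 interpret M: left_module R M by fact
 show "q : module_hom R M N" by (rule homI) (use assms in auto)
 have cl: "q u : car N" if "u : car M" for u using car that by auto
 have ex: "EX u:car M. x = q u" if "x : car N" for x using car that by auto
 show "left_module R N"
 proof (rule left_moduleI)
  show "ring R" by (rule M.R.ring_axioms)
  show "\<zero>\<^bsub>N\<^esub> : car N" using cl zero by simp
  fix x assume "x : car N"
  then obtain u where u: "u : car M" "x = q u" using ex by blast
  have "q (\<ominus>\<^bsub>M\<^esub> u) \<oplus>\<^bsub>N\<^esub> x = \<zero>\<^bsub>N\<^esub>" using u add[of "\<ominus>\<^bsub>M\<^esub> u" u] zero by (simp add: M.M.l_neg)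
  then show "EX y:car N. y \<oplus>\<^bsub>N\<^esub> x = \<zero>\<^bsub>N\<^esub>" using u cl by blast
  show "\<zero>\<^bsub>N\<^esub> \<oplus>\<^bsub>N\<^esub> x = x" using u add[of "\<zero>\<^bsub>M\<^esub>" u] zero by simp
  show "\<one>\<^bsub>R\<^esub> \<odot>\<^bsub>N\<^esub> x = x" using u smult[of "\<one>\<^bsub>R\<^esub>" u] M.smult_one by simp
  fix y assume "y : car N"
  then obtain v where v: "v : car M" "y = q v" using ex by blast
  show "x \<oplus>\<^bsub>N\<^esub> y : car N" using u v add[of u v] cl[of "u \<oplus>\<^bsub>M\<^esub> v"] by simp
  show "x \<oplus>\<^bsub>N\<^esub> y = y \<oplus>\<^bsub>N\<^esub> x" using u v add[of u v] add[of v u] M.M.a_comm[of u v] by simp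
  fix z assume "z : car N"
  then obtain w where w: "w : car M" "z = q w" using ex by blast
  show "(x \<oplus>\<^bsub>N\<^esub> y) \<oplus>\<^bsub>N\<^esub> z = x \<oplus>\<^bsub>N\<^esub> (y \<oplus>\<^bsub>N\<^esub> z)"
   using u v w M.M.a_assoc[of u v w] add[of u v] add[of v w] add[of "u \<oplus>\<^bsub>M\<^esub> v" w] add[of u "v \<oplus>\<^bsub>M\<^esub> w"]
   by simp
 next
  fix a x assume a: "a : car R" and "x : car N"
  then obtain u where u: "u : car M" "x = q u" using ex by blast
  show "a \<odot>\<^bsub>N\<^esub> x : car N" using u a smult[of a u] cl[of "a \<odot>\<^bsub>M\<^esub> u"] M.smult_closed by simp
  show "(b \<oplus>\<^bsub>R\<^esub> a) \<odot>\<^bsub>N\<^esub> x = b \<odot>\<^bsub>N\<^esub> x \<oplus>\<^bsub>N\<^esub> a \<odot>\<^bsub>N\<^esub> x" if b: "b : car R" for b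
   using u a b M.smult_l_distr[of b a u] smult[of a u] smult[of b u] smult[of "b \<oplus>\<^bsub>R\<^esub> a" u]
    add[of "b \<odot>\<^bsub>M\<^esub> u" "a \<odot>\<^bsub>M\<^esub> u"] M.smult_closed by simp
  show "(b \<otimes>\<^bsub>R\<^esub> a) \<odot>\<^bsub>N\<^esub> x = b \<odot>\<^bsub>N\<^esub> (a \<odot>\<^bsub>N\<^esub> x)" if b: "b : car R" for b
   using u a b M.smult_assoc1[of b a u] smult[of a u] smult[of b "a \<odot>\<^bsub>M\<^esub> u"] smult[of "b \<otimes>\<^bsub>R\<^esub> a" u]
    M.smult_closed by simp
  fix y assume "y : car N"
  then obtain v where v: "v : car M" "y = q v" using ex by blast
  show "a \<odot>\<^bsub>N\<^esub> (x \<oplus>\<^bsub>N\<^esub> y) = a \<odot>\<^bsub>N\<^esub> x \<oplus>\<^bsub>N\<^esub> a \<odot>\<^bsub>N\<^esub> y"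
   using u v a M.smult_r_distr[of a u v] smult[of a u] smult[of a v] smult[of a "u \<oplus>\<^bsub>M\<^esub> v"]
    add[of u v] add[of "a \<odot>\<^bsub>M\<^esub> u" "a \<odot>\<^bsub>M\<^esub> v"] M.smult_closed by simp
 qed
qed

context kalg
begin

abbreviation "sc c \<equiv> c \<odot>\<^bsub>A\<^esub> \<one>\<^bsub>A\<^esub>"
abbreviation "Hom \<equiv> module_hom A"
abbreviation amult (infixl "\<cdot>" 70) where "a \<cdot> b \<equiv> a \<otimes>\<^bsub>A\<^esub> b"
abbreviation "lmod \<equiv> left_module A"
abbreviation "fdm \<equiv> fd_module K A"
abbreviation "proj \<equiv> projective K A"
abbreviation "indec \<equiv> indecomposable K A"
abbreviation "regm \<equiv> regular_module A"

lemma submodI: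
 assumes M: "lmod M" and sub: "U <= car M" and zero: "\<zero>\<^bsub>M\<^esub> : U"
  and add: "!!x y. x : U ==> y : U ==> x \<oplus>\<^bsub>M\<^esub> y : U"
  and smult: "!!a x. a : car A ==> x : U ==> a \<odot>\<^bsub>M\<^esub> x : U"
 shows "submod A M U"
proof -
 interpret M: left_module A M by fact
 have "\<ominus>\<^bsub>M\<^esub> x : U" if "x : U" for x
  using smult[of "\<ominus>\<^bsub>A\<^esub> \<one>\<^bsub>A\<^esub>" x] that sub M.smult_minus_left[of "\<one>\<^bsub>A\<^esub>" x] M.smult_one[of x] by auto
 then show ?thesis
  by (intro Module.submodule.intro subgroup.intro)
   (use assms in \<open>auto simp: submodule_axioms_def a_inv_def\<close>)
qed

lemma subD:
 assumes "submod A M U"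
 shows "x : U ==> x : car M" "\<zero>\<^bsub>M\<^esub> : U" "x : U ==> y : U ==> x \<oplus>\<^bsub>M\<^esub> y : U"
  "a : car A ==> x : U ==> a \<odot>\<^bsub>M\<^esub> x : U" "x : U ==> \<ominus>\<^bsub>M\<^esub> x : U"
  "x : U ==> y : U ==> x \<ominus>\<^bsub>M\<^esub> y : U"
proof -
 interpret Module.submodule U A M by fact
 show "x : U ==> x : car M" "\<zero>\<^bsub>M\<^esub> : U" "x : U ==> y : U ==> x \<oplus>\<^bsub>M\<^esub> y : U"
  "a : car A ==> x : U ==> a \<odot>\<^bsub>M\<^esub> x : U" "x : U ==> \<ominus>\<^bsub>M\<^esub> x : U"
  "x : U ==> y : U ==> x \<ominus>\<^bsub>M\<^esub> y : U"
  using subset one_closed m_closed m_inv_closed by (auto simp: a_inv_def a_minus_def)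
qed

lemma submod_subset: "submod A M U ==> U <= car M"
 using subD(1) by auto

lemma left_module_sub:
 assumes M: "lmod M" and U: "submod A M U"
 shows "lmod (M(|carrier := U|))"
proof -
 interpret M: left_module A M by fact
 have c: "x : U ==> x : car M" for x by (rule subD(1)[OF U])
 have inv: "EX y:U. y \<oplus>\<^bsub>M\<^esub> x = \<zero>\<^bsub>M\<^esub>" if "x : U" for x
  using M.M.l_neg[OF c[OF that]] subD(5)[OF U that] by blast
 show ?thesis
  by (rule left_moduleI)
   (use subD(2-4)[OF U] inv in \<open>auto simp: A.ring_axioms c M.M.a_ac M.smult_l_distr
     M.smult_r_distr M.smult_assoc1 M.smult_one\<close>)
qed

lemma submod_kernel:
 assumes "lmod M" "lmod N" "f : Hom M N"
 shows "submod A M (ker_of M N f)"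
proof -
 interpret M: left_module A M by fact
 interpret N: left_module A N by fact
 show ?thesis
  by (rule submodI) (use assms in \<open>auto simp: homD[OF assms(3)] M.hom_zero M.smult_closed\<close>)
qed

lemma submod_vimage:
 assumes "lmod M" "lmod N" "f : Hom M N" "submod A N V"
 shows "submod A M {x : car M. f x : V}"
proof -
 interpret M: left_module A M by fact
 interpret N: left_module A N by fact
 show ?thesis
  by (rule submodI)
   (use assms subD[OF assms(4)] in \<open>auto simp: homD[OF assms(3)] M.hom_zero M.smult_closed\<close>)
qed

lemma submod_image:
 assumes "lmod M" "lmod N" "f : Hom M N" "submod A M U"
 shows "submod A N (f ` U)"
proof -
 interpret M: left_module A M by fact
 interpret N: left_module A N by fact
 note U = subD[OF assms(4)]
 note f = homD[OF assms(3)]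
 show ?thesis
 proof (rule submodI)
  show "f ` U <= car N" using U f by auto
  show "\<zero>\<^bsub>N\<^esub> : f ` U" using U(2) M.hom_zero[OF assms(2,3)] by force
  show "x \<oplus>\<^bsub>N\<^esub> y : f ` U" if "x : f ` U" "y : f ` U" for x y
   using that U(1,3) f(2) by (auto simp flip: f(2))
  show "a \<odot>\<^bsub>N\<^esub> x : f ` U" if "a : car A" "x : f ` U" for a x
   using that U(1,4) by (auto simp flip: f(3))
 qed fact
qed

lemma submod_carrier: "lmod M ==> submod A M (car M)"
proof -
 assume "lmod M"
 then interpret M: left_module A M .
 show ?thesis by (rule submodI) (auto simp: M.left_module_axioms M.smult_closed)
qed

lemma submod_zero: "lmod M ==> submod A M {\<zero>\<^bsub>M\<^esub>}"
proof -
 assume "lmod M"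
 then interpret M: left_module A M .
 show ?thesis by (rule submodI) (auto simp: M.left_module_axioms)
qed

lemma mem_set_add: "x : U <+>\<^bsub>M\<^esub> V \<longleftrightarrow> (EX u:U. EX v:V. x = u \<oplus>\<^bsub>M\<^esub> v)"
 by (auto simp: set_add_def')

lemma submod_sum:
 assumes M: "lmod M" and U: "submod A M U" and V: "submod A M V"
 shows "submod A M (U <+>\<^bsub>M\<^esub> V)"
proof -
 interpret M: left_module A M by fact
 note UM = subD(1)[OF U] and VM = subD(1)[OF V]
 show ?thesis
 proof (rule submodI[OF M])
  show "U <+>\<^bsub>M\<^esub> V <= car M" using UM VM by (auto simp: mem_set_add)
  show "\<zero>\<^bsub>M\<^esub> : U <+>\<^bsub>M\<^esub> V"
   unfolding mem_set_add using subD(2)[OF U] subD(2)[OF V] M.M.l_zero[OF M.M.zero_closed] by metis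
  show "x \<oplus>\<^bsub>M\<^esub> y : U <+>\<^bsub>M\<^esub> V" if xy: "x : U <+>\<^bsub>M\<^esub> V" "y : U <+>\<^bsub>M\<^esub> V" for x y
  proof -
   obtain u v u' v' where *: "x = u \<oplus>\<^bsub>M\<^esub> v" "y = u' \<oplus>\<^bsub>M\<^esub> v'" "u : U" "v : V" "u' : U" "v' : V"
    using xy unfolding mem_set_add by blast
   then have "x \<oplus>\<^bsub>M\<^esub> y = (u \<oplus>\<^bsub>M\<^esub> u') \<oplus>\<^bsub>M\<^esub> (v \<oplus>\<^bsub>M\<^esub> v')"
    using UM VM by (simp add: M.M.add.m_ac)
   then show ?thesis unfolding mem_set_add using subD(3)[OF U *(3,5)] subD(3)[OF V *(4,6)] by blast
  qed
  show "a \<odot>\<^bsub>M\<^esub> x : U <+>\<^bsub>M\<^esub> V" if a: "a : car A" and x: "x : U <+>\<^bsub>M\<^esub> V" for a x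
  proof -
   obtain u v where *: "x = u \<oplus>\<^bsub>M\<^esub> v" "u : U" "v : V"
    using x unfolding mem_set_add by blast
   then have "a \<odot>\<^bsub>M\<^esub> x = a \<odot>\<^bsub>M\<^esub> u \<oplus>\<^bsub>M\<^esub> a \<odot>\<^bsub>M\<^esub> v" using UM VM a by (simp add: M.smult_r_distr)
   then show ?thesis unfolding mem_set_add using subD(4)[OF U a *(2)] subD(4)[OF V a *(3)] by blast
  qed
 qed
qed

lemma submod_sub_iff:
 assumes M: "lmod M" and V: "submod A M V"
 shows "submod A (M(|carrier := V|)) U \<longleftrightarrow> submod A M U & U <= V"
proof
 assume U: "submod A (M(|carrier := V|)) U"
 have "U <= V" using submod_subset[OF U] by simp
 moreover have "submod A M U"
  by (rule submodI) (use subD[OF U] subD[OF V] M in auto)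
 ultimately show "submod A M U & U <= V" by simp
next
 assume U: "submod A M U & U <= V"
 then show "submod A (M(|carrier := V|)) U"
  by (intro submodI) (use subD[of U M] left_module_sub[OF M V] in auto)
qed

lemma hcomp:
 assumes "f : Hom M N" "g : Hom N L"
 shows "(%x. g (f x)) : Hom M L"
 by (rule homI) (use assms in \<open>auto simp: homD[OF assms(1)] homD[OF assms(2)]\<close>)

lemma hom_id: "lmod M ==> (%x. x) : Hom M M"
 by (rule homI) auto

lemma hom_zero_map: "lmod N ==> (%x. \<zero>\<^bsub>N\<^esub>) : Hom M N"
proof -
 assume "lmod N"
 then interpret N: left_module A N .
 show ?thesis by (rule homI) auto
qed

lemma hom_add:
 assumes "lmod N" "f : Hom M N" "g : Hom M N"
 shows "(%x. f x \<oplus>\<^bsub>N\<^esub> g x) : Hom M N"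
proof -
 interpret N: left_module A N by fact
 show ?thesis
  by (rule homI)
   (auto simp: homD[OF assms(2)] homD[OF assms(3)] N.smult_r_distr N.M.add.m_ac)
qed

lemma hom_diff:
 assumes "lmod N" "f : Hom M N" "g : Hom M N"
 shows "(%x. f x \<ominus>\<^bsub>N\<^esub> g x) : Hom M N"
proof -
 interpret N: left_module A N by fact
 have "(%x. \<ominus>\<^bsub>N\<^esub> g x) : Hom M N"
  by (rule homI)
   (auto simp: homD[OF assms(3)] N.smult_minus_right N.M.minus_add)
 from hom_add[OF assms(1,2) this] show ?thesis by (simp add: a_minus_def)
qed

lemma hom_into_sub:
 "f : Hom M N ==> (!!x. x : car M ==> f x : V) ==>
  f : Hom M (N(|carrier := V|))"
 unfolding module_hom_def by auto

lemma hom_from_sub: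
 assumes "f : Hom M N" "U <= car M" shows "f : Hom (M(|carrier := U|)) N"
 by (rule homI) (use homD[OF assms(1)] subsetD[OF assms(2)] in simp_all)

lemma hom_out_of_sub:
 assumes "f : Hom M (N(|carrier := V|))" "V <= car N" shows "f : Hom M N"
 using assms unfolding module_hom_def by auto

lemma hom_cong:
 assumes "lmod M" "f : Hom M N" "!!x. x : car M ==> g x = f x"
 shows "g : Hom M N"
proof -
 interpret M: left_module A M by fact
 show ?thesis by (rule homI) (auto simp: assms(3) homD[OF assms(2)] M.smult_closed)
qed

lemma hom_res:
 assumes "lmod M" "f : Hom M N" shows "restrict f (car M) : mod_Hom A M N"
 unfolding mod_Hom_def using hom_cong[OF assms, of "restrict f (car M)"] by auto

lemma hom_inv_into:
 assumes M: "lmod M" and f: "f : Hom M N"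
  and bij: "bij_betw f (car M) (car N)"
 shows "inv_into (car M) f : Hom N M"
proof -
 interpret M: left_module A M by fact
 let ?g = "inv_into (car M) f"
 have g: "?g (f x) = x" if "x : car M" for x
  using that bij by (simp add: bij_betw_def)
 have ex: "EX u:car M. y = f u" if "y : car N" for y using that bij by (auto simp: bij_betw_def)
 show ?thesis
 proof (rule homI)
  show "?g x : car M" if "x : car N" for x using ex[OF that] g by auto
  show "?g (x \<oplus>\<^bsub>N\<^esub> y) = ?g x \<oplus>\<^bsub>M\<^esub> ?g y" if xy: "x : car N" "y : car N" for x y
  proof -
   obtain u v where uv: "u : car M" "v : car M" "x = f u" "y = f v" using ex[OF xy(1)] ex[OF xy(2)] by blast
   have "x \<oplus>\<^bsub>N\<^esub> y = f (u \<oplus>\<^bsub>M\<^esub> v)" using uv by (simp add: homD[OF f])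
   then show ?thesis using uv g by simp
  qed
  show "?g (a \<odot>\<^bsub>N\<^esub> x) = a \<odot>\<^bsub>M\<^esub> ?g x" if ax: "a : car A" "x : car N" for a x
  proof -
   obtain u where u: "u : car M" "x = f u" using ex[OF ax(2)] by blast
   have "a \<odot>\<^bsub>N\<^esub> x = f (a \<odot>\<^bsub>M\<^esub> u)" using u ax by (simp add: homD[OF f])
   then show ?thesis using u ax g M.smult_closed by simp
  qed
 qed
qed

lemma inj_on_hom_iff:
 assumes M: "lmod M" and N: "lmod N" and f: "f : Hom M N"
 shows "inj_on f (car M) \<longleftrightarrow> (ALL x:car M. f x = \<zero>\<^bsub>N\<^esub> --> x = \<zero>\<^bsub>M\<^esub>)"
proof
 interpret M: left_module A M by fact
 assume inj: "inj_on f (car M)"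
 show "ALL x:car M. f x = \<zero>\<^bsub>N\<^esub> --> x = \<zero>\<^bsub>M\<^esub>"
  using M.hom_zero[OF N f] M.M.zero_closed inj_onD[OF inj, of _ "\<zero>\<^bsub>M\<^esub>"] by auto
next
 interpret M: left_module A M by fact
 interpret N: left_module A N by fact
 assume z: "ALL x:car M. f x = \<zero>\<^bsub>N\<^esub> --> x = \<zero>\<^bsub>M\<^esub>"
 show "inj_on f (car M)"
 proof (rule inj_onI)
  fix x y assume xy: "x : car M" "y : car M" "f x = f y"
  then have "f (x \<ominus>\<^bsub>M\<^esub> y) = \<zero>\<^bsub>N\<^esub>"
   using M.hom_minus[OF N f] homD(1)[OF f] by (simp add: N.M.minus_eq_zero_iff)
  then have "x \<ominus>\<^bsub>M\<^esub> y = \<zero>\<^bsub>M\<^esub>" using z xy M.M.minus_closed by blast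
  then show "x = y" using xy by (simp add: M.M.minus_eq_zero_iff)
 qed
qed

lemma vs_restrict:
 assumes "lmod M" shows "vectorspace K (restrict_scalars A M)"
proof -
 interpret M: left_module A M by fact
 note s = M.smult_closed[OF scal_closed]
 show ?thesis
  by (rule vs_criteria)
   (auto simp: field_K s M.M.a_ac scal_add scal_mult scal_one scal_closed
    M.smult_l_distr M.smult_r_distr M.smult_assoc1 M.smult_one intro!: bexI[of _ "\<ominus>\<^bsub>M\<^esub> _"] M.M.r_neg)
qed

lemma hom_restrict_scalars:
 "f : Hom M N ==> f : module_hom K (restrict_scalars A M) (restrict_scalars A N)"
 by (rule homI) (auto simp: homD scal_closed)

lemma subspace_restrict_scalars:
 assumes "lmod M" "submod A M U" shows "subspace K U (restrict_scalars A M)"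
 using vs_restrict[OF assms(1)] subD[OF assms(2)]
 by (auto simp: subspace_def LinearCombinations.submodule_def vectorspace_def scal_closed)

abbreviation "mdim M \<equiv> vdim K (restrict_scalars A M)"

lemma fdD:
 "fdm M ==> lmod M" "fdm M ==> fin_dim_space K (restrict_scalars A M)"
 unfolding fd_module_def by auto

lemma fd_sub:
 assumes "fdm M" "submod A M U"
 shows "fdm (M(|carrier := U|))" "mdim (M(|carrier := U|)) \<le> mdim M"
  "mdim (M(|carrier := U|)) = mdim M ==> U = car M"
 using left_module_sub[OF fdD(1)[OF assms(1)] assms(2)]
  fin_dim_space_subspace[OF fdD(2)[OF assms(1)] subspace_restrict_scalars[OF fdD(1)[OF assms(1)] assms(2)]]
 unfolding fd_module_def restrict_scalars_sub by auto

lemma fd_surj: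
 assumes "fdm M" "lmod N" "f : Hom M N" "f ` car M = car N"
 shows "fdm N"
 using fin_dim_space_surj[OF fdD(2)[OF assms(1)] vs_restrict[OF assms(2)]
   hom_restrict_scalars[OF assms(3)]] assms unfolding fd_module_def by auto

lemma mdim_rank_nullity:
 assumes "fdm M" "lmod N" "f : Hom M N"
 shows "mdim M = mdim (N(|carrier := f ` car M|)) + mdim (M(|carrier := ker_of M N f|))"
 using vdim_rank_nullity[OF fdD(2)[OF assms(1)] vs_restrict[OF assms(2)]
   hom_restrict_scalars[OF assms(3)]] by (simp add: restrict_scalars_sub)

lemma mdim_zero:
 assumes "fdm M" shows "mdim M = 0 \<longleftrightarrow> car M = {\<zero>\<^bsub>M\<^esub>}"
 using vdim_zero[OF fdD(2)[OF assms]] by simp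

lemma mdim_inj:
 assumes M: "fdm M" and N: "lmod N" and f: "f : Hom M N"
  and inj: "inj_on f (car M)"
 shows "mdim (N(|carrier := f ` car M|)) = mdim M"
proof -
 note lM = fdD(1)[OF M]
 interpret M: left_module A M by fact
 have "ker_of M N f = {\<zero>\<^bsub>M\<^esub>}"
  using inj_on_hom_iff[OF lM N f] inj M.hom_zero[OF N f] M.M.zero_closed by blast
 moreover have "mdim (M(|carrier := {\<zero>\<^bsub>M\<^esub>}|)) = 0"
  using mdim_zero[OF fd_sub(1)[OF M submod_zero[OF lM]]] by simp
 ultimately show ?thesis using mdim_rank_nullity[OF M N f] by simp
qed

lemma endo_inj_imp_bij:
 assumes M: "fdm M" and f: "f : Hom M M" and inj: "inj_on f (car M)"
 shows "bij_betw f (car M) (car M)"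
 using mdim_inj[OF M fdD(1)[OF M] f inj]
  fd_sub(3)[OF M submod_image[OF fdD(1)[OF M] fdD(1)[OF M] f submod_carrier[OF fdD(1)[OF M]]]] inj
 by (simp add: bij_betw_def)

lemma endo_surj_imp_bij:
 assumes M: "fdm M" and f: "f : Hom M M" and surj: "f ` car M = car M"
 shows "bij_betw f (car M) (car M)"
proof -
 note lM = fdD(1)[OF M]
 have "mdim (M(|carrier := ker_of M M f|)) = 0" using mdim_rank_nullity[OF M lM f] surj by simp
 then have "ker_of M M f = {\<zero>\<^bsub>M\<^esub>}" using mdim_zero[OF fd_sub(1)[OF M submod_kernel[OF lM lM f]]] by simp
 then have "inj_on f (car M)" using inj_on_hom_iff[OF lM lM f] by auto
 then show ?thesis using surj by (simp add: bij_betw_def)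
qed

text \<open>Each element is encoded by coefficients, chosen arbitrarily, over an enumerated finite
  spanning set. The encoding is injective because the linear combination recovers the element, and
  the operations are simply transported along it.\<close>

lemma std_copy:
 fixes M :: "('a, 'm) module"
 assumes M: "fdm M"
 obtains N :: "('k, 'a) smod" and f where "fdm N" "f : Hom M N"
  "bij_betw f (car M) (car N)"
proof -
 note lM = fdD(1)[OF M]
 interpret M: left_module A M by fact
 let ?V = "restrict_scalars A M"
 interpret V: vectorspace K ?V by (rule vs_restrict[OF lM])
 obtain B where B: "finite B" "B <= car ?V" "V.span B = car ?V"
  using fdsD(2)[OF fdD(2)[OF M]] unfolding V.fin_dim_def by auto
 obtain e where e: "bij_betw e {0..<card B} B" using ex_bij_betw_nat_finite[OF B(1)] by blast
 define cf where "cf x = (SOME a. a : B \<rightarrow> car K & V.lincomb a B = x)" for x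
 have cf: "cf x : B \<rightarrow> car K" "V.lincomb (cf x) B = x" if "x : car M" for x
  using someI_ex[OF V.finite_in_span[OF B(1,2), of x]] B(3) that unfolding cf_def by auto
 define q where "q x = (%i. if i < card B then cf x (e i) else undefined)" for x
 have inj: "inj_on q (car M)"
 proof (rule inj_onI)
  fix x y assume xy: "x : car M" "y : car M" "q x = q y"
  have "cf x b = cf y b" if b: "b : B" for b
  proof -
   obtain i where i: "i < card B" "b = e i" using e b unfolding bij_betw_def by force
   then show ?thesis using fun_cong[OF xy(3), of i] by (simp add: q_def)
  qed
  then have "V.lincomb (cf x) B = V.lincomb (cf y) B"
   using V.lincomb_cong[OF refl B(2), of "cf x" "cf y"] cf(1)[OF xy(2)] by auto
  then show "x = y" using cf xy by simp
 qed
 define p where "p = inv_into (car M) q"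
 have p: "p (q x) = x" if "x : car M" for x using inj that by (simp add: p_def)
 define N :: "('k, 'a) smod" where "N = (|carrier = q ` car M, mult = undefined, one = undefined,
  zero = q \<zero>\<^bsub>M\<^esub>, add = (%x y. q (p x \<oplus>\<^bsub>M\<^esub> p y)), smult = (%a x. q (a \<odot>\<^bsub>M\<^esub> p x))|)"
 have lN: "lmod N" and q: "q : Hom M N"
  by (rule left_module_hom_image[OF lM, where q = q]; simp add: N_def p)+
 have bij: "bij_betw q (car M) (car N)" using inj by (simp add: bij_betw_def N_def)
 then have "q ` car M = car N" by (simp add: bij_betw_def)
 then show ?thesis by (rule that[OF fd_surj[OF M lN q] q bij])
qed

text \<open>The quotient is realised on one representative per coset. So it keeps the element type
  of M, and quotients of standard modules are again standard. The choice of q depends only on the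
  coset, because its defining predicate does.\<close>

lemma quotient_exists:
 fixes M :: "('a, 'm) module"
 assumes M: "fdm M" and U: "submod A M U"
 obtains N :: "('a, 'm) module" and q where "fdm N" "q : Hom M N"
  "q ` car M = car N" "ker_of M N q = U"
proof -
 note lM = fdD(1)[OF M]
 interpret M: left_module A M by fact
 note Ud = subD[OF U]
 define q where "q x = (SOME y. y : car M & x \<ominus>\<^bsub>M\<^esub> y : U)" for x
 have q: "q x : car M" "x \<ominus>\<^bsub>M\<^esub> q x : U" if "x : car M" for x
  using someI[of "%y. y : car M & x \<ominus>\<^bsub>M\<^esub> y : U" x] that Ud(2)
  unfolding q_def by (auto simp: M.M.minus_eq_zero_iff[THEN iffD2])
 have d1: "(x \<ominus>\<^bsub>M\<^esub> z) = (x \<ominus>\<^bsub>M\<^esub> y) \<oplus>\<^bsub>M\<^esub> (y \<ominus>\<^bsub>M\<^esub> z)"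
  if "x : car M" "y : car M" "z : car M" for x y z
  using that by (simp add: a_minus_def M.M.a_assoc M.M.r_neg1)
 have d2: "y \<ominus>\<^bsub>M\<^esub> x = \<ominus>\<^bsub>M\<^esub> (x \<ominus>\<^bsub>M\<^esub> y)" if "x : car M" "y : car M" for x y
  using that by (simp add: a_minus_def M.M.minus_add M.M.a_comm)
 have q_eq: "q x = q y" if xy: "x : car M" "y : car M" "x \<ominus>\<^bsub>M\<^esub> y : U" for x y
 proof -
  have "x \<ominus>\<^bsub>M\<^esub> z : U \<longleftrightarrow> y \<ominus>\<^bsub>M\<^esub> z : U" if z: "z : car M" for z
  proof -
   have yx: "y \<ominus>\<^bsub>M\<^esub> x : U" using d2[OF xy(1,2)] Ud(5)[OF xy(3)] by simp
   show ?thesis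
    using d1[OF xy(1,2) z] d1[OF xy(2,1) z] Ud(3)[OF xy(3), of "y \<ominus>\<^bsub>M\<^esub> z"] Ud(3)[OF yx, of "x \<ominus>\<^bsub>M\<^esub> z"]
    by auto
  qed
  then have "(%z. z : car M & x \<ominus>\<^bsub>M\<^esub> z : U) = (%z. z : car M & y \<ominus>\<^bsub>M\<^esub> z : U)" by auto
  then show ?thesis unfolding q_def by simp
 qed
 have q_iff: "q x = q y \<longleftrightarrow> x \<ominus>\<^bsub>M\<^esub> y : U" if xy: "x : car M" "y : car M" for x y
 proof
  assume e: "q x = q y"
  have "q x \<ominus>\<^bsub>M\<^esub> y : U" using e d2[OF xy(2) q(1)[OF xy(2)]] Ud(5)[OF q(2)[OF xy(2)]] by simp
  then show "x \<ominus>\<^bsub>M\<^esub> y : U" using d1[OF xy(1) q(1)[OF xy(1)] xy(2)] Ud(3)[OF q(2)[OF xy(1)]] by simp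
 qed (rule q_eq[OF xy])
 define N :: "('a, 'm) module" where "N = (|carrier = q ` car M, mult = undefined, one = undefined,
  zero = q \<zero>\<^bsub>M\<^esub>, add = (%x y. q (x \<oplus>\<^bsub>M\<^esub> y)), smult = (%a x. q (a \<odot>\<^bsub>M\<^esub> x))|)"
 have Ncar: "car N = q ` car M" and Nzero: "\<zero>\<^bsub>N\<^esub> = q \<zero>\<^bsub>M\<^esub>" by (simp_all add: N_def)
 have Nadd: "q (x \<oplus>\<^bsub>M\<^esub> y) = q x \<oplus>\<^bsub>N\<^esub> q y" if xy: "x : car M" "y : car M" for x y
 proof -
  have "(x \<oplus>\<^bsub>M\<^esub> y) \<ominus>\<^bsub>M\<^esub> (q x \<oplus>\<^bsub>M\<^esub> q y) = (x \<ominus>\<^bsub>M\<^esub> q x) \<oplus>\<^bsub>M\<^esub> (y \<ominus>\<^bsub>M\<^esub> q y)"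
   using xy q(1) by (simp add: a_minus_def M.M.minus_add M.M.a_assoc M.M.a_lcomm)
  then show ?thesis using xy q Ud by (simp add: N_def q_iff)
 qed
 have Nsm: "q (a \<odot>\<^bsub>M\<^esub> x) = a \<odot>\<^bsub>N\<^esub> q x" if ax: "a : car A" "x : car M" for a x
 proof -
  have "(a \<odot>\<^bsub>M\<^esub> x) \<ominus>\<^bsub>M\<^esub> (a \<odot>\<^bsub>M\<^esub> q x) = a \<odot>\<^bsub>M\<^esub> (x \<ominus>\<^bsub>M\<^esub> q x)"
   using ax q(1) by (simp add: a_minus_def M.smult_r_distr M.smult_minus_right)
  then show ?thesis using ax q Ud M.smult_closed by (simp add: N_def q_iff)
 qed
 note qh = left_module_hom_image(2)[OF lM Ncar Nzero Nadd Nsm]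
 have lN: "lmod N" by (rule left_module_hom_image(1)[OF lM Ncar Nzero Nadd Nsm])
 have "ker_of M N q = U"
 proof -
  have "x \<ominus>\<^bsub>M\<^esub> \<zero>\<^bsub>M\<^esub> = x" if "x : car M" for x
   using M.M.minus_add_cancel[OF that M.M.zero_closed] that by simp
  then show ?thesis using Ud(1) q_iff[of _ "\<zero>\<^bsub>M\<^esub>"] by (auto simp: Nzero)
 qed
 moreover have im: "q ` car M = car N" by (simp add: N_def)
 ultimately show ?thesis using that[OF fd_surj[OF M lN qh im] qh im] by blast
qed

end

section \<open>Direct sums and biproducts\<close>

lemma direct_sum_simps [simp]:
 "car (direct_sum I M) = (\<Pi>\<^sub>E i\<in>I. car (M i))" "\<zero>\<^bsub>direct_sum I M\<^esub> = (\<lambda>i\<in>I. \<zero>\<^bsub>M i\<^esub>)"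
 "x \<oplus>\<^bsub>direct_sum I M\<^esub> y = (\<lambda>i\<in>I. x i \<oplus>\<^bsub>M i\<^esub> y i)" "a \<odot>\<^bsub>direct_sum I M\<^esub> x = (\<lambda>i\<in>I. a \<odot>\<^bsub>M i\<^esub> x i)"
 by (simp_all add: direct_sum_def)

context kalg
begin

lemma left_module_direct_sum:
 assumes M: "!!i. i : I ==> lmod (M i)"
 shows "lmod (direct_sum I M)"
proof -
 let ?D = "direct_sum I M"
 have eqI: "(\<lambda>i\<in>I. y i) = x" if "x : car ?D" "!!i. i : I ==> y i = x i" for x y
  by (rule extensionalityI[of _ I]) (use that in \<open>auto simp: PiE_iff\<close>)
 have zero: "\<zero>\<^bsub>?D\<^esub> \<oplus>\<^bsub>?D\<^esub> x = x" and one: "\<one>\<^bsub>A\<^esub> \<odot>\<^bsub>?D\<^esub> x = x"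
  and inv: "EX y:car ?D. y \<oplus>\<^bsub>?D\<^esub> x = \<zero>\<^bsub>?D\<^esub>" if x: "x : car ?D" for x
 proof -
  have *: "x i : car (M i) & \<zero>\<^bsub>M i\<^esub> \<oplus>\<^bsub>M i\<^esub> x i = x i & \<one>\<^bsub>A\<^esub> \<odot>\<^bsub>M i\<^esub> x i = x i
   & \<ominus>\<^bsub>M i\<^esub> x i : car (M i) & \<ominus>\<^bsub>M i\<^esub> x i \<oplus>\<^bsub>M i\<^esub> x i = \<zero>\<^bsub>M i\<^esub>" if i: "i : I" for i
  proof -
   interpret Mi: left_module A "M i" by (rule M[OF i])
   have "x i : car (M i)" using x i by (auto simp: PiE_iff)
   then show ?thesis using Mi.M.l_neg Mi.smult_one by simp
  qed
  have "\<zero>\<^bsub>?D\<^esub> \<oplus>\<^bsub>?D\<^esub> x = (\<lambda>i\<in>I. \<zero>\<^bsub>M i\<^esub> \<oplus>\<^bsub>M i\<^esub> x i)" by (auto intro!: restrict_ext)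
  then show "\<zero>\<^bsub>?D\<^esub> \<oplus>\<^bsub>?D\<^esub> x = x" using eqI[OF x] * by simp
  show "\<one>\<^bsub>A\<^esub> \<odot>\<^bsub>?D\<^esub> x = x" using eqI[OF x] * by simp
  have "(\<lambda>i\<in>I. \<ominus>\<^bsub>M i\<^esub> x i) \<oplus>\<^bsub>?D\<^esub> x = \<zero>\<^bsub>?D\<^esub>" using * by (auto intro!: restrict_ext)
  moreover have "(\<lambda>i\<in>I. \<ominus>\<^bsub>M i\<^esub> x i) : car ?D" using * by auto
  ultimately show "EX y:car ?D. y \<oplus>\<^bsub>?D\<^esub> x = \<zero>\<^bsub>?D\<^esub>" by blast
 qed
 show ?thesis
  by (rule left_moduleI[OF _ _ _ _ _ zero inv _ _ _ _ one])
   (auto intro!: restrict_ext A.ring_axioms PiE_I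
    left_module.smult_closed[OF M] left_module.smult_l_distr[OF M] left_module.smult_r_distr[OF M]
    left_module.smult_assoc1[OF M] abelian_groupE(1)[OF left_module.axioms(2)[OF M]]
    abelian_groupE(2)[OF left_module.axioms(2)[OF M]] abelian_groupE(3)[OF left_module.axioms(2)[OF M]]
    abelian_groupE(4)[OF left_module.axioms(2)[OF M]])
qed

lemma hom_component:
 assumes "i : I" shows "(%x. x i) : Hom (direct_sum I M) (M i)"
 by (rule homI) (use assms in auto)

lemma hom_direct_sum:
 assumes M: "!!i. i : I ==> lmod (M i)" and L: "lmod L"
  and f: "!!i. i : I ==> f i : Hom L (M i)"
 shows "(%x. \<lambda>i\<in>I. f i x) : Hom L (direct_sum I M)"
 by (rule homI) (auto simp: homD[OF f] left_module.smult_closed[OF L] intro!: restrict_ext)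

text \<open>Inclusions and projections characterise a direct sum independently of its element type.
  This matters because the elements of \<open>direct_sum\<close> are families, whereas the
  definitions ask for standard modules.\<close>

definition biprod :: "('a, 's) module => ('a, 'm) module => ('a, 'n) module =>
  ('m => 's) => ('n => 's) => ('s => 'm) => ('s => 'n) => bool" where
 "biprod S M N i1 i2 p1 p2 \<longleftrightarrow> lmod S & lmod M & lmod N
  & i1 : Hom M S & i2 : Hom N S & p1 : Hom S M & p2 : Hom S N
  & (ALL x:car M. p1 (i1 x) = x & p2 (i1 x) = \<zero>\<^bsub>N\<^esub>)
  & (ALL y:car N. p2 (i2 y) = y & p1 (i2 y) = \<zero>\<^bsub>M\<^esub>)
  & (ALL s:car S. i1 (p1 s) \<oplus>\<^bsub>S\<^esub> i2 (p2 s) = s)"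

lemma biprodD:
 assumes "biprod S M N i1 i2 p1 p2"
 shows "lmod S" "lmod M" "lmod N"
  "i1 : Hom M S" "i2 : Hom N S" "p1 : Hom S M" "p2 : Hom S N"
  "x : car M ==> p1 (i1 x) = x" "x : car M ==> p2 (i1 x) = \<zero>\<^bsub>N\<^esub>"
  "y : car N ==> p2 (i2 y) = y" "y : car N ==> p1 (i2 y) = \<zero>\<^bsub>M\<^esub>"
  "s : car S ==> i1 (p1 s) \<oplus>\<^bsub>S\<^esub> i2 (p2 s) = s"
 using assms unfolding biprod_def by auto

lemma left_module_sub_image:
 fixes M :: "('a, 'm) module" and N :: "('a, 'n) module"
 assumes "lmod M" "lmod N" "f : Hom M N"
 shows "lmod (N(|carrier := f ` car M|))"
 by (rule left_module_sub[OF assms(2) submod_image[OF assms submod_carrier[OF assms(1)]]])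

lemma fd_image:
 fixes M :: "('a, 'm) module" and N :: "('a, 'n) module"
 assumes M: "fdm M" and N: "lmod N" and f: "f : Hom M N"
 shows "fdm (N(|carrier := f ` car M|))"
 by (rule fd_surj[OF M left_module_sub_image[OF fdD(1)[OF M] N f] hom_into_sub[OF f]]) auto

lemma biprod_fd:
 assumes b: "biprod S M N i1 i2 p1 p2" and M: "fdm M" and N: "fdm N"
 shows "fdm S"
proof -
 note b = biprodD[OF b]
 have "fin_dim_space K (restrict_scalars A S)"
 proof (rule fin_dim_space_sum)
  show "vectorspace K (restrict_scalars A S)" by (rule vs_restrict[OF b(1)])
  show "subspace K (i1 ` car M) (restrict_scalars A S)"
   by (rule subspace_restrict_scalars[OF b(1) submod_image[OF b(2,1,4) submod_carrier[OF b(2)]]])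
  show "subspace K (i2 ` car N) (restrict_scalars A S)"
   by (rule subspace_restrict_scalars[OF b(1) submod_image[OF b(3,1,5) submod_carrier[OF b(3)]]])
  show "fin_dim_space K ((restrict_scalars A S)(|carrier := i1 ` car M|))"
   using fdD(2)[OF fd_image[OF M b(1,4)]] by (simp add: restrict_scalars_sub)
  show "fin_dim_space K ((restrict_scalars A S)(|carrier := i2 ` car N|))"
   using fdD(2)[OF fd_image[OF N b(1,5)]] by (simp add: restrict_scalars_sub)
  fix v assume "v : car (restrict_scalars A S)"
  then have v: "v : car S" by simp
  then show "EX u:i1 ` car M. EX w:i2 ` car N. v = u \<oplus>\<^bsub>restrict_scalars A S\<^esub> w"
   using b(12)[OF v, symmetric] homD(1)[OF b(6) v] homD(1)[OF b(7) v]
   unfolding restrict_scalars_simps by blast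
 qed
 then show ?thesis using b(1) by (simp add: fd_module_def)
qed

lemma biprod_insert:
 assumes i: "i \<notin> I" and M: "!!j. j : insert i I ==> lmod (M j)"
 shows "biprod (direct_sum (insert i I) M) (M i) (direct_sum I M)
  (%x. \<lambda>j\<in>insert i I. if j = i then x else \<zero>\<^bsub>M j\<^esub>)
  (%x. \<lambda>j\<in>insert i I. if j = i then \<zero>\<^bsub>M j\<^esub> else x j) (%x. x i) (%x. restrict x I)"
proof -
 have l: "lmod (M i)" using M by simp
 have lI: "lmod (direct_sum I M)" by (rule left_module_direct_sum) (use M in simp)
 have z: "\<zero>\<^bsub>M j\<^esub> : car (M j)" "x : car (M j) ==> \<zero>\<^bsub>M j\<^esub> \<oplus>\<^bsub>M j\<^esub> x = x"
  "x : car (M j) ==> x \<oplus>\<^bsub>M j\<^esub> \<zero>\<^bsub>M j\<^esub> = x" if "j : insert i I" for x j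
 proof -
  interpret Mj: left_module A "M j" by (rule M[OF that])
  show "\<zero>\<^bsub>M j\<^esub> : car (M j)" "x : car (M j) ==> \<zero>\<^bsub>M j\<^esub> \<oplus>\<^bsub>M j\<^esub> x = x"
  "x : car (M j) ==> x \<oplus>\<^bsub>M j\<^esub> \<zero>\<^bsub>M j\<^esub> = x" by auto
 qed
 have 1: "(%x. \<lambda>j\<in>insert i I. if j = i then x else \<zero>\<^bsub>M j\<^esub>) : Hom (M i) (direct_sum (insert i I) M)"
 proof (rule hom_direct_sum[OF M l])
  fix j assume j: "j : insert i I"
  show "(%x. if j = i then x else \<zero>\<^bsub>M j\<^esub>) : Hom (M i) (M j)"
   by (cases "j = i") (use hom_id[OF l] hom_zero_map[OF M[OF j]] in auto)
 qed
 have 2: "(%x. \<lambda>j\<in>insert i I. if j = i then \<zero>\<^bsub>M j\<^esub> else x j) : Hom (direct_sum I M) (direct_sum (insert i I) M)"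
 proof (rule hom_direct_sum[OF M lI])
  fix j assume j: "j : insert i I"
  show "(%x. if j = i then \<zero>\<^bsub>M j\<^esub> else x j) : Hom (direct_sum I M) (M j)"
   by (cases "j = i") (use hom_component[of j I M] hom_zero_map[OF l, of "direct_sum I M"] j in auto)
 qed
 have 3: "(%x. restrict x I) : Hom (direct_sum (insert i I) M) (direct_sum I M)"
  by (rule homI) (auto intro!: restrict_ext)
 have lS: "lmod (direct_sum (insert i I) M)" by (rule left_module_direct_sum[OF M])
 have 4: "(\<lambda>j\<in>insert i I. (\<lambda>j\<in>insert i I. if j = i then s i else \<zero>\<^bsub>M j\<^esub>) j \<oplus>\<^bsub>M j\<^esub>
   (\<lambda>j\<in>insert i I. if j = i then \<zero>\<^bsub>M j\<^esub> else restrict s I j) j) = s"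
  if s: "s : car (direct_sum (insert i I) M)" for s
 proof (rule extensionalityI[of _ "insert i I"])
  show "s : extensional (insert i I)" using s by (simp add: PiE_iff)
  fix j assume j: "j : insert i I"
  have "s j : car (M j)" using s j by (auto simp: PiE_iff)
  then show "(\<lambda>j\<in>insert i I. (\<lambda>j\<in>insert i I. if j = i then s i else \<zero>\<^bsub>M j\<^esub>) j \<oplus>\<^bsub>M j\<^esub>
   (\<lambda>j\<in>insert i I. if j = i then \<zero>\<^bsub>M j\<^esub> else restrict s I j) j) j = s j"
   using z(2,3)[OF j] j by auto
 qed simp
 have 5: "restrict (\<lambda>j\<in>insert i I. if j = i then x else \<zero>\<^bsub>M j\<^esub>) I = (\<lambda>j\<in>I. \<zero>\<^bsub>M j\<^esub>)" for x
  using i by (auto simp: fun_eq_iff)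
 have 6: "restrict (\<lambda>j\<in>insert i I. if j = i then \<zero>\<^bsub>M j\<^esub> else y j) I = y" if y: "y : car (direct_sum I M)" for y
  by (rule extensionalityI[of _ I]) (use y i in \<open>auto simp: PiE_iff\<close>)
 show ?thesis
  unfolding biprod_def direct_sum_simps(3)
  using l lI lS 1 2 3 4 5 6 hom_component[of i "insert i I" M] by simp
qed

lemma fd_zero:
 assumes M: "lmod M" and z: "car M = {\<zero>\<^bsub>M\<^esub>}" shows "fdm M"
proof -
 interpret V: vectorspace K "restrict_scalars A M" by (rule vs_restrict[OF M])
 have "V.fin_dim" unfolding V.fin_dim_def by (rule exI[of _ "{}"]) (simp add: V.span_empty z)
 then show ?thesis using M V.vectorspace_axioms by (simp add: fd_module_def fin_dim_space_def)
qed

lemma fd_direct_sum: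
 assumes "finite I" "!!i. i : I ==> fdm (M i)"
 shows "fdm (direct_sum I M)"
 using assms
proof (induction I)
 case empty
 show ?case by (rule fd_zero) (auto intro!: left_module_direct_sum)
next
 case (insert i I)
 have l: "lmod (M j)" if "j : insert i I" for j by (rule fdD(1)[OF insert.prems[OF that]])
 have "fdm (M i)" by (rule insert.prems) simp
 moreover have "fdm (direct_sum I M)" by (rule insert.IH) (rule insert.prems, simp)
 ultimately show ?case using biprod_fd[OF biprod_insert[OF insert.hyps(2) l]] by simp
qed

lemma biprod_transport:
 assumes b: "biprod S M N i1 i2 p1 p2" and S': "lmod S'"
  and f: "f : Hom S S'" and bij: "bij_betw f (car S) (car S')"
 shows "biprod S' M N (%x. f (i1 x)) (%x. f (i2 x)) (%x. p1 (inv_into (car S) f x)) (%x. p2 (inv_into (car S) f x))"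
proof -
 note b = biprodD[OF b]
 let ?g = "inv_into (car S) f"
 have g: "?g : Hom S' S" by (rule hom_inv_into[OF b(1) f bij])
 have gf: "?g (f x) = x" if "x : car S" for x using that bij by (simp add: bij_betw_def)
 have fg: "f (?g x) = x" if "x : car S'" for x using bij_betw_inv_into_right[OF bij that] .
 have "f (i1 (p1 (?g s))) \<oplus>\<^bsub>S'\<^esub> f (i2 (p2 (?g s))) = s" if s: "s : car S'" for s
 proof -
  have gs: "?g s : car S" by (rule homD(1)[OF g s])
  have "f (i1 (p1 (?g s))) \<oplus>\<^bsub>S'\<^esub> f (i2 (p2 (?g s))) = f (i1 (p1 (?g s)) \<oplus>\<^bsub>S\<^esub> i2 (p2 (?g s)))"
   by (rule homD(2)[OF f, symmetric])
    (simp_all add: homD(1)[OF b(4)] homD(1)[OF b(5)] homD(1)[OF b(6)] homD(1)[OF b(7)] gs)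
  then show ?thesis using b(12)[OF gs] fg[OF s] by simp
 qed
 then show ?thesis unfolding biprod_def
  using b(1-3) S' hcomp[OF b(4) f] hcomp[OF b(5) f] hcomp[OF g b(6)] hcomp[OF g b(7)]
   b(8-11) gf homD(1)[OF b(4)] homD(1)[OF b(5)] by simp
qed

text \<open>The direct sum over {0, 1} is formed first and then moved to a standard copy, so sums of
  standard modules stay within that type.\<close>

lemma std_biprod:
 fixes M N :: "('k, 'a) smod"
 assumes M: "fdm M" and N: "fdm N"
 obtains S :: "('k, 'a) smod" and i1 i2 p1 p2 where "fdm S" "biprod S M N i1 i2 p1 p2"
proof -
 define F where "F i = (if i = (0::nat) then M else N)" for i
 let ?S = "direct_sum {0, 1} F"
 have F: "fdm (F i)" "lmod (F i)" for i using M N fdD by (auto simp: F_def)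
 have FM: "F 0 = M" and FN: "F (Suc 0) = N" by (auto simp: F_def)
 interpret M: left_module A M by (rule fdD(1)[OF M])
 interpret N: left_module A N by (rule fdD(1)[OF N])
 have S: "fdm ?S" by (rule fd_direct_sum) (use F in auto)
 have 1: "(%x. \<lambda>j\<in>{0, 1}. if j = 0 then x else \<zero>\<^bsub>F j\<^esub>) : Hom M ?S"
 proof (rule hom_direct_sum[OF F(2) M.left_module_axioms])
  fix j assume "j : {0, 1::nat}"
  then show "(%x. if j = 0 then x else \<zero>\<^bsub>F j\<^esub>) : Hom M (F j)"
   using hom_id[OF M.left_module_axioms] hom_zero_map[OF N.left_module_axioms, of M] FM FN by auto
 qed
 have 2: "(%x. \<lambda>j\<in>{0, 1}. if j = 0 then \<zero>\<^bsub>F j\<^esub> else x) : Hom N ?S"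
 proof (rule hom_direct_sum[OF F(2) N.left_module_axioms])
  fix j assume "j : {0, 1::nat}"
  then show "(%x. if j = 0 then \<zero>\<^bsub>F j\<^esub> else x) : Hom N (F j)"
   using hom_id[OF N.left_module_axioms] hom_zero_map[OF M.left_module_axioms, of N] FM FN by auto
 qed
 have 3: "(\<lambda>j\<in>{0, 1}. (\<lambda>j\<in>{0, 1}. if j = 0 then x 0 else \<zero>\<^bsub>F j\<^esub>) j \<oplus>\<^bsub>F j\<^esub> (\<lambda>j\<in>{0, 1}. if j = 0 then \<zero>\<^bsub>F j\<^esub> else x 1) j) = x"
  if x: "x : car ?S" for x
 proof (rule extensionalityI[of _ "{0, 1}"])
  show "x : extensional {0, 1}" using x by (auto simp: PiE_iff)
  fix j assume j: "j : {0, 1::nat}"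
  have "x 0 : car M" "x 1 : car N" using x FM FN by (auto simp: PiE_iff)
  then show "(\<lambda>j\<in>{0, 1}. (\<lambda>j\<in>{0, 1}. if j = 0 then x 0 else \<zero>\<^bsub>F j\<^esub>) j \<oplus>\<^bsub>F j\<^esub> (\<lambda>j\<in>{0, 1}. if j = 0 then \<zero>\<^bsub>F j\<^esub> else x 1) j) j = x j"
   using j by (auto simp: FM FN)
 qed simp
 have bS: "biprod ?S M N (%x. \<lambda>j\<in>{0, 1}. if j = 0 then x else \<zero>\<^bsub>F j\<^esub>) (%x. \<lambda>j\<in>{0, 1}. if j = 0 then \<zero>\<^bsub>F j\<^esub> else x)
   (%x. x 0) (%x. x 1)"
  unfolding biprod_def direct_sum_simps(3)
  using 1 2 3 hom_component[of 0 "{0, 1}" F] hom_component[of 1 "{0, 1}" F] fdD(1)[OF S]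
   M.left_module_axioms N.left_module_axioms by (simp add: FM FN)
 obtain S' :: "('k, 'a) smod" and f where S': "fdm S'" "f : Hom ?S S'"
  "bij_betw f (car ?S) (car S')" using std_copy[OF S] by blast
 show ?thesis
  by (rule that[OF S'(1) biprod_transport[OF bS fdD(1)[OF S'(1)] S'(2,3)]])
qed

lemma biprod_hom_eqI:
 assumes b: "biprod S M N i1 i2 p1 p2" and L: "lmod L"
  and f: "f : Hom S L" "g : Hom S L"
  and "!!x. x : car M ==> f (i1 x) = g (i1 x)" "!!x. x : car N ==> f (i2 x) = g (i2 x)"
  and s: "s : car S"
 shows "f s = g s"
proof -
 note b = biprodD[OF b]
 have "f (i1 (p1 s) \<oplus>\<^bsub>S\<^esub> i2 (p2 s)) = g (i1 (p1 s) \<oplus>\<^bsub>S\<^esub> i2 (p2 s))"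
  using assms(5)[of "p1 s"] assms(6)[of "p2 s"] homD(1)[OF b(6) s] homD(1)[OF b(7) s]
  by (simp add: homD(2)[OF f(1)] homD(2)[OF f(2)] homD(1)[OF b(4)] homD(1)[OF b(5)])
 then show ?thesis using b(12)[OF s] by simp
qed

lemma biprod_copair:
 assumes b: "biprod S M N i1 i2 p1 p2" and L: "lmod L"
  and f: "f : Hom M L" and g: "g : Hom N L"
 obtains h where "h : Hom S L" "!!x. x : car M ==> h (i1 x) = f x"
  "!!x. x : car N ==> h (i2 x) = g x"
proof (rule that)
 note b = biprodD[OF b]
 interpret L: left_module A L by fact
 interpret M: left_module A M by (rule b(2))
 interpret N: left_module A N by (rule b(3))
 show "(%s. f (p1 s) \<oplus>\<^bsub>L\<^esub> g (p2 s)) : Hom S L"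
  by (rule hom_add[OF L hcomp[OF b(6) f] hcomp[OF b(7) g]])
 show "f (p1 (i1 x)) \<oplus>\<^bsub>L\<^esub> g (p2 (i1 x)) = f x" if "x : car M" for x
  using b(8,9)[OF that] N.hom_zero[OF L g] homD(1)[OF f that] by simp
 show "f (p1 (i2 x)) \<oplus>\<^bsub>L\<^esub> g (p2 (i2 x)) = g x" if "x : car N" for x
  using b(10,11)[OF that] M.hom_zero[OF L f] homD(1)[OF g that] by simp
qed

end

section \<open>Projective and indecomposable modules\<close>

context kalg
begin

lemma projD: "proj P ==> fdm P" "proj P ==> lmod P"
 using fdD(1) unfolding projective_def by auto

lemma projectiveI:
 fixes P :: "('a, 'p) module"
 assumes "fdm P"
  and "!!(M :: ('k, 'a) smod) (N :: ('k, 'a) smod) f g.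
   [|fdm M; fdm N; f : Hom M N; f ` car M = car N; g : Hom P N|]
   ==> EX h:Hom P M. ALL x:car P. f (h x) = g x"
 shows "proj P"
 unfolding projective_def
proof (intro conjI assms(1) allI impI, elim conjE)
 fix M N :: "('k, 'a) smod" and f g
 assume M: "fdm M" and N: "fdm N" and f: "mod_epi A M N f" and g: "g : mod_Hom A P N"
 have P: "lmod P" by (rule fdD(1)[OF assms(1)])
 have "f : Hom M N" "f ` car M = car N" "g : Hom P N" "g : extensional (car P)"
  using f g by (auto simp: mod_epi_def mod_Hom_def)
 with assms(2)[OF M N] obtain h where h: "h : Hom P M" "ALL x:car P. f (h x) = g x" by blast
 have "compose (car P) f (restrict h (car P)) = g"
  using h(2) \<open>g : extensional (car P)\<close>
  by (intro extensionalityI[of _ "car P"]) (auto simp: compose_def)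
 then show "EX h:mod_Hom A P M. compose (car P) f h = g"
  using hom_res[OF P h(1)] by blast
qed

text \<open>\<open>projective\<close> tests only epimorphisms between standard modules. Replacing
  source and target by standard copies gives the lifting property for all finite dimensional
  modules.\<close>

lemma projective_lift:
 fixes P :: "('a, 'p) module" and M :: "('a, 'm) module" and N :: "('a, 'n) module"
 assumes P: "proj P" and M: "fdm M" and N: "fdm N"
  and f: "f : Hom M N" and surj: "f ` car M = car N" and g: "g : Hom P N"
 obtains h where "h : Hom P M" "!!x. x : car P ==> f (h x) = g x"
proof -
 note lP = projD(2)[OF P] and lM = fdD(1)[OF M] and lN = fdD(1)[OF N]
 obtain M' :: "('k, 'a) smod" and a where M': "fdm M'" and a: "a : Hom M M'"
  and ba: "bij_betw a (car M) (car M')" using std_copy[OF M] by blast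
 obtain N' :: "('k, 'a) smod" and b where N': "fdm N'" and b: "b : Hom N N'"
  and bb: "bij_betw b (car N) (car N')" using std_copy[OF N] by blast
 let ?c = "inv_into (car M) a"
 have c: "?c : Hom M' M" by (rule hom_inv_into[OF lM a ba])
 have ca: "?c (a x) = x" if "x : car M" for x using that ba by (simp add: bij_betw_def)
 define f' where "f' = restrict (%x. b (f (?c x))) (car M')"
 define g' where "g' = restrict (%x. b (g x)) (car P)"
 have f'1: "f' : mod_Hom A M' N'" unfolding f'_def
  by (rule hom_res[OF fdD(1)[OF M'] hcomp[OF hcomp[OF c f] b]])
 have "f' ` car M' = car N'"
 proof
  show "f' ` car M' <= car N'" using f'1 by (auto simp: mod_Hom_def dest: homD(1))
  show "car N' <= f' ` car M'"
  proof
   fix y assume "y : car N'"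
   then obtain n where n: "n : car N" "y = b n" using bb by (auto simp: bij_betw_def)
   obtain m where m: "m : car M" "n = f m" using surj n by blast
   have am: "a m : car M'" by (rule homD(1)[OF a m(1)])
   then have "f' (a m) = y" using n m ca by (simp add: f'_def)
   then show "y : f' ` car M'" using am by blast
  qed
 qed
 then have "mod_epi A M' N' f'" using f'1 by (simp add: mod_epi_def)
 moreover have "g' : mod_Hom A P N'" unfolding g'_def by (rule hom_res[OF lP hcomp[OF g b]])
 ultimately obtain h where h: "h : mod_Hom A P M'" "compose (car P) f' h = g'"
  using P M' N' unfolding projective_def by blast
 have hh: "h : Hom P M'" using h(1) by (simp add: mod_Hom_def)
 show ?thesis
 proof (rule that[OF hcomp[OF hh c]])
  fix x assume x: "x : car P"
  have hx: "h x : car M'" by (rule homD(1)[OF hh x])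
  have "f' (h x) = g' x" using fun_cong[OF h(2), of x] x by (simp add: compose_def)
  then have "b (f (?c (h x))) = b (g x)" using hx x by (simp add: f'_def g'_def)
  then show "f (?c (h x)) = g x"
   using bb homD(1)[OF f homD(1)[OF c hx]] homD(1)[OF g x]
   by (auto simp: bij_betw_def dest: inj_onD)
 qed
qed

lemma projective_lift_image:
 fixes P :: "('a, 'p) module" and M :: "('a, 'm) module" and N :: "('a, 'n) module"
 assumes P: "proj P" and M: "fdm M" and N: "lmod N"
  and f: "f : Hom M N" and g: "g : Hom P N"
  and im: "!!x. x : car P ==> g x : f ` car M"
 obtains h where "h : Hom P M" "!!x. x : car P ==> f (h x) = g x"
proof -
 have surj: "f ` car M = car (N(|carrier := f ` car M|))" by simp
 have fI: "f : Hom M (N(|carrier := f ` car M|))" by (rule hom_into_sub[OF f]) simp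
 have gI: "g : Hom P (N(|carrier := f ` car M|))" by (rule hom_into_sub[OF g im])
 show ?thesis by (rule projective_lift[OF P M fd_image[OF M N f] fI surj gI]) (rule that)
qed

lemma projective_retract:
 assumes P: "proj P" and Q: "fdm Q" and i: "i : Hom Q P"
  and r: "r : Hom P Q" and ri: "!!x. x : car Q ==> r (i x) = x"
 shows "proj Q"
proof (rule projectiveI[OF Q])
 fix M N :: "('k, 'a) smod" and f g
 assume MN: "fdm M" "fdm N" "f : Hom M N" "f ` car M = car N"
  and g: "g : Hom Q N"
 obtain h where h: "h : Hom P M" "!!x. x : car P ==> f (h x) = g (r x)"
  by (rule projective_lift[OF P MN hcomp[OF r g]]) (rule that)
 have *: "f (h (i x)) = g x" if "x : car Q" for x
  using h(2)[OF homD(1)[OF i that]] ri[OF that] by simp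
 show "EX h:Hom Q M. ALL x:car Q. f (h x) = g x"
  by (rule bexI[OF ballI hcomp[OF i h(1)]]) (rule *)
qed

lemma projective_iso:
 assumes P: "proj P" and Q: "lmod Q" and f: "f : Hom P Q"
  and bij: "bij_betw f (car P) (car Q)"
 shows "proj Q"
proof (rule projective_retract[OF P])
 show "fdm Q" by (rule fd_surj[OF projD(1)[OF P] Q f]) (use bij in \<open>simp add: bij_betw_def\<close>)
 show "inv_into (car P) f : Hom Q P" by (rule hom_inv_into[OF projD(2)[OF P] f bij])
 show "f (inv_into (car P) f x) = x" if "x : car Q" for x by (rule bij_betw_inv_into_right[OF bij that])
qed (rule f)

lemma projective_biprod:
 assumes b: "biprod S P Q i1 i2 p1 p2" and P: "proj P" and Q: "proj Q"
 shows "proj S"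
proof (rule projectiveI[OF biprod_fd[OF b projD(1)[OF P] projD(1)[OF Q]]])
 fix M N :: "('k, 'a) smod" and f g
 assume MN: "fdm M" "fdm N" "f : Hom M N" "f ` car M = car N"
  and g: "g : Hom S N"
 note bd = biprodD[OF b]
 obtain h1 where h1: "h1 : Hom P M" "!!x. x : car P ==> f (h1 x) = g (i1 x)"
  by (rule projective_lift[OF P MN hcomp[OF bd(4) g]]) (rule that)
 obtain h2 where h2: "h2 : Hom Q M" "!!x. x : car Q ==> f (h2 x) = g (i2 x)"
  by (rule projective_lift[OF Q MN hcomp[OF bd(5) g]]) (rule that)
 obtain h where h: "h : Hom S M" "!!x. x : car P ==> h (i1 x) = h1 x"
  "!!x. x : car Q ==> h (i2 x) = h2 x" by (rule biprod_copair[OF b fdD(1)[OF MN(1)] h1(1) h2(1)]) (rule that)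
 have *: "f (h x) = g x" if "x : car S" for x
  by (rule biprod_hom_eqI[OF b fdD(1)[OF MN(2)] hcomp[OF h(1) MN(3)] g _ _ that])
   (simp_all add: h(2,3) h1(2) h2(2))
 show "EX h:Hom S M. ALL x:car S. f (h x) = g x" by (rule bexI[OF ballI h(1)]) (rule *)
qed

lemma projective_zero:
 assumes M: "lmod M" and z: "car M = {\<zero>\<^bsub>M\<^esub>}"
 shows "proj M"
proof (rule projectiveI[OF fd_zero[OF assms]])
 fix L N :: "('k, 'a) smod" and f g
 assume LN: "fdm L" "fdm N" "f : Hom L N" and g: "g : Hom M N"
 interpret L: left_module A L by (rule fdD(1)[OF LN(1)])
 interpret M: left_module A M by (rule M)
 have "f \<zero>\<^bsub>L\<^esub> = g \<zero>\<^bsub>M\<^esub>"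
  using L.hom_zero[OF fdD(1)[OF LN(2)] LN(3)] M.hom_zero[OF fdD(1)[OF LN(2)] g] by simp
 then show "EX h:Hom M L. ALL x:car M. f (h x) = g x"
  using hom_zero_map[OF L.left_module_axioms, of M] z by (intro bexI[of _ "%x. \<zero>\<^bsub>L\<^esub>"]) auto
qed

lemma left_module_regular: "lmod (regm)"
proof -
 have "EX y:car A. y \<oplus>\<^bsub>A\<^esub> x = \<zero>\<^bsub>A\<^esub>" if "x : car A" for x
  using A.l_neg[OF that] A.a_inv_closed[OF that] by blast
 then show ?thesis
  by (intro left_moduleI) (auto simp: A.ring_axioms A.a_ac A.m_assoc A.l_distr A.r_distr)
qed

lemma fd_regular: "fdm (regm)"
 using left_module_regular fin_dim_regular by (simp add: fd_module_def)

text \<open>For an idempotent e this set is the left ideal A e, and a map out of it is determined by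
  the image of e.\<close>

abbreviation left_ideal :: "'a => ('a, 'a) module" where
 "left_ideal e \<equiv> (regm)(|carrier := {a : car A. a \<cdot> e = a}|)"

lemma submod_left_ideal:
 assumes "e : car A"
 shows "submod A (regm) {a : car A. a \<cdot> e = a}"
 by (rule submodI[OF left_module_regular]) (use assms in \<open>auto simp: A.l_distr A.m_assoc\<close>)

lemma fd_left_ideal: "e : car A ==> fdm (left_ideal e)"
 by (rule fd_sub(1)[OF fd_regular submod_left_ideal])

lemma projective_left_ideal:
 assumes e: "e : car A" "e \<cdot> e = e"
 shows "proj (left_ideal e)"
proof (rule projectiveI[OF fd_left_ideal[OF e(1)]])
 fix M N :: "('k, 'a) smod" and f g
 assume MN: "fdm M" "fdm N" "f : Hom M N" "f ` car M = car N"
  and g: "g : Hom (left_ideal e) N"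
 interpret M: left_module A M by (rule fdD(1)[OF MN(1)])
 have "g e : car N" by (rule homD(1)[OF g]) (use e in simp)
 then obtain m where m: "m : car M" "f m = g e" using MN(4) by (metis imageE)
 have h: "(%a. a \<odot>\<^bsub>M\<^esub> m) : Hom (left_ideal e) M"
  by (rule homI) (use m in \<open>auto simp: M.smult_closed M.smult_l_distr M.smult_assoc1\<close>)
 have *: "f (a \<odot>\<^bsub>M\<^esub> m) = g a" if "a : car (left_ideal e)" for a
  using homD(3)[OF MN(3) _ m(1), of a] homD(3)[OF g, of a e] that e m by simp
 show "EX h:Hom (left_ideal e) M. ALL x:car (left_ideal e). f (h x) = g x"
  by (rule bexI[OF ballI h]) (rule *)
qed

lemma projective_regular: "proj (regm)"
proof -
 have "left_ideal \<one>\<^bsub>A\<^esub> = regm" by (simp add: regular_module_def cong: conj_cong)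
 then show ?thesis using projective_left_ideal[of "\<one>\<^bsub>A\<^esub>"] by simp
qed

lemma std_projective:
 assumes P: "proj P"
 obtains P' :: "('k, 'a) smod" and f where "proj P'" "f : Hom P P'"
  "bij_betw f (car P) (car P')"
proof -
 obtain P' :: "('k, 'a) smod" and f where P': "fdm P'" "f : Hom P P'"
  "bij_betw f (car P) (car P')" using std_copy[OF projD(1)[OF P]] by blast
 show ?thesis by (rule that[OF projective_iso[OF P fdD(1)[OF P'(1)] P'(2,3)] P'(2,3)])
qed

text \<open>A free module is built with one summand for each element of S. The predicate Q is
  carried along so that the same construction later yields an induction principle for projective
  modules.\<close>

lemma projective_cover_finite_set:
 fixes Q :: "('k, 'a) smod => bool"
 assumes M: "fdm M" and S: "finite S" "S <= car M"
  and reg: "!!R r. [|proj R; r : Hom (regm) R;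
   bij_betw r (car (regm)) (car R)|] ==> Q R"
  and bip: "!!S M N i1 i2 p1 p2. [|biprod S M N i1 i2 p1 p2; Q M; Q N|] ==> Q S"
 shows "\<exists>(P :: ('k, 'a) smod) f. proj P & Q P & f : Hom P M & S <= f ` car P"
 using S
proof (induction S)
 case empty
 \<comment> \<open>The start is the regular module with the zero map, as Q is known for copies of it
   but not for the zero module.\<close>
 obtain R :: "('k, 'a) smod" and r where R: "proj R" "r : Hom (regm) R"
  "bij_betw r (car (regm)) (car R)"
  by (rule std_projective[OF projective_regular]) (rule that)
 show ?case using R reg[OF R] hom_zero_map[OF fdD(1)[OF M], of R] by blast
next
 case (insert s S)
 then obtain P :: "('k, 'a) smod" and f where
  P: "proj P" "f : Hom P M" "S <= f ` car P" and QP: "Q P" by blast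
 obtain R :: "('k, 'a) smod" and r where R: "proj R" and r: "r : Hom (regm) R"
  and br: "bij_betw r (car (regm)) (car R)"
  using std_projective[OF projective_regular] by blast
 interpret M: left_module A M by (rule fdD(1)[OF M])
 have s: "s : car M" using insert by simp
 let ?c = "inv_into (car (regm)) r"
 have c: "?c : Hom R (regm)" by (rule hom_inv_into[OF left_module_regular r br])
 have "(%a. a \<odot>\<^bsub>M\<^esub> s) : Hom (regm) M"
  by (rule homI) (use s in \<open>auto simp: M.smult_closed M.smult_l_distr M.smult_assoc1\<close>)
 from hcomp[OF c this] have h: "(%y. ?c y \<odot>\<^bsub>M\<^esub> s) : Hom R M" .
 obtain F :: "('k, 'a) smod" and i1 i2 p1 p2 where F: "biprod F P R i1 i2 p1 p2"
  by (rule std_biprod[OF projD(1)[OF P(1)] projD(1)[OF R]]) (rule that)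
 obtain k where k: "k : Hom F M" "!!x. x : car P ==> k (i1 x) = f x"
  "!!x. x : car R ==> k (i2 x) = ?c x \<odot>\<^bsub>M\<^esub> s"
  by (rule biprod_copair[OF F M.left_module_axioms P(2) h]) (rule that)
 have "S <= k ` car F"
 proof
  fix x assume "x : S"
  then obtain y where y: "y : car P" "x = f y" using P(3) by blast
  then show "x : k ` car F" using k(2)[OF y(1)] homD(1)[OF biprodD(4)[OF F] y(1)] by (metis imageI)
 qed
 moreover have "s : k ` car F"
 proof -
  have r1: "r \<one>\<^bsub>A\<^esub> : car R" by (rule homD(1)[OF r]) simp
  have "?c (r \<one>\<^bsub>A\<^esub>) = \<one>\<^bsub>A\<^esub>" using br by (simp add: bij_betw_def)
  then have "k (i2 (r \<one>\<^bsub>A\<^esub>)) = s" using k(3)[OF r1] M.smult_one[OF s] by simp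
  then show ?thesis using homD(1)[OF biprodD(5)[OF F] r1] by blast
 qed
 moreover have "proj F" "Q F"
  by (rule projective_biprod[OF F P(1) R], rule bip[OF F QP reg[OF R r br]])
 ultimately show ?case using k(1) by blast
qed

lemma projective_epi_exists_with:
 fixes Q :: "('k, 'a) smod => bool"
 assumes M: "fdm M"
  and reg: "!!R r. [|proj R; r : Hom (regm) R;
   bij_betw r (car (regm)) (car R)|] ==> Q R"
  and bip: "!!S M N i1 i2 p1 p2. [|biprod S M N i1 i2 p1 p2; Q M; Q N|] ==> Q S"
 shows "\<exists>(P :: ('k, 'a) smod) f. proj P & Q P & f : Hom P M & f ` car P = car M"
proof -
 note lM = fdD(1)[OF M]
 let ?V = "restrict_scalars A M"
 interpret V: vectorspace K ?V by (rule vs_restrict[OF lM])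
 obtain B where B: "finite B" "B <= car M" "V.span B = car M"
  using fdsD(2)[OF fdD(2)[OF M]] unfolding V.fin_dim_def by auto
 have "\<exists>(P :: ('k, 'a) smod) f. proj P & Q P & f : Hom P M & B <= f ` car P"
  by (rule projective_cover_finite_set[where Q = Q, OF M B(1,2)]) (rule reg, assumption+, rule bip, assumption+)
 then obtain P :: "('k, 'a) smod" and f where
  P: "proj P" and QP: "Q P" and f: "f : Hom P M" and Bf: "B <= f ` car P" by blast
 have sub: "submod A M (f ` car P)"
  by (rule submod_image[OF projD(2)[OF P] lM f submod_carrier[OF projD(2)[OF P]]])
 have "LinearCombinations.submodule K (f ` car P) ?V"
  using subspace_restrict_scalars[OF lM sub] by (simp add: subspace_def)
 from V.span_is_subset[OF Bf this] B(3) have "car M <= f ` car P" by simp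
 then have "f ` car P = car M" using submod_subset[OF sub] by blast
 then show ?thesis using P QP f by blast
qed

lemma projective_epi_exists:
 assumes M: "fdm M"
 obtains P :: "('k, 'a) smod" and f where "proj P" "f : Hom P M" "f ` car P = car M"
proof -
 have "\<exists>(P :: ('k, 'a) smod) f. proj P & True & f : Hom P M & f ` car P = car M"
  by (rule projective_epi_exists_with[OF M]) (rule TrueI)+
 then show ?thesis using that by blast
qed

text \<open>A projective module is a retract of a free module of finite rank: the epimorphism from
  the free module splits by lifting the identity.\<close>

lemma projective_induct [consumes 1, case_names regular biprod retract]:
 fixes P :: "('k, 'a) smod"
 assumes P: "proj P"
  and reg: "!!R r. [|proj R; r : Hom (regm) R;
   bij_betw r (car (regm)) (car R)|] ==> Q R"
  and bip: "!!S M N i1 i2 p1 p2. [|biprod S M N i1 i2 p1 p2; Q M; Q N|] ==> Q S"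
  and ret: "!!F P i r. [|lmod F; lmod P; i : Hom P F; r : Hom F P;
   !!x. x : car P ==> r (i x) = x; Q F|] ==> Q P"
 shows "Q P"
proof -
 have "\<exists>(F :: ('k, 'a) smod) f. proj F & Q F & f : Hom F P & f ` car F = car P"
  by (rule projective_epi_exists_with[OF projD(1)[OF P]]) (rule reg, assumption+, rule bip, assumption+)
 then obtain F :: "('k, 'a) smod" and f where F: "proj F" "Q F" and f: "f : Hom F P"
  and surj: "f ` car F = car P" by blast
 obtain i where i: "i : Hom P F" and fi: "!!x. x : car P ==> f (i x) = x"
  by (rule projective_lift[OF P projD(1)[OF F(1)] projD(1)[OF P] f surj hom_id[OF projD(2)[OF P]]])
   (rule that)
 show ?thesis by (rule ret[OF projD(2)[OF F(1)] projD(2)[OF P] i f fi F(2)])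
qed

section \<open>Fitting's lemma and local endomorphism rings\<close>

lemma hom_funpow: "lmod M ==> f : Hom M M ==> f ^^ n : Hom M M"
proof (induction n)
 case 0 then show ?case using hom_id[of M] by (simp add: id_def)
next
 case (Suc n)
 then show ?case using hcomp[of "f ^^ n" M M f M] by (simp add: comp_def)
qed

text \<open>Choose n such that the image of f^n has least dimension. The image of f^(2n) lies inside
  it and has the same dimension, so f^n is onto, hence injective, on its own image. The bound n >= 1
  lets later arguments split off one factor f.\<close>

lemma fitting:
 assumes M: "fdm M" and f: "f : Hom M M"
 obtains n where "n \<ge> 1" "(f ^^ n) ` (f ^^ n) ` car M = (f ^^ n) ` car M"
  "!!x. x : (f ^^ n) ` car M ==> (f ^^ n) x = \<zero>\<^bsub>M\<^esub> ==> x = \<zero>\<^bsub>M\<^esub>"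
proof -
 note lM = fdD(1)[OF M]
 define d where "d n = mdim (M(|carrier := (f ^^ n) ` car M|))" for n
 obtain n where n: "n \<ge> 1" "!!m. m \<ge> 1 ==> d n \<le> d m"
  using ex_has_least_nat[of "%n. n \<ge> 1" 1 d] by auto
 let ?g = "f ^^ n"
 have g: "?g : Hom M M" by (rule hom_funpow[OF lM f])
 have im: "submod A M (?g ` car M)" by (rule submod_image[OF lM lM g submod_carrier[OF lM]])
 have im2: "submod A M (?g ` ?g ` car M)" by (rule submod_image[OF lM lM g im])
 have le: "?g ` ?g ` car M <= ?g ` car M" using homD(1)[OF g] by auto
 have fI: "fdm (M(|carrier := ?g ` car M|))" by (rule fd_sub(1)[OF M im])
 have s: "submod A (M(|carrier := ?g ` car M|)) (?g ` ?g ` car M)"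
  using submod_sub_iff[OF lM im] im2 le by simp
 have "(f ^^ (n + n)) ` car M = ?g ` ?g ` car M" by (simp add: funpow_add image_comp)
 then have "d n \<le> mdim (M(|carrier := ?g ` ?g ` car M|))" using n(2)[of "n + n"] n(1) by (simp add: d_def)
 then have eq: "?g ` ?g ` car M = ?g ` car M"
  using fd_sub(2,3)[OF fI s] by (simp add: d_def)
 have gI: "?g : Hom (M(|carrier := ?g ` car M|)) (M(|carrier := ?g ` car M|))"
  by (rule hom_into_sub[OF hom_from_sub[OF g]]) (use homD(1)[OF g] in auto)
 have "inj_on ?g (?g ` car M)"
  using endo_surj_imp_bij[OF fI gI] eq by (simp add: bij_betw_def)
 then have "x = \<zero>\<^bsub>M\<^esub>" if "x : ?g ` car M" "?g x = \<zero>\<^bsub>M\<^esub>" for x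
  using iffD1[OF inj_on_hom_iff[OF fdD(1)[OF fI] fdD(1)[OF fI] gI], rule_format, of x] that
  by simp
 then show ?thesis using that[OF n(1) eq] by blast
qed

lemma mem_set_addI: "u : U ==> v : V ==> x = u \<oplus>\<^bsub>M\<^esub> v ==> x : U <+>\<^bsub>M\<^esub> V"
 unfolding mem_set_add by blast

lemma fitting_internal_direct_sum:
 assumes M: "lmod M" and g: "g : Hom M M"
  and eq: "g ` g ` car M = g ` car M"
  and inj: "!!x. x : g ` car M ==> g x = \<zero>\<^bsub>M\<^esub> ==> x = \<zero>\<^bsub>M\<^esub>"
 shows "internal_direct_sum A M (g ` car M) (ker_of M M g)"
proof -
 interpret M: left_module A M by fact
 have im: "submod A M (g ` car M)" by (rule submod_image[OF M M g submod_carrier[OF M]])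
 have ker: "submod A M (ker_of M M g)" by (rule submod_kernel[OF M M g])
 have "x : g ` car M <+>\<^bsub>M\<^esub> ker_of M M g" if x: "x : car M" for x
 proof -
  have "g x : g ` g ` car M" using eq x by simp
  then obtain u where u: "u : g ` car M" "g x = g u" by auto
  have uM: "u : car M" using subD(1)[OF im u(1)] .
  have "g (x \<ominus>\<^bsub>M\<^esub> u) = \<zero>\<^bsub>M\<^esub>"
   using M.hom_minus[OF M g x uM] u homD(1)[OF g uM] by (simp add: M.M.minus_eq_zero_iff)
  then have "x \<ominus>\<^bsub>M\<^esub> u : ker_of M M g" using x uM by simp
  then show ?thesis using M.M.add_minus_cancel_left[OF x uM, symmetric] u(1) by (rule mem_set_addI[rotated])
 qed
 then have "g ` car M <+>\<^bsub>M\<^esub> ker_of M M g = car M"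
  using submod_subset[OF submod_sum[OF M im ker]] by blast
 moreover have "g ` car M \<inter> ker_of M M g = {\<zero>\<^bsub>M\<^esub>}"
  using inj subD(2)[OF im] subD(2)[OF ker] by auto
 ultimately show ?thesis using im ker by (simp add: internal_direct_sum_def)
qed

lemma indecD:
 assumes "indec M"
 shows "fdm M" "lmod M" "car M ~= {\<zero>\<^bsub>M\<^esub>}"
  "internal_direct_sum A M U V ==> U = {\<zero>\<^bsub>M\<^esub>} \<or> V = {\<zero>\<^bsub>M\<^esub>}"
proof -
 show M: "fdm M" using assms by (simp add: indecomposable_def)
 show "lmod M" by (rule fdD(1)[OF M])
 show "car M ~= {\<zero>\<^bsub>M\<^esub>}" using assms by (simp add: indecomposable_def)
 show "internal_direct_sum A M U V ==> U = {\<zero>\<^bsub>M\<^esub>} \<or> V = {\<zero>\<^bsub>M\<^esub>}"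
  using assms unfolding indecomposable_def by blast
qed

text \<open>M is the direct sum of the image and the kernel of f^n, so one of them is zero. A zero
  kernel makes f itself injective because n >= 1, and injective endomorphisms are bijective by
  dimension.\<close>

lemma indecomposable_endo:
 assumes M: "indec M" and f: "f : Hom M M"
 shows "bij_betw f (car M) (car M) \<or> (EX n. ALL x:car M. (f ^^ n) x = \<zero>\<^bsub>M\<^esub>)"
proof -
 note fM = indecD(1)[OF M] and lM = indecD(2)[OF M]
 interpret M: left_module A M by (rule lM)
 obtain n where n: "n \<ge> 1" "(f ^^ n) ` (f ^^ n) ` car M = (f ^^ n) ` car M"
  "!!x. x : (f ^^ n) ` car M ==> (f ^^ n) x = \<zero>\<^bsub>M\<^esub> ==> x = \<zero>\<^bsub>M\<^esub>" by (rule fitting[OF fM f]) (rule that)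
 let ?g = "f ^^ n"
 have g: "?g : Hom M M" by (rule hom_funpow[OF lM f])
 from indecD(4)[OF M fitting_internal_direct_sum[OF lM g n(2,3)]]
 show ?thesis
 proof
  assume "?g ` car M = {\<zero>\<^bsub>M\<^esub>}"
  then show ?thesis by blast
 next
  assume ker: "ker_of M M ?g = {\<zero>\<^bsub>M\<^esub>}"
  have "f x = \<zero>\<^bsub>M\<^esub> --> x = \<zero>\<^bsub>M\<^esub>" if x: "x : car M" for x
  proof
   assume fx: "f x = \<zero>\<^bsub>M\<^esub>"
   obtain m where m: "n = Suc m" using n(1) by (cases n) auto
   have "?g x = (f ^^ m) (f x)" by (simp add: m funpow_swap1)
   also have "\<dots> = \<zero>\<^bsub>M\<^esub>" using fx M.hom_zero[OF lM hom_funpow[OF lM f]] by simp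
   finally show "x = \<zero>\<^bsub>M\<^esub>" using ker x by blast
  qed
  then have "inj_on f (car M)" using inj_on_hom_iff[OF lM lM f] by blast
  then show ?thesis using endo_inj_imp_bij[OF fM f] by blast
 qed
qed

text \<open>Put u = a + b. If b is not bijective, neither is u^(-1) b, so that map is nilpotent.
  From a x = 0 follows u x = b x, so u^(-1) b fixes x, and nilpotency gives x = 0.\<close>

lemma indecomposable_local:
 assumes M: "indec M" and a: "a : Hom M M" and b: "b : Hom M M"
  and bij: "bij_betw (%x. a x \<oplus>\<^bsub>M\<^esub> b x) (car M) (car M)"
 shows "bij_betw a (car M) (car M) \<or> bij_betw b (car M) (car M)"
proof (rule disjCI)
 assume nb: "\<not> bij_betw b (car M) (car M)"
 note fM = indecD(1)[OF M] and lM = indecD(2)[OF M]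
 interpret M: left_module A M by (rule lM)
 define u where "u x = a x \<oplus>\<^bsub>M\<^esub> b x" for x
 have u: "u : Hom M M" using hom_add[OF lM a b] by (simp add: u_def[abs_def])
 have bu: "bij_betw u (car M) (car M)" using bij by (simp add: u_def[abs_def])
 let ?v = "inv_into (car M) u"
 have v: "?v : Hom M M" by (rule hom_inv_into[OF lM u bu])
 have vu: "?v (u x) = x" if "x : car M" for x using that bu by (simp add: bij_betw_def)
 have bv: "bij_betw ?v (car M) (car M)" by (rule bij_betw_inv_into[OF bu])
 define c where "c x = ?v (b x)" for x
 have c: "c : Hom M M" using hcomp[OF b v] by (simp add: c_def[abs_def])
 have "\<not> bij_betw c (car M) (car M)"
 proof
  assume bc: "bij_betw c (car M) (car M)"
  have "bij_betw (u \<circ> c) (car M) (car M)" by (rule bij_betw_trans[OF bc bu])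
  moreover have "(u \<circ> c) x = b x" if "x : car M" for x
   using bij_betw_inv_into_right[OF bu homD(1)[OF b that]] by (simp add: c_def)
  ultimately show False using nb bij_betw_cong[of "car M" "u \<circ> c" b "car M"] by blast
 qed
 then obtain n where n: "!!x. x : car M ==> (c ^^ n) x = \<zero>\<^bsub>M\<^esub>"
  using indecomposable_endo[OF M c] by blast
 have "a x = \<zero>\<^bsub>M\<^esub> --> x = \<zero>\<^bsub>M\<^esub>" if x: "x : car M" for x
 proof
  assume "a x = \<zero>\<^bsub>M\<^esub>"
  then have "u x = b x" using homD(1)[OF b x] by (simp add: u_def)
  then have cx: "c x = x" using vu[OF x] by (simp add: c_def)
  have "(c ^^ k) x = x" for k by (induction k) (auto simp: cx)
  then show "x = \<zero>\<^bsub>M\<^esub>" using n[OF x] by simp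
 qed
 then have "inj_on a (car M)" using inj_on_hom_iff[OF lM lM a] by blast
 then show "bij_betw a (car M) (car M)" by (rule endo_inj_imp_bij[OF fM a])
qed

text \<open>Bijectivity of v u makes N the direct sum of the image of u and the kernel of v. The
  image is not zero, so the kernel is, and then v is injective and u is onto.\<close>

lemma split_mono_indecomposable:
 fixes M :: "('a, 'm) module" and N :: "('a, 'n) module"
 assumes M: "lmod M" "car M ~= {\<zero>\<^bsub>M\<^esub>}" and N: "indec N"
  and u: "u : Hom M N" and v: "v : Hom N M"
  and bij: "bij_betw (%x. v (u x)) (car M) (car M)"
 shows "bij_betw u (car M) (car N)"
proof -
 note lN = indecD(2)[OF N]
 interpret M: left_module A M by (rule M)
 interpret N: left_module A N by (rule lN)
 have vu: "(%x. v (u x)) : Hom M M" by (rule hcomp[OF u v])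
 have vu0: "x = \<zero>\<^bsub>M\<^esub>" if "x : car M" "v (u x) = \<zero>\<^bsub>M\<^esub>" for x
  using inj_on_hom_iff[OF M(1) M(1) vu] bij that by (simp add: bij_betw_def)
 have inju: "inj_on u (car M)"
  using bij by (auto simp: bij_betw_def inj_on_def)
 have im: "submod A N (u ` car M)" by (rule submod_image[OF M(1) lN u submod_carrier[OF M(1)]])
 have ker: "submod A N (ker_of N M v)" by (rule submod_kernel[OF lN M(1) v])
 have "y : u ` car M <+>\<^bsub>N\<^esub> ker_of N M v" if y: "y : car N" for y
 proof -
  have "v y : (%x. v (u x)) ` car M" using bij homD(1)[OF v y] by (simp add: bij_betw_def)
  then obtain x where x: "x : car M" "v y = v (u x)" by blast
  have ux: "u x : car N" by (rule homD(1)[OF u x(1)])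
  have "v (y \<ominus>\<^bsub>N\<^esub> u x) = \<zero>\<^bsub>M\<^esub>"
   using N.hom_minus[OF M(1) v y ux] x homD(1)[OF v ux] by (simp add: M.M.minus_eq_zero_iff)
  then have "y \<ominus>\<^bsub>N\<^esub> u x : ker_of N M v" using y ux by simp
  then show ?thesis using N.M.add_minus_cancel_left[OF y ux, symmetric] x(1) by (intro mem_set_addI) auto
 qed
 then have "u ` car M <+>\<^bsub>N\<^esub> ker_of N M v = car N"
  using submod_subset[OF submod_sum[OF lN im ker]] by blast
 moreover have "u ` car M \<inter> ker_of N M v = {\<zero>\<^bsub>N\<^esub>}"
  using subD(2)[OF im] subD(2)[OF ker] vu0 M.hom_zero[OF lN u] by auto
 ultimately have "internal_direct_sum A N (u ` car M) (ker_of N M v)"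
  using im ker by (simp add: internal_direct_sum_def)
 then consider "u ` car M = {\<zero>\<^bsub>N\<^esub>}" | "ker_of N M v = {\<zero>\<^bsub>N\<^esub>}" using indecD(4)[OF N] by blast
 then show ?thesis
 proof cases
  case 1
  have "x = \<zero>\<^bsub>M\<^esub>" if x: "x : car M" for x
  proof -
   have "u x = \<zero>\<^bsub>N\<^esub>" using 1 x by blast
   then show ?thesis using vu0[OF x] N.hom_zero[OF M(1) v] by simp
  qed
  then have "car M = {\<zero>\<^bsub>M\<^esub>}" using M.M.zero_closed by blast
  then show ?thesis using M(2) by blast
 next
  case 2
  have injv: "inj_on v (car N)" using inj_on_hom_iff[OF lN M(1) v] 2 by blast
  have "y : u ` car M" if y: "y : car N" for y
  proof -
   have "v y : (%x. v (u x)) ` car M" using bij homD(1)[OF v y] by (simp add: bij_betw_def)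
   then obtain x where x: "x : car M" "v y = v (u x)" by blast
   then have "y = u x" using inj_onD[OF injv x(2) y homD(1)[OF u x(1)]] by simp
   then show ?thesis using x(1) by blast
  qed
  then show ?thesis using inju homD(1)[OF u] by (auto simp: bij_betw_def)
 qed
qed

end

section \<open>Projective presentations\<close>

lemma superfluousD:
 assumes "superfluous A M L" "Module.submodule U A M"
  and "!!x. x : car M ==> EX u:U. EX v:L. x = u \<oplus>\<^bsub>M\<^esub> v"
  and "U <+>\<^bsub>M\<^esub> L <= car M"
 shows "U = car M"
proof -
 have "U <+>\<^bsub>M\<^esub> L = car M" using assms(3,4) by (auto simp: set_add_def')
 then show ?thesis using assms(1,2) unfolding superfluous_def by blast
qed

context kalg
begin

definition presents where
 "presents P1 d P0 e M \<longleftrightarrow> proj P1 & proj P0 & lmod M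
  & e : Hom P0 M & e ` car P0 = car M
  & d : Hom P1 P0 & d ` car P1 = ker_of P0 M e"

text \<open>This is surjectivity of Hom(d, N). For the presentation behind tau M it says that Hom(N,
  tau M) is zero, and if d is injective it follows from vanishing of Ext^1(M, N).\<close>

definition lifts where
 "lifts d P1 P0 N \<longleftrightarrow>
  (ALL g:Hom P1 N. EX h:Hom P0 N. ALL x:car P1. h (d x) = g x)"

lemma presD:
 assumes "presents P1 d P0 e M"
 shows "proj P1" "proj P0" "lmod M" "e : Hom P0 M"
  "e ` car P0 = car M" "d : Hom P1 P0" "d ` car P1 = ker_of P0 M e"
 using assms unfolding presents_def by auto

lemma presD2:
 assumes "presents P1 d P0 e M"
 shows "fdm M" "!!x. x : car P1 ==> e (d x) = \<zero>\<^bsub>M\<^esub>"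
  "!!y. y : car P0 ==> e y = \<zero>\<^bsub>M\<^esub> ==> y : d ` car P1"
proof -
 note p = presD[OF assms]
 show "fdm M" by (rule fd_surj[OF projD(1)[OF p(2)] p(3,4,5)])
 show "!!x. x : car P1 ==> e (d x) = \<zero>\<^bsub>M\<^esub>" using p(7) by blast
 show "!!y. y : car P0 ==> e y = \<zero>\<^bsub>M\<^esub> ==> y : d ` car P1" using p(7) by blast
qed

lemma liftsE:
 assumes "lifts d P1 P0 N" "g : Hom P1 N"
 obtains h where "h : Hom P0 N" "!!x. x : car P1 ==> h (d x) = g x"
 using assms unfolding lifts_def by blast

lemma hom_factor:
 fixes P :: "('a, 'p) module" and M :: "('a, 'm) module" and N :: "('a, 'n) module"
 assumes P: "lmod P" and M: "lmod M" and N: "lmod N"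
  and e: "e : Hom P M" and surj: "e ` car P = car M"
  and h: "h : Hom P N" and ker: "!!x. x : car P ==> e x = \<zero>\<^bsub>M\<^esub> ==> h x = \<zero>\<^bsub>N\<^esub>"
 obtains k where "k : Hom M N" "!!x. x : car P ==> k (e x) = h x"
proof -
 interpret P: left_module A P by fact
 interpret M: left_module A M by fact
 interpret N: left_module A N by fact
 note e' = homD[OF e] and h' = homD[OF h]
 define k where "k y = h (inv_into (car P) e y)" for y
 have k: "k (e x) = h x" if x: "x : car P" for x
 proof -
  let ?y = "inv_into (car P) e (e x)"
  have y: "?y : car P" "e ?y = e x"
   using x by (auto intro: inv_into_into f_inv_into_f)
  then have "e (?y \<ominus>\<^bsub>P\<^esub> x) = \<zero>\<^bsub>M\<^esub>" using P.hom_minus[OF M e y(1) x] e'(1) x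
   by (simp add: M.M.minus_eq_zero_iff)
  then have "h (?y \<ominus>\<^bsub>P\<^esub> x) = \<zero>\<^bsub>N\<^esub>" using ker y x by simp
  then show ?thesis using P.hom_minus[OF N h y(1) x] h'(1) x y by (simp add: N.M.minus_eq_zero_iff k_def)
 qed
 have ex: "EX x:car P. y = e x" if "y : car M" for y using surj that by blast
 have "k : Hom M N"
 proof (rule homI)
  fix y assume "y : car M"
  then obtain x where x: "x : car P" "y = e x" using ex by blast
  show "k y : car N" using x k h'(1) by simp
  fix y' assume "y' : car M"
  then obtain x' where x': "x' : car P" "y' = e x'" using ex by blast
  have "y \<oplus>\<^bsub>M\<^esub> y' = e (x \<oplus>\<^bsub>P\<^esub> x')" using x x' e'(2) by simp
  then show "k (y \<oplus>\<^bsub>M\<^esub> y') = k y \<oplus>\<^bsub>N\<^esub> k y'" using x x' k h'(2) by simp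
 next
  fix a y assume a: "a : car A" and "y : car M"
  then obtain x where x: "x : car P" "y = e x" using ex by blast
  have "a \<odot>\<^bsub>M\<^esub> y = e (a \<odot>\<^bsub>P\<^esub> x)" using x a e'(3) by simp
  then show "k (a \<odot>\<^bsub>M\<^esub> y) = a \<odot>\<^bsub>N\<^esub> k y" using x a k h'(3) P.smult_closed by simp
 qed
 then show ?thesis using k by (rule that)
qed

lemma presents_factor:
 fixes P0 :: "('a, 'p) module" and M :: "('a, 'm) module" and N :: "('a, 'n) module"
 assumes p: "presents P1 d P0 e M" and N: "lmod N" and h: "h : Hom P0 N"
  and hd: "!!x. x : car P1 ==> h (d x) = \<zero>\<^bsub>N\<^esub>"
 obtains k where "k : Hom M N" "!!x. x : car P0 ==> k (e x) = h x"
proof -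
 note pp = presD[OF p]
 have "h x = \<zero>\<^bsub>N\<^esub>" if "x : car P0" "e x = \<zero>\<^bsub>M\<^esub>" for x
  using presD2(3)[OF p that] hd by blast
 then show ?thesis
  by (rule hom_factor[OF projD(2)[OF pp(2)] pp(3) N pp(4,5) h _ that])
qed

text \<open>Take a projective P of least dimension mapping onto M. If U + ker f = P, then f maps U
  onto M, so f lifts to e : P -> U with f e = f. The image of e^n from Fitting's lemma is a
  projective summand still mapping onto M. By minimality it is P, and it lies in U.\<close>

lemma projective_cover_exists:
 assumes M: "fdm M"
 obtains P :: "('k, 'a) smod" and f where "proj P" "f : Hom P M"
  "f ` car P = car M" "superfluous A P (ker_of P M f)"
proof -
 note lM = fdD(1)[OF M]
 define good where "good = (\<lambda>(P :: ('k, 'a) smod, f).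
  proj P & f : Hom P M & f ` car P = car M)"
 obtain P' :: "('k, 'a) smod" and f' where "proj P'" "f' : Hom P' M"
  "f' ` car P' = car M" by (rule projective_epi_exists[OF M]) (rule that)
 then have "good (P', f')" by (simp add: good_def)
 then obtain Pf where "good Pf" and min: "!!x. good x ==> mdim (fst Pf) \<le> mdim (fst x)"
  using ex_has_least_nat[of good "(P', f')" "%x. mdim (fst x)"] by blast
 then obtain P f where Pf: "Pf = (P, f)" and P: "proj P" and f: "f : Hom P M"
  and sf: "f ` car P = car M" unfolding good_def by (cases Pf) auto
 note fP = projD(1)[OF P] and lP = projD(2)[OF P]
 interpret P: left_module A P by (rule lP)
 interpret M: left_module A M by (rule lM)
 have "superfluous A P (ker_of P M f)"
  unfolding superfluous_def
 proof (intro allI impI, elim conjE)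
  fix U assume U: "submod A P U" and sum: "U <+>\<^bsub>P\<^esub> ker_of P M f = car P"
  have UP: "U <= car P" by (rule submod_subset[OF U])
  have fU: "f : Hom (P(|carrier := U|)) M" by (rule hom_from_sub[OF f UP])
  have "f x : f ` U" if x: "x : car P" for x
  proof -
   have "x : U <+>\<^bsub>P\<^esub> ker_of P M f" using x by (simp only: sum)
   then obtain u v where uv: "u : U" "v : ker_of P M f" "x = u \<oplus>\<^bsub>P\<^esub> v"
    unfolding mem_set_add by blast
   have c: "u : car P" "v : car P" "f v = \<zero>\<^bsub>M\<^esub>" using uv(1,2) UP by auto
   have "f x = f u" using uv(3) homD(2)[OF f c(1,2)] homD(1)[OF f c(1)] c(3) by simp
   then show ?thesis using uv(1) by blast
  qed
  then have sfU: "f x : f ` car (P(|carrier := U|))" if "x : car P" for x using that by simp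
  obtain e where e: "e : Hom P (P(|carrier := U|))" and fe: "!!x. x : car P ==> f (e x) = f x"
   by (rule projective_lift_image[OF P fd_sub(1)[OF fP U] lM fU f sfU]) (assumption, rule that)
  have eP: "e : Hom P P" by (rule hom_out_of_sub[OF e UP])
  obtain n where n: "n \<ge> 1" "(e ^^ n) ` (e ^^ n) ` car P = (e ^^ n) ` car P"
   "!!x. x : (e ^^ n) ` car P ==> (e ^^ n) x = \<zero>\<^bsub>P\<^esub> ==> x = \<zero>\<^bsub>P\<^esub>"
   by (rule fitting[OF fP eP]) (rule that)
  let ?g = "e ^^ n" and ?I = "(e ^^ n) ` car P"
  have g: "?g : Hom P P" by (rule hom_funpow[OF lP eP])
  have I: "submod A P ?I" by (rule submod_image[OF lP lP g submod_carrier[OF lP]])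
  have IP: "?I <= car P" by (rule submod_subset[OF I])
  have fg: "f ((e ^^ m) x) = f x" if "x : car P" for x m
  proof (induction m)
   case (Suc m)
   have "(e ^^ m) x : car P" by (rule homD(1)[OF hom_funpow[OF lP eP] that])
   then show ?case using fe Suc by simp
  qed simp
  have fI: "fdm (P(|carrier := ?I|))" by (rule fd_sub(1)[OF fP I])
  have gI: "?g : Hom (P(|carrier := ?I|)) (P(|carrier := ?I|))"
   by (rule hom_into_sub[OF hom_from_sub[OF g IP]]) (use homD(1)[OF g] in auto)
  have bg: "bij_betw ?g (car (P(|carrier := ?I|))) (car (P(|carrier := ?I|)))"
   by (rule endo_surj_imp_bij[OF fI gI]) (simp add: n(2))
  let ?w = "inv_into (car (P(|carrier := ?I|))) ?g"
  have w: "?w : Hom (P(|carrier := ?I|)) (P(|carrier := ?I|))"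
   by (rule hom_inv_into[OF fdD(1)[OF fI] gI bg])
  have g': "?g : Hom P (P(|carrier := ?I|))" by (rule hom_into_sub[OF g]) simp
  \<comment> \<open>On I the map g is bijective with inverse w, so w after g retracts P onto
    I.\<close>
  have "proj (P(|carrier := ?I|))"
  proof (rule projective_retract[OF P fI _ hcomp[OF g' w]])
   show "(%x. x) : Hom (P(|carrier := ?I|)) P" by (rule hom_from_sub[OF hom_id[OF lP] IP])
   show "?w (?g x) = x" if "x : car (P(|carrier := ?I|))" for x
    by (rule inv_into_f_f[OF _ that]) (use bg in \<open>simp add: bij_betw_def\<close>)
  qed
  moreover have "f ` ?I = car M" unfolding image_image using fg sf by (simp cong: image_cong)
  ultimately have "good (P(|carrier := ?I|), f)" using hom_from_sub[OF f IP] by (simp add: good_def)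
  then have "mdim P \<le> mdim (P(|carrier := ?I|))" using min[of "(P(|carrier := ?I|), f)"] Pf by simp
  then have eq: "?I = car P" using fd_sub(2,3)[OF fP I] by simp
  obtain m where m: "n = Suc m" using n(1) by (cases n) auto
  have gU: "?g x : U" if x: "x : car P" for x
  proof -
   have "(e ^^ m) x : car P" by (rule homD(1)[OF hom_funpow[OF lP eP] x])
   then show ?thesis using homD(1)[OF e] by (simp add: m)
  qed
  show "U = car P"
   by (rule equalityI[OF UP]) (subst eq[symmetric], rule image_subsetI, rule gU)
 qed
 then show ?thesis by (rule that[OF P f sf])
qed

lemma superfluous_restrict: "ker_of P M (restrict f (car P)) = ker_of P M f"
 by auto

lemma projective_cover_sub:
 fixes P0 :: "('k, 'a) smod"
 assumes P0: "fdm P0" and U: "submod A P0 U"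
 obtains P1 :: "('k, 'a) smod" and d where "proj P1" "d : mod_Hom A P1 P0"
  "d ` car P1 = U" "superfluous A P1 (ker_of P1 P0 d)"
proof -
 obtain P1 :: "('k, 'a) smod" and f where P1: "proj P1" "f : Hom P1 (P0(|carrier := U|))"
  "f ` car P1 = car (P0(|carrier := U|))" "superfluous A P1 (ker_of P1 (P0(|carrier := U|)) f)"
  by (rule projective_cover_exists[OF fd_sub(1)[OF P0 U]]) (rule that)
 have f: "f : Hom P1 P0" by (rule hom_out_of_sub[OF P1(2) submod_subset[OF U]])
 have e: "ker_of P1 P0 (restrict f (car P1)) = ker_of P1 (P0(|carrier := U|)) f" by auto
 show ?thesis
 proof (rule that[OF P1(1) hom_res[OF projD(2)[OF P1(1)] f]])
  show "restrict f (car P1) ` car P1 = U" using P1(3) by simp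
  show "superfluous A P1 (ker_of P1 P0 (restrict f (car P1)))" unfolding e by (rule P1(4))
 qed
qed

lemma min_presentation_exists:
 assumes M: "fdm M"
 obtains P1 P0 :: "('k, 'a) smod" and d1 d0 where "min_proj_presentation K A M (P1, d1, P0, d0)"
proof -
 note lM = fdD(1)[OF M]
 obtain P0 :: "('k, 'a) smod" and f where P0: "proj P0" and f: "f : Hom P0 M"
  and sf: "f ` car P0 = car M" and su: "superfluous A P0 (ker_of P0 M f)"
  by (rule projective_cover_exists[OF M]) (rule that)
 let ?d0 = "restrict f (car P0)"
 have d0: "?d0 : mod_Hom A P0 M" by (rule hom_res[OF projD(2)[OF P0] f])
 have d0h: "?d0 : Hom P0 M" using d0 by (simp add: mod_Hom_def)
 have ker: "submod A P0 (ker_of P0 M ?d0)" by (rule submod_kernel[OF projD(2)[OF P0] lM d0h])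
 obtain P1 :: "('k, 'a) smod" and d where P1: "proj P1" "d : mod_Hom A P1 P0"
  "d ` car P1 = ker_of P0 M ?d0" "superfluous A P1 (ker_of P1 P0 d)"
  by (rule projective_cover_sub[OF projD(1)[OF P0] ker]) (rule that)
 have "superfluous A P0 (ker_of P0 M ?d0)" using su by (simp only: superfluous_restrict)
 then have "min_proj_presentation K A M (P1, d, P0, ?d0)"
  using P0 P1 d0 sf unfolding min_proj_presentation_def a_kernel_eq mod_epi_def by simp
 then show ?thesis by (rule that)
qed

lemma min_presentationD:
 assumes "min_proj_presentation K A M (P1, d, P0, e)" and "lmod M"
 shows "presents P1 d P0 e M" "superfluous A P0 (ker_of P0 M e)" "superfluous A P1 (ker_of P1 P0 d)"
 using assms unfolding min_proj_presentation_def presents_def a_kernel_eq mod_epi_def mod_Hom_def by auto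

lemma proj_resolution_exists:
 assumes M: "fdm M"
 obtains P2 P1 P0 :: "('k, 'a) smod" and d2 d1 d0 where "proj_resolution K A M (P2, d2, P1, d1, P0, d0)"
proof -
 obtain P1 P0 :: "('k, 'a) smod" and d1 d0 where m: "min_proj_presentation K A M (P1, d1, P0, d0)"
  by (rule min_presentation_exists[OF M]) (rule that)
 note p = presD[OF min_presentationD(1)[OF m fdD(1)[OF M]]]
 have ker: "submod A P1 (ker_of P1 P0 d1)"
  by (rule submod_kernel[OF projD(2)[OF p(1)] projD(2)[OF p(2)] p(6)])
 obtain P2 :: "('k, 'a) smod" and d2 where P2: "proj P2" "d2 : mod_Hom A P2 P1"
  "d2 ` car P2 = ker_of P1 P0 d1" "superfluous A P2 (ker_of P2 P1 d2)"
  by (rule projective_cover_sub[OF projD(1)[OF p(1)] ker]) (rule that)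
 have "proj_resolution K A M (P2, d2, P1, d1, P0, d0)"
  using m P2 unfolding proj_resolution_def min_proj_presentation_def a_kernel_eq by simp
 then show ?thesis by (rule that)
qed

text \<open>A minimal presentation of a direct summand \<open>X\<close> of \<open>T\<close> is a direct summand of every presentation
  of \<open>T\<close>: minimality makes the comparison maps \<open>X \<rightarrow> T \<rightarrow> X\<close> invertible.\<close>

lemma compare_presentations:
 fixes T :: "('a, 't) module" and X :: "('a, 'x) module"
  and P1 P0 :: "('a, 'p) module" and Q1 Q0 :: "('a, 'q) module"
 assumes p: "presents P1 d P0 e T" and q: "presents Q1 d' Q0 e' X"
  and s0: "superfluous A Q0 (ker_of Q0 X e')" and s1: "superfluous A Q1 (ker_of Q1 Q0 d')"
  and i: "i : Hom X T" and r: "r : Hom T X" and ri: "!!x. x : car X ==> r (i x) = x"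
 obtains a0 a1 b0 b1 where "a0 : Hom Q0 P0" "a1 : Hom Q1 P1"
  "b0 : Hom P0 Q0" "b1 : Hom P1 Q1"
  "!!x. x : car Q1 ==> d (a1 x) = a0 (d' x)" "!!x. x : car P1 ==> d' (b1 x) = b0 (d x)"
  "bij_betw (%x. b0 (a0 x)) (car Q0) (car Q0)" "bij_betw (%x. b1 (a1 x)) (car Q1) (car Q1)"
proof -
 note pd = presD[OF p] and qd = presD[OF q]
 note fP1 = projD(1)[OF pd(1)] and fP0 = projD(1)[OF pd(2)]
  and fQ1 = projD(1)[OF qd(1)] and fQ0 = projD(1)[OF qd(2)]
 note lP1 = projD(2)[OF pd(1)] and lP0 = projD(2)[OF pd(2)]
  and lQ1 = projD(2)[OF qd(1)] and lQ0 = projD(2)[OF qd(2)]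
 interpret X: left_module A X by (rule qd(3))
 interpret T: left_module A T by (rule pd(3))
 interpret Q0: left_module A Q0 by (rule lQ0)
 interpret Q1: left_module A Q1 by (rule lQ1)
 obtain a0 where a0: "a0 : Hom Q0 P0" and ea0: "!!x. x : car Q0 ==> e (a0 x) = i (e' x)"
  by (rule projective_lift[OF qd(2) fP0 presD2(1)[OF p] pd(4,5) hcomp[OF qd(4) i]]) (rule that)
 have im1: "a0 (d' x) : d ` car P1" if x: "x : car Q1" for x
 proof (rule presD2(3)[OF p homD(1)[OF a0 homD(1)[OF qd(6) x]]])
  show "e (a0 (d' x)) = \<zero>\<^bsub>T\<^esub>"
   using ea0[OF homD(1)[OF qd(6) x]] presD2(2)[OF q x] X.hom_zero[OF pd(3) i] by simp
 qed
 obtain a1 where a1: "a1 : Hom Q1 P1" and da1: "!!x. x : car Q1 ==> d (a1 x) = a0 (d' x)"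
  by (rule projective_lift_image[OF qd(1) fP1 lP0 pd(6) hcomp[OF qd(6) a0] im1]) (assumption, rule that)
 obtain b0 where b0: "b0 : Hom P0 Q0" and eb0: "!!x. x : car P0 ==> e' (b0 x) = r (e x)"
  by (rule projective_lift[OF pd(2) fQ0 presD2(1)[OF q] qd(4,5) hcomp[OF pd(4) r]]) (rule that)
 have im2: "b0 (d x) : d' ` car Q1" if x: "x : car P1" for x
 proof (rule presD2(3)[OF q homD(1)[OF b0 homD(1)[OF pd(6) x]]])
  show "e' (b0 (d x)) = \<zero>\<^bsub>X\<^esub>"
   using eb0[OF homD(1)[OF pd(6) x]] presD2(2)[OF p x] T.hom_zero[OF qd(3) r] by simp
 qed
 obtain b1 where b1: "b1 : Hom P1 Q1" and db1: "!!x. x : car P1 ==> d' (b1 x) = b0 (d x)"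
  by (rule projective_lift_image[OF pd(1) fQ1 lQ0 qd(6) hcomp[OF pd(6) b0] im2]) (assumption, rule that)
 define a where "a x = b0 (a0 x)" for x
 define b where "b x = b1 (a1 x)" for x
 have a: "a : Hom Q0 Q0" using hcomp[OF a0 b0] by (simp add: a_def[abs_def])
 have b: "b : Hom Q1 Q1" using hcomp[OF a1 b1] by (simp add: b_def[abs_def])
 have e'a: "e' (a x) = e' x" if x: "x : car Q0" for x
  using eb0[OF homD(1)[OF a0 x]] ea0[OF x] ri[OF homD(1)[OF qd(4) x]] by (simp add: a_def)
 have d'b: "d' (b x) = a (d' x)" if x: "x : car Q1" for x
  using db1[OF homD(1)[OF a1 x]] da1[OF x] by (simp add: a_def b_def)
 have ima: "submod A Q0 (a ` car Q0)" by (rule submod_image[OF lQ0 lQ0 a submod_carrier[OF lQ0]])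
 have imb: "submod A Q1 (b ` car Q1)" by (rule submod_image[OF lQ1 lQ1 b submod_carrier[OF lQ1]])
 have ke: "submod A Q0 (ker_of Q0 X e')" by (rule submod_kernel[OF lQ0 qd(3) qd(4)])
 have kd: "submod A Q1 (ker_of Q1 Q0 d')" by (rule submod_kernel[OF lQ1 lQ0 qd(6)])
 \<comment> \<open>From e' a = e' each y differs from a y by an element of ker e', so superfluity of
   that kernel makes a surjective.\<close>
 have "a ` car Q0 = car Q0"
 proof (rule superfluousD[OF s0 ima _ submod_subset[OF submod_sum[OF lQ0 ima ke]]])
  fix y assume y: "y : car Q0"
  have ay: "a y : car Q0" by (rule homD(1)[OF a y])
  have "e' (y \<ominus>\<^bsub>Q0\<^esub> a y) = \<zero>\<^bsub>X\<^esub>"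
   using Q0.hom_minus[OF qd(3,4) y ay] e'a[OF y] homD(1)[OF qd(4) y] by (simp add: X.M.minus_eq_zero_iff)
  then have "y \<ominus>\<^bsub>Q0\<^esub> a y : ker_of Q0 X e'" using y ay by simp
  moreover have "y = a y \<oplus>\<^bsub>Q0\<^esub> (y \<ominus>\<^bsub>Q0\<^esub> a y)" using Q0.M.add_minus_cancel_left[OF y ay] by simp
  ultimately show "EX u:a ` car Q0. EX v:ker_of Q0 X e'. y = u \<oplus>\<^bsub>Q0\<^esub> v" using y by blast
 qed
 then have bija: "bij_betw a (car Q0) (car Q0)" by (rule endo_surj_imp_bij[OF fQ0 a])
 \<comment> \<open>The automorphism a preserves ker e' and is injective there, hence onto. Below,
   this writes d' y as a (d' z) = d' (b z), which is the correction needed for surjectivity of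
   b.\<close>
 let ?L = "Q0(|carrier := ker_of Q0 X e'|)"
 have fL: "fdm ?L" by (rule fd_sub(1)[OF fQ0 ke])
 have aL: "a : Hom ?L ?L"
  by (rule hom_into_sub[OF hom_from_sub[OF a]]) (use e'a homD(1)[OF a] in auto)
 have "inj_on a (car ?L)" using bija by (auto simp: bij_betw_def inj_on_def)
 then have "bij_betw a (car ?L) (car ?L)" by (rule endo_inj_imp_bij[OF fL aL])
 then have aL': "a ` ker_of Q0 X e' = ker_of Q0 X e'" by (simp add: bij_betw_def)
 have "b ` car Q1 = car Q1"
 proof (rule superfluousD[OF s1 imb _ submod_subset[OF submod_sum[OF lQ1 imb kd]]])
  fix y assume y: "y : car Q1"
  have "d' y : a ` (d' ` car Q1)" using aL' qd(7) y by blast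
  then obtain z where z: "z : car Q1" "d' y = a (d' z)" by blast
  have bz: "b z : car Q1" by (rule homD(1)[OF b z(1)])
  have "d' (y \<ominus>\<^bsub>Q1\<^esub> b z) = \<zero>\<^bsub>Q0\<^esub>"
   using Q1.hom_minus[OF lQ0 qd(6) y bz] d'b[OF z(1)] z homD(1)[OF qd(6) y] by (simp add: Q0.M.minus_eq_zero_iff)
  then have "y \<ominus>\<^bsub>Q1\<^esub> b z : ker_of Q1 Q0 d'" using y bz by simp
  moreover have "y = b z \<oplus>\<^bsub>Q1\<^esub> (y \<ominus>\<^bsub>Q1\<^esub> b z)" using Q1.M.add_minus_cancel_left[OF y bz] by simp
  ultimately show "EX u:b ` car Q1. EX v:ker_of Q1 Q0 d'. y = u \<oplus>\<^bsub>Q1\<^esub> v" using z(1) by blast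
 qed
 then have bijb: "bij_betw b (car Q1) (car Q1)" by (rule endo_surj_imp_bij[OF fQ1 b])
 show ?thesis
  by (rule that[OF a0 a1 b0 b1 da1 db1])
   (use bija bijb in \<open>simp_all add: a_def[abs_def] b_def[abs_def]\<close>)
qed

text \<open>Extend g b1 over P0 to h and go back along a0. The result is off by the automorphism b0
  a0, whose inverse is inserted before a0. With X = T and identity maps, this passes from any
  presentation of T to a minimal one.\<close>

lemma lifts_summand:
 fixes T :: "('a, 't) module" and X :: "('a, 'x) module" and N :: "('a, 'n) module"
  and P1 P0 :: "('a, 'p) module" and Q1 Q0 :: "('a, 'q) module"
 assumes p: "presents P1 d P0 e T" and l: "lifts d P1 P0 N" and q: "presents Q1 d' Q0 e' X"
  and s0: "superfluous A Q0 (ker_of Q0 X e')" and s1: "superfluous A Q1 (ker_of Q1 Q0 d')"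
  and i: "i : Hom X T" and r: "r : Hom T X" and ri: "!!x. x : car X ==> r (i x) = x"
 shows "lifts d' Q1 Q0 N"
 unfolding lifts_def
proof
 fix g assume g: "g : Hom Q1 N"
 note pd = presD[OF p] and qd = presD[OF q]
 note lQ1 = projD(2)[OF qd(1)] and lQ0 = projD(2)[OF qd(2)]
 obtain a0 a1 b0 b1 where a0: "a0 : Hom Q0 P0" and a1: "a1 : Hom Q1 P1"
  and b0: "b0 : Hom P0 Q0" and b1: "b1 : Hom P1 Q1"
  and da1: "!!x. x : car Q1 ==> d (a1 x) = a0 (d' x)" and db1: "!!x. x : car P1 ==> d' (b1 x) = b0 (d x)"
  and bij0: "bij_betw (%x. b0 (a0 x)) (car Q0) (car Q0)"
  and bij1: "bij_betw (%x. b1 (a1 x)) (car Q1) (car Q1)"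
  by (rule compare_presentations[OF p q s0 s1 i r ri]) (assumption, rule that)
 obtain h where h: "h : Hom P0 N" and hd: "!!x. x : car P1 ==> h (d x) = g (b1 x)"
  by (rule liftsE[OF l hcomp[OF b1 g]]) (rule that)
 let ?c = "inv_into (car Q0) (%x. b0 (a0 x))"
 have c: "?c : Hom Q0 Q0" by (rule hom_inv_into[OF lQ0 hcomp[OF a0 b0] bij0])
 have cab: "?c (b0 (a0 x)) = x" if "x : car Q0" for x
  using inv_into_f_f[OF bij_betw_imp_inj_on[OF bij0] that] .
 have *: "h (a0 (?c (d' p))) = g p" if p: "p : car Q1" for p
 proof -
  have "p : (%x. b1 (a1 x)) ` car Q1" using bij1 p by (simp add: bij_betw_def)
  then obtain x where x: "x : car Q1" "p = b1 (a1 x)" by blast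
  have a1x: "a1 x : car P1" by (rule homD(1)[OF a1 x(1)])
  have "d' p = b0 (a0 (d' x))" using db1[OF a1x] da1[OF x(1)] x(2) by simp
  then have "?c (d' p) = d' x" using cab[OF homD(1)[OF qd(6) x(1)]] by simp
  then show ?thesis using da1[OF x(1)] hd[OF a1x] x(2) by simp
 qed
 show "EX h:Hom Q0 N. ALL x:car Q1. h (d' x) = g x"
  by (rule bexI[OF ballI hcomp[OF hcomp[OF c a0] h]]) (rule *)
qed

end

section \<open>Homomorphism spaces and Ext\<close>

context kalg
begin

text \<open>The space of homomorphisms is cut out of the power of N indexed by the elements of P, so
  its linear structure comes from \<open>direct_sum\<close> and
  \<open>restrict_scalars\<close>.\<close>

definition HomK :: "('a, 'p) module => ('a, 'n) module => ('k, 'p => 'n) module" where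
 "HomK P N = (restrict_scalars A (direct_sum (car P) (%_. N)))(|carrier := mod_Hom A P N|)"

lemma hom_space_simps [simp]:
 "car (HomK P N) = mod_Hom A P N" "\<zero>\<^bsub>HomK P N\<^esub> = zero_map P N"
 "f \<oplus>\<^bsub>HomK P N\<^esub> g = (\<lambda>x\<in>car P. f x \<oplus>\<^bsub>N\<^esub> g x)"
 "c \<odot>\<^bsub>HomK P N\<^esub> f = (\<lambda>x\<in>car P. (sc c) \<odot>\<^bsub>N\<^esub> f x)"
 by (simp_all add: HomK_def zero_map_def restrict_scalars_def direct_sum_def)

lemma mHomD: "f : mod_Hom A M N ==> f : Hom M N" "f : mod_Hom A M N ==> f : extensional (car M)"
 by (auto simp: mod_Hom_def)

lemma mod_Hom_eqI:
 assumes "f : mod_Hom A M N" "g : mod_Hom A M N" "!!x. x : car M ==> f x = g x"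
 shows "f = g"
 by (rule extensionalityI[OF mHomD(2)[OF assms(1)] mHomD(2)[OF assms(2)] assms(3)])

lemma hom_scal:
 assumes "lmod N" "f : Hom P N" "c : car K"
 shows "(%x. (sc c) \<odot>\<^bsub>N\<^esub> f x) : Hom P N"
proof -
 interpret N: left_module A N by fact
 note s = scal_closed[OF assms(3)] and f = homD[OF assms(2)]
 show ?thesis
 proof (rule homI)
  fix a x assume a: "a : car A" and x: "x : car P"
  then show "(sc c) \<odot>\<^bsub>N\<^esub> f (a \<odot>\<^bsub>P\<^esub> x) = a \<odot>\<^bsub>N\<^esub> ((sc c) \<odot>\<^bsub>N\<^esub> f x)"
   using N.smult_assoc1[OF s a f(1)[OF x]] N.smult_assoc1[OF a s f(1)[OF x]] scal_central[OF assms(3) a] f(3)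
   by simp
 qed (simp_all add: s f N.smult_closed N.smult_r_distr)
qed

lemma subspace_hom_space:
 assumes P: "lmod P" and N: "lmod N"
 shows "subspace K (mod_Hom A P N) (restrict_scalars A (direct_sum (car P) (%_. N)))"
proof -
 interpret N: left_module A N by fact
 let ?D = "restrict_scalars A (direct_sum (car P) (%_. N))"
 have vs: "vectorspace K ?D" by (rule vs_restrict[OF left_module_direct_sum[OF N]])
 have "mod_Hom A P N <= car ?D"
 proof
  fix f assume f: "f : mod_Hom A P N"
  show "f : car ?D" using homD(1)[OF mHomD(1)[OF f]] mHomD(2)[OF f] by (simp add: PiE_iff)
 qed
 moreover have "\<zero>\<^bsub>?D\<^esub> : mod_Hom A P N"
  using hom_res[OF P hom_zero_map[OF N]] by simp
 moreover have "f \<oplus>\<^bsub>?D\<^esub> g : mod_Hom A P N" if "f : mod_Hom A P N" "g : mod_Hom A P N" for f g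
  using hom_res[OF P hom_add[OF N mHomD(1)[OF that(1)] mHomD(1)[OF that(2)]]] by simp
 moreover have "c \<odot>\<^bsub>?D\<^esub> f : mod_Hom A P N" if "c : car K" "f : mod_Hom A P N" for c f
  using hom_res[OF P hom_scal[OF N mHomD(1)[OF that(2)] that(1)]] by simp
 moreover have "module K ?D" using vs by (simp add: vectorspace_def)
 ultimately show ?thesis using vs by (simp add: subspace_def LinearCombinations.submodule_def)
qed

lemma vectorspace_hom_space:
 assumes "lmod P" "lmod N" shows "vectorspace K (HomK P N)"
 unfolding HomK_def
 by (rule vectorspace.subspace_is_vs[OF vs_restrict[OF left_module_direct_sum] subspace_hom_space])
  (use assms in auto)

lemma hom_eq_on_submod:
 assumes "lmod M" "lmod N" "f : Hom M N" "g : Hom M N"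
 shows "submod A M {x : car M. f x = g x}"
proof -
 interpret M: left_module A M by fact
 show ?thesis
  by (rule submodI[OF assms(1)])
   (auto simp: M.hom_zero[OF assms(2,3)] M.hom_zero[OF assms(2,4)] homD(2,3)[OF assms(3)]
    homD(2,3)[OF assms(4)] M.smult_closed)
qed

text \<open>Restriction to a finite spanning set B of P embeds Hom(P, N) into a finite power of N:
  the set where two homomorphisms agree is a submodule, so agreement on B is agreement
  everywhere.\<close>

lemma fin_dim_hom_space:
 fixes P :: "('a, 'p) module" and N :: "('a, 'n) module"
 assumes P: "fdm P" and N: "fdm N"
 shows "fin_dim_space K (HomK P N)"
proof -
 note lP = fdD(1)[OF P] and lN = fdD(1)[OF N]
 let ?V = "restrict_scalars A P"
 interpret V: vectorspace K ?V by (rule vs_restrict[OF lP])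
 obtain B where B: "finite B" "B <= car P" "V.span B = car P"
  using fdsD(2)[OF fdD(2)[OF P]] unfolding V.fin_dim_def by auto
 let ?D = "direct_sum B (%_. N)"
 have D: "fdm ?D" by (rule fd_direct_sum[OF B(1) N])
 have r: "(%f. restrict f B) : module_hom K (HomK P N) (restrict_scalars A ?D)"
 proof (rule homI)
  fix f assume "f : car (HomK P N)"
  then show "restrict f B : car (restrict_scalars A ?D)"
   using homD(1)[OF mHomD(1), of f P N] B(2) by auto
 next
  fix f g
  show "restrict (f \<oplus>\<^bsub>HomK P N\<^esub> g) B = restrict f B \<oplus>\<^bsub>restrict_scalars A ?D\<^esub> restrict g B"
   using B(2) by (auto simp: fun_eq_iff)
 next
  fix c f
  show "restrict (c \<odot>\<^bsub>HomK P N\<^esub> f) B = c \<odot>\<^bsub>restrict_scalars A ?D\<^esub> restrict f B"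
   using B(2) by (auto simp: fun_eq_iff)
 qed
 have "inj_on (%f. restrict f B) (car (HomK P N))"
 proof (rule inj_onI)
  fix f g assume fg: "f : car (HomK P N)" "g : car (HomK P N)" "restrict f B = restrict g B"
  then have f: "f : mod_Hom A P N" and g: "g : mod_Hom A P N" by auto
  have "f x = g x" if "x : B" for x using fun_cong[OF fg(3), of x] that by simp
  then have "B <= {x : car P. f x = g x}" using B(2) by auto
  moreover have "LinearCombinations.submodule K {x : car P. f x = g x} ?V"
   using subspace_restrict_scalars[OF lP hom_eq_on_submod[OF lP lN mHomD(1)[OF f] mHomD(1)[OF g]]]
   by (simp add: subspace_def)
  ultimately have "car P <= {x : car P. f x = g x}" using V.span_is_subset B(3) by blast
  then show "f = g" by (intro mod_Hom_eqI[OF f g]) blast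
 qed
 then show ?thesis by (rule fin_dim_space_inj[OF vectorspace_hom_space[OF lP lN] fdD(2)[OF D] r])
qed

text \<open>Unfolds the chosen resolution: a factor group with one element means that every cocycle
  is a coboundary. The piece P2 -> P1 is recorded as a presentation of the image of d1.\<close>

lemma Ext1_zeroD:
 fixes M :: "('a, 'm) module" and N :: "('a, 'n) module"
 assumes M: "fdm M" and N: "lmod N" and ext: "Ext1_zero K A M N"
 obtains P2 P1 P0 :: "('k, 'a) smod" and d2 d1 d0 where "presents P1 d1 P0 d0 M"
  "presents P2 d2 P1 d1 (P0(|carrier := d1 ` car P1|))"
  "ALL g:Hom P1 N. (ALL x:car P2. g (d2 x) = \<zero>\<^bsub>N\<^esub>) -->
   (EX h:Hom P0 N. ALL x:car P1. h (d1 x) = g x)"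
proof -
 note lM = fdD(1)[OF M]
 interpret N: left_module A N by (rule N)
 define r where "r = (SOME r. proj_resolution K A M (r :: ('k, 'a) smod \<times> _))"
 have "EX r. proj_resolution K A M (r :: ('k, 'a) smod \<times> _)"
  by (rule proj_resolution_exists[OF M]) (rule exI)
 then have r1: "proj_resolution K A M r" unfolding r_def by (rule someI_ex)
 obtain P2 d2 P1 d1 P0 d0 where r: "r = (P2, d2, P1, d1, P0, d0)" by (cases r) auto
 have res: "proj P2" "proj P1" "proj P0" "d0 : mod_Hom A P0 M"
  "d0 ` car P0 = car M" "d1 : mod_Hom A P1 P0" "d1 ` car P1 = ker_of P0 M d0"
  "d2 : mod_Hom A P2 P1" "d2 ` car P2 = ker_of P1 P0 d1"
  using r1 unfolding r proj_resolution_def a_kernel_eq mod_epi_def by auto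
 note lP1 = projD(2)[OF res(2)] and lP0 = projD(2)[OF res(3)] and lP2 = projD(2)[OF res(1)]
 have p1: "presents P1 d1 P0 d0 M"
  unfolding presents_def using res(2,3,5,7) mHomD(1)[OF res(4)] mHomD(1)[OF res(6)] lM by blast
 have d1: "d1 : Hom P1 (P0(|carrier := d1 ` car P1|))" by (rule hom_into_sub[OF mHomD(1)[OF res(6)]]) simp
 have p2: "presents P2 d2 P1 d1 (P0(|carrier := d1 ` car P1|))"
  unfolding presents_def
  using res(1,2,9) d1 mHomD(1)[OF res(8)] left_module_sub_image[OF lP1 lP0 mHomD(1)[OF res(6)]] by simp
 define I where "I = (%f. compose (car P1) f d1) ` mod_Hom A P0 N"
 define Z where "Z = kernel (Hom_group A P1 N) (Hom_group A P2 N) (%f. compose (car P2) f d2)"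
 define G where "G = (Hom_group A P1 N)(|carrier := Z|)"
 have E: "Ext1 K A M N = G Mod I"
  unfolding Ext1_def r_def[symmetric] r I_def Z_def G_def by simp
 have key: "EX h:Hom P0 N. ALL x:car P1. h (d1 x) = g x"
  if g: "g : Hom P1 N" and gd: "!!x. x : car P2 ==> g (d2 x) = \<zero>\<^bsub>N\<^esub>" for g
 proof -
  define g' where "g' = restrict g (car P1)"
  have g': "g' : mod_Hom A P1 N" unfolding g'_def by (rule hom_res[OF lP1 g])
  have "compose (car P2) g' d2 = zero_map P2 N"
   unfolding compose_def zero_map_def
   using gd homD(1)[OF mHomD(1)[OF res(8)]] by (intro restrict_ext) (simp add: g'_def)
  then have "g' : Z" using g' by (simp add: Z_def kernel_def Hom_group_def)
  then have "I #>\<^bsub>G\<^esub> g' : car (Ext1 K A M N)"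
   unfolding E by (auto simp: FactGroup_def RCOSETS_def G_def)
  then have eq: "I #>\<^bsub>G\<^esub> g' = I" using ext unfolding Ext1_zero_def E by (simp add: FactGroup_def)
  \<comment> \<open>Since zero lies in I, g' lies in its own coset, which is I because the factor
    group is trivial. So g' is a coboundary.\<close>
  have z: "zero_map P1 N : I"
  proof -
   have "zero_map P0 N : mod_Hom A P0 N"
    using hom_res[OF lP0 hom_zero_map[OF N]] by (simp add: zero_map_def)
   moreover have "compose (car P1) (zero_map P0 N) d1 = zero_map P1 N"
    unfolding compose_def zero_map_def
    using homD(1)[OF mHomD(1)[OF res(6)]] by (intro restrict_ext) simp
   ultimately show ?thesis unfolding I_def by (metis imageI)
  qed
  have "zero_map P1 N \<otimes>\<^bsub>G\<^esub> g' = g'"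
  proof (rule extensionalityI[of _ "car P1"])
   show "g' : extensional (car P1)" by (rule mHomD(2)[OF g'])
  qed (use homD(1)[OF mHomD(1)[OF g']] in \<open>auto simp: G_def Hom_group_def zero_map_def\<close>)
  from this[symmetric] have "EX i:I. g' = i \<otimes>\<^bsub>G\<^esub> g'" by (rule bexI[OF _ z])
  then have "g' : I #>\<^bsub>G\<^esub> g'" by (simp add: r_coset_def)
  then have "g' : I" by (simp only: eq)
  then obtain h where h: "h : mod_Hom A P0 N" "g' = compose (car P1) h d1" unfolding I_def by blast
  have "h (d1 x) = g x" if "x : car P1" for x
   using fun_cong[OF h(2), of x] that by (simp add: g'_def compose_def)
  then show ?thesis using mHomD(1)[OF h(1)] by blast
 qed
 show ?thesis by (rule that[OF p1 p2]) (use key in blast)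
qed

text \<open>Transfers the vanishing from the resolution hidden in \<open>Ext1\<close> to an
  arbitrary projective Q0 over M. Lifts b : P0 -> Q0 and a : Q0 -> P0 of the identity of M compare
  the two; g pulled back along b d1 is a cocycle, hence extends to some h on P0.\<close>

lemma Ext1_zero_extend:
 fixes M :: "('a, 'm) module" and N :: "('a, 'n) module" and Q0 :: "('a, 'q) module"
 assumes M: "fdm M" and N: "lmod N" and ext: "Ext1_zero K A M N"
  and Q0: "proj Q0" and e': "e' : Hom Q0 M" and surj: "e' ` car Q0 = car M"
  and g: "g : Hom (Q0(|carrier := ker_of Q0 M e'|)) N"
 obtains k where "k : Hom Q0 N" "!!x. x : car Q0 ==> e' x = \<zero>\<^bsub>M\<^esub> ==> k x = g x"
proof -
 obtain P2 P1 P0 :: "('k, 'a) smod" and d2 d1 e where p1: "presents P1 d1 P0 e M"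
  and p2: "presents P2 d2 P1 d1 (P0(|carrier := d1 ` car P1|))"
  and key: "ALL g:Hom P1 N. (ALL x:car P2. g (d2 x) = \<zero>\<^bsub>N\<^esub>) -->
   (EX h:Hom P0 N. ALL x:car P1. h (d1 x) = g x)"
  by (rule Ext1_zeroD[OF M N ext]) (rule that)
 note q1 = presD[OF p1] and q2 = presD[OF p2]
 note lM = fdD(1)[OF M] and lQ = projD(2)[OF Q0] and lP0 = projD(2)[OF q1(2)]
  and lP1 = projD(2)[OF q1(1)]
 interpret N: left_module A N by (rule N)
 interpret M: left_module A M by (rule lM)
 interpret Q: left_module A Q0 by (rule lQ)
 interpret P0: left_module A P0 by (rule lP0)
 let ?L = "Q0(|carrier := ker_of Q0 M e'|)"
 have sL: "submod A Q0 (ker_of Q0 M e')" by (rule submod_kernel[OF lQ lM e'])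
 have lL: "lmod ?L" by (rule left_module_sub[OF lQ sL])
 interpret L: left_module A ?L by (rule lL)
 obtain b where b: "b : Hom P0 Q0" and e'b: "!!x. x : car P0 ==> e' (b x) = e x"
  by (rule projective_lift[OF q1(2) projD(1)[OF Q0] M e' surj q1(4)]) (rule that)
 obtain a where a: "a : Hom Q0 P0" and ea: "!!x. x : car Q0 ==> e (a x) = e' x"
  by (rule projective_lift[OF Q0 projD(1)[OF q1(2)] M q1(4,5) e']) (rule that)
 note b' = homD[OF b] and a' = homD[OF a] and d' = homD[OF q1(6)] and g' = homD[OF g]
 have t: "(%x. b (d1 x)) : Hom P1 ?L"
  by (rule hom_into_sub[OF hcomp[OF q1(6) b]]) (use b'(1) d'(1) e'b presD2(2)[OF p1] in simp)
 have "EX h:Hom P0 N. ALL x:car P1. h (d1 x) = g (b (d1 x))"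
 proof (rule key[rule_format, OF hcomp[OF t g]])
  fix x assume x: "x : car P2"
  have "d1 (d2 x) = \<zero>\<^bsub>P0\<^esub>" using presD2(2)[OF p2 x] by simp
  then have "b (d1 (d2 x)) = \<zero>\<^bsub>Q0\<^esub>" using P0.hom_zero[OF lQ b] by simp
  then show "g (b (d1 (d2 x))) = \<zero>\<^bsub>N\<^esub>" using L.hom_zero[OF N g] by simp
 qed
 then obtain h where h: "h : Hom P0 N" and hd: "!!x. x : car P1 ==> h (d1 x) = g (b (d1 x))" by blast
 have th: "(%y. y \<ominus>\<^bsub>Q0\<^esub> b (a y)) : Hom Q0 ?L"
 proof (rule hom_into_sub[OF hom_diff[OF lQ hom_id[OF lQ] hcomp[OF a b]]])
  fix y assume y: "y : car Q0"
  have ba: "b (a y) : car Q0" using y a'(1) b'(1) by simp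
  have "e' (y \<ominus>\<^bsub>Q0\<^esub> b (a y)) = \<zero>\<^bsub>M\<^esub>"
   using Q.hom_minus[OF lM e' y ba] e'b[OF a'(1)[OF y]] ea[OF y] homD(1)[OF e' y]
   by (simp add: M.M.minus_eq_zero_iff)
  then show "y \<ominus>\<^bsub>Q0\<^esub> b (a y) : ker_of Q0 M e'" using y ba by simp
 qed
 \<comment> \<open>Split y as b (a y) + (y - b (a y)). The second part always lies in the kernel,
   where g is defined, and h replaces g on the first; on the kernel the two pieces add up to g
   y.\<close>
 have k: "(%y. h (a y) \<oplus>\<^bsub>N\<^esub> g (y \<ominus>\<^bsub>Q0\<^esub> b (a y))) : Hom Q0 N"
  by (rule hom_add[OF N hcomp[OF a h] hcomp[OF th g]])
 show ?thesis
 proof (rule that[OF k])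
  fix y assume y: "y : car Q0" "e' y = \<zero>\<^bsub>M\<^esub>"
  have "e (a y) = \<zero>\<^bsub>M\<^esub>" using ea y by simp
  then obtain p where p: "p : car P1" "a y = d1 p" using presD2(3)[OF p1 a'(1)[OF y(1)]] by blast
  have ba: "b (a y) : car ?L" using homD(1)[OF t p(1)] p(2) by simp
  have yb: "y \<ominus>\<^bsub>Q0\<^esub> b (a y) : car ?L" by (rule homD(1)[OF th y(1)])
  have "h (a y) \<oplus>\<^bsub>N\<^esub> g (y \<ominus>\<^bsub>Q0\<^esub> b (a y)) = g (b (a y) \<oplus>\<^bsub>?L\<^esub> (y \<ominus>\<^bsub>Q0\<^esub> b (a y)))"
   using g'(2)[OF ba yb] hd[OF p(1)] p(2) by simp
  also have "b (a y) \<oplus>\<^bsub>?L\<^esub> (y \<ominus>\<^bsub>Q0\<^esub> b (a y)) = y"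
   using Q.M.add_minus_cancel_left[OF y(1)] ba by simp
  finally show "h (a y) \<oplus>\<^bsub>N\<^esub> g (y \<ominus>\<^bsub>Q0\<^esub> b (a y)) = g y" .
 qed
qed

text \<open>Injectivity identifies Q1 with the kernel of e, so maps from Q1 are maps from that
  kernel, and the vanishing of Ext extends them to Q0.\<close>

lemma Ext1_zero_imp_lifts:
 fixes M :: "('a, 'm) module" and N :: "('a, 'n) module" and Q1 Q0 :: "('a, 'q) module"
 assumes N: "lmod N" and ext: "Ext1_zero K A M N"
  and p: "presents Q1 d Q0 e M" and inj: "inj_on d (car Q1)"
 shows "lifts d Q1 Q0 N"
 unfolding lifts_def
proof
 note q = presD[OF p]
 note lQ1 = projD(2)[OF q(1)]
 fix g assume g: "g : Hom Q1 N"
 let ?L = "Q0(|carrier := ker_of Q0 M e|)"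
 have d: "d : Hom Q1 ?L" by (rule hom_into_sub[OF q(6)]) (use q(7) in blast)
 have bij: "bij_betw d (car Q1) (car ?L)" using inj q(7) by (simp add: bij_betw_def)
 obtain k where k: "k : Hom Q0 N"
  and kg: "!!x. x : car Q0 ==> e x = \<zero>\<^bsub>M\<^esub> ==> k x = g (inv_into (car Q1) d x)"
  by (rule Ext1_zero_extend[OF presD2(1)[OF p] N ext q(2,4,5) hcomp[OF hom_inv_into[OF lQ1 d bij] g]])
   (rule that)
 have *: "k (d x) = g x" if x: "x : car Q1" for x
  using kg[OF homD(1)[OF q(6) x] presD2(2)[OF p x]] inv_into_f_f[OF inj x] by simp
 show "EX h:Hom Q0 N. ALL x:car Q1. h (d x) = g x" by (rule bexI[OF ballI k]) (rule *)
qed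

text \<open>The following two lemmas say that \<open>Hom(P, A) \<otimes>\<^sub>A N \<rightarrow> Hom(P, N)\<close> is an isomorphism for projective \<open>P\<close>:
  it is surjective, and it is injective after applying \<open>Hom\<^sub>\<int>(-, K)\<close>.\<close>

lemma projective_hom_induct:
 fixes P :: "('k, 'a) smod" and N :: "('a, 'n) module"
 assumes P: "proj P" and N: "lmod N"
  and W_cong: "!!g h. g : W ==> h : Hom P N ==> (!!x. x : car P ==> h x = g x) ==> h : W"
  and W_add: "!!g h. g : W ==> h : W ==> (%x. g x \<oplus>\<^bsub>N\<^esub> h x) : W"
  and W_elem: "!!f y. f : Hom P (regm) ==> y : car N ==> (%p. f p \<odot>\<^bsub>N\<^esub> y) : W"
  and g: "g : Hom P N"
 shows "g : W"
proof -
 interpret N: left_module A N by (rule N)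
 \<comment> \<open>W is quantified inside the property, since the biproduct and retract cases use
   the hypothesis for the pull-back of W along a projection or an inclusion.\<close>
 define G where "G P \<longleftrightarrow> (ALL W. (ALL g h. g : W --> h : Hom P N --> (ALL x:car P. h x = g x) --> h : W) -->
  (ALL g h. g : W --> h : W --> (%x. g x \<oplus>\<^bsub>N\<^esub> h x) : W) -->
  (ALL f y. f : Hom P (regm) --> y : car N --> (%p. f p \<odot>\<^bsub>N\<^esub> y) : W) -->
  Hom P N <= W)" for P :: "('k, 'a) smod"
 have "G P" using P
 proof (induction rule: projective_induct)
  case (regular R r)
  let ?c = "inv_into (car (regm)) r"
  have c: "?c : Hom R (regm)" by (rule hom_inv_into[OF left_module_regular regular(2,3)])
  have r1: "r \<one>\<^bsub>A\<^esub> : car R" by (rule homD(1)[OF regular(2)]) simp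
  show ?case unfolding G_def
  proof (intro allI impI subsetI)
   fix W g
   assume W: "ALL g h. g : W --> h : Hom R N --> (ALL x:car R. h x = g x) --> h : W"
    and We: "ALL f y. f : Hom R (regm) --> y : car N --> (%p. f p \<odot>\<^bsub>N\<^esub> y) : W"
    and g: "g : Hom R N"
   have "(%p. ?c p \<odot>\<^bsub>N\<^esub> g (r \<one>\<^bsub>A\<^esub>)) : W" using We c homD(1)[OF g r1] by blast
   moreover have "g x = ?c x \<odot>\<^bsub>N\<^esub> g (r \<one>\<^bsub>A\<^esub>)" if x: "x : car R" for x
   proof -
    have cx: "?c x : car A" using homD(1)[OF c x] by simp
    have "x = r (?c x)" using bij_betw_inv_into_right[OF regular(3) x] by simp
    also have "\<dots> = r (?c x \<odot>\<^bsub>regm\<^esub> \<one>\<^bsub>A\<^esub>)" using cx by simp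
    also have "\<dots> = ?c x \<odot>\<^bsub>R\<^esub> r \<one>\<^bsub>A\<^esub>" by (rule homD(3)[OF regular(2) cx]) simp
    finally have "x = ?c x \<odot>\<^bsub>R\<^esub> r \<one>\<^bsub>A\<^esub>" .
    then show ?thesis using homD(3)[OF g cx r1] by simp
   qed
   ultimately show "g : W" using W g by blast
  qed
 next
  case (biprod S M L i1 i2 p1 p2)
  note b = biprodD[OF biprod(1)]
  show ?case unfolding G_def
  proof (intro allI impI subsetI)
   fix W g
   assume W: "ALL g h. g : W --> h : Hom S N --> (ALL x:car S. h x = g x) --> h : W"
    and Wa: "ALL g h. g : W --> h : W --> (%x. g x \<oplus>\<^bsub>N\<^esub> h x) : W"
    and We: "ALL f y. f : Hom S (regm) --> y : car N --> (%p. f p \<odot>\<^bsub>N\<^esub> y) : W"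
    and g: "g : Hom S N"
   have sub: "(%s. w (p s)) : W" if G: "G Q" and p: "p : Hom S Q" and w: "w : Hom Q N" for Q p w
   proof -
    have "Hom Q N <= {w. (%s. w (p s)) : W}"
    proof (rule G[unfolded G_def, rule_format])
     show "h : {w. (%s. w (p s)) : W}"
      if "g : {w. (%s. w (p s)) : W}" "h : Hom Q N" "!!x. x : car Q ==> h x = g x" for g h
      using W[rule_format, of "%s. g (p s)", OF _ hcomp[OF p that(2)]] that(1,3) homD(1)[OF p] by simp
     show "(%x. g x \<oplus>\<^bsub>N\<^esub> h x) : {w. (%s. w (p s)) : W}"
      if "g : {w. (%s. w (p s)) : W}" "h : {w. (%s. w (p s)) : W}" for g h
      using Wa that by simp
     show "(%q. f q \<odot>\<^bsub>N\<^esub> y) : {w. (%s. w (p s)) : W}"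
      if "f : Hom Q (regm)" "y : car N" for f y
      using We[rule_format, OF hcomp[OF p that(1)] that(2)] by simp
    qed
    then show ?thesis using w by blast
   qed
   have "(%s. g (i1 (p1 s))) : W" "(%s. g (i2 (p2 s))) : W"
    by (rule sub[OF biprod(2) b(6) hcomp[OF b(4) g]], rule sub[OF biprod(3) b(7) hcomp[OF b(5) g]])
   then have m: "(%s. g (i1 (p1 s)) \<oplus>\<^bsub>N\<^esub> g (i2 (p2 s))) : W" by (rule Wa[rule_format])
   have e: "g s = g (i1 (p1 s)) \<oplus>\<^bsub>N\<^esub> g (i2 (p2 s))" if s: "s : car S" for s
    using b(12)[OF s] homD(2)[OF g, of "i1 (p1 s)" "i2 (p2 s)"] s
    by (simp add: homD(1)[OF b(4)] homD(1)[OF b(5)] homD(1)[OF b(6)] homD(1)[OF b(7)])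
   show "g : W" by (rule W[rule_format, OF m g]) (rule e)
  qed
 next
  case (retract F P i r)
  show ?case unfolding G_def
  proof (intro allI impI subsetI)
   fix W g
   assume W: "ALL g h. g : W --> h : Hom P N --> (ALL x:car P. h x = g x) --> h : W"
    and Wa: "ALL g h. g : W --> h : W --> (%x. g x \<oplus>\<^bsub>N\<^esub> h x) : W"
    and We: "ALL f y. f : Hom P (regm) --> y : car N --> (%p. f p \<odot>\<^bsub>N\<^esub> y) : W"
    and g: "g : Hom P N"
   have "Hom F N <= {w. (%s. w (i s)) : W}"
   proof (rule retract(6)[unfolded G_def, rule_format])
    show "h : {w. (%s. w (i s)) : W}"
     if "g : {w. (%s. w (i s)) : W}" "h : Hom F N" "!!x. x : car F ==> h x = g x" for g h
     using W[rule_format, of "%s. g (i s)", OF _ hcomp[OF retract(3) that(2)]] that(1,3) homD(1)[OF retract(3)] by simp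
    show "(%x. g x \<oplus>\<^bsub>N\<^esub> h x) : {w. (%s. w (i s)) : W}"
     if "g : {w. (%s. w (i s)) : W}" "h : {w. (%s. w (i s)) : W}" for g h
     using Wa that by simp
    show "(%p. f p \<odot>\<^bsub>N\<^esub> y) : {w. (%s. w (i s)) : W}"
     if "f : Hom F (regm)" "y : car N" for f y
     using We[rule_format, OF hcomp[OF retract(3) that(1)] that(2)] by simp
   qed
   then have m: "(%x. g (r (i x))) : W" using hcomp[OF retract(4) g] by blast
   show "g : W" by (rule W[rule_format, OF m g]) (simp add: retract(5))
  qed
 qed
 moreover have "ALL g h. g : W --> h : Hom P N --> (ALL x:car P. h x = g x) --> h : W"
  using W_cong by blast
 moreover have "ALL g h. g : W --> h : W --> (%x. g x \<oplus>\<^bsub>N\<^esub> h x) : W" using W_add by simp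
 moreover have "ALL f y. f : Hom P (regm) --> y : car N --> (%p. f p \<odot>\<^bsub>N\<^esub> y) : W"
  using W_elem by simp
 ultimately have "Hom P N <= W" unfolding G_def by simp
 then show ?thesis using g by blast
qed

lemma projective_extend_balanced:
 fixes P :: "('k, 'a) smod" and N :: "('a, 'n) module"
  and be :: "'n => ((nat => 'k) => 'a) => 'k"
 assumes P: "proj P" and N: "lmod N"
  and cl: "!!x f. x : car N ==> f : Hom P (regm) ==> be x f : car K"
  and add1: "!!x y f. [|x : car N; y : car N; f : Hom P (regm)|] ==>
   be (x \<oplus>\<^bsub>N\<^esub> y) f = be x f \<oplus>\<^bsub>K\<^esub> be y f"
  and add2: "!!x f g. [|x : car N; f : Hom P (regm); g : Hom P (regm)|] ==>
   be x (%p. f p \<oplus>\<^bsub>A\<^esub> g p) = be x f \<oplus>\<^bsub>K\<^esub> be x g"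
  and bal: "!!x f a. [|x : car N; f : Hom P (regm); a : car A|] ==>
   be (a \<odot>\<^bsub>N\<^esub> x) f = be x (%p. f p \<cdot> a)"
  and cong: "!!x f g. [|x : car N; f : Hom P (regm); g : Hom P (regm);
   !!p. p : car P ==> f p = g p|] ==> be x f = be x g"
 shows "EX ph. (ALL g:Hom P N. ph g : car K)
  & (ALL g:Hom P N. ALL h:Hom P N. ph (%x. g x \<oplus>\<^bsub>N\<^esub> h x) = ph g \<oplus>\<^bsub>K\<^esub> ph h)
  & (ALL g:Hom P N. ALL h:Hom P N. (ALL x:car P. g x = h x) --> ph g = ph h)
  & (ALL f:Hom P (regm). ALL x:car N. ph (%p. f p \<odot>\<^bsub>N\<^esub> x) = be x f)"
proof -
 interpret N: left_module A N by (rule N)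
 \<comment> \<open>\<open>bl\<close> collects that the pairing is biadditive and balanced over A,
   and \<open>ex\<close> that ph is the induced functional on Hom(P, N). The induction runs over all
   pairings at once because \<open>pull\<close> changes them in the biproduct and retract
   cases.\<close>
 define bl where "bl P be \<longleftrightarrow> (ALL x:car N. ALL f:Hom P (regm).
   be x f : car K
   & (ALL y:car N. be (x \<oplus>\<^bsub>N\<^esub> y) f = be x f \<oplus>\<^bsub>K\<^esub> be y f)
   & (ALL g:Hom P (regm). be x (%p. f p \<oplus>\<^bsub>A\<^esub> g p) = be x f \<oplus>\<^bsub>K\<^esub> be x g)
   & (ALL a:car A. be (a \<odot>\<^bsub>N\<^esub> x) f = be x (%p. f p \<cdot> a))
   & (ALL g:Hom P (regm). (ALL p:car P. f p = g p) --> be x f = be x g))"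
  for P :: "('k, 'a) smod" and be :: "'n => ((nat => 'k) => 'a) => 'k"
 define ex where "ex P be ph \<longleftrightarrow> (ALL g:Hom P N. ph g : car K)
  & (ALL g:Hom P N. ALL h:Hom P N. ph (%x. g x \<oplus>\<^bsub>N\<^esub> h x) = ph g \<oplus>\<^bsub>K\<^esub> ph h)
  & (ALL g:Hom P N. ALL h:Hom P N. (ALL x:car P. g x = h x) --> ph g = ph h)
  & (ALL f:Hom P (regm). ALL x:car N. ph (%p. f p \<odot>\<^bsub>N\<^esub> x) = be x f)"
  for P :: "('k, 'a) smod" and be :: "'n => ((nat => 'k) => 'a) => 'k" and ph :: "((nat => 'k) => 'n) => 'k"
 have blD: "be x f : car K" "y : car N ==> be (x \<oplus>\<^bsub>N\<^esub> y) f = be x f \<oplus>\<^bsub>K\<^esub> be y f"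
  "g : Hom P (regm) ==> be x (%p. f p \<oplus>\<^bsub>A\<^esub> g p) = be x f \<oplus>\<^bsub>K\<^esub> be x g"
  "a : car A ==> be (a \<odot>\<^bsub>N\<^esub> x) f = be x (%p. f p \<cdot> a)"
  "g : Hom P (regm) ==> (!!p. p : car P ==> f p = g p) ==> be x f = be x g"
  if "bl P be" "x : car N" "f : Hom P (regm)" for P be x f y g a
 proof -
  note b = that(1)[unfolded bl_def, rule_format, OF that(2,3)]
  show "be x f : car K" by (rule b[THEN conjunct1])
  show "y : car N ==> be (x \<oplus>\<^bsub>N\<^esub> y) f = be x f \<oplus>\<^bsub>K\<^esub> be y f"
   by (rule b[THEN conjunct2, THEN conjunct1, rule_format])
  show "g : Hom P (regm) ==> be x (%p. f p \<oplus>\<^bsub>A\<^esub> g p) = be x f \<oplus>\<^bsub>K\<^esub> be x g"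
   by (rule b[THEN conjunct2, THEN conjunct2, THEN conjunct1, rule_format])
  show "a : car A ==> be (a \<odot>\<^bsub>N\<^esub> x) f = be x (%p. f p \<cdot> a)"
   by (rule b[THEN conjunct2, THEN conjunct2, THEN conjunct2, THEN conjunct1, rule_format])
  show "g : Hom P (regm) ==> (!!p. p : car P ==> f p = g p) ==> be x f = be x g"
   by (rule b[THEN conjunct2, THEN conjunct2, THEN conjunct2, THEN conjunct2, rule_format])
 qed
 have exD: "ph g : car K"
  "h : Hom P N ==> ph (%x. g x \<oplus>\<^bsub>N\<^esub> h x) = ph g \<oplus>\<^bsub>K\<^esub> ph h"
  "h : Hom P N ==> (!!x. x : car P ==> g x = h x) ==> ph g = ph h"
  if "ex P be ph" "g : Hom P N" for P be ph g h
 proof -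
  note e = that(1)[unfolded ex_def]
  show "ph g : car K" by (rule e[THEN conjunct1, rule_format, OF that(2)])
  show "h : Hom P N ==> ph (%x. g x \<oplus>\<^bsub>N\<^esub> h x) = ph g \<oplus>\<^bsub>K\<^esub> ph h"
   by (rule e[THEN conjunct2, THEN conjunct1, rule_format, OF that(2)])
  show "h : Hom P N ==> (!!x. x : car P ==> g x = h x) ==> ph g = ph h"
   by (rule e[THEN conjunct2, THEN conjunct2, THEN conjunct1, rule_format, OF that(2)])
 qed
 have exD4: "ph (%p. f p \<odot>\<^bsub>N\<^esub> x) = be x f"
  if "ex P be ph" "f : Hom P (regm)" "x : car N" for P be ph f x
  by (rule that(1)[unfolded ex_def, THEN conjunct2, THEN conjunct2, THEN conjunct2, rule_format, OF that(2,3)])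
 have pull: "bl Q (%x f. be x (%s. f (p s)))" if bl: "bl P be" and p: "p : Hom P Q" for P Q p be
  unfolding bl_def
 proof (intro ballI)
  fix x f assume x: "x : car N" and f: "f : Hom Q (regm)"
  note fp = hcomp[OF p f]
  note bx = blD[OF bl x fp]
  show "be x (%s. f (p s)) : car K
   & (ALL y:car N. be (x \<oplus>\<^bsub>N\<^esub> y) (%s. f (p s)) = be x (%s. f (p s)) \<oplus>\<^bsub>K\<^esub> be y (%s. f (p s)))
   & (ALL g:Hom Q (regm).
     be x (%s. f (p s) \<oplus>\<^bsub>A\<^esub> g (p s)) = be x (%s. f (p s)) \<oplus>\<^bsub>K\<^esub> be x (%s. g (p s)))
   & (ALL a:car A. be (a \<odot>\<^bsub>N\<^esub> x) (%s. f (p s)) = be x (%s. f (p s) \<cdot> a))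
   & (ALL g:Hom Q (regm). (ALL p:car Q. f p = g p) -->
     be x (%s. f (p s)) = be x (%s. g (p s)))"
  proof (intro conjI ballI impI)
   fix g assume g: "g : Hom Q (regm)" and "ALL p:car Q. f p = g p"
   then have eq: "f (p s) = g (p s)" if "s : car P" for s using homD(1)[OF p that] by blast
   show "be x (%s. f (p s)) = be x (%s. g (p s))" by (rule bx(5)[OF hcomp[OF p g] eq])
  next
   fix g assume g: "g : Hom Q (regm)"
   show "be x (%s. f (p s) \<oplus>\<^bsub>A\<^esub> g (p s)) = be x (%s. f (p s)) \<oplus>\<^bsub>K\<^esub> be x (%s. g (p s))"
    by (rule bx(3)[OF hcomp[OF p g]])
  qed (rule bx(1) bx(2) bx(4); assumption)+
 qed
 have "ALL be. bl P be --> (EX ph. ex P be ph)" using P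
 proof (induction rule: projective_induct)
  case (regular R r)
  let ?c = "inv_into (car (regm)) r"
  have c: "?c : Hom R (regm)" by (rule hom_inv_into[OF left_module_regular regular(2,3)])
  have r1: "r \<one>\<^bsub>A\<^esub> : car R" by (rule homD(1)[OF regular(2)]) simp
  show ?case
  proof (intro allI impI exI)
   fix be assume bl: "bl R be"
   \<comment> \<open>Hom(A, N) is N by evaluation at 1, so the functional is forced: g(1) is paired
     with the coordinate map R -> A.\<close>
   show "ex R be (%g. be (g (r \<one>\<^bsub>A\<^esub>)) ?c)"
    unfolding ex_def
   proof (intro conjI ballI impI)
    fix g assume g: "g : Hom R N"
    note gr = homD(1)[OF g r1]
    show "be (g (r \<one>\<^bsub>A\<^esub>)) ?c : car K" by (rule blD(1)[OF bl gr c])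
    fix h assume h: "h : Hom R N"
    show "be (g (r \<one>\<^bsub>A\<^esub>) \<oplus>\<^bsub>N\<^esub> h (r \<one>\<^bsub>A\<^esub>)) ?c = be (g (r \<one>\<^bsub>A\<^esub>)) ?c \<oplus>\<^bsub>K\<^esub> be (h (r \<one>\<^bsub>A\<^esub>)) ?c"
     by (rule blD(2)[OF bl gr c homD(1)[OF h r1]])
    assume "ALL x:car R. g x = h x"
    then show "be (g (r \<one>\<^bsub>A\<^esub>)) ?c = be (h (r \<one>\<^bsub>A\<^esub>)) ?c" using r1 by simp
   next
    fix f x assume f: "f : Hom R (regm)" and x: "x : car N"
    have fr: "f (r \<one>\<^bsub>A\<^esub>) : car A" using homD(1)[OF f r1] by simp
    have eq: "?c p \<cdot> f (r \<one>\<^bsub>A\<^esub>) = f p" if p: "p : car R" for p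
    proof -
     have cx: "?c p : car A" using homD(1)[OF c p] by simp
     have "p = r (?c p)" using bij_betw_inv_into_right[OF regular(3) p] by simp
     also have "\<dots> = r (?c p \<odot>\<^bsub>regm\<^esub> \<one>\<^bsub>A\<^esub>)" using cx by simp
     also have "\<dots> = ?c p \<odot>\<^bsub>R\<^esub> r \<one>\<^bsub>A\<^esub>" by (rule homD(3)[OF regular(2) cx]) simp
     finally have "p = ?c p \<odot>\<^bsub>R\<^esub> r \<one>\<^bsub>A\<^esub>" .
     then show ?thesis using homD(3)[OF f cx r1] by simp
    qed
    have cf: "(%p. ?c p \<cdot> f (r \<one>\<^bsub>A\<^esub>)) : Hom R (regm)"
     by (rule homI) (use homD[OF c] fr in \<open>simp_all add: A.l_distr A.m_assoc\<close>)
    have "be x (%p. ?c p \<cdot> f (r \<one>\<^bsub>A\<^esub>)) = be x f" by (rule blD(5)[OF bl x cf f eq])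
    then show "be (f (r \<one>\<^bsub>A\<^esub>) \<odot>\<^bsub>N\<^esub> x) ?c = be x f" using blD(4)[OF bl x c fr] by simp
   qed
  qed
 next
  case (biprod S M L i1 i2 p1 p2)
  note bd = biprodD[OF biprod(1)]
  show ?case
  proof (intro allI impI)
   fix be assume bl: "bl S be"
   obtain ph1 where 1: "ex M (%x f. be x (%s. f (p1 s))) ph1" using biprod(2) pull[OF bl bd(6)] by blast
   obtain ph2 where 2: "ex L (%x f. be x (%s. f (p2 s))) ph2" using biprod(3) pull[OF bl bd(7)] by blast
   note e1 = exD[OF 1] and e2 = exD[OF 2]
   have "ex S be (%g. ph1 (%x. g (i1 x)) \<oplus>\<^bsub>K\<^esub> ph2 (%x. g (i2 x)))"
    unfolding ex_def
   proof (intro conjI ballI impI)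
    fix g assume g: "g : Hom S N"
    note g1 = hcomp[OF bd(4) g] and g2 = hcomp[OF bd(5) g]
    show "ph1 (%x. g (i1 x)) \<oplus>\<^bsub>K\<^esub> ph2 (%x. g (i2 x)) : car K" using e1(1)[OF g1] e2(1)[OF g2] by simp
    fix h assume h: "h : Hom S N"
    note h1 = hcomp[OF bd(4) h] and h2 = hcomp[OF bd(5) h]
    show "ph1 (%x. g (i1 x) \<oplus>\<^bsub>N\<^esub> h (i1 x)) \<oplus>\<^bsub>K\<^esub> ph2 (%x. g (i2 x) \<oplus>\<^bsub>N\<^esub> h (i2 x)) =
     ph1 (%x. g (i1 x)) \<oplus>\<^bsub>K\<^esub> ph2 (%x. g (i2 x)) \<oplus>\<^bsub>K\<^esub> (ph1 (%x. h (i1 x)) \<oplus>\<^bsub>K\<^esub> ph2 (%x. h (i2 x)))"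
     using e1(2)[OF g1 h1] e2(2)[OF g2 h2] e1(1)[OF g1] e2(1)[OF g2] e1(1)[OF h1] e2(1)[OF h2]
     by (simp add: K.a_ac)
    assume eq: "ALL x:car S. g x = h x"
    have "ph1 (%x. g (i1 x)) = ph1 (%x. h (i1 x))" by (rule e1(3)[OF g1 h1]) (use eq homD(1)[OF bd(4)] in simp)
    moreover have "ph2 (%x. g (i2 x)) = ph2 (%x. h (i2 x))" by (rule e2(3)[OF g2 h2]) (use eq homD(1)[OF bd(5)] in simp)
    ultimately show "ph1 (%x. g (i1 x)) \<oplus>\<^bsub>K\<^esub> ph2 (%x. g (i2 x)) = ph1 (%x. h (i1 x)) \<oplus>\<^bsub>K\<^esub> ph2 (%x. h (i2 x))" by simp
   next
    fix f x assume f: "f : Hom S (regm)" and x: "x : car N"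
    note f1 = hcomp[OF bd(4) f] and f2 = hcomp[OF bd(5) f]
    note f1' = hcomp[OF bd(6) f1] and f2' = hcomp[OF bd(7) f2]
    have "ph1 (%p. f (i1 p) \<odot>\<^bsub>N\<^esub> x) = be x (%s. f (i1 (p1 s)))" by (rule exD4[OF 1 f1 x])
    moreover have "ph2 (%p. f (i2 p) \<odot>\<^bsub>N\<^esub> x) = be x (%s. f (i2 (p2 s)))" by (rule exD4[OF 2 f2 x])
    moreover have "be x (%s. f (i1 (p1 s)) \<oplus>\<^bsub>A\<^esub> f (i2 (p2 s))) = be x (%s. f (i1 (p1 s))) \<oplus>\<^bsub>K\<^esub> be x (%s. f (i2 (p2 s)))"
     by (rule blD(3)[OF bl x f1' f2'])
    moreover have "be x (%s. f (i1 (p1 s)) \<oplus>\<^bsub>A\<^esub> f (i2 (p2 s))) = be x f"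
    proof -
     have eq: "f (i1 (p1 s)) \<oplus>\<^bsub>A\<^esub> f (i2 (p2 s)) = f s" if s: "s : car S" for s
      using bd(12)[OF s] homD(2)[OF f, of "i1 (p1 s)" "i2 (p2 s)"] s
      by (simp add: homD(1)[OF bd(4)] homD(1)[OF bd(5)] homD(1)[OF bd(6)] homD(1)[OF bd(7)])
     have h: "(%s. f (i1 (p1 s)) \<oplus>\<^bsub>A\<^esub> f (i2 (p2 s))) : Hom S (regm)"
      using hom_add[OF left_module_regular f1' f2'] by simp
     show ?thesis by (rule blD(5)[OF bl x h f eq])
    qed
    ultimately show "ph1 (%p. f (i1 p) \<odot>\<^bsub>N\<^esub> x) \<oplus>\<^bsub>K\<^esub> ph2 (%p. f (i2 p) \<odot>\<^bsub>N\<^esub> x) = be x f" by simp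
   qed
   then show "EX ph. ex S be ph" by blast
  qed
 next
  case (retract F P i r)
  show ?case
  proof (intro allI impI)
   fix be assume bl: "bl P be"
   obtain ph where 1: "ex F (%x f. be x (%p. f (i p))) ph" using retract(6) pull[OF bl retract(3)] by blast
   have "ex P be (%g. ph (%s. g (r s)))"
    unfolding ex_def
   proof (intro conjI ballI impI)
    fix g assume g: "g : Hom P N"
    note gr = hcomp[OF retract(4) g]
    show "ph (%s. g (r s)) : car K" by (rule exD(1)[OF 1 gr])
    fix h assume h: "h : Hom P N"
    note hr = hcomp[OF retract(4) h]
    show "ph (%s. g (r s) \<oplus>\<^bsub>N\<^esub> h (r s)) = ph (%s. g (r s)) \<oplus>\<^bsub>K\<^esub> ph (%s. h (r s))"
     by (rule exD(2)[OF 1 gr hr])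
    assume "ALL x:car P. g x = h x"
    then have eq: "g (r s) = h (r s)" if "s : car F" for s using homD(1)[OF retract(4) that] by blast
    show "ph (%s. g (r s)) = ph (%s. h (r s))" by (rule exD(3)[OF 1 gr hr eq])
   next
    fix f x assume f: "f : Hom P (regm)" and x: "x : car N"
    note fr = hcomp[OF retract(4) f]
    have "ph (%s. f (r s) \<odot>\<^bsub>N\<^esub> x) = be x (%p. f (r (i p)))" by (rule exD4[OF 1 fr x])
    also have "\<dots> = be x f"
     by (rule blD(5)[OF bl x hcomp[OF retract(3) fr] f]) (simp add: retract(5))
    finally show "ph (%s. f (r s) \<odot>\<^bsub>N\<^esub> x) = be x f" .
   qed
   then show "EX ph. ex P be ph" by blast
  qed
 qed
 moreover have "bl P be" unfolding bl_def by (intro ballI conjI impI cl add1 add2 bal cong; simp)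
 ultimately show ?thesis unfolding ex_def by blast
qed


end

section \<open>The Auslander-Reiten translation\<close>

lemma A_dual_simps [simp]:
 "car (A_dual A P) = mod_Hom A P (regular_module A)" "\<zero>\<^bsub>A_dual A P\<^esub> = zero_map P (regular_module A)"
 "f \<oplus>\<^bsub>A_dual A P\<^esub> g = (\<lambda>x\<in>car P. f x \<oplus>\<^bsub>A\<^esub> g x)"
 "a \<odot>\<^bsub>A_dual A P\<^esub> f = (\<lambda>x\<in>car P. f x \<otimes>\<^bsub>A\<^esub> a)"
 by (simp_all add: A_dual_def)

lemma K_dual_simps [simp]:
 "car (K_dual K A N) = module_hom K (restrict_scalars A N) (regular_module K) \<inter> extensional (car N)"
 "\<zero>\<^bsub>K_dual K A N\<^esub> = (\<lambda>x\<in>car N. \<zero>\<^bsub>K\<^esub>)"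
 "ph \<oplus>\<^bsub>K_dual K A N\<^esub> \<psi> = (\<lambda>x\<in>car N. ph x \<oplus>\<^bsub>K\<^esub> \<psi> x)"
 "a \<odot>\<^bsub>K_dual K A N\<^esub> ph = (\<lambda>x\<in>car N. ph (a \<odot>\<^bsub>N\<^esub> x))"
 by (simp_all add: K_dual_def)

context kalg
begin

text \<open>The identity of P is a sum of maps q |-> f(q) y with f : P -> A. If every f vanishes at
  p, so does the identity.\<close>

lemma projective_separates:
 fixes P :: "('k, 'a) smod"
 assumes P: "proj P" and p: "p : car P" "p ~= \<zero>\<^bsub>P\<^esub>"
 shows "EX f:Hom P (regm). f p ~= \<zero>\<^bsub>A\<^esub>"
proof (rule ccontr)
 assume "\<not> ?thesis"
 then have z: "f p = \<zero>\<^bsub>A\<^esub>" if "f : Hom P (regm)" for f using that by blast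
 interpret P: left_module A P by (rule projD(2)[OF P])
 have "(%x. x) : {g. g p = \<zero>\<^bsub>P\<^esub>}"
 proof (rule projective_hom_induct[OF P projD(2)[OF P] _ _ _ hom_id[OF projD(2)[OF P]]])
  fix f y assume f: "f : Hom P (regm)" and y: "y : car P"
  show "(%q. f q \<odot>\<^bsub>P\<^esub> y) : {g. g p = \<zero>\<^bsub>P\<^esub>}" using z[OF f] y by simp
 qed (use p(1) in simp_all)
 then show False using p by simp
qed

text \<open>Let d x = 0. For f : P1 -> A and y in some X i, the map q |-> f(q) y factors through d,
  so f(x) y = 0. Joint faithfulness gives f(x) = 0 for all f, and such f separate the points of
  P1.\<close>

lemma presents_inj:
 fixes P1 P0 :: "('k, 'a) smod" and X :: "'i => ('a, 'n) module"
 assumes p: "presents P1 d P0 e M" and X: "!!i. i : I ==> lmod (X i)"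
  and l: "!!i. i : I ==> lifts d P1 P0 (X i)"
  and faithful: "!!a. a : car A ==> (!!i x. i : I ==> x : car (X i) ==> a \<odot>\<^bsub>X i\<^esub> x = \<zero>\<^bsub>X i\<^esub>) ==> a = \<zero>\<^bsub>A\<^esub>"
 shows "inj_on d (car P1)"
proof -
 note q = presD[OF p]
 note lP1 = projD(2)[OF q(1)] and lP0 = projD(2)[OF q(2)]
 interpret P0: left_module A P0 by (rule lP0)
 have "x = \<zero>\<^bsub>P1\<^esub>" if x: "x : car P1" "d x = \<zero>\<^bsub>P0\<^esub>" for x
 proof (rule ccontr)
  assume "x ~= \<zero>\<^bsub>P1\<^esub>"
  then obtain f where f: "f : Hom P1 (regm)" "f x ~= \<zero>\<^bsub>A\<^esub>"
   using projective_separates[OF q(1) x(1)] by blast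
  have fx: "f x : car A" using homD(1)[OF f(1) x(1)] by simp
  have "f x \<odot>\<^bsub>X i\<^esub> y = \<zero>\<^bsub>X i\<^esub>" if i: "i : I" and y: "y : car (X i)" for i y
  proof -
   interpret Xi: left_module A "X i" by (rule X[OF i])
   have "(%q. f q \<odot>\<^bsub>X i\<^esub> y) : Hom P1 (X i)"
    by (rule homI)
     (use homD[OF f(1)] y in \<open>simp_all add: Xi.smult_closed Xi.smult_l_distr Xi.smult_assoc1\<close>)
   then obtain h where h: "h : Hom P0 (X i)" "!!q. q : car P1 ==> h (d q) = f q \<odot>\<^bsub>X i\<^esub> y"
    by (rule liftsE[OF l[OF i]]) (rule that)
   show ?thesis using h(2)[OF x(1)] x(2) P0.hom_zero[OF X[OF i] h(1)] by simp
  qed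
  then show False using faithful[OF fx] f(2) by blast
 qed
 then show ?thesis using inj_on_hom_iff[OF lP1 lP0 q(6)] by blast
qed

lemma A_dual_neg:
 assumes P: "lmod P" and f: "f : mod_Hom A P (regm)"
 shows "(\<lambda>x\<in>car P. \<ominus>\<^bsub>A\<^esub> f x) : mod_Hom A P (regm)"
  "(\<lambda>x\<in>car P. \<ominus>\<^bsub>A\<^esub> f x) \<oplus>\<^bsub>A_dual A P\<^esub> f = \<zero>\<^bsub>A_dual A P\<^esub>"
proof -
 note f' = homD[OF mHomD(1)[OF f], simplified]
 have "(%x. \<ominus>\<^bsub>A\<^esub> f x) : Hom P (regm)"
  by (rule homI) (use f' in \<open>simp_all add: A.minus_add A.r_minus\<close>)
 then show "(\<lambda>x\<in>car P. \<ominus>\<^bsub>A\<^esub> f x) : mod_Hom A P (regm)" by (rule hom_res[OF P])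
 show "(\<lambda>x\<in>car P. \<ominus>\<^bsub>A\<^esub> f x) \<oplus>\<^bsub>A_dual A P\<^esub> f = \<zero>\<^bsub>A_dual A P\<^esub>"
  unfolding A_dual_simps zero_map_def by (rule restrict_ext) (simp add: f' A.l_neg)
qed

lemma mod_Hom_regular_add:
 assumes P: "lmod P" and f: "f : mod_Hom A P (regm)" and g: "g : mod_Hom A P (regm)"
 shows "(\<lambda>x\<in>car P. f x \<oplus>\<^bsub>A\<^esub> g x) : mod_Hom A P (regm)"
 using hom_res[OF P hom_add[OF left_module_regular mHomD(1)[OF f] mHomD(1)[OF g]]] by simp

lemma mod_Hom_regular_smult:
 assumes P: "lmod P" and f: "f : mod_Hom A P (regm)" and a: "a : car A"
 shows "(\<lambda>x\<in>car P. f x \<cdot> a) : mod_Hom A P (regm)"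
proof (rule hom_res[OF P homI])
 note f' = homD[OF mHomD(1)[OF f], simplified]
 show "f x \<cdot> a : car (regm)" if "x : car P" for x using f'(1)[OF that] a by simp
 show "f (x \<oplus>\<^bsub>P\<^esub> y) \<cdot> a = f x \<cdot> a \<oplus>\<^bsub>regm\<^esub> f y \<cdot> a" if "x : car P" "y : car P" for x y
  using f'(1,2) that a by (simp add: A.l_distr)
 show "f (b \<odot>\<^bsub>P\<^esub> x) \<cdot> a = b \<odot>\<^bsub>regm\<^esub> (f x \<cdot> a)" if "b : car A" "x : car P" for b x
  using f'(1,3) that a by (simp add: A.m_assoc)
qed

lemma abelian_group_A_dual:
 assumes P: "lmod P" shows "abelian_group (A_dual A P)"
proof (rule abelian_groupI)
 fix f assume f: "f : car (A_dual A P)"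
 then have f1: "f : mod_Hom A P (regm)" by simp
 note f' = homD(1)[OF mHomD(1)[OF f1], simplified]
 show "EX g:car (A_dual A P). g \<oplus>\<^bsub>A_dual A P\<^esub> f = \<zero>\<^bsub>A_dual A P\<^esub>"
  by (rule bexI[of _ "\<lambda>x\<in>car P. \<ominus>\<^bsub>A\<^esub> f x"], rule A_dual_neg(2)[OF P f1]) (use A_dual_neg(1)[OF P f1] in simp)
 show "\<zero>\<^bsub>A_dual A P\<^esub> \<oplus>\<^bsub>A_dual A P\<^esub> f = f"
  by (rule extensionalityI[OF _ mHomD(2)[OF f1]]) (simp_all add: zero_map_def f')
 fix g assume g: "g : car (A_dual A P)"
 then have g1: "g : mod_Hom A P (regm)" by simp
 note g' = homD(1)[OF mHomD(1)[OF g1], simplified]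
 show "f \<oplus>\<^bsub>A_dual A P\<^esub> g : car (A_dual A P)" using mod_Hom_regular_add[OF P f1 g1] by simp
 show "f \<oplus>\<^bsub>A_dual A P\<^esub> g = g \<oplus>\<^bsub>A_dual A P\<^esub> f" by (simp add: f' g' A.a_comm cong: restrict_cong)
 fix h assume h: "h : car (A_dual A P)"
 then have h1: "h : mod_Hom A P (regm)" by simp
 note h' = homD(1)[OF mHomD(1)[OF h1], simplified]
 show "(f \<oplus>\<^bsub>A_dual A P\<^esub> g) \<oplus>\<^bsub>A_dual A P\<^esub> h = f \<oplus>\<^bsub>A_dual A P\<^esub> (g \<oplus>\<^bsub>A_dual A P\<^esub> h)"
  unfolding A_dual_simps by (rule restrict_ext) (simp add: f' g' h' A.a_assoc)
next
 show "\<zero>\<^bsub>A_dual A P\<^esub> : car (A_dual A P)"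
  using hom_res[OF P hom_zero_map[OF left_module_regular]] by (simp add: zero_map_def)
qed

abbreviation "dual_image d P1 P0 \<equiv> (%f. compose (car P1) f d) ` car (A_dual A P0)"
abbreviation "dcls d P1 P0 f \<equiv> dual_image d P1 P0 +>\<^bsub>A_dual A P1\<^esub> f"

context
 fixes P1 P0 :: "('a, 'p) module" and d
 assumes P1: "lmod P1" and P0: "lmod P0" and d: "d : Hom P1 P0"
begin

lemma dual_image_iff:
 "f : dual_image d P1 P0 \<longleftrightarrow> (EX h:mod_Hom A P0 (regm). f = (\<lambda>p\<in>car P1. h (d p)))"
 by (auto simp: compose_def)

lemma dual_image_subset: "dual_image d P1 P0 <= mod_Hom A P1 (regm)"
proof
 fix f assume "f : dual_image d P1 P0"
 then obtain h where h: "h : mod_Hom A P0 (regm)" "f = (\<lambda>p\<in>car P1. h (d p))"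
  unfolding dual_image_iff by blast
 show "f : mod_Hom A P1 (regm)" unfolding h(2) by (rule hom_res[OF P1 hcomp[OF d mHomD(1)[OF h(1)]]])
qed

lemma dual_image_smult:
 assumes "f : dual_image d P1 P0" "a : car A"
 shows "a \<odot>\<^bsub>A_dual A P1\<^esub> f : dual_image d P1 P0"
proof -
 obtain h where h: "h : mod_Hom A P0 (regm)" "f = (\<lambda>p\<in>car P1. h (d p))"
  using assms(1) unfolding dual_image_iff by blast
 have "a \<odot>\<^bsub>A_dual A P1\<^esub> f = (\<lambda>p\<in>car P1. (\<lambda>x\<in>car P0. h x \<cdot> a) (d p))"
  unfolding h(2) A_dual_simps by (rule restrict_ext) (simp add: homD(1)[OF d])
 then show ?thesis unfolding dual_image_iff using mod_Hom_regular_smult[OF P0 h(1) assms(2)] by blast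
qed

lemma abelian_subgroup_dual_image: "abelian_subgroup (dual_image d P1 P0) (A_dual A P1)"
proof (rule abelian_subgroupI3[OF _ abelian_group_A_dual[OF P1]], rule additive_subgroupI)
 interpret D: abelian_group "A_dual A P1" by (rule abelian_group_A_dual[OF P1])
 show "subgroup (dual_image d P1 P0) (add_monoid (A_dual A P1))"
 proof (rule subgroup.intro)
  show "dual_image d P1 P0 <= car (add_monoid (A_dual A P1))" using dual_image_subset by simp
  have "zero_map P0 (regm) : mod_Hom A P0 (regm)"
   using hom_res[OF P0 hom_zero_map[OF left_module_regular]] by (simp add: zero_map_def)
  moreover have "zero_map P1 (regm) = (\<lambda>p\<in>car P1. zero_map P0 (regm) (d p))"
   unfolding zero_map_def by (rule restrict_ext) (simp add: homD(1)[OF d])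
  ultimately show "\<one>\<^bsub>add_monoid (A_dual A P1)\<^esub> : dual_image d P1 P0" unfolding dual_image_iff by auto
 next
  fix f g assume "f : dual_image d P1 P0" "g : dual_image d P1 P0"
  then obtain h k where h: "h : mod_Hom A P0 (regm)" "f = (\<lambda>p\<in>car P1. h (d p))"
   and k: "k : mod_Hom A P0 (regm)" "g = (\<lambda>p\<in>car P1. k (d p))"
   unfolding dual_image_iff by blast
  have e: "f \<oplus>\<^bsub>A_dual A P1\<^esub> g = (\<lambda>p\<in>car P1. (\<lambda>x\<in>car P0. h x \<oplus>\<^bsub>A\<^esub> k x) (d p))"
   unfolding h(2) k(2) A_dual_simps by (rule restrict_ext) (simp add: homD(1)[OF d])
  have "f \<oplus>\<^bsub>A_dual A P1\<^esub> g : dual_image d P1 P0"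
   unfolding dual_image_iff by (rule bexI[OF _ mod_Hom_regular_add[OF P0 h(1) k(1)]]) (rule e)
  then show "f \<otimes>\<^bsub>add_monoid (A_dual A P1)\<^esub> g : dual_image d P1 P0" by simp
 next
  fix f assume fI: "f : dual_image d P1 P0"
  then obtain h where h: "h : mod_Hom A P0 (regm)" "f = (\<lambda>p\<in>car P1. h (d p))"
   unfolding dual_image_iff by blast
  have f: "f : mod_Hom A P1 (regm)" using fI dual_image_subset by blast
  have "\<ominus>\<^bsub>A_dual A P1\<^esub> f = (\<lambda>x\<in>car P1. \<ominus>\<^bsub>A\<^esub> f x)"
   by (rule D.minus_equality[OF A_dual_neg(2)[OF P1 f]]) (use f A_dual_neg(1)[OF P1 f] in simp_all)
  also have "\<dots> = (\<lambda>p\<in>car P1. (\<lambda>x\<in>car P0. \<ominus>\<^bsub>A\<^esub> h x) (d p))"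
   unfolding h(2) by (rule restrict_ext) (simp add: homD(1)[OF d])
  finally have "\<ominus>\<^bsub>A_dual A P1\<^esub> f : dual_image d P1 P0"
   unfolding dual_image_iff using A_dual_neg(1)[OF P0 h(1)] by blast
  then show "inv\<^bsub>add_monoid (A_dual A P1)\<^esub> f : dual_image d P1 P0" by (simp add: a_inv_def)
 qed
qed

lemma transpose_carrier:
 "car (transpose_of A P1 d P0) = dcls d P1 P0 ` mod_Hom A P1 (regm)"
 by (auto simp: transpose_of_def quot_module_def A_RCOSETS_def')

lemma transpose_add:
 assumes "f : mod_Hom A P1 (regm)" "g : mod_Hom A P1 (regm)"
 shows "dcls d P1 P0 f \<oplus>\<^bsub>transpose_of A P1 d P0\<^esub> dcls d P1 P0 g
  = dcls d P1 P0 (\<lambda>x\<in>car P1. f x \<oplus>\<^bsub>A\<^esub> g x)"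
proof -
 interpret I: abelian_subgroup "dual_image d P1 P0" "A_dual A P1" by (rule abelian_subgroup_dual_image)
 show ?thesis using I.a_rcos_sum[of f g] assms by (simp add: transpose_of_def quot_module_def)
qed

lemma dual_class_add_image:
 assumes "f : mod_Hom A P1 (regm)" "i : dual_image d P1 P0"
 shows "dcls d P1 P0 (i \<oplus>\<^bsub>A_dual A P1\<^esub> f) = dcls d P1 P0 f"
proof -
 interpret I: abelian_subgroup "dual_image d P1 P0" "A_dual A P1" by (rule abelian_subgroup_dual_image)
 have "i : car (A_dual A P1)" using assms(2) dual_image_subset by auto
 then have "dcls d P1 P0 (i \<oplus>\<^bsub>A_dual A P1\<^esub> f) = dcls d P1 P0 i +>\<^bsub>A_dual A P1\<^esub> f"
  using I.a_coset_add_assoc[OF I.a_subset, of i f] assms(1) by simp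
 also have "dcls d P1 P0 i = dual_image d P1 P0"
  using I.a_rcos_const[OF assms(2)] .
 finally show ?thesis .
qed

text \<open>The action in \<open>quot_module\<close> is a union over all representatives of a coset.
  It is a single coset because the image of the dual map is stable under the right action.\<close>

lemma transpose_smult:
 assumes f: "f : mod_Hom A P1 (regm)" and a: "a : car A"
 shows "a \<odot>\<^bsub>transpose_of A P1 d P0\<^esub> dcls d P1 P0 f = dcls d P1 P0 (\<lambda>x\<in>car P1. f x \<cdot> a)"
proof -
 interpret I: abelian_subgroup "dual_image d P1 P0" "A_dual A P1" by (rule abelian_subgroup_dual_image)
 have eq: "dcls d P1 P0 (a \<odot>\<^bsub>A_dual A P1\<^esub> y) = dcls d P1 P0 (a \<odot>\<^bsub>A_dual A P1\<^esub> f)"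
  if y: "y : dcls d P1 P0 f" for y
 proof -
  obtain i where i: "i : dual_image d P1 P0" "y = i \<oplus>\<^bsub>A_dual A P1\<^esub> f" using y unfolding a_r_coset_def' by blast
  have im: "i : mod_Hom A P1 (regm)" using i(1) dual_image_subset by blast
  note f' = homD(1)[OF mHomD(1)[OF f], simplified] and i' = homD(1)[OF mHomD(1)[OF im], simplified]
  have e: "a \<odot>\<^bsub>A_dual A P1\<^esub> y = (a \<odot>\<^bsub>A_dual A P1\<^esub> i) \<oplus>\<^bsub>A_dual A P1\<^esub> (a \<odot>\<^bsub>A_dual A P1\<^esub> f)"
   unfolding i(2) A_dual_simps by (rule restrict_ext) (simp add: f' i' a A.l_distr)
  have m: "a \<odot>\<^bsub>A_dual A P1\<^esub> f : mod_Hom A P1 (regm)" using mod_Hom_regular_smult[OF P1 f a] by simp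
  show ?thesis unfolding e by (rule dual_class_add_image[OF m dual_image_smult[OF i(1) a]])
 qed
 have "f : dcls d P1 P0 f" by (rule I.a_rcos_self) (use f in simp)
 then have "(\<Union>y\<in>dcls d P1 P0 f. dcls d P1 P0 (a \<odot>\<^bsub>A_dual A P1\<^esub> y)) = dcls d P1 P0 (a \<odot>\<^bsub>A_dual A P1\<^esub> f)"
  by (rule UN_constant_eq) (rule ballI, rule eq)
 then show ?thesis by (simp add: transpose_of_def quot_module_def)
qed

lemma dual_class_eqD:
 assumes f: "f : mod_Hom A P1 (regm)"
  and eq: "dcls d P1 P0 f = dcls d P1 P0 g"
 obtains h where "h : mod_Hom A P0 (regm)" "f = (\<lambda>p\<in>car P1. h (d p) \<oplus>\<^bsub>A\<^esub> g p)"
proof -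
 interpret I: abelian_subgroup "dual_image d P1 P0" "A_dual A P1" by (rule abelian_subgroup_dual_image)
 have "f : dcls d P1 P0 f" by (rule I.a_rcos_self) (use f in simp)
 then have "f : dcls d P1 P0 g" by (simp only: eq)
 then obtain i where i: "i : dual_image d P1 P0" "f = i \<oplus>\<^bsub>A_dual A P1\<^esub> g" unfolding a_r_coset_def' by blast
 obtain h where h: "h : mod_Hom A P0 (regm)" "i = (\<lambda>p\<in>car P1. h (d p))"
  using i(1) unfolding dual_image_iff by blast
 have "f = (\<lambda>p\<in>car P1. h (d p) \<oplus>\<^bsub>A\<^esub> g p)" unfolding i(2) h(2) A_dual_simps by (rule restrict_ext) simp
 then show ?thesis by (rule that[OF h(1)])
qed

end

text \<open>If g does not factor through d, some functional ph on Hom(P1, N) kills all maps that do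
  factor but not g. Sending x to the functional that takes the class of f to ph(f(-) x) gives a
  homomorphism from N to the dual of the transpose. It cannot be zero, as the maps f(-) x generate
  Hom(P1, N).\<close>

lemma tau_rigid_imp_lifts:
 fixes P1 P0 :: "('k, 'a) smod" and N :: "('a, 'n) module"
 assumes p: "presents P1 d P0 e M" and N: "fdm N"
  and hom0: "mod_Hom A N (K_dual K A (transpose_of A P1 d P0)) = {zero_map N (K_dual K A (transpose_of A P1 d P0))}"
 shows "lifts d P1 P0 N"
 unfolding lifts_def
proof (rule ballI, rule ccontr)
 note q = presD[OF p] and lN = fdD(1)[OF N]
 note lP1 = projD(2)[OF q(1)] and lP0 = projD(2)[OF q(2)]
 note tr = lP1 lP0 q(6)
 interpret N: left_module A N by (rule lN)
 let ?T = "transpose_of A P1 d P0" and ?D = "mod_Hom A P1 (regm)"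
 fix g assume g: "g : Hom P1 N" and no: "\<not> (EX h:Hom P0 N. ALL x:car P1. h (d x) = g x)"
 define g' where "g' = restrict g (car P1)"
 have g': "g' : mod_Hom A P1 N" unfolding g'_def by (rule hom_res[OF lP1 g])
 define U where "U = {f : mod_Hom A P1 N. EX h:Hom P0 N. ALL x:car P1. f x = h (d x)}"
 have d': "x : car P1 ==> d x : car P0" for x by (rule homD(1)[OF q(6)])
 have U: "subspace K U (HomK P1 N)"
 proof -
  have vs: "vectorspace K (HomK P1 N)" by (rule vectorspace_hom_space[OF lP1 lN])
  then have "module K (HomK P1 N)" by (simp add: vectorspace_def)
  moreover have "zero_map P1 N : U"
   unfolding U_def using hom_res[OF lP1 hom_zero_map[OF lN]] hom_zero_map[OF lN, of P0]
   by (auto simp: zero_map_def intro!: bexI[of _ "%x. \<zero>\<^bsub>N\<^esub>"])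
  moreover have "(\<lambda>x\<in>car P1. u x \<oplus>\<^bsub>N\<^esub> v x) : U" if u: "u : U" and v: "v : U" for u v
  proof -
   obtain h where h: "h : Hom P0 N" "ALL x:car P1. u x = h (d x)" using u unfolding U_def by blast
   obtain k where k: "k : Hom P0 N" "ALL x:car P1. v x = k (d x)" using v unfolding U_def by blast
   have uv: "u : Hom P1 N" "v : Hom P1 N" using u v mHomD(1) unfolding U_def by auto
   show ?thesis unfolding U_def
    using hom_res[OF lP1 hom_add[OF lN uv]] h(2) k(2) bexI[OF _ hom_add[OF lN h(1) k(1)]] by simp
  qed
  moreover have "(\<lambda>x\<in>car P1. (sc c) \<odot>\<^bsub>N\<^esub> u x) : U" if u: "u : U" and c: "c : car K" for u c
  proof -
   obtain h where h: "h : Hom P0 N" "ALL x:car P1. u x = h (d x)" using u unfolding U_def by blast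
   have uv: "u : Hom P1 N" using u mHomD(1) unfolding U_def by auto
   show ?thesis unfolding U_def
    using hom_res[OF lP1 hom_scal[OF lN uv c]] h(2) bexI[OF _ hom_scal[OF lN h(1) c]] by simp
  qed
  moreover have "U <= mod_Hom A P1 N" unfolding U_def by blast
  ultimately show ?thesis using vs by (simp add: subspace_def LinearCombinations.submodule_def)
 qed
 have "g' \<notin> U"
 proof
  assume "g' : U"
  then obtain h where "h : Hom P0 N" "ALL x:car P1. g' x = h (d x)" unfolding U_def by blast
  then show False using no by (auto simp: g'_def)
 qed
 then obtain ph where ph: "ph : module_hom K (HomK P1 N) (regular_module K)" and phU: "!!u. u : U ==> ph u = \<zero>\<^bsub>K\<^esub>"
  and phg: "ph g' ~= \<zero>\<^bsub>K\<^esub>"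
  using separating_functional[OF fin_dim_hom_space[OF projD(1)[OF q(1)] N] U, of g'] g' by auto
 note ph' = homD[OF ph, simplified]
 \<comment> \<open>\<open>m f x\<close> is the image in Hom(P1, N) of the tensor of f and x.\<close>
 define m where "m f x = (\<lambda>p\<in>car P1. f p \<odot>\<^bsub>N\<^esub> x)" for f x
 have m0: "(%p. f p \<odot>\<^bsub>N\<^esub> x) : Hom Q N" if "f : Hom Q (regm)" "x : car N"
  for f x and Q :: "('k, 'a) smod"
  by (rule homI)
   (use homD[OF that(1)] that(2) in \<open>simp_all add: N.smult_closed N.smult_l_distr N.smult_assoc1\<close>)
 have m: "m f x : mod_Hom A P1 N" if "f : ?D" "x : car N" for f x
  unfolding m_def by (rule hom_res[OF lP1 m0[OF mHomD(1)[OF that(1)] that(2)]])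
 have fA: "f p : car A" if "f : ?D" "p : car P1" for f p using homD(1)[OF mHomD(1)[OF that(1)] that(2)] by simp
 have m_addf: "ph (m (\<lambda>p\<in>car P1. f p \<oplus>\<^bsub>A\<^esub> f' p) x) = ph (m f x) \<oplus>\<^bsub>K\<^esub> ph (m f' x)"
  if "f : ?D" "f' : ?D" "x : car N" for f f' x
 proof -
  have "m (\<lambda>p\<in>car P1. f p \<oplus>\<^bsub>A\<^esub> f' p) x = (\<lambda>p\<in>car P1. m f x p \<oplus>\<^bsub>N\<^esub> m f' x p)"
   unfolding m_def by (rule restrict_ext) (simp add: fA that N.smult_l_distr)
  then show ?thesis using ph'(2)[OF m[OF that(1,3)] m[OF that(2,3)]] by simp
 qed
 have m_addx: "ph (m f (x \<oplus>\<^bsub>N\<^esub> y)) = ph (m f x) \<oplus>\<^bsub>K\<^esub> ph (m f y)"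
  if "f : ?D" "x : car N" "y : car N" for f x y
 proof -
  have "m f (x \<oplus>\<^bsub>N\<^esub> y) = (\<lambda>p\<in>car P1. m f x p \<oplus>\<^bsub>N\<^esub> m f y p)"
   unfolding m_def by (rule restrict_ext) (simp add: fA that N.smult_r_distr)
  then show ?thesis using ph'(2)[OF m[OF that(1,2)] m[OF that(1,3)]] by simp
 qed
 have m_bal: "m f (a \<odot>\<^bsub>N\<^esub> x) = m (\<lambda>p\<in>car P1. f p \<cdot> a) x" if "f : ?D" "x : car N" "a : car A" for f x a
  unfolding m_def by (rule restrict_ext) (simp add: fA that N.smult_assoc1)
 have m_scal: "ph (m (\<lambda>p\<in>car P1. f p \<cdot> (sc c)) x) = c \<otimes>\<^bsub>K\<^esub> ph (m f x)"
  if "f : ?D" "x : car N" "c : car K" for f x c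
 proof -
  have "m (\<lambda>p\<in>car P1. f p \<cdot> (sc c)) x = (\<lambda>p\<in>car P1. (sc c) \<odot>\<^bsub>N\<^esub> m f x p)"
   unfolding m_def
   by (rule restrict_ext)
    (simp add: fA that scal_closed scal_central[symmetric] N.smult_assoc1[OF scal_closed, symmetric])
  then show ?thesis using ph'(3)[OF that(3) m[OF that(1,2)]] by simp
 qed
 have m_wd: "ph (m f x) = ph (m f' x)"
  if f: "f : ?D" "f' : ?D" and x: "x : car N" and eq: "dcls d P1 P0 f = dcls d P1 P0 f'" for f f' x
 proof -
  obtain h where h: "h : mod_Hom A P0 (regm)" "f = (\<lambda>p\<in>car P1. h (d p) \<oplus>\<^bsub>A\<^esub> f' p)"
   by (rule dual_class_eqD[OF tr f(1) eq]) (rule that)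
  let ?hd = "\<lambda>p\<in>car P1. h (d p)"
  have hd: "?hd : ?D" by (rule hom_res[OF lP1 hcomp[OF q(6) mHomD(1)[OF h(1)]]])
  have "f = (\<lambda>p\<in>car P1. ?hd p \<oplus>\<^bsub>A\<^esub> f' p)" unfolding h(2) by (rule restrict_ext) simp
  then have "ph (m f x) = ph (m ?hd x) \<oplus>\<^bsub>K\<^esub> ph (m f' x)" using m_addf[OF hd f(2) x] by simp
  moreover have "m ?hd x : U"
   unfolding U_def using m[OF hd x] bexI[OF _ m0[OF mHomD(1)[OF h(1)] x]] by (simp add: m_def)
  ultimately show ?thesis using phU ph'(1)[OF m[OF f(2) x]] by simp
 qed
 \<comment> \<open>Ph has to be a function on cosets; its value is read off at a chosen
   representative, and \<open>m_wd\<close> makes it independent of the choice.\<close>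
 define rep where "rep C = (SOME f. f : ?D & C = dcls d P1 P0 f)" for C
 define Ph where "Ph = (\<lambda>x\<in>car N. \<lambda>C\<in>car ?T. ph (m (rep C) x))"
 have cT: "dcls d P1 P0 f : car ?T" if "f : ?D" for f unfolding transpose_carrier[OF tr] using that by blast
 have Ph: "Ph x (dcls d P1 P0 f) = ph (m f x)" if f: "f : ?D" and x: "x : car N" for f x
 proof -
  have "rep (dcls d P1 P0 f) : ?D & dcls d P1 P0 f = dcls d P1 P0 (rep (dcls d P1 P0 f))"
   unfolding rep_def by (rule someI[where x = f]) (use f in simp)
  then have "ph (m f x) = ph (m (rep (dcls d P1 P0 f)) x)" using m_wd[OF f _ x] by blast
  then show ?thesis using cT[OF f] x by (simp add: Ph_def)
 qed
 have exT: "EX f:?D. C = dcls d P1 P0 f" if "C : car ?T" for C using that unfolding transpose_carrier[OF tr] by blast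
 have Tadd: "!!f g. f : ?D ==> g : ?D ==> dcls d P1 P0 f \<oplus>\<^bsub>?T\<^esub> dcls d P1 P0 g
  = dcls d P1 P0 (\<lambda>x\<in>car P1. f x \<oplus>\<^bsub>A\<^esub> g x)" by (rule transpose_add[OF tr])
 have Tsm: "!!f a. f : ?D ==> a : car A ==>
  a \<odot>\<^bsub>?T\<^esub> dcls d P1 P0 f = dcls d P1 P0 (\<lambda>x\<in>car P1. f x \<cdot> a)" by (rule transpose_smult[OF tr])
 have Dadd: "!!f g. f : ?D ==> g : ?D ==> (\<lambda>x\<in>car P1. f x \<oplus>\<^bsub>A\<^esub> g x) : ?D" by (rule mod_Hom_regular_add[OF lP1])
 have Dsm: "!!f a. f : ?D ==> a : car A ==> (\<lambda>x\<in>car P1. f x \<cdot> a) : ?D" by (rule mod_Hom_regular_smult[OF lP1])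
 have Phcl: "Ph x : car (K_dual K A ?T)" if x: "x : car N" for x
 proof -
  have "Ph x : module_hom K (restrict_scalars A ?T) (regular_module K)"
  proof (rule homI)
   fix C assume "C : car (restrict_scalars A ?T)"
   then obtain f where f: "f : ?D" "C = dcls d P1 P0 f" using exT by auto
   show "Ph x C : car (regular_module K)" using Ph[OF f(1) x] f(2) ph'(1)[OF m[OF f(1) x]] by simp
   fix C' assume "C' : car (restrict_scalars A ?T)"
   then obtain f' where f': "f' : ?D" "C' = dcls d P1 P0 f'" using exT by auto
   show "Ph x (C \<oplus>\<^bsub>restrict_scalars A ?T\<^esub> C') = Ph x C \<oplus>\<^bsub>regular_module K\<^esub> Ph x C'"
    using Ph[OF f(1) x] Ph[OF f'(1) x] Ph[OF Dadd[OF f(1) f'(1)] x] Tadd[OF f(1) f'(1)] m_addf[OF f(1) f'(1) x] f(2) f'(2)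
    by simp
  next
   fix c C assume c: "c : car K" and "C : car (restrict_scalars A ?T)"
   then obtain f where f: "f : ?D" "C = dcls d P1 P0 f" using exT by auto
   note s = scal_closed[OF c]
   show "Ph x (c \<odot>\<^bsub>restrict_scalars A ?T\<^esub> C) = c \<odot>\<^bsub>regular_module K\<^esub> Ph x C"
    using Ph[OF f(1) x] Ph[OF Dsm[OF f(1) s] x] Tsm[OF f(1) s] m_scal[OF f(1) x c] f(2) by simp
  qed
  moreover have "Ph x : extensional (car ?T)" using x by (simp add: Ph_def)
  ultimately show ?thesis by simp
 qed
 have "Ph : mod_Hom A N (K_dual K A ?T)"
  unfolding mod_Hom_def
 proof (rule IntI)
  show "Ph : extensional (car N)" by (simp add: Ph_def)
  have ext: "Ph x : extensional (car ?T)" if "x : car N" for x using Phcl[OF that] by simp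
  show "Ph : Hom N (K_dual K A ?T)"
  proof (rule homI)
   fix x y assume x: "x : car N" and y: "y : car N"
   show "Ph (x \<oplus>\<^bsub>N\<^esub> y) = Ph x \<oplus>\<^bsub>K_dual K A ?T\<^esub> Ph y"
   proof (rule extensionalityI[OF ext])
    fix C assume C: "C : car ?T"
    then obtain f where f: "f : ?D" "C = dcls d P1 P0 f" using exT by auto
    show "Ph (x \<oplus>\<^bsub>N\<^esub> y) C = (Ph x \<oplus>\<^bsub>K_dual K A ?T\<^esub> Ph y) C"
     using C Ph[OF f(1) x] Ph[OF f(1) y] Ph[OF f(1), of "x \<oplus>\<^bsub>N\<^esub> y"] m_addx[OF f(1) x y] f(2) x y by simp
   qed (use x y in simp_all)
  next
   fix a x assume a: "a : car A" and x: "x : car N"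
   note ax = N.smult_closed[OF a x]
   show "Ph (a \<odot>\<^bsub>N\<^esub> x) = a \<odot>\<^bsub>K_dual K A ?T\<^esub> Ph x"
   proof (rule extensionalityI[OF ext[OF ax]])
    fix C assume C: "C : car ?T"
    then obtain f where f: "f : ?D" "C = dcls d P1 P0 f" using exT by auto
    show "Ph (a \<odot>\<^bsub>N\<^esub> x) C = (a \<odot>\<^bsub>K_dual K A ?T\<^esub> Ph x) C"
     using C Ph[OF f(1) ax] Ph[OF Dsm[OF f(1) a] x] Tsm[OF f(1) a] m_bal[OF f(1) x a] f(2) by simp
   qed simp
  qed (rule Phcl)
 qed
 then have "Ph = zero_map N (K_dual K A ?T)" unfolding hom0 by simp
 then have phm: "ph (m f x) = \<zero>\<^bsub>K\<^esub>" if "f : ?D" "x : car N" for f x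
  using Ph[OF that] cT[OF that(1)] that(2) by (simp add: zero_map_def)
 \<comment> \<open>By \<open>phm\<close> the functional kills every \<open>m f x\<close>; by
   generation it kills all of Hom(P1, N), in particular g.\<close>
 have "g : {w : Hom P1 N. ph (restrict w (car P1)) = \<zero>\<^bsub>K\<^esub>}"
 proof (rule projective_hom_induct[OF q(1) lN _ _ _ g])
  fix u v assume u: "u : {w : Hom P1 N. ph (restrict w (car P1)) = \<zero>\<^bsub>K\<^esub>}"
   and v: "v : Hom P1 N" and eq: "!!x. x : car P1 ==> v x = u x"
  have "restrict v (car P1) = restrict u (car P1)" by (rule restrict_ext) (rule eq)
  then show "v : {w : Hom P1 N. ph (restrict w (car P1)) = \<zero>\<^bsub>K\<^esub>}" using u v by simp
 next
  fix u v assume u: "u : {w : Hom P1 N. ph (restrict w (car P1)) = \<zero>\<^bsub>K\<^esub>}"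
   and v: "v : {w : Hom P1 N. ph (restrict w (car P1)) = \<zero>\<^bsub>K\<^esub>}"
  have uv: "u : Hom P1 N" "v : Hom P1 N" using u v by auto
  have "(\<lambda>x\<in>car P1. u x \<oplus>\<^bsub>N\<^esub> v x) = (\<lambda>x\<in>car P1. restrict u (car P1) x \<oplus>\<^bsub>N\<^esub> restrict v (car P1) x)"
   by (rule restrict_ext) simp
  then show "(%x. u x \<oplus>\<^bsub>N\<^esub> v x) : {w : Hom P1 N. ph (restrict w (car P1)) = \<zero>\<^bsub>K\<^esub>}"
   using ph'(2)[OF hom_res[OF lP1 uv(1)] hom_res[OF lP1 uv(2)]] u v hom_add[OF lN uv] by simp
 next
  fix f y assume f: "f : Hom P1 (regm)" and y: "y : car N"
  have "(\<lambda>p\<in>car P1. f p \<odot>\<^bsub>N\<^esub> y) = m (restrict f (car P1)) y" unfolding m_def by (rule restrict_ext) simp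
  then show "(%p. f p \<odot>\<^bsub>N\<^esub> y) : {w : Hom P1 N. ph (restrict w (car P1)) = \<zero>\<^bsub>K\<^esub>}"
   using m0[OF f y] phm[OF hom_res[OF lP1 f] y] by simp
 qed
 then show False using phg by (simp add: g'_def)
qed

text \<open>A homomorphism Ph amounts to a balanced pairing of N with Hom(P1, A), which extends to
  an additive functional ph on Hom(P1, N). This ph kills the maps that factor through d, and by
  assumption these are all maps, so the pairing vanishes.\<close>

lemma lifts_imp_tau_rigid:
 fixes P1 P0 :: "('k, 'a) smod" and N :: "('a, 'n) module"
 assumes p: "presents P1 d P0 e M" and lN: "lmod N" and l: "lifts d P1 P0 N"
 shows "mod_Hom A N (K_dual K A (transpose_of A P1 d P0)) = {zero_map N (K_dual K A (transpose_of A P1 d P0))}"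
proof -
 note q = presD[OF p]
 note lP1 = projD(2)[OF q(1)] and lP0 = projD(2)[OF q(2)]
 note tr = lP1 lP0 q(6)
 interpret N: left_module A N by (rule lN)
 let ?T = "transpose_of A P1 d P0" and ?D = "mod_Hom A P1 (regm)"
 let ?KT = "K_dual K A ?T" and ?R = "regm"
 have exT: "EX f:?D. C = dcls d P1 P0 f" if "C : car ?T" for C using that unfolding transpose_carrier[OF tr] by blast
 have cT: "dcls d P1 P0 f : car ?T" if "f : ?D" for f unfolding transpose_carrier[OF tr] using that by blast
 have Tadd: "!!f g. f : ?D ==> g : ?D ==> dcls d P1 P0 f \<oplus>\<^bsub>?T\<^esub> dcls d P1 P0 g
  = dcls d P1 P0 (\<lambda>x\<in>car P1. f x \<oplus>\<^bsub>A\<^esub> g x)" by (rule transpose_add[OF tr])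
 have Tsm: "!!f a. f : ?D ==> a : car A ==>
  a \<odot>\<^bsub>?T\<^esub> dcls d P1 P0 f = dcls d P1 P0 (\<lambda>x\<in>car P1. f x \<cdot> a)" by (rule transpose_smult[OF tr])
 have Dadd: "!!f g. f : ?D ==> g : ?D ==> (\<lambda>x\<in>car P1. f x \<oplus>\<^bsub>A\<^esub> g x) : ?D" by (rule mod_Hom_regular_add[OF lP1])
 have Dsm: "!!f a. f : ?D ==> a : car A ==> (\<lambda>x\<in>car P1. f x \<cdot> a) : ?D" by (rule mod_Hom_regular_smult[OF lP1])
 have Tcl: "C \<oplus>\<^bsub>?T\<^esub> C' : car ?T" if C: "C : car ?T" and C': "C' : car ?T" for C C'
 proof -
  obtain f where f: "f : ?D" "C = dcls d P1 P0 f" using exT[OF C] by blast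
  obtain f' where f': "f' : ?D" "C' = dcls d P1 P0 f'" using exT[OF C'] by blast
  show ?thesis using Tadd[OF f(1) f'(1)] cT[OF Dadd[OF f(1) f'(1)]] f(2) f'(2) by simp
 qed
 have Tscl: "a \<odot>\<^bsub>?T\<^esub> C : car ?T" if C: "C : car ?T" and a: "a : car A" for C a
 proof -
  obtain f where f: "f : ?D" "C = dcls d P1 P0 f" using exT[OF C] by blast
  show ?thesis using Tsm[OF f(1) a] cT[OF Dsm[OF f(1) a]] f(2) by simp
 qed
 have z: "\<zero>\<^bsub>?KT\<^esub> : car ?KT"
  unfolding K_dual_simps
  by (rule IntI, rule homI) (use Tcl Tscl scal_closed in simp_all)
 have zadd: "\<zero>\<^bsub>?KT\<^esub> \<oplus>\<^bsub>?KT\<^esub> \<zero>\<^bsub>?KT\<^esub> = \<zero>\<^bsub>?KT\<^esub>" by (simp cong: restrict_cong)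
 have zsm: "a \<odot>\<^bsub>?KT\<^esub> \<zero>\<^bsub>?KT\<^esub> = \<zero>\<^bsub>?KT\<^esub>" if "a : car A" for a
  unfolding K_dual_simps by (rule restrict_ext) (use Tscl[OF _ that] in simp)
 have "(%x. \<zero>\<^bsub>?KT\<^esub>) : Hom N ?KT" by (rule homI) (simp_all only: z zadd zsm)
 then have zm: "zero_map N ?KT : mod_Hom A N ?KT" unfolding zero_map_def by (rule hom_res[OF lN])
 have "Ph = zero_map N ?KT" if Ph: "Ph : mod_Hom A N ?KT" for Ph
 proof (rule mod_Hom_eqI[OF Ph zm])
  note Ph1 = homD[OF mHomD(1)[OF Ph]]
  have Ph2: "Ph x : module_hom K (restrict_scalars A ?T) (regular_module K)" "Ph x : extensional (car ?T)"
   if "x : car N" for x using Ph1(1)[OF that] by simp_all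
  \<comment> \<open>The pairing attached to Ph: evaluate Ph x at the class of f.\<close>
  define be where "be x f = Ph x (dcls d P1 P0 (restrict f (car P1)))" for x f
  have fD: "restrict f (car P1) : ?D" if "f : Hom P1 ?R" for f by (rule hom_res[OF lP1 that])
  have b1: "be x f : car K" if "x : car N" "f : Hom P1 ?R" for x f
   using homD(1)[OF Ph2(1)[OF that(1)]] cT[OF fD[OF that(2)]] by (simp add: be_def)
  have b2: "be (x \<oplus>\<^bsub>N\<^esub> y) f = be x f \<oplus>\<^bsub>K\<^esub> be y f" if "x : car N" "y : car N" "f : Hom P1 ?R" for x y f
   using Ph1(2)[OF that(1,2)] cT[OF fD[OF that(3)]] by (simp add: be_def)
  have b3: "be x (%p. f p \<oplus>\<^bsub>A\<^esub> g p) = be x f \<oplus>\<^bsub>K\<^esub> be x g"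
   if "x : car N" "f : Hom P1 ?R" "g : Hom P1 ?R" for x f g
  proof -
   have "(\<lambda>p\<in>car P1. f p \<oplus>\<^bsub>A\<^esub> g p) = (\<lambda>p\<in>car P1. restrict f (car P1) p \<oplus>\<^bsub>A\<^esub> restrict g (car P1) p)"
    by (rule restrict_ext) simp
   then show ?thesis
    using Tadd[OF fD[OF that(2)] fD[OF that(3)]] cT[OF fD[OF that(2)]] cT[OF fD[OF that(3)]]
     homD(2)[OF Ph2(1)[OF that(1)], of "dcls d P1 P0 (restrict f (car P1))" "dcls d P1 P0 (restrict g (car P1))"]
    by (simp add: be_def)
  qed
  have b4: "be (a \<odot>\<^bsub>N\<^esub> x) f = be x (%p. f p \<cdot> a)" if "x : car N" "f : Hom P1 ?R" "a : car A" for x f a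
  proof -
   have "(\<lambda>p\<in>car P1. f p \<cdot> a) = (\<lambda>p\<in>car P1. restrict f (car P1) p \<cdot> a)" by (rule restrict_ext) simp
   then show ?thesis
    using Ph1(3)[OF that(3,1)] Tsm[OF fD[OF that(2)] that(3)] cT[OF fD[OF that(2)]] by (simp add: be_def)
  qed
  have b5: "be x f = be x g" if "!!p. p : car P1 ==> f p = g p" for x f g
  proof -
   have "restrict f (car P1) = restrict g (car P1)" by (rule restrict_ext) (rule that)
   then show ?thesis by (simp add: be_def)
  qed
  have "EX ph. (ALL g:Hom P1 N. ph g : car K)
   & (ALL g:Hom P1 N. ALL h:Hom P1 N. ph (%x. g x \<oplus>\<^bsub>N\<^esub> h x) = ph g \<oplus>\<^bsub>K\<^esub> ph h)
   & (ALL g:Hom P1 N. ALL h:Hom P1 N. (ALL x:car P1. g x = h x) --> ph g = ph h)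
   & (ALL f:Hom P1 ?R. ALL x:car N. ph (%p. f p \<odot>\<^bsub>N\<^esub> x) = be x f)"
   by (rule projective_extend_balanced[OF q(1) lN]) (fact b1, fact b2, fact b3, fact b4, rule b5)
  then obtain ph where ph1: "ALL g:Hom P1 N. ph g : car K"
   and ph2: "ALL g:Hom P1 N. ALL h:Hom P1 N. ph (%x. g x \<oplus>\<^bsub>N\<^esub> h x) = ph g \<oplus>\<^bsub>K\<^esub> ph h"
   and ph3: "ALL g:Hom P1 N. ALL h:Hom P1 N. (ALL x:car P1. g x = h x) --> ph g = ph h"
   and ph4: "ALL f:Hom P1 ?R. ALL x:car N. ph (%p. f p \<odot>\<^bsub>N\<^esub> x) = be x f" by (elim exE conjE) (rule that)
  note ph1 = ph1[rule_format] and ph2 = ph2[rule_format] and ph3 = ph3[rule_format] and ph4 = ph4[rule_format]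
  \<comment> \<open>The map h d lies in the image of the dual map, so its class is the zero class,
    on which the additive Ph x vanishes.\<close>
  have b0: "be x (%p. h (d p)) = \<zero>\<^bsub>K\<^esub>" if x: "x : car N" and h: "h : Hom P0 ?R" for x h
  proof -
   interpret I: abelian_subgroup "dual_image d P1 P0" "A_dual A P1" by (rule abelian_subgroup_dual_image[OF tr])
   let ?f = "\<lambda>p\<in>car P1. h (d p)" and ?z = "zero_map P1 ?R"
   have "?f = (\<lambda>p\<in>car P1. restrict h (car P0) (d p))"
    by (rule restrict_ext) (simp add: homD(1)[OF q(6)])
   then have f: "?f : dual_image d P1 P0" unfolding dual_image_iff[OF tr] using hom_res[OF lP0 h] by blast
   have z: "?z : dual_image d P1 P0" 
    using additive_subgroup.zero_closed[OF I.is_additive_subgroup] unfolding A_dual_simps(2) .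
   have zD: "?z : ?D" using dual_image_subset[OF tr] z by blast
   have "dcls d P1 P0 ?f = dcls d P1 P0 ?z"
    using I.a_rcos_const[OF f] I.a_rcos_const[OF z] by simp
   moreover have "(\<lambda>p\<in>car P1. ?z p \<oplus>\<^bsub>A\<^esub> ?z p) = ?z" unfolding zero_map_def by (rule restrict_ext) simp
   then have "dcls d P1 P0 ?z \<oplus>\<^bsub>?T\<^esub> dcls d P1 P0 ?z = dcls d P1 P0 ?z" using Tadd[OF zD zD] by simp
   then have "Ph x (dcls d P1 P0 ?z) = Ph x (dcls d P1 P0 ?z) \<oplus>\<^bsub>K\<^esub> Ph x (dcls d P1 P0 ?z)"
    using homD(2)[OF Ph2(1)[OF x], of "dcls d P1 P0 ?z" "dcls d P1 P0 ?z"] cT[OF zD] by simp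
   moreover have "Ph x (dcls d P1 P0 ?z) : car K" using homD(1)[OF Ph2(1)[OF x]] cT[OF zD] by simp
   ultimately show ?thesis by (simp add: be_def)
  qed
  \<comment> \<open>It suffices to treat the generators p |-> f(p) y of Hom(P0, N), for which
    \<open>b0\<close> applies.\<close>
  have hd: "ph (%p. h (d p)) = \<zero>\<^bsub>K\<^esub>" if h: "h : Hom P0 N" for h
  proof -
   have "h : {w : Hom P0 N. ph (%p. w (d p)) = \<zero>\<^bsub>K\<^esub>}"
   proof (rule projective_hom_induct[OF q(2) lN _ _ _ h])
    fix u v assume u: "u : {w : Hom P0 N. ph (%p. w (d p)) = \<zero>\<^bsub>K\<^esub>}" and v: "v : Hom P0 N"
     and eq: "!!x. x : car P0 ==> v x = u x"
    have u1: "u : Hom P0 N" using u by simp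
    have "ph (%p. v (d p)) = ph (%p. u (d p))"
     by (rule ph3[OF hcomp[OF q(6) v] hcomp[OF q(6) u1]]) (simp add: eq homD(1)[OF q(6)])
    then show "v : {w : Hom P0 N. ph (%p. w (d p)) = \<zero>\<^bsub>K\<^esub>}" using u v by simp
   next
    fix u v assume u: "u : {w : Hom P0 N. ph (%p. w (d p)) = \<zero>\<^bsub>K\<^esub>}"
     and v: "v : {w : Hom P0 N. ph (%p. w (d p)) = \<zero>\<^bsub>K\<^esub>}"
    have u1: "u : Hom P0 N" "v : Hom P0 N" using u v by simp_all
    have "ph (%p. u (d p) \<oplus>\<^bsub>N\<^esub> v (d p)) = ph (%p. u (d p)) \<oplus>\<^bsub>K\<^esub> ph (%p. v (d p))"
     by (rule ph2[OF hcomp[OF q(6) u1(1)] hcomp[OF q(6) u1(2)]])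
    then show "(%x. u x \<oplus>\<^bsub>N\<^esub> v x) : {w : Hom P0 N. ph (%p. w (d p)) = \<zero>\<^bsub>K\<^esub>}"
     using u v hom_add[OF lN u1] by simp
   next
    fix f y assume f: "f : Hom P0 ?R" and y: "y : car N"
    have "ph (%p. f (d p) \<odot>\<^bsub>N\<^esub> y) = be y (%p. f (d p))" by (rule ph4[OF hcomp[OF q(6) f] y])
    moreover have "(%p. f p \<odot>\<^bsub>N\<^esub> y) : Hom P0 N"
     by (rule homI)
      (use homD[OF f] y in \<open>simp_all add: N.smult_closed N.smult_l_distr N.smult_assoc1\<close>)
    ultimately show "(%p. f p \<odot>\<^bsub>N\<^esub> y) : {w : Hom P0 N. ph (%p. w (d p)) = \<zero>\<^bsub>K\<^esub>}"
     using b0[OF y f] by simp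
   qed
   then show ?thesis by simp
  qed
  have bz: "be x f = \<zero>\<^bsub>K\<^esub>" if x: "x : car N" and f: "f : Hom P1 ?R" for x f
  proof -
   have m: "(%p. f p \<odot>\<^bsub>N\<^esub> x) : Hom P1 N"
    by (rule homI)
     (use homD[OF f] x in \<open>simp_all add: N.smult_closed N.smult_l_distr N.smult_assoc1\<close>)
   then obtain h where h: "h : Hom P0 N" "!!p. p : car P1 ==> h (d p) = f p \<odot>\<^bsub>N\<^esub> x"
    by (rule liftsE[OF l]) (rule that)
   have "ph (%p. f p \<odot>\<^bsub>N\<^esub> x) = ph (%p. h (d p))"
    by (rule ph3[OF m hcomp[OF q(6) h(1)]]) (simp add: h(2))
   then show ?thesis using ph4[OF f x] hd[OF h(1)] by simp
  qed
  fix x assume x: "x : car N"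
  have "Ph x = \<zero>\<^bsub>?KT\<^esub>"
  proof (rule extensionalityI[OF Ph2(2)[OF x]])
   fix C assume C: "C : car ?T"
   then obtain f where f: "f : ?D" "C = dcls d P1 P0 f" using exT by blast
   have "be x f = Ph x C" using extensional_restrict[OF mHomD(2)[OF f(1)]] f(2) by (simp add: be_def)
   then show "Ph x C = \<zero>\<^bsub>?KT\<^esub> C" using bz[OF x mHomD(1)[OF f(1)]] C by simp
  qed simp
  then show "Ph x = zero_map N ?KT x" using x by (simp add: zero_map_def)
 qed
 then show ?thesis using zm by blast
qed

text \<open>The presentation produced is the one selected inside \<open>AR_translate\<close>. It has
  to be exposed together with its minimality, so that it can be compared with other
  presentations.\<close>

lemma tau_rigid_iff_lifts:
 fixes M :: "('a, 'm) module"
 assumes M: "fdm M"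
 obtains P1 P0 :: "('k, 'a) smod" and d e where "presents P1 d P0 e M"
  "superfluous A P0 (ker_of P0 M e)" "superfluous A P1 (ker_of P1 P0 d)"
  "tau_rigid K A M \<longleftrightarrow> lifts d P1 P0 M"
proof -
 define r where "r = (SOME r. min_proj_presentation K A M (r :: ('k, 'a) smod \<times> _))"
 have "EX r. min_proj_presentation K A M (r :: ('k, 'a) smod \<times> _)"
  by (rule min_presentation_exists[OF M]) (rule exI)
 then have r1: "min_proj_presentation K A M r" unfolding r_def by (rule someI_ex)
 obtain P1 d P0 e where r: "r = (P1, d, P0, e)" by (cases r) auto
 have AR: "AR_translate K A M = K_dual K A (transpose_of A P1 d P0)"
  unfolding AR_translate_def r_def[symmetric] r by simp
 note m = min_presentationD[OF r1[unfolded r] fdD(1)[OF M]]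
 have "tau_rigid K A M \<longleftrightarrow> lifts d P1 P0 M"
  unfolding tau_rigid_def AR
  using tau_rigid_imp_lifts[OF m(1) M] lifts_imp_tau_rigid[OF m(1) fdD(1)[OF M]] M by blast
 then show ?thesis by (rule that[OF m])
qed

end

section \<open>Counting modules with orthogonal presentations\<close>

text \<open>Gaussian elimination by induction on the equations. The coefficients are real because
  they will be differences of dimensions, independently of the characteristic of K.\<close>

lemma homogeneous_system_nontrivial:
 fixes a :: "'j => 'c => real"
 assumes "finite C" "finite J" "card C < card J"
 shows "EX c. (EX j:J. c j ~= 0) & (ALL k:C. (\<Sum>j\<in>J. c j * a j k) = 0)"
 using assms
proof (induction C arbitrary: J a)
 case empty
 then have "J ~= {}" by auto
 then show ?case by (intro exI[of _ "%_. 1"]) auto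
next
 case (insert k C)
 show ?case
 proof (cases "ALL j:J. a j k = 0")
  case True
  have "card C < card J" using insert by simp
  from insert.IH[OF insert.prems(1) this, of a] obtain c where
   c: "EX j:J. c j ~= 0" "ALL k:C. (\<Sum>j\<in>J. c j * a j k) = 0" by blast
  have "(\<Sum>j\<in>J. c j * a j k) = 0" using True by simp
  then show ?thesis using c by blast
 next
  case False
  then obtain j0 where j0: "j0 : J" "a j0 k ~= 0" by blast
  let ?J = "J - {j0}"
  have "finite ?J" "card C < card ?J" using insert j0 by simp_all
  from insert.IH[OF this, of "%j l. a j l - a j k / a j0 k * a j0 l"] obtain c where
   c: "EX j:?J. c j ~= 0" "ALL l:C. (\<Sum>j\<in>?J. c j * (a j l - a j k / a j0 k * a j0 l)) = 0" by blast
  define s where "s = (\<Sum>j\<in>?J. c j * a j k)"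
  \<comment> \<open>The pivot unknown j0 is eliminated by solving equation k for it; the remaining
    equations then reduce to those solved by c.\<close>
  define c' where "c' j = (if j = j0 then - s / a j0 k else c j)" for j
  have split: "(\<Sum>j\<in>J. c' j * a j l) = - s / a j0 k * a j0 l + (\<Sum>j\<in>?J. c j * a j l)" for l
  proof -
   have "(\<Sum>j\<in>J. c' j * a j l) = c' j0 * a j0 l + (\<Sum>j\<in>?J. c' j * a j l)"
    by (rule sum.remove[OF insert.prems(1) j0(1)])
   moreover have "(\<Sum>j\<in>?J. c' j * a j l) = (\<Sum>j\<in>?J. c j * a j l)" by (rule sum.cong) (auto simp: c'_def)
   ultimately show ?thesis by (simp add: c'_def)
  qed
  have "(\<Sum>j\<in>J. c' j * a j l) = 0" if l: "l : insert k C" for l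
  proof (cases "l = k")
   case True
   then show ?thesis using split[of k] j0(2) by (simp add: s_def)
  next
   case False
   then have "(\<Sum>j\<in>?J. c j * (a j l - a j k / a j0 k * a j0 l)) = 0" using c(2) l by blast
   moreover have "(\<Sum>j\<in>?J. c j * (a j l - a j k / a j0 k * a j0 l))
     = (\<Sum>j\<in>?J. c j * a j l) - s / a j0 k * a j0 l"
    by (simp add: s_def algebra_simps sum_subtractf sum_distrib_left sum_divide_distrib)
   ultimately show ?thesis using split[of l] by simp
  qed
  moreover have "EX j:J. c' j ~= 0" using c(1) by (auto simp: c'_def)
  ultimately show ?thesis by blast
 qed
qed

context kalg
begin

abbreviation "hdim P N \<equiv> vdim K (HomK P N)"

lemma hom_space_sub: "(HomK P N)(|carrier := mod_Hom A P (N(|carrier := U|))|) = HomK P (N(|carrier := U|))"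
 by (simp add: HomK_def restrict_scalars_def direct_sum_def)

lemma post_comp_linear:
 assumes P: "lmod P" and N: "lmod N" and L: "lmod L" and q: "q : Hom N L"
 shows "(%f. \<lambda>x\<in>car P. q (f x)) : module_hom K (HomK P N) (HomK P L)"
proof (rule homI)
 fix f assume "f : car (HomK P N)"
 then have f: "f : mod_Hom A P N" by simp
 show "(\<lambda>x\<in>car P. q (f x)) : car (HomK P L)"
  using hom_res[OF P hcomp[OF mHomD(1)[OF f] q]] by simp
 note f' = homD(1)[OF mHomD(1)[OF f]]
 fix g assume "g : car (HomK P N)"
 then have g: "g : mod_Hom A P N" by simp
 note g' = homD(1)[OF mHomD(1)[OF g]]
 show "(\<lambda>x\<in>car P. q ((f \<oplus>\<^bsub>HomK P N\<^esub> g) x)) =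
  (\<lambda>x\<in>car P. q (f x)) \<oplus>\<^bsub>HomK P L\<^esub> (\<lambda>x\<in>car P. q (g x))"
  unfolding hom_space_simps by (rule restrict_ext) (simp add: f' g' homD(2)[OF q])
next
 fix c f assume c: "c : car K" and "f : car (HomK P N)"
 then have f: "f : mod_Hom A P N" by simp
 note f' = homD(1)[OF mHomD(1)[OF f]]
 show "(\<lambda>x\<in>car P. q ((c \<odot>\<^bsub>HomK P N\<^esub> f) x)) = c \<odot>\<^bsub>HomK P L\<^esub> (\<lambda>x\<in>car P. q (f x))"
  unfolding hom_space_simps by (rule restrict_ext) (simp add: f' homD(3)[OF q] scal_closed[OF c])
qed

lemma pre_comp_linear:
 assumes P1: "lmod P1" and P0: "lmod P0" and N: "lmod N" and d: "d : Hom P1 P0"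
 shows "(%f. \<lambda>x\<in>car P1. f (d x)) : module_hom K (HomK P0 N) (HomK P1 N)"
proof (rule homI)
 note d' = homD(1)[OF d]
 fix f assume "f : car (HomK P0 N)"
 then have f: "f : mod_Hom A P0 N" by simp
 show "(\<lambda>x\<in>car P1. f (d x)) : car (HomK P1 N)"
  using hom_res[OF P1 hcomp[OF d mHomD(1)[OF f]]] by simp
 fix g
 show "(\<lambda>x\<in>car P1. (f \<oplus>\<^bsub>HomK P0 N\<^esub> g) (d x)) =
  (\<lambda>x\<in>car P1. f (d x)) \<oplus>\<^bsub>HomK P1 N\<^esub> (\<lambda>x\<in>car P1. g (d x))"
  unfolding hom_space_simps by (rule restrict_ext) (simp add: d')
next
 fix c f
 show "(\<lambda>x\<in>car P1. (c \<odot>\<^bsub>HomK P0 N\<^esub> f) (d x)) = c \<odot>\<^bsub>HomK P1 N\<^esub> (\<lambda>x\<in>car P1. f (d x))"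
  unfolding hom_space_simps by (rule restrict_ext) (simp add: homD(1)[OF d])
qed

text \<open>Rank-nullity for Hom(P, q): it is onto because P is projective, and its kernel consists
  of the maps into ker q.\<close>

lemma hdim_exact:
 fixes P :: "('a, 'p) module" and N :: "('a, 'n) module" and L :: "('a, 'l) module"
 assumes P: "proj P" and N: "fdm N" and L: "fdm L"
  and q: "q : Hom N L" and surj: "q ` car N = car L"
 shows "hdim P N = hdim P (N(|carrier := ker_of N L q|)) + hdim P L"
proof -
 note lP = projD(2)[OF P] and lN = fdD(1)[OF N] and lL = fdD(1)[OF L]
 let ?T = "%f. \<lambda>x\<in>car P. q (f x)"
 note T = post_comp_linear[OF lP lN lL q]
 have im: "?T ` car (HomK P N) = car (HomK P L)"
 proof (rule equalityI)
  show "?T ` car (HomK P N) <= car (HomK P L)" using homD(1)[OF T] by (rule image_subsetI)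
  show "car (HomK P L) <= ?T ` car (HomK P N)"
  proof
   fix g assume "g : car (HomK P L)"
   then have g: "g : mod_Hom A P L" by simp
   obtain h where h: "h : Hom P N" "!!x. x : car P ==> q (h x) = g x"
    by (rule projective_lift[OF P N L q surj mHomD(1)[OF g]]) (rule that)
   have "g = ?T (restrict h (car P))"
    by (rule extensionalityI[OF mHomD(2)[OF g]]) (simp_all add: h(2))
   moreover have "restrict h (car P) : car (HomK P N)" using hom_res[OF lP h(1)] by simp
   ultimately show "g : ?T ` car (HomK P N)" by (rule image_eqI)
  qed
 qed
 have ker: "{f : car (HomK P N). ?T f = \<zero>\<^bsub>HomK P L\<^esub>} = mod_Hom A P (N(|carrier := ker_of N L q|))"
 proof (rule Collect_eqI[THEN trans[OF _ Collect_mem_eq]])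
  fix f
  show "(f : car (HomK P N) & ?T f = \<zero>\<^bsub>HomK P L\<^esub>) = (f : mod_Hom A P (N(|carrier := ker_of N L q|)))"
  proof
   assume a: "f : car (HomK P N) & ?T f = \<zero>\<^bsub>HomK P L\<^esub>"
   then have f: "f : mod_Hom A P N" by simp
   have "q (f x) = \<zero>\<^bsub>L\<^esub>" if "x : car P" for x
    using fun_cong[OF conjunct2[OF a], of x] that by (simp add: zero_map_def)
   then have "f : Hom P (N(|carrier := ker_of N L q|))"
    by (intro hom_into_sub[OF mHomD(1)[OF f]]) (simp add: homD(1)[OF mHomD(1)[OF f]])
   then show "f : mod_Hom A P (N(|carrier := ker_of N L q|))" using mHomD(2)[OF f] by (simp add: mod_Hom_def)
  next
   assume f: "f : mod_Hom A P (N(|carrier := ker_of N L q|))"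
   have f1: "f x : ker_of N L q" if "x : car P" for x using homD(1)[OF mHomD(1)[OF f] that] by simp
   have "f : Hom P N" by (rule hom_out_of_sub[OF mHomD(1)[OF f]]) simp
   then have "f : mod_Hom A P N" using mHomD(2)[OF f] by (simp add: mod_Hom_def)
   moreover have "?T f = \<zero>\<^bsub>HomK P L\<^esub>" unfolding hom_space_simps zero_map_def by (rule restrict_ext) (use f1 in simp)
   ultimately show "f : car (HomK P N) & ?T f = \<zero>\<^bsub>HomK P L\<^esub>" by simp
  qed
 qed
 have "(HomK P L)(|carrier := ?T ` car (HomK P N)|) = HomK P L" unfolding im by simp
 then show ?thesis
  using vdim_rank_nullity[OF fin_dim_hom_space[OF projD(1)[OF P] N] vectorspace_hom_space[OF lP lL] T]
  unfolding ker hom_space_sub by simp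
qed

lemma hdim_zero_module:
 assumes P: "proj P" and N: "fdm N" and z: "car N = {\<zero>\<^bsub>N\<^esub>}"
 shows "hdim P N = 0"
proof -
 have "{x : car N. x = \<zero>\<^bsub>N\<^esub>} = car N" using z by blast
 then have "N(|carrier := {x : car N. x = \<zero>\<^bsub>N\<^esub>}|) = N" by simp
 then show ?thesis using hdim_exact[OF P N N hom_id[OF fdD(1)[OF N]]] by simp
qed

lemma hdim_bij:
 fixes P :: "('a, 'p) module" and N :: "('a, 'n) module" and L :: "('a, 'l) module"
 assumes P: "proj P" and N: "fdm N" and L: "fdm L"
  and q: "q : Hom N L" and bij: "bij_betw q (car N) (car L)"
 shows "hdim P N = hdim P L"
proof -
 note lN = fdD(1)[OF N] and lL = fdD(1)[OF L]
 interpret N: left_module A N by (rule lN)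
 have "ker_of N L q = {\<zero>\<^bsub>N\<^esub>}"
  using inj_on_hom_iff[OF lN lL q] bij N.hom_zero[OF lL q] N.M.zero_closed by (auto simp: bij_betw_def)
 moreover have "hdim P (N(|carrier := {\<zero>\<^bsub>N\<^esub>}|)) = 0"
  by (rule hdim_zero_module[OF P fd_sub(1)[OF N submod_zero[OF lN]]]) simp
 ultimately show ?thesis using hdim_exact[OF P N L q] bij by (simp add: bij_betw_def)
qed

text \<open>Induction on the dimension through a proper nonzero submodule replaces composition
  series: an additive quantity is determined by its values on simple modules.\<close>

lemma additive_vanishes:
 fixes \<psi> :: "('k, 'a) smod => real"
 assumes add: "!!N L q. [|fdm N; fdm L; q : Hom N L; q ` car N = car L|] ==>
   \<psi> N = \<psi> (N(|carrier := ker_of N L q|)) + \<psi> L"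
  and simple: "!!S. simple_module K A S ==> \<psi> S = 0" and N: "fdm N"
 shows "\<psi> N = 0"
 using N
proof (induction "mdim N" arbitrary: N rule: less_induct)
 case less
 note N = less.prems and lN = fdD(1)[OF less.prems]
 consider "car N = {\<zero>\<^bsub>N\<^esub>}" | "simple_module K A N"
  | U where "submod A N U" "U ~= {\<zero>\<^bsub>N\<^esub>}" "U ~= car N"
  using N unfolding simple_module_def by blast
 then show ?case
 proof cases
  case 1
  \<comment> \<open>For the zero module, additivity along the identity reads psi N = psi N + psi
    N.\<close>
  have "{x : car N. x = \<zero>\<^bsub>N\<^esub>} = car N" using 1 by blast
  then have "N(|carrier := {x : car N. x = \<zero>\<^bsub>N\<^esub>}|) = N" by simp
  then show ?thesis using add[OF N N hom_id[OF lN]] by simp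
 next
  case 2
  then show ?thesis by (rule simple)
 next
  case 3
  obtain L :: "('k, 'a) smod" and q where L: "fdm L" and q: "q : Hom N L"
   and surj: "q ` car N = car L" and ker: "ker_of N L q = U"
   by (rule quotient_exists[OF N 3(1)]) (rule that)
  have fU: "fdm (N(|carrier := U|))" by (rule fd_sub(1)[OF N 3(1)])
  have "mdim (N(|carrier := U|)) ~= mdim N" using fd_sub(3)[OF N 3(1)] 3(3) by blast
  then have ltU: "mdim (N(|carrier := U|)) < mdim N" using fd_sub(2)[OF N 3(1)] by simp
  have "mdim (N(|carrier := U|)) ~= 0" using mdim_zero[OF fU] 3(2) by simp
  then have ltL: "mdim L < mdim N" using mdim_rank_nullity[OF N fdD(1)[OF L] q] surj ker by simp
  show ?thesis using add[OF N L q surj] less.hyps[OF ltU fU] less.hyps[OF ltL L] ker by simp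
 qed
qed

text \<open>As P1 is projective, a map into the quotient comes from a map into N, which extends over
  P0.\<close>

lemma lifts_quotient:
 fixes P1 P0 :: "('a, 'p) module" and N :: "('a, 'n) module" and L :: "('a, 'l) module"
 assumes p: "presents P1 d P0 e T" and l: "lifts d P1 P0 N" and N: "fdm N" and L: "fdm L"
  and q: "q : Hom N L" and surj: "q ` car N = car L"
 shows "lifts d P1 P0 L"
 unfolding lifts_def
proof
 note pd = presD[OF p]
 fix g assume g: "g : Hom P1 L"
 obtain g' where g': "g' : Hom P1 N" "!!x. x : car P1 ==> q (g' x) = g x"
  by (rule projective_lift[OF pd(1) N L q surj g]) (rule that)
 obtain h where h: "h : Hom P0 N" "!!x. x : car P1 ==> h (d x) = g' x"
  by (rule liftsE[OF l g'(1)]) (rule that)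
 show "EX h:Hom P0 L. ALL x:car P1. h (d x) = g x"
  by (rule bexI[OF ballI hcomp[OF h(1) q]]) (simp add: h(2) g'(2))
qed

text \<open>Extend q g over P0, lift the extension to N, and correct it by the difference on P1,
  which takes values in ker q.\<close>

lemma lifts_extension:
 fixes P1 P0 :: "('a, 'p) module" and N :: "('a, 'n) module" and L :: "('a, 'l) module"
 assumes p: "presents P1 d P0 e T" and N: "fdm N" and L: "fdm L"
  and q: "q : Hom N L" and surj: "q ` car N = car L"
  and l1: "lifts d P1 P0 (N(|carrier := ker_of N L q|))" and l2: "lifts d P1 P0 L"
 shows "lifts d P1 P0 N"
 unfolding lifts_def
proof
 note pd = presD[OF p] and lN = fdD(1)[OF N] and lL = fdD(1)[OF L]
 interpret N: left_module A N by (rule lN)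
 interpret L: left_module A L by (rule lL)
 fix g assume g: "g : Hom P1 N"
 obtain k where k: "k : Hom P0 L" "!!x. x : car P1 ==> k (d x) = q (g x)"
  by (rule liftsE[OF l2 hcomp[OF g q]]) (rule that)
 obtain h where h: "h : Hom P0 N" "!!x. x : car P0 ==> q (h x) = k x"
  by (rule projective_lift[OF pd(2) N L q surj k(1)]) (rule that)
 note cl = homD(1)[OF g] homD(1)[OF pd(6)] homD(1)[OF h(1)] homD(1)[OF q]
 have "(%x. g x \<ominus>\<^bsub>N\<^esub> h (d x)) : Hom P1 (N(|carrier := ker_of N L q|))"
  by (rule hom_into_sub[OF hom_diff[OF lN g hcomp[OF pd(6) h(1)]]])
   (simp add: cl N.hom_minus[OF lL q] h(2) k(2) L.M.minus_eq_zero_iff)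
 then obtain j where j: "j : Hom P0 (N(|carrier := ker_of N L q|))" "!!x. x : car P1 ==> j (d x) = g x \<ominus>\<^bsub>N\<^esub> h (d x)"
  by (rule liftsE[OF l1]) (rule that)
 have jN: "j : Hom P0 N" by (rule hom_out_of_sub[OF j(1)]) simp
 show "EX h:Hom P0 N. ALL x:car P1. h (d x) = g x"
  by (rule bexI[OF ballI hom_add[OF lN jN h(1)]]) (simp add: j(2) cl N.M.minus_add_cancel)
qed

lemma lifts_biprod:
 assumes b: "biprod S M N i1 i2 p1 p2" and l1: "lifts d P1 P0 M" and l2: "lifts d P1 P0 N"
 shows "lifts d P1 P0 S"
 unfolding lifts_def
proof
 note bd = biprodD[OF b]
 fix g assume g: "g : Hom P1 S"
 obtain h where h: "h : Hom P0 M" "!!x. x : car P1 ==> h (d x) = p1 (g x)"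
  by (rule liftsE[OF l1 hcomp[OF g bd(6)]]) (rule that)
 obtain k where k: "k : Hom P0 N" "!!x. x : car P1 ==> k (d x) = p2 (g x)"
  by (rule liftsE[OF l2 hcomp[OF g bd(7)]]) (rule that)
 show "EX h:Hom P0 S. ALL x:car P1. h (d x) = g x"
  by (rule bexI[OF ballI hom_add[OF bd(1) hcomp[OF h(1) bd(4)] hcomp[OF k(1) bd(5)]]])
   (simp add: h(2) k(2) bd(12)[OF homD(1)[OF g]])
qed

lemma lifts_zero_module:
 assumes N: "lmod N" and z: "car N = {\<zero>\<^bsub>N\<^esub>}"
 shows "lifts d P1 P0 N"
 unfolding lifts_def
proof
 fix g assume g: "g : Hom P1 N"
 have "g x = \<zero>\<^bsub>N\<^esub>" if "x : car P1" for x using homD(1)[OF g that] z by simp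
 then show "EX h:Hom P0 N. ALL x:car P1. h (d x) = g x"
  by (intro bexI[OF _ hom_zero_map[OF N]]) simp
qed

text \<open>The assumption on ker q does the work of Ext^1(T, ker q) = 0. A lift w0 of u e to P0
  maps the image of d into ker q; extending this restriction to v on P0 and subtracting it makes w0
  - v descend to T.\<close>

lemma lifts_hom_lift:
 fixes P1 P0 :: "('a, 'p) module" and T :: "('a, 't) module" and N :: "('a, 'n) module" and L :: "('a, 'l) module"
 assumes p: "presents P1 d P0 e T" and N: "fdm N" and L: "fdm L"
  and q: "q : Hom N L" and surj: "q ` car N = car L"
  and l: "lifts d P1 P0 (N(|carrier := ker_of N L q|))" and u: "u : Hom T L"
 obtains w where "w : Hom T N" "!!x. x : car T ==> q (w x) = u x"
proof -
 note pd = presD[OF p] and lN = fdD(1)[OF N] and lL = fdD(1)[OF L]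
 interpret N: left_module A N by (rule lN)
 interpret L: left_module A L by (rule lL)
 interpret T: left_module A T by (rule pd(3))
 obtain w0 where w0: "w0 : Hom P0 N" "!!x. x : car P0 ==> q (w0 x) = u (e x)"
  by (rule projective_lift[OF pd(2) N L q surj hcomp[OF pd(4) u]]) (rule that)
 note cl = homD(1)[OF pd(6)] homD(1)[OF w0(1)]
 have "(%x. w0 (d x)) : Hom P1 (N(|carrier := ker_of N L q|))"
  by (rule hom_into_sub[OF hcomp[OF pd(6) w0(1)]])
   (simp add: cl w0(2) presD2(2)[OF p] T.hom_zero[OF lL u])
 then obtain v where v: "v : Hom P0 (N(|carrier := ker_of N L q|))" "!!x. x : car P1 ==> v (d x) = w0 (d x)"
  by (rule liftsE[OF l]) (rule that)
 have vN: "v : Hom P0 N" by (rule hom_out_of_sub[OF v(1)]) simp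
 have qv: "q (v x) = \<zero>\<^bsub>L\<^esub>" if "x : car P0" for x using homD(1)[OF v(1) that] by simp
 obtain w where w: "w : Hom T N" "!!x. x : car P0 ==> w (e x) = w0 x \<ominus>\<^bsub>N\<^esub> v x"
  by (rule presents_factor[OF p lN hom_diff[OF lN w0(1) vN]])
   (simp add: v(2) cl N.M.minus_eq_zero_iff, rule that)
 show ?thesis
 proof (rule that[OF w(1)])
  fix y assume "y : car T"
  then obtain x where x: "x : car P0" "y = e x" using pd(5) by blast
  have "q (w y) = q (w0 x) \<ominus>\<^bsub>L\<^esub> q (v x)"
   using w(2)[OF x(1)] x(2) N.hom_minus[OF lL q homD(1)[OF w0(1) x(1)] homD(1)[OF vN x(1)]] by simp
  then show "q (w y) = u y"
   using qv[OF x(1)] w0(2)[OF x(1)] x(2) homD(1)[OF u homD(1)[OF pd(4) x(1)]] by (simp add: a_minus_def)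
 qed
qed

text \<open>The kernel of Hom(d, N) is Hom(T, N), and its cokernel is zero exactly under
  \<open>lifts\<close>. Hence the difference of the two dimensions is dim Hom(T, N) minus the
  dimension of the cokernel; the three claims are the cases in which at most one of these is
  nonzero.\<close>

lemma hdim_compare:
 fixes P1 P0 :: "('a, 'p) module" and T :: "('a, 't) module" and N :: "('a, 'n) module"
 assumes p: "presents P1 d P0 e T" and N: "fdm N"
 shows "lifts d P1 P0 N ==> (!!u x. u : Hom T N ==> x : car T ==> u x = \<zero>\<^bsub>N\<^esub>) ==> hdim P0 N = hdim P1 N"
  and "lifts d P1 P0 N ==> u : Hom T N ==> y : car T ==> u y ~= \<zero>\<^bsub>N\<^esub> ==> hdim P0 N ~= hdim P1 N"
  and "\<not> lifts d P1 P0 N ==> (!!u x. u : Hom T N ==> x : car T ==> u x = \<zero>\<^bsub>N\<^esub>) ==> hdim P0 N ~= hdim P1 N"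
proof -
 note pd = presD[OF p] and lN = fdD(1)[OF N]
 note lP1 = projD(2)[OF pd(1)] and lP0 = projD(2)[OF pd(2)]
 interpret T: left_module A T by (rule pd(3))
 let ?D = "%f. \<lambda>x\<in>car P1. f (d x)"
 note D = pre_comp_linear[OF lP1 lP0 lN pd(6)]
 have fd1: "fin_dim_space K (HomK P1 N)" by (rule fin_dim_hom_space[OF projD(1)[OF pd(1)] N])
 have fd0: "fin_dim_space K (HomK P0 N)" by (rule fin_dim_hom_space[OF projD(1)[OF pd(2)] N])
 interpret LM: linear_map K "HomK P0 N" "HomK P1 N" ?D
  by (rule linear_mapI[OF fdsD(1)[OF fd0] fdsD(1)[OF fd1] D])
 let ?I = "(HomK P1 N)(|carrier := ?D ` car (HomK P0 N)|)"
 let ?Z = "(HomK P0 N)(|carrier := {f : car (HomK P0 N). ?D f = \<zero>\<^bsub>HomK P1 N\<^esub>}|)"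
 have rn: "hdim P0 N = vdim K ?I + vdim K ?Z" by (rule vdim_rank_nullity[OF fd0 fdsD(1)[OF fd1] D])
 have sI: "subspace K (?D ` car (HomK P0 N)) (HomK P1 N)" using LM.imT_is_subspace unfolding LM.im_def .
 have sZ: "subspace K {f : car (HomK P0 N). ?D f = \<zero>\<^bsub>HomK P1 N\<^esub>} (HomK P0 N)"
  using LM.kerT_is_subspace unfolding LM.ker_def .
 have fZ: "fin_dim_space K ?Z" by (rule fin_dim_space_subspace(1)[OF fd0 sZ])
 have surj: "lifts d P1 P0 N \<longleftrightarrow> ?D ` car (HomK P0 N) = car (HomK P1 N)"
 proof
  assume l: "lifts d P1 P0 N"
  show "?D ` car (HomK P0 N) = car (HomK P1 N)"
  proof (rule equalityI)
   show "?D ` car (HomK P0 N) <= car (HomK P1 N)" using homD(1)[OF D] by (rule image_subsetI)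
   show "car (HomK P1 N) <= ?D ` car (HomK P0 N)"
   proof
    fix g assume "g : car (HomK P1 N)"
    then have g: "g : mod_Hom A P1 N" by simp
    obtain h where h: "h : Hom P0 N" "!!x. x : car P1 ==> h (d x) = g x"
     by (rule liftsE[OF l mHomD(1)[OF g]]) (rule that)
    have "g = ?D (restrict h (car P0))"
     by (rule extensionalityI[OF mHomD(2)[OF g]]) (simp_all add: h(2) homD(1)[OF pd(6)])
    moreover have "restrict h (car P0) : car (HomK P0 N)" using hom_res[OF lP0 h(1)] by simp
    ultimately show "g : ?D ` car (HomK P0 N)" by (rule image_eqI)
   qed
  qed
 next
  assume eq: "?D ` car (HomK P0 N) = car (HomK P1 N)"
  show "lifts d P1 P0 N" unfolding lifts_def
  proof
   fix g assume g: "g : Hom P1 N"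
   have "restrict g (car P1) : ?D ` car (HomK P0 N)" unfolding eq using hom_res[OF lP1 g] by simp
   then obtain h where h: "h : mod_Hom A P0 N" "restrict g (car P1) = ?D h" by auto
   have "h (d x) = g x" if "x : car P1" for x using fun_cong[OF h(2), of x] that by simp
   then show "EX h:Hom P0 N. ALL x:car P1. h (d x) = g x" using mHomD(1)[OF h(1)] by blast
  qed
 qed
 have kerz: "vdim K ?Z = 0" if hz: "!!u x. u : Hom T N ==> x : car T ==> u x = \<zero>\<^bsub>N\<^esub>"
 proof -
  have "f = \<zero>\<^bsub>HomK P0 N\<^esub>" if f: "f : mod_Hom A P0 N" "?D f = \<zero>\<^bsub>HomK P1 N\<^esub>" for f
  proof -
   have fd: "f (d x) = \<zero>\<^bsub>N\<^esub>" if "x : car P1" for x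
    using fun_cong[OF f(2), of x] that by (simp add: zero_map_def)
   obtain k where k: "k : Hom T N" "!!x. x : car P0 ==> k (e x) = f x"
    by (rule presents_factor[OF p lN mHomD(1)[OF f(1)] fd]) (assumption, rule that)
   show ?thesis
    by (rule extensionalityI[OF mHomD(2)[OF f(1)]])
     (simp_all add: zero_map_def k(2)[symmetric] hz[OF k(1)] homD(1)[OF pd(4)])
  qed
  then have "car ?Z = {\<zero>\<^bsub>?Z\<^esub>}" using subspace.submod[OF sZ] by (auto simp: LinearCombinations.submodule_def)
  then show ?thesis using vdim_zero[OF fZ] by simp
 qed
 show "hdim P0 N = hdim P1 N"
  if "lifts d P1 P0 N" "!!u x. u : Hom T N ==> x : car T ==> u x = \<zero>\<^bsub>N\<^esub>"
 proof -
  have "vdim K ?Z = 0" by (rule kerz) (rule that(2))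
  moreover have "?I = HomK P1 N" using that(1) unfolding surj by simp
  ultimately show ?thesis using rn by simp
 qed
 show "hdim P0 N ~= hdim P1 N"
  if "lifts d P1 P0 N" and u: "u : Hom T N" "y : car T" "u y ~= \<zero>\<^bsub>N\<^esub>"
 proof -
  have I: "?I = HomK P1 N" using that(1) unfolding surj by simp
  let ?f = "\<lambda>x\<in>car P0. u (e x)"
  have f: "?f : mod_Hom A P0 N" by (rule hom_res[OF lP0 hcomp[OF pd(4) u(1)]])
  obtain x where x: "x : car P0" "y = e x" using u(2) pd(5) by blast
  have "?D ?f = \<zero>\<^bsub>HomK P1 N\<^esub>"
   unfolding hom_space_simps zero_map_def
   by (rule restrict_ext) (simp add: homD(1)[OF pd(6)] presD2(2)[OF p] T.hom_zero[OF lN u(1)])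
  then have "?f : car ?Z" using f by simp
  moreover have "?f ~= \<zero>\<^bsub>?Z\<^esub>"
  proof
   assume "?f = \<zero>\<^bsub>?Z\<^esub>"
   then have "?f x = zero_map P0 N x" by simp
   then show False using x u(3) by (simp add: zero_map_def)
  qed
  ultimately have "vdim K ?Z ~= 0" using vdim_zero[OF fZ] by blast
  then show ?thesis using rn I by simp
 qed
 show "hdim P0 N ~= hdim P1 N"
  if "\<not> lifts d P1 P0 N" "!!u x. u : Hom T N ==> x : car T ==> u x = \<zero>\<^bsub>N\<^esub>"
 proof
  assume "hdim P0 N = hdim P1 N"
  moreover have "vdim K ?Z = 0" by (rule kerz) (rule that(2))
  ultimately have "vdim K ?I = hdim P1 N" using rn by simp
  then have "?D ` car (HomK P0 N) = car (HomK P1 N)" by (rule fin_dim_space_subspace(3)[OF fd1 sI])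
  then show False using that(1) surj by blast
 qed
qed

end

text \<open>Inserting i1 p1 + i2 p2 = id between u and v writes a bijection as a sum of two
  endomorphisms of an indecomposable module, one of which must be bijective.\<close>

lemma (in kalg) indecomposable_split_biprod:
 assumes M: "indecomposable K A M" and b: "biprod S N L i1 i2 p1 p2"
  and u: "u : module_hom A M S" and v: "v : module_hom A S M"
  and bij: "bij_betw (%x. v (u x)) (car M) (car M)"
 shows "bij_betw (%x. v (i1 (p1 (u x)))) (car M) (car M) \<or> bij_betw (%x. v (i2 (p2 (u x)))) (car M) (car M)"
proof -
 note bd = biprodD[OF b]
 let ?a = "%x. v (i1 (p1 (u x)))" and ?b = "%x. v (i2 (p2 (u x)))"
 have eq: "v (u x) = ?a x \<oplus>\<^bsub>M\<^esub> ?b x" if "x : car M" for x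
 proof -
  note ux = homD(1)[OF u that]
  have "v (u x) = v (i1 (p1 (u x)) \<oplus>\<^bsub>S\<^esub> i2 (p2 (u x)))" by (simp only: bd(12)[OF ux])
  then show ?thesis
   using homD(2)[OF v] homD(1)[OF bd(4)] homD(1)[OF bd(5)] homD(1)[OF bd(6) ux]
    homD(1)[OF bd(7) ux] by simp
 qed
 have "bij_betw (%x. ?a x \<oplus>\<^bsub>M\<^esub> ?b x) (car M) (car M)"
  using bij by (subst (asm) bij_betw_cong[OF eq]) simp_all
 from indecomposable_local[OF M _ _ this]
 show "bij_betw ?a (car M) (car M) \<or> bij_betw ?b (car M) (car M)"
  using hcomp[OF hcomp[OF hcomp[OF u bd(6)] bd(4)] v] hcomp[OF hcomp[OF hcomp[OF u bd(7)] bd(5)] v]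
  by blast
qed

text \<open>The index set is abstract because it will be a disjoint sum of indices of X and indices
  of Y.\<close>

locale presented_family = kalg K A for K :: "'k ring" and A :: "('k, 'a) module" +
 fixes J :: "'j set" and T :: "'j => ('k, 'a) smod"
  and P1 P0 :: "'j => ('a, 'p) module" and d e
 assumes finJ: "finite J" and indec_T: "j : J ==> indecomposable K A (T j)"
  and noniso: "i : J ==> j : J ==> i ~= j ==> \<not> mod_iso A (T i) (T j)"
  and pres: "j : J ==> presents (P1 j) (d j) (P0 j) (e j) (T j)"
  and lift: "i : J ==> j : J ==> lifts (d j) (P1 j) (P0 j) (T i)"
begin

text \<open>For minimal presentations these are the modules N with Hom(N, tau T_j) = 0 for all j, a
  torsion class: closed under quotients and extensions. It contains all T_j by
  orthogonality.\<close>

definition torsion :: "('a, 'm) module => bool" where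
 "torsion N \<longleftrightarrow> (ALL j:J. lifts (d j) (P1 j) (P0 j) N)"

text \<open>For torsion modules, \<open>avoids i\<close> says that \<open>T i\<close> is not a direct summand.\<close>

definition avoids :: "'j => ('k, 'a) smod => bool" where
 "avoids i E \<longleftrightarrow> fdm E & torsion E &
  (ALL u:Hom (T i) E. ALL v:Hom E (T i).
   \<not> bij_betw (%x. v (u x)) (car (T i)) (car (T i)))"

lemma avoidsD:
 assumes "avoids i E" "u : Hom (T i) E" "v : Hom E (T i)"
 shows "\<not> bij_betw (%x. v (u x)) (car (T i)) (car (T i))"
 using assms unfolding avoids_def by blast

lemma torsion_quotient:
 fixes N :: "('a, 'n) module" and L :: "('a, 'l) module"
 assumes "torsion N" "fdm N" "fdm L" "q : Hom N L" "q ` car N = car L"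
 shows "torsion L"
 unfolding torsion_def
proof
 fix j assume j: "j : J"
 show "lifts (d j) (P1 j) (P0 j) L"
  by (rule lifts_quotient[OF pres[OF j] _ assms(2-5)]) (use assms(1) j in \<open>simp add: torsion_def\<close>)
qed

text \<open>By locality of the endomorphism ring, T i splitting off a direct sum would split off one
  of the two summands.\<close>

lemma avoids_biprod:
 assumes i: "i : J" and E: "avoids i E" and E': "avoids i E'" and S: "fdm S"
  and b: "biprod S E E' i1 i2 p1 p2"
 shows "avoids i S"
 unfolding avoids_def
proof (intro conjI ballI notI)
 note bd = biprodD[OF b]
 show "fdm S" by (rule S)
 show "torsion S" unfolding torsion_def
 proof
  fix j assume j: "j : J"
  show "lifts (d j) (P1 j) (P0 j) S"
   by (rule lifts_biprod[OF b]) (use E E' j in \<open>simp_all add: avoids_def torsion_def\<close>)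
 qed
 fix u v assume u: "u : Hom (T i) S" and v: "v : Hom S (T i)"
  and bij: "bij_betw (%x. v (u x)) (car (T i)) (car (T i))"
 let ?a = "%x. v (i1 (p1 (u x)))" and ?b = "%x. v (i2 (p2 (u x)))"
 have "bij_betw ?a (car (T i)) (car (T i)) \<or> bij_betw ?b (car (T i)) (car (T i))"
  by (rule indecomposable_split_biprod[OF indec_T[OF i] b u v, OF bij])
 then show False
 proof
  assume "bij_betw ?a (car (T i)) (car (T i))"
  then show False using avoidsD[OF E hcomp[OF u bd(6)] hcomp[OF bd(4) v]] by simp
 next
  assume "bij_betw ?b (car (T i)) (car (T i))"
  then show False using avoidsD[OF E' hcomp[OF u bd(7)] hcomp[OF bd(5) v]] by simp
 qed
qed

text \<open>A split monomorphism from T i into the indecomposable T j is an isomorphism, which is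
  excluded for j different from i.\<close>

lemma avoids_member:
 assumes i: "i : J" and j: "j : J" "j ~= i"
 shows "avoids i (T j)"
 unfolding avoids_def
proof (intro conjI ballI notI)
 note iD = indecD[OF indec_T[OF i]]
 show "fdm (T j)" by (rule indecD(1)[OF indec_T[OF j(1)]])
 show "torsion (T j)" using lift[OF j(1)] by (simp add: torsion_def)
 fix u v assume u: "u : Hom (T i) (T j)" and v: "v : Hom (T j) (T i)"
  and bij: "bij_betw (%x. v (u x)) (car (T i)) (car (T i))"
 have b: "bij_betw u (car (T i)) (car (T j))"
  by (rule split_mono_indecomposable[OF iD(2) _ indec_T[OF j(1)] u v]) (use indec_T[OF i] bij in \<open>simp_all add: indecomposable_def\<close>)
 have "mod_iso A (T i) (T j)" unfolding mod_iso_def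
 proof (rule bexI[OF _ hom_res[OF iD(2) u]])
  show "bij_betw (\<lambda>x\<in>car (T i). u x) (car (T i)) (car (T j))" using b by (subst bij_betw_restrict_eq)
 qed
 then show False using noniso[OF i j(1)] j(2) by blast
qed

text \<open>Starting from the zero module, one copy of T j is added to E for each listed map h, and
  f is h on that copy.\<close>

lemma approximation_finite:
 assumes i: "i : J" and "finite H" and "!!j h. (j, h) : H ==> j : J - {i} & h : Hom (T j) (T i)"
 shows "EX E f. avoids i E & f : Hom E (T i) &
  (ALL (j, h):H. EX g:Hom (T j) E. ALL x:car (T j). f (g x) = h x)"
 using assms(2,3)
proof (induction H)
 case empty
 note iD = indecD[OF indec_T[OF i]]
 interpret Ti: left_module A "T i" by (rule iD(2))
 let ?Z = "(T i)(|carrier := {\<zero>\<^bsub>T i\<^esub>}|)"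
 have Z: "fdm ?Z" by (rule fd_sub(1)[OF iD(1) submod_zero[OF iD(2)]])
 have "avoids i ?Z" unfolding avoids_def
 proof (intro conjI ballI notI)
  show "torsion ?Z" unfolding torsion_def by (intro ballI lifts_zero_module[OF fdD(1)[OF Z]]) simp
  fix u v assume u: "u : Hom (T i) ?Z" and v: "v : Hom ?Z (T i)"
   and bij: "bij_betw (%x. v (u x)) (car (T i)) (car (T i))"
  have uz: "u x = \<zero>\<^bsub>T i\<^esub>" if "x : car (T i)" for x using homD(1)[OF u that] by simp
  have "x = \<zero>\<^bsub>T i\<^esub>" if x: "x : car (T i)" for x
   by (rule inj_onD[OF bij_betw_imp_inj_on[OF bij]]) (simp_all add: uz x)
  then have "car (T i) = {\<zero>\<^bsub>T i\<^esub>}" by auto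
  then show False using indec_T[OF i] by (simp add: indecomposable_def)
 qed (rule Z)
 moreover have "id : Hom ?Z (T i)"
  by (rule homI) simp_all
 ultimately show ?case by blast
next
 case (insert p H)
 obtain j h where p: "p = (j, h)" by (cases p)
 have j: "j : J" "j ~= i" and h: "h : Hom (T j) (T i)" using insert.prems[of j h] p by auto
 have "EX E f. avoids i E & f : Hom E (T i) &
  (ALL (j, h):H. EX g:Hom (T j) E. ALL x:car (T j). f (g x) = h x)"
  by (rule insert.IH) (rule insert.prems, simp)
 then obtain E f where E: "avoids i E" and f: "f : Hom E (T i)"
  and H': "ALL (j, h):H. EX g:Hom (T j) E. ALL x:car (T j). f (g x) = h x" by blast
 have H: "EX g:Hom (T j) E. ALL x:car (T j). f (g x) = h x" if "(j, h) : H" for j h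
  using bspec[OF H' that] by simp
 note Tj = avoids_member[OF i j]
 note lT = indecD(2)[OF indec_T[OF i]]
 have fE: "fdm E" using E by (simp add: avoids_def)
 obtain S :: "('k, 'a) smod" and i1 i2 p1 p2 where S: "fdm S" and b: "biprod S E (T j) i1 i2 p1 p2"
  by (rule std_biprod[OF fE indecD(1)[OF indec_T[OF j(1)]]]) (rule that)
 obtain k where k: "k : Hom S (T i)" "!!x. x : car E ==> k (i1 x) = f x"
  "!!x. x : car (T j) ==> k (i2 x) = h x"
  by (rule biprod_copair[OF b lT f h]) (rule that)
 note bd = biprodD[OF b]
 have "EX g:Hom (T j') S. ALL x:car (T j'). k (g x) = h' x" if "(j', h') : insert p H" for j' h'
 proof (cases "(j', h') = p")
  case True
  then have [simp]: "j' = j" "h' = h" using p by auto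
  show ?thesis using bd(5) k(3) by auto
 next
  case False
  then have "(j', h') : H" using that by simp
  then obtain g where g: "g : Hom (T j') E" "ALL x:car (T j'). f (g x) = h' x" using H by blast
  show ?thesis by (rule bexI[OF ballI hcomp[OF g(1) bd(4)]]) (simp add: k(2) homD(1)[OF g(1)] g(2))
 qed
 then show ?case using avoids_biprod[OF i E Tj S b] k(1) by blast
qed

text \<open>This is a right approximation of T i by sums of the other T j. It is enough to factor a
  finite spanning set of each Hom space, since the maps that factor through f form a
  subspace.\<close>

lemma approximation:
 assumes i: "i : J"
 obtains E f where "avoids i E" "f : Hom E (T i)"
  "!!j h. j : J ==> j ~= i ==> h : Hom (T j) (T i) ==>
   EX g:Hom (T j) E. ALL x:car (T j). f (g x) = h x"
proof -
 let ?H = "%j. HomK (T j) (T i)"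
 have fT: "fdm (T j)" and lT: "lmod (T j)" if "j : J" for j
  using indecD(1,2)[OF indec_T[OF that]] by auto
 have "EX B. finite B & B <= car (?H j) & LinearCombinations.module.span K (?H j) B = car (?H j)"
  if j: "j : J" for j
 proof -
  have f: "fin_dim_space K (?H j)" by (rule fin_dim_hom_space[OF fT[OF j] fT[OF i]])
  interpret V: vectorspace K "?H j" by (rule fdsD(1)[OF f])
  show ?thesis using fdsD(2)[OF f] unfolding V.fin_dim_def by auto
 qed
 then obtain B where B: "!!j. j : J ==> finite (B j)" "!!j. j : J ==> B j <= car (?H j)"
  "!!j. j : J ==> LinearCombinations.module.span K (?H j) (B j) = car (?H j)" by metis
 have "finite (Sigma (J - {i}) B)" using finJ B(1) by auto
 moreover have "j : J - {i} & h : Hom (T j) (T i)" if "(j, h) : Sigma (J - {i}) B" for j h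
  using that B(2)[of j] by (auto simp: mod_Hom_def)
 ultimately obtain E f where E: "avoids i E" and f: "f : Hom E (T i)"
  and H: "ALL (j, h):Sigma (J - {i}) B. EX g:Hom (T j) E. ALL x:car (T j). f (g x) = h x"
  using approximation_finite[OF i, of "Sigma (J - {i}) B"] by blast
 have fE: "fdm E" using E by (simp add: avoids_def)
 show ?thesis
 proof (rule that[OF E f])
  fix j h assume j: "j : J" "j ~= i" and h: "h : Hom (T j) (T i)"
  let ?D = "%g. \<lambda>x\<in>car (T j). f (g x)"
  have fs: "fin_dim_space K (?H j)" "fin_dim_space K (HomK (T j) E)"
   by (rule fin_dim_hom_space[OF fT[OF j(1)] fT[OF i]], rule fin_dim_hom_space[OF fT[OF j(1)] fE])
  interpret V: vectorspace K "?H j" by (rule fdsD(1)[OF fs(1)])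
  interpret LM: linear_map K "HomK (T j) E" "?H j" ?D
   by (rule linear_mapI[OF fdsD(1)[OF fs(2)] fdsD(1)[OF fs(1)]
    post_comp_linear[OF lT[OF j(1)] fdD(1)[OF fE] lT[OF i] f]])
  have sub: "LinearCombinations.submodule K (?D ` car (HomK (T j) E)) (?H j)"
   using subspace.submod[OF LM.imT_is_subspace] unfolding LM.im_def .
  have "B j <= ?D ` car (HomK (T j) E)"
  proof
   fix b assume b: "b : B j"
   then obtain g where g: "g : Hom (T j) E" "ALL x:car (T j). f (g x) = b x" using H j by blast
   have "b : mod_Hom A (T j) (T i)" using B(2)[OF j(1)] b by auto
   then have "b = ?D (restrict g (car (T j)))"
    by (rule extensionalityI[OF mHomD(2)]) (simp_all add: g(2))
   then show "b : ?D ` car (HomK (T j) E)" using hom_res[OF lT[OF j(1)] g(1)] by (intro image_eqI) simp_all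
  qed
  from V.span_is_subset[OF this sub] have "car (?H j) <= ?D ` car (HomK (T j) E)" unfolding B(3)[OF j(1)] .
  then have "restrict h (car (T j)) : ?D ` car (HomK (T j) E)" using hom_res[OF lT[OF j(1)] h] by auto
  then obtain g where g: "g : mod_Hom A (T j) E" "restrict h (car (T j)) = ?D g" by auto
  have "f (g x) = h x" if "x : car (T j)" for x using fun_cong[OF g(2), of x] that by simp
  then show "EX g:Hom (T j) E. ALL x:car (T j). f (g x) = h x" using mHomD(1)[OF g(1)] by blast
 qed
qed

text \<open>Take N = T_i / f(E). The submodule f(E) is torsion as an image of E, so a map T_j -> N
  lifts to T_i; for j different from i the lift factors through f, hence the map is zero. The
  projection T_i -> N is not zero, so exactly the form of i is nonzero on the torsion module
  N.\<close>

lemma separating_module_of_proper_image: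
 assumes i: "i : J" and E: "avoids i E" and f: "f : Hom E (T i)"
  and approx: "!!j h. j : J ==> j ~= i ==> h : Hom (T j) (T i) ==>
   EX g:Hom (T j) E. ALL x:car (T j). f (g x) = h x"
  and ns: "f ` car E ~= car (T i)"
 shows "\<exists>N :: ('k, 'a) smod. fdm N & (ALL j:J - {i}. hdim (P0 j) N = hdim (P1 j) N) & hdim (P0 i) N ~= hdim (P1 i) N"
proof -
 note iD = indecD[OF indec_T[OF i]]
 have fE: "fdm E" and tE: "torsion E" using E by (simp_all add: avoids_def)
 note lE = fdD(1)[OF fE]
 have sub: "submod A (T i) (f ` car E)" by (rule submod_image[OF lE iD(2) f submod_carrier[OF lE]])
 obtain N :: "('k, 'a) smod" and q where N: "fdm N" and q: "q : Hom (T i) N"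
  and surj: "q ` car (T i) = car N" and ker: "ker_of (T i) N q = f ` car E"
  by (rule quotient_exists[OF iD(1) sub]) (rule that)
 have Ti: "torsion (T i)" using lift[OF i] by (simp add: torsion_def)
 have tN: "torsion N" by (rule torsion_quotient[OF Ti iD(1) N q surj])
 have fI: "fdm ((T i)(|carrier := f ` car E|))" by (rule fd_sub(1)[OF iD(1) sub])
 have "f : Hom E ((T i)(|carrier := f ` car E|))" by (rule hom_into_sub[OF f]) simp
 from torsion_quotient[OF tE fE fI this] have tI: "torsion ((T i)(|carrier := ker_of (T i) N q|))" unfolding ker by simp
 have z: "u x = \<zero>\<^bsub>N\<^esub>" if j: "j : J" "j ~= i" and u: "u : Hom (T j) N" and x: "x : car (T j)" for j u x
 proof -
  have l: "lifts (d j) (P1 j) (P0 j) ((T i)(|carrier := ker_of (T i) N q|))" using tI j(1) by (simp add: torsion_def)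
  obtain w where w: "w : Hom (T j) (T i)" "!!x. x : car (T j) ==> q (w x) = u x"
   by (rule lifts_hom_lift[OF pres[OF j(1)] iD(1) N q surj l u]) (rule that)
  obtain g where g: "g : Hom (T j) E" "ALL x:car (T j). f (g x) = w x" using approx[OF j w(1)] by blast
  have "w x : ker_of (T i) N q" unfolding ker using g x homD(1)[OF g(1) x] by (metis image_eqI)
  then show ?thesis using w(2)[OF x] by simp
 qed
 have "hdim (P0 j) N = hdim (P1 j) N" if j: "j : J" "j ~= i" for j
 proof (rule hdim_compare(1)[OF pres[OF j(1)] N])
  show "lifts (d j) (P1 j) (P0 j) N" using tN j(1) by (simp add: torsion_def)
  show "u x = \<zero>\<^bsub>N\<^esub>" if "u : Hom (T j) N" "x : car (T j)" for u x by (rule z[OF j that])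
 qed
 moreover have "hdim (P0 i) N ~= hdim (P1 i) N"
 proof -
  obtain y where y: "y : car (T i)" "y \<notin> f ` car E" using ns subD(1)[OF sub] by auto
  have "q y ~= \<zero>\<^bsub>N\<^esub>" using y unfolding ker[symmetric] by simp
  moreover have "lifts (d i) (P1 i) (P0 i) N" using tN i by (simp add: torsion_def)
  ultimately show ?thesis using hdim_compare(2)[OF pres[OF i] N _ q y(1)] by blast
 qed
 ultimately show ?thesis using N by blast
qed

text \<open>Let Z = ker f and let t be its largest torsion submodule; take N = Z / t. There are no
  nonzero maps T_j -> N for any j, and N has the lifting property for all j except i, so only the
  form of i is nonzero.\<close>

lemma separating_module_of_epi:
 assumes i: "i : J" and E: "avoids i E" and f: "f : Hom E (T i)"
  and approx: "!!j h. j : J ==> j ~= i ==> h : Hom (T j) (T i) ==>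
   EX g:Hom (T j) E. ALL x:car (T j). f (g x) = h x"
  and fsurj: "f ` car E = car (T i)"
 shows "\<exists>N :: ('k, 'a) smod. fdm N & (ALL j:J - {i}. hdim (P0 j) N = hdim (P1 j) N) & hdim (P0 i) N ~= hdim (P1 i) N"
proof -
 note iD = indecD[OF indec_T[OF i]]
 have fE: "fdm E" and tE: "torsion E" using E by (simp_all add: avoids_def)
 note lE = fdD(1)[OF fE]
 interpret E: left_module A E by (rule lE)
 interpret Ti: left_module A "T i" by (rule iD(2))
 define Z where "Z = E(|carrier := ker_of E (T i) f|)"
 have subZ: "submod A E (ker_of E (T i) f)" by (rule submod_kernel[OF lE iD(2) f])
 have fZ: "fdm Z" unfolding Z_def by (rule fd_sub(1)[OF fE subZ])
 note lZ = fdD(1)[OF fZ]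
 \<comment> \<open>Extend g inside E to h. Then f h descends to a map T_j -> T_i, which the
   approximation factors as f w. Subtracting w e from h leaves the values on the image of d
   unchanged and moves the rest into Z.\<close>
 have lZj: "lifts (d j) (P1 j) (P0 j) Z" if j: "j : J" "j ~= i" for j
  unfolding lifts_def
 proof
  note pj = presD[OF pres[OF j(1)]]
  interpret Tj: left_module A "T j" by (rule pj(3))
  fix g assume g: "g : Hom (P1 j) Z"
  have gE: "g : Hom (P1 j) E" by (rule hom_out_of_sub[OF g[unfolded Z_def]]) auto
  have lj: "lifts (d j) (P1 j) (P0 j) E" using tE j by (simp add: torsion_def)
  obtain h where h: "h : Hom (P0 j) E" "!!x. x : car (P1 j) ==> h (d j x) = g x"
   by (rule liftsE[OF lj gE]) (rule that)
  have fg: "f (h (d j x)) = \<zero>\<^bsub>T i\<^esub>" if "x : car (P1 j)" for x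
   using homD(1)[OF g that] h(2)[OF that] by (simp add: Z_def)
  obtain v where v: "v : Hom (T j) (T i)" "!!x. x : car (P0 j) ==> v (e j x) = f (h x)"
   by (rule presents_factor[OF pres[OF j(1)] iD(2) hcomp[OF h(1) f] fg]) (assumption, rule that)
  obtain w where w: "w : Hom (T j) E" "ALL x:car (T j). f (w x) = v x" using approx[OF j v(1)] by blast
  note cl = homD(1)[OF pj(4)] homD(1)[OF h(1)] homD(1)[OF w(1)] homD(1)[OF f]
  have hom: "(%x. h x \<ominus>\<^bsub>E\<^esub> w (e j x)) : Hom (P0 j) Z"
   unfolding Z_def by (rule hom_into_sub[OF hom_diff[OF lE h(1) hcomp[OF pj(4) w(1)]]])
    (simp add: cl E.hom_minus[OF iD(2) f] w(2) v(2) Ti.M.minus_eq_zero_iff)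
  show "EX h:Hom (P0 j) Z. ALL x:car (P1 j). h (d j x) = g x"
   by (rule bexI[OF ballI hom])
    (simp add: h(2) presD2(2)[OF pres[OF j(1)]] Tj.hom_zero[OF lE w(1)] homD(1)[OF gE] a_minus_def)
 qed
 \<comment> \<open>Otherwise the identity of T_i would lift along f, making T_i a summand of
   E.\<close>
 have not_torsion: "\<not> torsion Z"
 proof
  assume "torsion Z"
  then have l: "lifts (d i) (P1 i) (P0 i) (E(|carrier := ker_of E (T i) f|))" using i by (simp add: torsion_def Z_def)
  obtain w where w: "w : Hom (T i) E" "!!x. x : car (T i) ==> f (w x) = x"
   by (rule lifts_hom_lift[OF pres[OF i] fE iD(1) f fsurj l hom_id[OF iD(2)]]) (rule that)
  have "bij_betw (%x. f (w x)) (car (T i)) (car (T i))"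
   by (subst bij_betw_cong[OF w(2)]) (simp_all add: bij_betw_def)
  then show False using avoidsD[OF E w(1) f] by blast
 qed
 \<comment> \<open>The torsion part is obtained as a torsion submodule of greatest dimension; the
   zero submodule shows that there is a candidate.\<close>
 let ?C = "{t. submod A Z t & torsion (Z(|carrier := t|))}"
 let ?m = "%t. mdim (Z(|carrier := t|))"
 have "{\<zero>\<^bsub>Z\<^esub>} : ?C"
  using submod_zero[OF lZ] by (auto simp: torsion_def intro!: lifts_zero_module[OF left_module_sub[OF lZ submod_zero[OF lZ]]])
 then obtain t where t: "t : ?C" "!!t'. t' : ?C ==> ?m t' \<le> ?m t"
  using ex_has_greatest_nat[of "%t. t : ?C" "{\<zero>\<^bsub>Z\<^esub>}" ?m "mdim Z"] fd_sub(2)[OF fZ] by fastforce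
 have subt: "submod A Z t" and tt: "torsion (Z(|carrier := t|))" using t(1) by auto
 obtain N :: "('k, 'a) smod" and q where N: "fdm N" and q: "q : Hom Z N"
  and surj: "q ` car Z = car N" and ker: "ker_of Z N q = t"
  by (rule quotient_exists[OF fZ subt]) (rule that)
 note lN = fdD(1)[OF N]
 interpret Z: left_module A Z by (rule lZ)
 interpret N: left_module A N by (rule lN)
 \<comment> \<open>The preimage W of the image of u is an extension of that image, a quotient of
   T_j, by t. So W is torsion, maximality gives W = t, and u is zero.\<close>
 have z: "u x = \<zero>\<^bsub>N\<^esub>" if j: "j : J" and u: "u : Hom (T j) N" and x: "x : car (T j)" for j u x
 proof -
  note jD = indecD[OF indec_T[OF j]]
  let ?V = "u ` car (T j)"
  have subV: "submod A N ?V" by (rule submod_image[OF jD(2) lN u submod_carrier[OF jD(2)]])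
  let ?W = "{z : car Z. q z : ?V}"
  have subW: "submod A Z ?W" by (rule submod_vimage[OF lZ lN q subV])
  have fV: "fdm (N(|carrier := ?V|))" by (rule fd_sub(1)[OF N subV])
  have "torsion (T j)" using lift[OF j] by (simp add: torsion_def)
  moreover have "u : Hom (T j) (N(|carrier := ?V|))" by (rule hom_into_sub[OF u]) simp
  ultimately have tV: "torsion (N(|carrier := ?V|))" using torsion_quotient[OF _ jD(1) fV] by simp
  have qW: "q : Hom (Z(|carrier := ?W|)) (N(|carrier := ?V|))"
   by (rule hom_into_sub[OF hom_from_sub[OF q]]) auto
  have sW: "q ` car (Z(|carrier := ?W|)) = car (N(|carrier := ?V|))"
  proof -
   have "?V <= q ` ?W"
   proof
    fix y assume y: "y : ?V"
    then obtain z where z: "z : car Z" "y = q z" using surj subD(1)[OF subV y] by auto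
    then have "z : ?W" using y by simp
    then show "y : q ` ?W" unfolding z(2) by (rule imageI)
   qed
   moreover have "q ` ?W <= ?V" by (rule image_subsetI) simp
   ultimately show ?thesis by (simp add: subset_antisym)
  qed
  have tV0: "t <= ?W" using ker subD(2)[OF subV] by auto
  have "ker_of (Z(|carrier := ?W|)) (N(|carrier := ?V|)) q = t" using ker tV0 by auto
  then have kk: "(Z(|carrier := ?W|))(|carrier := ker_of (Z(|carrier := ?W|)) (N(|carrier := ?V|)) q|) = Z(|carrier := t|)" by simp
  have fW: "fdm (Z(|carrier := ?W|))" by (rule fd_sub(1)[OF fZ subW])
  have "torsion (Z(|carrier := ?W|))" unfolding torsion_def
  proof
   fix k assume k: "k : J"
   show "lifts (d k) (P1 k) (P0 k) (Z(|carrier := ?W|))"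
   proof (rule lifts_extension[OF pres[OF k] fW fV qW sW])
    show "lifts (d k) (P1 k) (P0 k) (N(|carrier := ?V|))" using tV k by (simp add: torsion_def)
    show "lifts (d k) (P1 k) (P0 k) ((Z(|carrier := ?W|))(|carrier := ker_of (Z(|carrier := ?W|)) (N(|carrier := ?V|)) q|))"
     unfolding kk using tt k by (simp add: torsion_def)
   qed
  qed
  then have "?m ?W \<le> ?m t" using t(2) subW by simp
  moreover have "submod A (Z(|carrier := ?W|)) t" using submod_sub_iff[OF lZ subW] subt tV0 by simp
  ultimately have "t = ?W" using fd_sub(2,3)[OF fW, of t] by simp
  moreover obtain y where y: "y : car Z" "q y = u x"
   using surj homD(1)[OF u x] by (metis imageE)
  ultimately have "y : t" using x by auto
  then show ?thesis using ker y by auto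
 qed
 have lN': "lifts (d j) (P1 j) (P0 j) N" if j: "j : J" "j ~= i" for j
  by (rule lifts_quotient[OF pres[OF j(1)] lZj[OF j] fZ N q surj])
 have "hdim (P0 j) N = hdim (P1 j) N" if j: "j : J" "j ~= i" for j
 proof (rule hdim_compare(1)[OF pres[OF j(1)] N lN'[OF j]])
  show "u x = \<zero>\<^bsub>N\<^esub>" if "u : Hom (T j) N" "x : car (T j)" for u x by (rule z[OF j(1) that])
 qed
 moreover have "hdim (P0 i) N ~= hdim (P1 i) N"
 proof (rule hdim_compare(3)[OF pres[OF i] N])
  show "u x = \<zero>\<^bsub>N\<^esub>" if "u : Hom (T i) N" "x : car (T i)" for u x by (rule z[OF i that])
  show "\<not> lifts (d i) (P1 i) (P0 i) N"
  proof
   assume l: "lifts (d i) (P1 i) (P0 i) N"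
   have "torsion Z" unfolding torsion_def
   proof
    fix k assume k: "k : J"
    show "lifts (d k) (P1 k) (P0 k) Z"
    proof (rule lifts_extension[OF pres[OF k] fZ N q surj])
     show "lifts (d k) (P1 k) (P0 k) (Z(|carrier := ker_of Z N q|))" unfolding ker using tt k by (simp add: torsion_def)
     show "lifts (d k) (P1 k) (P0 k) N" using l lN'[OF k] by (cases "k = i") simp_all
    qed
   qed
   then show False using not_torsion by blast
  qed
 qed
 ultimately show ?thesis using N by blast
qed

lemma sep_module:
 assumes i: "i : J"
 shows "\<exists>N :: ('k, 'a) smod. fdm N & (ALL j:J - {i}. hdim (P0 j) N = hdim (P1 j) N) & hdim (P0 i) N ~= hdim (P1 i) N"
proof -
 obtain E f where E: "avoids i E" and f: "f : Hom E (T i)"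
  and approx: "!!j h. j : J ==> j ~= i ==> h : Hom (T j) (T i) ==>
   EX g:Hom (T j) E. ALL x:car (T j). f (g x) = h x"
  by (rule approximation[OF i]) (rule that)
 show ?thesis
 proof (cases "f ` car E = car (T i)")
  case True
  show ?thesis by (rule separating_module_of_epi[OF i E f _ True]) (rule approx)
 next
  case False
  show ?thesis by (rule separating_module_of_proper_image[OF i E f _ False]) (rule approx)
 qed
qed

text \<open>With more forms than classes of simple modules, a nontrivial combination vanishes on all
  simples, hence by additivity on all modules. Evaluated at the separating module of an index i with
  c i nonzero, only the i-th term survives, a contradiction. Finiteness is assumed because
  \<open>card\<close> of an infinite set is 0.\<close>

theorem card_le_num_simples:
 assumes fin: "finite (iso_classes A {S :: ('k, 'a) smod. simple_module K A S})"
 shows "card J \<le> num_simples K A"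
proof (rule ccontr)
 let ?C = "iso_classes A {S :: ('k, 'a) smod. simple_module K A S}"
 define rep :: "('k, 'a) smod set => ('k, 'a) smod" where "rep c = (SOME S. S : c)" for c
 define ch where "ch j N = real (hdim (P0 j) N) - real (hdim (P1 j) N)" for j and N :: "('k, 'a) smod"
 assume "\<not> card J \<le> num_simples K A"
 then have "card ?C < card J" by (simp add: num_simples_def)
 from homogeneous_system_nontrivial[OF fin finJ this, of "%j c. ch j (rep c)"]
 obtain c i where i: "i : J" "c i ~= 0" and c: "!!k. k : ?C ==> (\<Sum>j\<in>J. c j * ch j (rep k)) = 0" by blast
 obtain N :: "('k, 'a) smod" where N: "fdm N" "ALL j:J - {i}. hdim (P0 j) N = hdim (P1 j) N" "hdim (P0 i) N ~= hdim (P1 i) N"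
  using sep_module[OF i(1)] by blast
 have pj: "proj (P1 j)" "proj (P0 j)" if "j : J" for j
  using presD(1,2)[OF pres[OF that]] by auto
 have "(\<Sum>j\<in>J. c j * ch j N) = 0"
 proof (rule additive_vanishes[where \<psi> = "%N. \<Sum>j\<in>J. c j * ch j N", OF _ _ N(1)])
  fix N L :: "('k, 'a) smod" and q
  assume a: "fdm N" "fdm L" "q : Hom N L" "q ` car N = car L"
  have "ch j N = ch j (N(|carrier := ker_of N L q|)) + ch j L" if "j : J" for j
   using hdim_exact[OF pj(1)[OF that] a] hdim_exact[OF pj(2)[OF that] a] by (simp add: ch_def)
  then have "(\<Sum>j\<in>J. c j * ch j N) = (\<Sum>j\<in>J. c j * ch j (N(|carrier := ker_of N L q|)) + c j * ch j L)"
   by (intro sum.cong) (simp_all add: algebra_simps)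
  then show "(\<Sum>j\<in>J. c j * ch j N) = (\<Sum>j\<in>J. c j * ch j (N(|carrier := ker_of N L q|))) + (\<Sum>j\<in>J. c j * ch j L)"
   by (simp add: sum.distrib)
 next
  fix S :: "('k, 'a) smod" assume S: "simple_module K A S"
  let ?r = "{(M, N). M : {S :: ('k, 'a) smod. simple_module K A S} & N : {S. simple_module K A S} & mod_iso A M N}"
  let ?k = "?r `` {S}"
  have fS: "fdm S" using S by (simp add: simple_module_def)
  have k: "?k : ?C" unfolding iso_classes_def by (rule quotientI) (use S in simp)
  have "mod_iso A S S" unfolding mod_iso_def
  proof (rule bexI[OF _ hom_res[OF fdD(1)[OF fS] hom_id[OF fdD(1)[OF fS]]]])
   show "bij_betw (\<lambda>x\<in>car S. x) (car S) (car S)" by (simp add: bij_betw_def)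
  qed
  then have "S : ?k" using S by simp
  then have "rep ?k : ?k" unfolding rep_def by (rule someI)
  then have R: "simple_module K A (rep ?k)" "mod_iso A S (rep ?k)" by (simp_all only: Image_singleton_iff mem_Collect_eq case_prod_conv)
  then obtain f where f: "f : mod_Hom A S (rep ?k)" "bij_betw f (car S) (car (rep ?k))" unfolding mod_iso_def by blast
  have fR: "fdm (rep ?k)" using R(1) by (simp add: simple_module_def)
  have "ch j S = ch j (rep ?k)" if "j : J" for j
   using hdim_bij[OF pj(1)[OF that] fS fR mHomD(1)[OF f(1)] f(2)] hdim_bij[OF pj(2)[OF that] fS fR mHomD(1)[OF f(1)] f(2)]
   by (simp add: ch_def)
  then have "(\<Sum>j\<in>J. c j * ch j S) = (\<Sum>j\<in>J. c j * ch j (rep ?k))" by (intro sum.cong) simp_all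
  then show "(\<Sum>j\<in>J. c j * ch j S) = 0" using c[OF k] by simp
 qed
 moreover have "(\<Sum>j\<in>J. c j * ch j N) = c i * ch i N"
  using N(2) by (subst sum.remove[OF finJ i(1)]) (simp add: ch_def)
 ultimately show False using i(2) N(3) by (simp add: ch_def)
qed

end

section \<open>Matching two faithful tau-tilting modules\<close>

text \<open>If a proper nonempty S has exactly card S neighbours, match S by induction, and the rest
  after removing those neighbours; the condition for V in the rest follows from the one for the
  union of V and S. Otherwise every such S has a spare neighbour, so one pair can be fixed and its
  partner removed everywhere.\<close>

theorem hall:
 fixes N :: "'i => 'b set"
 assumes "finite I" "!!i. i : I ==> finite (N i)" "!!S. S <= I ==> card S \<le> card (\<Union>(N ` S))"
 shows "EX s. inj_on s I & (ALL i:I. s i : N i)"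
 using assms
proof (induction "card I" arbitrary: I N rule: less_induct)
 case less
 note fin = less.prems(1) and finN = less.prems(2) and hall = less.prems(3)
 show ?case
 proof (cases "EX S. S \<subset> I & S ~= {} & card S = card (\<Union>(N ` S))")
  case True
  then obtain S where S: "S \<subset> I" "S ~= {}" "card S = card (\<Union>(N ` S))" by blast
  have finS: "finite S" using S(1) fin finite_subset by blast
  have "card S < card I" using S(1) fin by (rule psubset_card_mono[rotated])
  then have "EX s. inj_on s S & (ALL i:S. s i : N i)"
  proof (rule less.hyps)
   show "finite S" by (rule finS)
   show "finite (N i)" if "i : S" for i using that S(1) by (intro finN) blast
   show "card V \<le> card (\<Union>(N ` V))" if "V <= S" for V using that S(1) by (intro hall) blast
  qed
  then obtain s where s: "inj_on s S" "ALL i:S. s i : N i" by blast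
  define N' where "N' i = N i - \<Union>(N ` S)" for i
  have lt: "card (I - S) < card I" using S fin by (intro psubset_card_mono) auto
  have c: "card V \<le> card (\<Union>(N' ` V))" if V: "V <= I - S" for V
  proof -
   have fV: "finite V" using V fin finite_subset by blast
   have "card V + card S = card (V \<union> S)" using V fV finS by (intro card_Un_disjoint[symmetric]) auto
   also have "\<dots> \<le> card (\<Union>(N ` (V \<union> S)))" by (rule hall) (use V S in auto)
   also have "\<Union>(N ` (V \<union> S)) = \<Union>(N' ` V) \<union> \<Union>(N ` S)" by (auto simp: N'_def)
   also have "card \<dots> \<le> card (\<Union>(N' ` V)) + card (\<Union>(N ` S))" by (rule card_Un_le)
   finally show ?thesis using S(3) by simp
  qed
  have "EX s. inj_on s (I - S) & (ALL i:I - S. s i : N' i)"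
  proof (rule less.hyps[OF lt])
   show "finite (N' i)" if "i : I - S" for i using that finN[of i] by (simp add: N'_def)
  qed (use fin in simp, rule c)
  then obtain s' where s': "inj_on s' (I - S)" "ALL i:I - S. s' i : N' i" by blast
  let ?s = "%i. if i : S then s i else s' i"
  have "inj_on ?s I"
  proof (rule inj_onI)
   fix i j assume ij: "i : I" "j : I" "?s i = ?s j"
   have "s i ~= s' j" if "i : S" "j : I - S" for i j using s(2) s'(2) that by (auto simp: N'_def)
   then show "i = j" using ij inj_onD[OF s(1), of i j] inj_onD[OF s'(1), of i j] by (metis DiffI)
  qed
  moreover have "ALL i:I. ?s i : N i" using s(2) s'(2) by (auto simp: N'_def)
  ultimately show ?thesis by blast
 next
  case False
  show ?thesis
  proof (cases "I = {}")
   case True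
   then show ?thesis by simp
  next
   case False
   then obtain i where i: "i : I" by blast
   have "card {i} \<le> card (\<Union>(N ` {i}))" using i by (intro hall) auto
   then obtain y where y: "y : N i" by fastforce
   define N' where "N' j = N j - {y}" for j
   have lt: "card (I - {i}) < card I" using i fin by (rule card_Diff1_less[rotated])
   have c: "card V \<le> card (\<Union>(N' ` V))" if V: "V <= I - {i}" for V
   proof (cases "V = {}")
    case False
    have "V \<subset> I" using V i by blast
    then have "card V < card (\<Union>(N ` V))"
     using \<open>\<not> (EX S. S \<subset> I & S ~= {} & card S = card (\<Union>(N ` S)))\<close> False hall[of V] by (auto simp: less_le)
    moreover have "\<Union>(N' ` V) = \<Union>(N ` V) - {y}" by (auto simp: N'_def)
    ultimately show ?thesis by (simp add: card_Diff_singleton_if) arith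
   qed simp
   have "EX s. inj_on s (I - {i}) & (ALL j:I - {i}. s j : N' j)"
   proof (rule less.hyps[OF lt])
    show "finite (N' j)" if "j : I - {i}" for j using that finN[of j] by (simp add: N'_def)
   qed (use fin in simp, rule c)
   then obtain s where s: "inj_on s (I - {i})" "ALL j:I - {i}. s j : N' j" by blast
   have "inj_on (s(i := y)) I" using s by (auto simp: inj_on_def N'_def)
   moreover have "ALL j:I. (s(i := y)) j : N j" using s(2) y by (auto simp: N'_def)
   ultimately show ?thesis by blast
  qed
 qed
qed

context kalg
begin

lemma mod_isoI:
 assumes "lmod M" "f : Hom M N" "bij_betw f (car M) (car N)"
 shows "mod_iso A M N"
 unfolding mod_iso_def
 by (rule bexI[OF _ hom_res[OF assms(1,2)]]) (simp add: assms(3) bij_betw_restrict_eq)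

lemma mod_isoE:
 assumes "mod_iso A M N"
 obtains f where "f : Hom M N" "bij_betw f (car M) (car N)"
 using assms unfolding mod_iso_def mod_Hom_def by blast

lemma mod_iso_sym:
 assumes M: "lmod M" and N: "lmod N" and iso: "mod_iso A M N"
 shows "mod_iso A N M"
proof -
 obtain f where f: "f : Hom M N" "bij_betw f (car M) (car N)" by (rule mod_isoE[OF iso])
 show ?thesis by (rule mod_isoI[OF N hom_inv_into[OF M f] bij_betw_inv_into[OF f(2)]])
qed

lemma mod_iso_trans:
 assumes M: "lmod M" and "mod_iso A M N" "mod_iso A N L"
 shows "mod_iso A M L"
proof -
 obtain f where f: "f : Hom M N" "bij_betw f (car M) (car N)" by (rule mod_isoE[OF assms(2)])
 obtain g where g: "g : Hom N L" "bij_betw g (car N) (car L)" by (rule mod_isoE[OF assms(3)])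
 show ?thesis by (rule mod_isoI[OF M hcomp[OF f(1) g(1)]]) (use bij_betw_trans[OF f(2) g(2)] in \<open>simp add: o_def\<close>)
qed

text \<open>The uniqueness half of Krull-Schmidt: an indecomposable summand of a finite sum splits
  off the first term or the remaining ones, and splitting off an indecomposable means being
  isomorphic to it.\<close>

lemma indecomposable_split_direct_sum:
 fixes M :: "('a, 'm) module" and X :: "'i => ('a, 'x) module"
 assumes M: "indec M" and "finite I" and X: "!!i. i : I ==> indec (X i)"
  and "u : Hom M (direct_sum I X)" "v : Hom (direct_sum I X) M"
  and "bij_betw (%x. v (u x)) (car M) (car M)"
 shows "EX i:I. mod_iso A M (X i)"
 using assms(2-)
proof (induction I arbitrary: u v)
 case empty
 have lM: "lmod M" by (rule indecD(2)[OF M])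
 interpret M: left_module A M by (rule lM)
 have "x = y" if xy: "x : car M" "y : car M" for x y
 proof (rule inj_onD[OF bij_betw_imp_inj_on[OF empty.prems(4)] _ xy])
  have "u x = u y" using homD(1)[OF empty.prems(2) xy(1)] homD(1)[OF empty.prems(2) xy(2)] by simp
  then show "v (u x) = v (u y)" by (rule arg_cong)
 qed
 then have "car M = {\<zero>\<^bsub>M\<^esub>}" using M.M.zero_closed by blast
 then show ?case using M by (simp add: indecomposable_def)
next
 case (insert i I)
 have lX: "lmod (X j)" if "j : insert i I" for j
  by (rule indecD(2)[OF insert.prems(1)[OF that]])
 have lM: "lmod M" by (rule indecD(2)[OF M])
 obtain i1 i2 p1 p2 where b: "biprod (direct_sum (insert i I) X) (X i) (direct_sum I X) i1 i2 p1 p2"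
  by (rule that) (rule biprod_insert[OF insert.hyps(2) lX])
 note bd = biprodD[OF b]
 note u = insert.prems(2) and v = insert.prems(3)
 have Xi: "indec (X i)" by (rule insert.prems(1)) simp
 from indecomposable_split_biprod[OF M b u v, OF insert.prems(4)] show ?case
 proof
  assume bij: "bij_betw (%x. v (i1 (p1 (u x)))) (car M) (car M)"
  have u1: "(%x. p1 (u x)) : Hom M (X i)" by (rule hcomp[OF u bd(6)])
  have v1: "(%x. v (i1 x)) : Hom (X i) M" by (rule hcomp[OF bd(4) v])
  have nz: "car M ~= {\<zero>\<^bsub>M\<^esub>}" using M by (simp add: indecomposable_def)
  have "bij_betw (%x. p1 (u x)) (car M) (car (X i))"
   by (rule split_mono_indecomposable[OF lM nz Xi u1 v1]) (rule bij)
  then have "mod_iso A M (X i)" by (rule mod_isoI[OF lM u1])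
  then show ?thesis by blast
 next
  assume bij: "bij_betw (%x. v (i2 (p2 (u x)))) (car M) (car M)"
  have "EX i:I. mod_iso A M (X i)"
  proof (rule insert.IH)
   show "indec (X j)" if "j : I" for j by (rule insert.prems(1)) (use that in simp)
   show "(%x. p2 (u x)) : Hom M (direct_sum I X)" by (rule hcomp[OF u bd(7)])
   show "(%x. v (i2 x)) : Hom (direct_sum I X) M" by (rule hcomp[OF bd(5) v])
  qed (rule bij)
  then show ?thesis by blast
 qed
qed

lemma summand_direct_sum:
 assumes X: "!!i. i : I ==> lmod (X i)" and i: "i : I"
 obtains u where "u : Hom (X i) (direct_sum I X)" "!!x. x : car (X i) ==> u x i = x"
proof -
 have "(if j = i then (%x. x) else (%x. \<zero>\<^bsub>X j\<^esub>)) : Hom (X i) (X j)" if "j : I" for j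
 proof (cases "j = i")
  case True
  then show ?thesis using hom_id[OF X[OF i]] by simp
 next
  case False
  have "(%x. \<zero>\<^bsub>X j\<^esub>) : Hom (X i) (X j)" by (rule hom_zero_map[OF X[OF that]])
  then show ?thesis using False by simp
 qed
 from hom_direct_sum[where M = X, OF X X[OF i] this]
 have "(%x. \<lambda>j\<in>I. (if j = i then (%x. x) else (%x. \<zero>\<^bsub>X j\<^esub>)) x) : Hom (X i) (direct_sum I X)" by blast
 then show ?thesis by (rule that) (simp add: i)
qed

text \<open>\<open>tau_tilting\<close> only asserts some decomposition Y into pairwise
  non-isomorphic indecomposables. Each Y l is a summand of the sum of X, hence isomorphic to some X
  (s l), and s is injective because the Y l are non-isomorphic.\<close>

lemma tau_tilting_family_noniso:
 assumes fam: "tau_tilting_family K A X" and ij: "i : {1..num_simples K A}" "j : {1..num_simples K A}" "i ~= j"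
 shows "\<not> mod_iso A (X i) (X j)"
proof
 let ?I = "{1..num_simples K A}"
 have X: "indec (X i)" if "i : ?I" for i using fam that by (simp add: tau_tilting_family_def)
 have lX: "lmod (X i)" if "i : ?I" for i by (rule indecD(2)[OF X[OF that]])
 obtain Y :: "nat => ('k, 'a) smod" where Y: "!!i. i : ?I ==> indec (Y i)"
  and nY: "!!i j. i : ?I ==> j : ?I ==> i ~= j ==> \<not> mod_iso A (Y i) (Y j)"
  and iso: "mod_iso A (direct_sum ?I X) (direct_sum ?I Y)"
  using fam unfolding tau_tilting_family_def tau_tilting_def total_sum_def by blast
 have lY: "lmod (Y i)" if "i : ?I" for i by (rule indecD(2)[OF Y[OF that]])
 have lS: "lmod (direct_sum ?I X)" by (rule left_module_direct_sum) (rule lX)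
 obtain f where f: "f : Hom (direct_sum ?I X) (direct_sum ?I Y)"
  "bij_betw f (car (direct_sum ?I X)) (car (direct_sum ?I Y))" by (rule mod_isoE[OF iso])
 let ?g = "inv_into (car (direct_sum ?I X)) f"
 have g: "?g : Hom (direct_sum ?I Y) (direct_sum ?I X)" by (rule hom_inv_into[OF lS f])
 have "EX i:?I. mod_iso A (Y l) (X i)" if l: "l : ?I" for l
 proof -
  obtain w where w: "w : Hom (Y l) (direct_sum ?I Y)" "!!x. x : car (Y l) ==> w x l = x"
   by (rule summand_direct_sum[OF lY l]) (assumption, rule that)
  show ?thesis
  proof (rule indecomposable_split_direct_sum[OF Y[OF l] finite_atLeastAtMost X])
   show "(%x. ?g (w x)) : Hom (Y l) (direct_sum ?I X)" by (rule hcomp[OF w(1) g])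
   show "(%x. f x l) : Hom (direct_sum ?I X) (Y l)" by (rule hcomp[OF f(1) hom_component[OF l]])
   have "f (?g (w x)) l = x" if "x : car (Y l)" for x
    using bij_betw_inv_into_right[OF f(2) homD(1)[OF w(1) that]] w(2)[OF that] by simp
   then show "bij_betw (%x. f (?g (w x)) l) (car (Y l)) (car (Y l))"
    by (subst bij_betw_cong[where g = "%x. x"]) (simp_all add: bij_betw_def)
  qed
 qed
 then obtain s where s: "!!l. l : ?I ==> s l : ?I" "!!l. l : ?I ==> mod_iso A (Y l) (X (s l))" by metis
 have sameY: "l = l'" if l: "l : ?I" "l' : ?I" and iso: "mod_iso A (X (s l)) (X (s l'))" for l l'
 proof (rule ccontr)
  assume "l ~= l'"
  moreover have "mod_iso A (Y l) (Y l')"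
   by (rule mod_iso_trans[OF lY[OF l(1)] mod_iso_trans[OF lY[OF l(1)] s(2)[OF l(1)] iso]
    mod_iso_sym[OF lY[OF l(2)] lX[OF s(1)[OF l(2)]] s(2)[OF l(2)]]])
  ultimately show False using nY[OF l] by blast
 qed
 have "inj_on s ?I"
 proof (rule inj_onI)
  fix l l' assume l: "l : ?I" "l' : ?I" "s l = s l'"
  show "l = l'" by (rule sameY[OF l(1,2)])
   (use mod_isoI[OF lX hom_id[OF lX], OF s(1) s(1), OF l(1) l(1)] l(3) in \<open>simp add: bij_betw_def\<close>)
 qed
 \<comment> \<open>An injection of the finite index set into itself is onto, so every X i is
   isomorphic to its own Y l.\<close>
 then have "s ` ?I = ?I" using s(1) by (intro endo_inj_surj) auto
 then obtain l l' where l: "l : ?I" "s l = i" "l' : ?I" "s l' = j" using ij(1,2) by (metis (no_types, lifting) imageE)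
 assume "mod_iso A (X i) (X j)"
 then show False using sameY[OF l(1,3)] l(2,4) ij(3) by simp
qed

text \<open>Rigidity of the sum passes to the minimal presentation of each summand X i by
  comparison, and from the sum as target to each quotient X j. Injectivity comes from the
  annihilator argument in the faithful case and from a resolution of length one in the tilting
  case.\<close>

lemma tau_tilting_family_presentations:
 assumes fam: "tau_tilting_family K A X"
  and ft: "faithful A (total_sum K A X) \<or> tilting K A (total_sum K A X)"
 obtains P1 P0 :: "nat => ('k, 'a) smod" and d e where
  "!!i. i : {1..num_simples K A} ==> presents (P1 i) (d i) (P0 i) (e i) (X i)"
  "!!i j. i : {1..num_simples K A} ==> j : {1..num_simples K A} ==> lifts (d i) (P1 i) (P0 i) (X j)"
  "!!i. i : {1..num_simples K A} ==> inj_on (d i) (car (P1 i))"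
proof -
 let ?I = "{1..num_simples K A}" and ?T = "direct_sum {1..num_simples K A} X"
 have X: "indec (X i)" if "i : ?I" for i using fam that by (simp add: tau_tilting_family_def)
 have fX: "fdm (X i)" if "i : ?I" for i by (rule indecD(1)[OF X[OF that]])
 have lX: "lmod (X i)" if "i : ?I" for i by (rule indecD(2)[OF X[OF that]])
 have fT: "fdm ?T" by (rule fd_direct_sum) (simp, rule fX)
 note lT = fdD(1)[OF fT]
 have tr: "tau_rigid K A ?T" using fam by (simp add: tau_tilting_family_def tau_tilting_def total_sum_def)
 obtain R1 R0 :: "('k, 'a) smod" and c b where R: "presents R1 c R0 b ?T" and eq: "tau_rigid K A ?T \<longleftrightarrow> lifts c R1 R0 ?T"
  by (rule tau_rigid_iff_lifts[OF fT]) (rule that)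
 have lR: "lifts c R1 R0 ?T" using eq tr by blast
 \<comment> \<open>The four data are bundled into one tuple so that a single choice over i produces
   matching families.\<close>
 have "EX q. (%(P1, d, P0, e). presents P1 d P0 e (X i) & (ALL j:?I. lifts d P1 P0 (X j)) & inj_on d (car P1))
   (q :: ('k, 'a) smod \<times> _ \<times> ('k, 'a) smod \<times> _)" if i: "i : ?I" for i
 proof -
  obtain P1 P0 :: "('k, 'a) smod" and d e where m: "min_proj_presentation K A (X i) (P1, d, P0, e)"
   by (rule min_presentation_exists[OF fX[OF i]]) (rule that)
  note p = min_presentationD[OF m lX[OF i]]
  obtain u where u: "u : Hom (X i) ?T" "!!x. x : car (X i) ==> u x i = x"
   by (rule summand_direct_sum[OF lX i]) (assumption, rule that)
  note r = hom_component[where M = X, OF i]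
  have l: "lifts d P1 P0 ?T" by (rule lifts_summand[OF R lR p u(1) r]) (rule u(2))
  have lj: "lifts d P1 P0 (X j)" if j: "j : ?I" for j
  proof (rule lifts_quotient[OF p(1) l fT fX[OF j] hom_component[OF j]])
   obtain w where w: "w : Hom (X j) ?T" "!!x. x : car (X j) ==> w x j = x"
    by (rule summand_direct_sum[OF lX j]) (assumption, rule that)
   show "(%x. x j) ` car ?T = car (X j)"
   proof (rule equalityI)
    show "(%x. x j) ` car ?T <= car (X j)"
     by (rule image_subsetI) (rule homD(1)[OF hom_component[OF j]])
    show "car (X j) <= (%x. x j) ` car ?T"
    proof
     fix x assume x: "x : car (X j)"
     show "x : (%x. x j) ` car ?T"
      using w(2)[OF x, symmetric] homD(1)[OF w(1) x] by (rule image_eqI)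
    qed
   qed
  qed
  have "inj_on d (car P1)" using ft
  proof
   assume F: "faithful A (total_sum K A X)"
   show ?thesis
   proof (rule presents_inj[OF p(1) lX lj])
    fix a assume a: "a : car A"
     and z: "!!i x. i : ?I ==> x : car (X i) ==> a \<odot>\<^bsub>X i\<^esub> x = \<zero>\<^bsub>X i\<^esub>"
    have "a : annihilator A (total_sum K A X)" unfolding annihilator_def total_sum_def
    proof (rule CollectI, rule conjI[OF a], rule ballI)
     fix x assume x: "x : car ?T"
     show "a \<odot>\<^bsub>?T\<^esub> x = \<zero>\<^bsub>?T\<^esub>" unfolding direct_sum_simps
     proof (rule restrict_ext)
      fix i assume i: "i : ?I"
      show "a \<odot>\<^bsub>X i\<^esub> x i = \<zero>\<^bsub>X i\<^esub>" by (rule z[OF i homD(1)[OF hom_component[OF i] x]])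
     qed
    qed
    then show "a = \<zero>\<^bsub>A\<^esub>" using F by (simp add: faithful_def)
   qed
  next
   \<comment> \<open>The first map c1 of a length-one resolution is injective. As b1 a1 is
     bijective, a1 is injective too, and c1 a1 = a0 d then forces d to be injective.\<close>
   assume "tilting K A (total_sum K A X)"
   then have "proj_dim_le_one K A ?T" by (simp add: tilting_def partial_tilting_def total_sum_def)
   then obtain Q1 Q0 :: "('k, 'a) smod" and c1 c0 where q: "proj Q1" "proj Q0" "mod_epi A Q0 ?T c0"
    "c1 : mod_Hom A Q1 Q0" "c1 ` car Q1 = a_kernel Q0 ?T c0" and inj: "inj_on c1 (car Q1)"
    unfolding proj_dim_le_one_def by blast
   have Q: "presents Q1 c1 Q0 c0 ?T"
    using q lT unfolding presents_def mod_epi_def a_kernel_eq mod_Hom_def by blast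
   obtain a0 a1 b0 b1 where a: "a0 : Hom P0 Q0" "a1 : Hom P1 Q1"
    "b0 : Hom Q0 P0" "b1 : Hom Q1 P1"
    "!!x. x : car P1 ==> c1 (a1 x) = a0 (d x)" "!!x. x : car Q1 ==> d (b1 x) = b0 (c1 x)"
    "bij_betw (%x. b0 (a0 x)) (car P0) (car P0)" "bij_betw (%x. b1 (a1 x)) (car P1) (car P1)"
    by (rule compare_presentations[OF Q p u(1) r]) (rule u(2), assumption, rule that)
   show ?thesis
   proof (rule inj_onI)
    fix x y assume xy: "x : car P1" "y : car P1" and dd: "d x = d y"
    have "c1 (a1 x) = c1 (a1 y)" using a(5)[OF xy(1)] a(5)[OF xy(2)] dd by simp
    then have "a1 x = a1 y" using inj_onD[OF inj] homD(1)[OF a(2) xy(1)] homD(1)[OF a(2) xy(2)] by blast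
    then show "x = y" using inj_onD[OF bij_betw_imp_inj_on[OF a(8)] _ xy] by simp
   qed
  qed
  then have "(%(P1, d, P0, e). presents P1 d P0 e (X i) & (ALL j:?I. lifts d P1 P0 (X j)) & inj_on d (car P1)) (P1, d, P0, e)"
   using p(1) lj by simp
  then show ?thesis by (rule exI)
 qed
 then have "ALL i:?I. EX q. (%(P1, d, P0, e). presents P1 d P0 e (X i) & (ALL j:?I. lifts d P1 P0 (X j)) & inj_on d (car P1))
   (q :: ('k, 'a) smod \<times> _ \<times> ('k, 'a) smod \<times> _)" by (intro ballI)
 from bchoice[OF this] obtain q :: "nat => ('k, 'a) smod \<times> _ \<times> ('k, 'a) smod \<times> _"
  where q: "ALL i:?I. (%(P1, d, P0, e). presents P1 d P0 e (X i) & (ALL j:?I. lifts d P1 P0 (X j)) & inj_on d (car P1)) (q i)"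
  by (rule exE)
 define P1 d P0 e where "P1 i = fst (q i)" and "d i = fst (snd (q i))" and "P0 i = fst (snd (snd (q i)))"
  and "e i = snd (snd (snd (q i)))" for i
 have "presents (P1 i) (d i) (P0 i) (e i) (X i) & (ALL j:?I. lifts (d i) (P1 i) (P0 i) (X j)) & inj_on (d i) (car (P1 i))" if "i : ?I" for i
  using bspec[OF q that] by (simp add: P1_def d_def P0_def e_def split: prod.splits)
 note * = this
 show ?thesis by (rule that[of P1 d P0 e]) (use * in simp_all)
qed

theorem ext_matched_of_faithful_or_tilting:
 assumes famX: "tau_tilting_family K A X" and famY: "tau_tilting_family K A Y"
  and ftX: "faithful A (total_sum K A X) \<or> tilting K A (total_sum K A X)"
  and ftY: "faithful A (total_sum K A Y) \<or> tilting K A (total_sum K A Y)"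
 shows "ext_matched K A X Y"
proof -
 let ?I = "{1..num_simples K A}"
 obtain P1 P0 :: "nat => ('k, 'a) smod" and d e where
  P: "!!i. i : ?I ==> presents (P1 i) (d i) (P0 i) (e i) (X i)"
  "!!i j. i : ?I ==> j : ?I ==> lifts (d i) (P1 i) (P0 i) (X j)"
  "!!i. i : ?I ==> inj_on (d i) (car (P1 i))"
  by (rule tau_tilting_family_presentations[OF famX ftX]) (rule that)
 obtain Q1 Q0 :: "nat => ('k, 'a) smod" and d' e' where
  Q: "!!i. i : ?I ==> presents (Q1 i) (d' i) (Q0 i) (e' i) (Y i)"
  "!!i j. i : ?I ==> j : ?I ==> lifts (d' i) (Q1 i) (Q0 i) (Y j)"
  "!!i. i : ?I ==> inj_on (d' i) (car (Q1 i))"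
  by (rule tau_tilting_family_presentations[OF famY ftY]) (rule that)
 have X: "indec (X i)" if "i : ?I" for i using famX that by (simp add: tau_tilting_family_def)
 have Y: "indec (Y i)" if "i : ?I" for i using famY that by (simp add: tau_tilting_family_def)
 note lX = indecD(2)[OF X] and lY = indecD(2)[OF Y]
 define R where "R i k \<longleftrightarrow> mod_iso A (X i) (Y k) \<or> \<not> Ext1_zero K A (X i) (Y k) \<or> \<not> Ext1_zero K A (Y k) (X i)" for i k
 define N where "N i = {k : ?I. R i k}" for i
 have "card S \<le> card (\<Union>(N ` S))" if S: "S <= ?I" for S
 proof (cases "?I = {}")
  case True
  then show ?thesis using S by simp
 next
  case False
  \<comment> \<open>A nonempty index set means that \<open>num_simples\<close> is positive, and a
    positive \<open>card\<close> implies finiteness.\<close>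
  then have fin: "finite (iso_classes A {S :: ('k, 'a) smod. simple_module K A S})"
   by (intro card_ge_0_finite) (simp add: num_simples_def)
  \<comment> \<open>U collects the indices of Y that have no neighbour in S, so no pair from S and U
    is isomorphic or linked by Ext in either direction.\<close>
  define U where "U = ?I - \<Union>(N ` S)"
  have NU: "\<Union>(N ` S) <= ?I" by (auto simp: N_def)
  have finS: "finite S" using S finite_subset by blast
  let ?J = "Sum_Type.Plus S U"
  have notR: "\<not> mod_iso A (X i) (Y k)" "Ext1_zero K A (X i) (Y k)" "Ext1_zero K A (Y k) (X i)" if "i : S" "k : U" for i k
   using that unfolding U_def N_def R_def by auto
  have notR': "\<not> mod_iso A (Y k) (X i)" if "i : S" "k : U" for i k
  proof
   have ik: "i : ?I" "k : ?I" using that S by (auto simp: U_def)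
   assume "mod_iso A (Y k) (X i)"
   from mod_iso_sym[OF lY[OF ik(2)] lX[OF ik(1)] this] show False using notR(1)[OF that] by blast
  qed
  have SI: "i : ?I" if "i : S" for i using S that by blast
  have UI: "i : ?I" if "i : U" for i using that by (simp add: U_def)
  \<comment> \<open>Within X and within Y everything comes from the tau-tilting property. Across the
    two, orthogonality comes from the vanishing of Ext and injectivity of the presentation maps; one
    direction of Ext serves each mixed case.\<close>
  have "presented_family K A ?J (case_sum X Y) (case_sum P1 Q1) (case_sum P0 Q0) (case_sum d d') (case_sum e e')"
  proof (intro presented_family.intro[OF kalg_axioms] presented_family_axioms.intro)
   show "finite ?J" using finS by (simp add: U_def)
  next
   fix j assume "j : ?J"
   then show "indec (case_sum X Y j)" by (elim PlusE) (simp_all add: X[OF SI] Y[OF UI])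
  next
   fix i j assume "i : ?J" "j : ?J" and ne: "i ~= j"
   then consider a b where "i = Inl a" "j = Inl b" "a : S" "b : S" | a b where "i = Inl a" "j = Inr b" "a : S" "b : U"
    | a b where "i = Inr a" "j = Inl b" "a : U" "b : S" | a b where "i = Inr a" "j = Inr b" "a : U" "b : U"
    by (elim PlusE)
   then show "\<not> mod_iso A (case_sum X Y i) (case_sum X Y j)"
   proof cases
    case (1 a b)
    then show ?thesis using tau_tilting_family_noniso[OF famX SI[OF 1(3)] SI[OF 1(4)]] ne by simp
   next
    case (2 a b)
    then show ?thesis using notR(1)[OF 2(3,4)] by simp
   next
    case (3 a b)
    then show ?thesis using notR'[OF 3(4,3)] by simp
   next
    case (4 a b)
    then show ?thesis using tau_tilting_family_noniso[OF famY UI[OF 4(3)] UI[OF 4(4)]] ne by simp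
   qed
  next
   fix j assume "j : ?J"
   then show "presents (case_sum P1 Q1 j) (case_sum d d' j) (case_sum P0 Q0 j) (case_sum e e' j) (case_sum X Y j)"
    by (elim PlusE) (simp_all add: P(1)[OF SI] Q(1)[OF UI])
  next
   fix i j assume "i : ?J" "j : ?J"
   then consider a b where "i = Inl a" "j = Inl b" "a : S" "b : S" | a b where "i = Inl a" "j = Inr b" "a : S" "b : U"
    | a b where "i = Inr a" "j = Inl b" "a : U" "b : S" | a b where "i = Inr a" "j = Inr b" "a : U" "b : U"
    by (elim PlusE)
   then show "lifts (case_sum d d' j) (case_sum P1 Q1 j) (case_sum P0 Q0 j) (case_sum X Y i)"
   proof cases
    case (1 a b)
    then show ?thesis using P(2)[OF SI[OF 1(4)] SI[OF 1(3)]] by simp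
   next
    case (2 a b)
    then show ?thesis
     using Ext1_zero_imp_lifts[OF lX[OF SI[OF 2(3)]] notR(3)[OF 2(3,4)] Q(1)[OF UI[OF 2(4)]] Q(3)[OF UI[OF 2(4)]]] by simp
   next
    case (3 a b)
    then show ?thesis
     using Ext1_zero_imp_lifts[OF lY[OF UI[OF 3(3)]] notR(2)[OF 3(4,3)] P(1)[OF SI[OF 3(4)]] P(3)[OF SI[OF 3(4)]]] by simp
   next
    case (4 a b)
    then show ?thesis using Q(2)[OF UI[OF 4(4)] UI[OF 4(3)]] by simp
   qed
  qed
  \<comment> \<open>The bound |S| + |U| <= n, with U the complement of the neighbours of S, is
    Hall's condition for S.\<close>
  from presented_family.card_le_num_simples[OF this fin]
  have "card S + card U \<le> num_simples K A" using finS by (simp add: card_Plus U_def)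
  moreover have "card U = num_simples K A - card (\<Union>(N ` S))" "card (\<Union>(N ` S)) \<le> num_simples K A"
   unfolding U_def using card_Diff_subset[OF finite_subset[OF NU] NU] card_mono[OF _ NU] by simp_all
  ultimately show ?thesis by linarith
 qed
 note hall_cond = this
 have "EX s. inj_on s ?I & (ALL i:?I. s i : N i)"
 proof (rule hall)
  show "finite (N i)" for i by (simp add: N_def)
 qed (rule finite_atLeastAtMost, rule hall_cond)
 then obtain s where s: "inj_on s ?I" "!!i. i : ?I ==> s i : N i" by blast
 \<comment> \<open>\<open>permutes\<close> demands the identity outside the index set.\<close>
 define s' where "s' i = (if i : ?I then s i else i)" for i
 have "s' ` ?I <= ?I" using s(2) by (auto simp: s'_def N_def)
 moreover have inj: "inj_on s' ?I" using s(1) by (subst inj_on_cong[where g = s]) (simp_all add: s'_def)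
 ultimately have "bij_betw s' ?I ?I" using endo_inj_surj[of ?I s'] by (simp add: bij_betw_def)
 then have "s' permutes ?I" by (rule bij_imp_permutes) (simp only: s'_def if_False)
 moreover have "R i (s' i)" if "i : ?I" for i using s(2)[OF that] that by (simp only: s'_def if_True N_def mem_Collect_eq)
 ultimately show ?thesis unfolding ext_matched_def R_def by blast
qed

end

section \<open>Path algebras\<close>

definition path_comp :: "('v, 'e) qpath => ('v, 'e) qpath => ('v, 'e) qpath" where
 "path_comp p q = (psource q, parrows q @ parrows p, ptarget p)"

text \<open>The range of summation in the product of \<open>path_algebra\<close>: all ways to write
  z as a composite of two paths.\<close>

definition splits :: "('v, 'e) pre_digraph => ('v, 'e) qpath => (('v, 'e) qpath \<times> ('v, 'e) qpath) set" where
 "splits Q z = {(p, q). p : qpaths Q & q : qpaths Q & ptarget q = psource p & z = path_comp p q}"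

lemma path_comp_simps [simp]:
 "psource (path_comp p q) = psource q" "ptarget (path_comp p q) = ptarget p"
 "parrows (path_comp p q) = parrows q @ parrows p"
 by (simp_all add: path_comp_def psource_def ptarget_def parrows_def)

lemma path_comp_assoc: "path_comp (path_comp a b) c = path_comp a (path_comp b c)"
 by (simp add: path_comp_def[of _ c] path_comp_def[of a]) (simp add: path_comp_def psource_def ptarget_def parrows_def)

lemma qpath_eq_iff: "p = q \<longleftrightarrow> psource p = psource q & parrows p = parrows q & ptarget p = ptarget q"
 by (cases p; cases q) (simp add: psource_def ptarget_def parrows_def)

lemma cas_unique: "pre_digraph.cas Q u p v ==> pre_digraph.cas Q u p w ==> v = w"
 by (induction p arbitrary: u) (simp_all add: pre_digraph.cas.simps)

lemma cas_appendI: "pre_digraph.cas Q u p v ==> pre_digraph.cas Q v q w ==> pre_digraph.cas Q u (p @ q) w"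
 by (induction p arbitrary: u) (simp_all add: pre_digraph.cas.simps)

lemma qpaths_iff: "p : qpaths Q \<longleftrightarrow> psource p : verts Q & set (parrows p) <= arcs Q & pre_digraph.cas Q (psource p) (parrows p) (ptarget p)"
 by (simp add: qpaths_def pre_digraph.awalk_def)

lemma path_comp_in_qpaths: "p : qpaths Q ==> q : qpaths Q ==> ptarget q = psource p ==> path_comp p q : qpaths Q"
 by (auto simp: qpaths_iff intro: cas_appendI)

text \<open>A factorisation of z is determined by the length of its first traversed factor; the
  intermediate vertex is then forced.\<close>

lemma finite_splits: "finite (splits Q z)"
proof (rule inj_on_finite[of "%(p, q). length (parrows q)" _ "{..length (parrows z)}"])
 show "inj_on (%(p, q). length (parrows q)) (splits Q z)"
 proof (rule inj_onI)
  fix x y assume x: "x : splits Q z" and y: "y : splits Q z"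
   and eq: "(case x of (p, q) => length (parrows q)) = (case y of (p, q) => length (parrows q))"
  obtain p q p' q' where xy: "x = (p, q)" "y = (p', q')" by (cases x; cases y)
  have zz: "path_comp p q = path_comp p' q'" using x y xy by (auto simp: splits_def)
  then have s: "psource q = psource q'" "ptarget p = ptarget p'" "parrows q @ parrows p = parrows q' @ parrows p'"
   by (simp_all add: path_comp_def)
  then have ar: "parrows q = parrows q'" "parrows p = parrows p'" using eq xy by simp_all
  have "ptarget q = ptarget q'"
   using x y xy s(1) ar(1) by (auto simp: splits_def qpaths_iff intro: cas_unique[of Q "psource q'" "parrows q'"])
  then show "x = y" using x y xy s ar by (simp add: splits_def qpath_eq_iff)
 qed
qed (auto simp: splits_def)

lemma splits_outside: "z \<notin> qpaths Q ==> splits Q z = {}"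
 by (auto simp: splits_def path_comp_in_qpaths)

context ring
begin

lemma finsum_Sigma:
 assumes "finite I" "!!i. i : I ==> finite (B i)" "!!i j. i : I ==> j : B i ==> f i j : car R"
 shows "finsum R (%i. finsum R (f i) (B i)) I = finsum R (%(i, j). f i j) (Sigma I B)"
 using assms
proof (induction I)
 case empty
 then show ?case by simp
next
 case (insert i I)
 have cl: "f i : B i \<rightarrow> car R" using insert.prems(2) by auto
 have clI: "(%i. finsum R (f i) (B i)) : I \<rightarrow> car R" using insert.prems(2) by (auto intro!: finsum_closed)
 have 1: "finsum R (%(i, j). f i j) (Pair i ` B i) = finsum R (f i) (B i)"
 proof -
  have "(%(i, j). f i j) : Pair i ` B i \<rightarrow> car R" using insert.prems(2) by auto
  from finsum_reindex[OF this] show ?thesis by (simp add: inj_on_def)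
 qed
 have 2: "finsum R (%i. finsum R (f i) (B i)) I = finsum R (%(i, j). f i j) (Sigma I B)"
  by (rule insert.IH) (use insert.prems in auto)
 have S: "Sigma (insert i I) B = Pair i ` B i \<union> Sigma I B" by auto
 have "finsum R (%(i, j). f i j) (Sigma (insert i I) B) = finsum R (f i) (B i) \<oplus> finsum R (%(i, j). f i j) (Sigma I B)"
  unfolding S 1[symmetric]
  by (rule finsum_Un_disjoint) (use insert in auto)
 then show ?case using 2 finsum_insert[OF insert.hyps clI] cl by simp
qed

end

locale quiver_path_algebra = K: field K + Q: fin_digraph Q for K :: "'k ring" and Q :: "('v, 'e) pre_digraph"
begin

abbreviation "R \<equiv> path_algebra K Q"

abbreviation rmult (infixl "\<star>" 70) where "f \<star> g \<equiv> f \<otimes>\<^bsub>R\<^esub> g"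
abbreviation rsmult (infixl "\<bullet>" 70) where "c \<bullet> f \<equiv> c \<odot>\<^bsub>R\<^esub> f"

lemma carrier_iff: "f : car R \<longleftrightarrow> (ALL p. f p : car K) & finite {p. f p ~= \<zero>\<^bsub>K\<^esub>} & (ALL p. p \<notin> qpaths Q --> f p = \<zero>\<^bsub>K\<^esub>)"
 by (simp add: path_algebra_def)

lemma closed: "f : car R ==> f p : car K" unfolding carrier_iff by blast

lemma outside: "f : car R ==> p \<notin> qpaths Q ==> f p = \<zero>\<^bsub>K\<^esub>" unfolding carrier_iff by blast

lemma ops:
 "(f \<oplus>\<^bsub>R\<^esub> g) = (%p. f p \<oplus>\<^bsub>K\<^esub> g p)" "\<zero>\<^bsub>R\<^esub> = (%p. \<zero>\<^bsub>K\<^esub>)" "c \<bullet> f = (%p. c \<otimes>\<^bsub>K\<^esub> f p)"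
 "(f \<star> g) z = finsum K (%(p, q). f p \<otimes>\<^bsub>K\<^esub> g q) (splits Q z)"
 "\<one>\<^bsub>R\<^esub> = (%p. if p : qpaths Q & parrows p = [] then \<one>\<^bsub>K\<^esub> else \<zero>\<^bsub>K\<^esub>)"
 by (simp_all add: path_algebra_def splits_def path_comp_def)

lemma trivial_path: "p : qpaths Q & parrows p = [] \<longleftrightarrow> (EX v:verts Q. p = (v, [], v))"
 by (auto simp: qpaths_iff qpath_eq_iff pre_digraph.cas.simps) (auto simp: psource_def ptarget_def parrows_def)

lemma qpath_ends: assumes "p : qpaths Q" shows "psource p : verts Q" "ptarget p : verts Q"
proof -
 have "v : verts Q" if "u : verts Q" "set l <= arcs Q" "pre_digraph.cas Q u l v" for u l v
  using that
 proof (induction l arbitrary: u)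
  case (Cons a l)
  show ?case by (rule Cons.IH[of "head Q a"]) (use Cons.prems in \<open>simp_all add: pre_digraph.cas.simps\<close>)
 qed (simp add: pre_digraph.cas.simps)
 then show "ptarget p : verts Q" using assms by (auto simp: qpaths_iff)
qed (use assms in \<open>simp add: qpaths_iff\<close>)

lemma add_in: assumes f: "f : car R" and g: "g : car R" shows "f \<oplus>\<^bsub>R\<^esub> g : car R"
proof -
 have "{p. f p \<oplus>\<^bsub>K\<^esub> g p ~= \<zero>\<^bsub>K\<^esub>} <= {p. f p ~= \<zero>\<^bsub>K\<^esub>} \<union> {p. g p ~= \<zero>\<^bsub>K\<^esub>}" by auto
 then have "finite {p. f p \<oplus>\<^bsub>K\<^esub> g p ~= \<zero>\<^bsub>K\<^esub>}" using f g by (auto simp: carrier_iff intro: finite_subset)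
 then show ?thesis using f g by (simp add: carrier_iff ops)
qed

lemma smult_in: assumes c: "c : car K" and f: "f : car R" shows "c \<bullet> f : car R"
proof -
 have "{p. c \<otimes>\<^bsub>K\<^esub> f p ~= \<zero>\<^bsub>K\<^esub>} <= {p. f p ~= \<zero>\<^bsub>K\<^esub>}" using c by auto
 then have "finite {p. c \<otimes>\<^bsub>K\<^esub> f p ~= \<zero>\<^bsub>K\<^esub>}" using f by (auto simp: carrier_iff intro: finite_subset)
 then show ?thesis using f c by (simp add: carrier_iff ops)
qed

lemma mult_in: assumes f: "f : car R" and g: "g : car R" shows "f \<star> g : car R"
proof -
 have cl: "(%(p, q). f p \<otimes>\<^bsub>K\<^esub> g q) : splits Q z \<rightarrow> car K" for z using f g by (auto simp: closed)
 have "{z. (f \<star> g) z ~= \<zero>\<^bsub>K\<^esub>} <= (%(p, q). path_comp p q) ` ({p. f p ~= \<zero>\<^bsub>K\<^esub>} \<times> {q. g q ~= \<zero>\<^bsub>K\<^esub>})"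
 proof
  fix z assume z: "z : {z. (f \<star> g) z ~= \<zero>\<^bsub>K\<^esub>}"
  have "EX (p, q):splits Q z. f p \<otimes>\<^bsub>K\<^esub> g q ~= \<zero>\<^bsub>K\<^esub>"
  proof (rule ccontr)
   assume "\<not> ?thesis"
   then have "(f \<star> g) z = \<zero>\<^bsub>K\<^esub>" unfolding ops by (intro K.add.finprod_one_eqI) auto
   then show False using z by simp
  qed
  then obtain p q where "(p, q) : splits Q z" "f p \<otimes>\<^bsub>K\<^esub> g q ~= \<zero>\<^bsub>K\<^esub>" by blast
  then have "z = path_comp p q" "f p ~= \<zero>\<^bsub>K\<^esub>" "g q ~= \<zero>\<^bsub>K\<^esub>" using f g by (auto simp: splits_def closed)
  then show "z : (%(p, q). path_comp p q) ` ({p. f p ~= \<zero>\<^bsub>K\<^esub>} \<times> {q. g q ~= \<zero>\<^bsub>K\<^esub>})" by auto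
 qed
 then have "finite {z. (f \<star> g) z ~= \<zero>\<^bsub>K\<^esub>}"
  by (rule finite_subset) (use f g in \<open>auto simp: carrier_iff\<close>)
 moreover have "(f \<star> g) z : car K" for z unfolding ops by (rule K.finsum_closed[OF cl])
 moreover have "(f \<star> g) z = \<zero>\<^bsub>K\<^esub>" if "z \<notin> qpaths Q" for z unfolding ops splits_outside[OF that] by simp
 ultimately show ?thesis by (simp add: carrier_iff)
qed

lemma one_in: "\<one>\<^bsub>R\<^esub> : car R"
proof -
 have "{p. \<one>\<^bsub>R\<^esub> p ~= \<zero>\<^bsub>K\<^esub>} <= (%v. (v, [], v)) ` verts Q" unfolding ops using trivial_path by (auto split: if_splits)
 then have "finite {p. \<one>\<^bsub>R\<^esub> p ~= \<zero>\<^bsub>K\<^esub>}" by (rule finite_subset) simp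
 then show ?thesis by (auto simp: carrier_iff ops)
qed

lemma finsum_splits_single:
 assumes p: "(p, q) : splits Q z" and cl: "!!p q. F p q : car K"
  and z: "!!p' q'. (p', q') : splits Q z ==> (p', q') ~= (p, q) ==> F p' q' = \<zero>\<^bsub>K\<^esub>"
 shows "finsum K (%(p, q). F p q) (splits Q z) = F p q"
proof -
 have "finsum K (%(p, q). F p q) (splits Q z) = finsum K (%(p, q). F p q) {(p, q)}"
 proof (rule K.add.finprod_mono_neutral_cong_right)
  fix x assume "x : splits Q z - {(p, q)}"
  then show "(%(p, q). F p q) x = \<zero>\<^bsub>K\<^esub>" using z[of "fst x" "snd x"] by (simp add: split_beta)
 qed (use p cl in \<open>simp_all add: finite_splits Pi_iff split_beta\<close>)
 then show ?thesis using cl by simp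
qed

lemma one_mult: assumes f: "f : car R" shows "\<one>\<^bsub>R\<^esub> \<star> f = f" "f \<star> \<one>\<^bsub>R\<^esub> = f"
proof -
 have o: "\<one>\<^bsub>R\<^esub> p = \<one>\<^bsub>K\<^esub>" if "p : qpaths Q" "parrows p = []" for p using that by (simp add: ops)
 have o0: "\<one>\<^bsub>R\<^esub> p = \<zero>\<^bsub>K\<^esub>" if "\<not> (p : qpaths Q & parrows p = [])" for p using that by (simp only: ops if_False)
 have ends: "psource p = ptarget p" if "p : qpaths Q" "parrows p = []" for p
  using that by (simp add: qpaths_iff pre_digraph.cas.simps)
 have triv: "psource (v, [], v) = v" "ptarget (v, [], v) = v" "parrows (v, [], v) = []" for v :: 'v
  by (simp_all add: psource_def ptarget_def parrows_def)
 have tq: "(v, [], v) : qpaths Q" if "v : verts Q" for v using that trivial_path by blast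
 have "(\<one>\<^bsub>R\<^esub> \<star> f) z = f z & (f \<star> \<one>\<^bsub>R\<^esub>) z = f z" for z
 proof (cases "z : qpaths Q")
  case False
  then show ?thesis using outside[OF f] outside[OF mult_in[OF one_in f]] outside[OF mult_in[OF f one_in]] by simp
 next
  case True
  let ?t = "(ptarget z, [], ptarget z)" and ?s = "(psource z, [], psource z)"
  note ends_z = qpath_ends[OF True]
  have t: "(?t, z) : splits Q z" "(z, ?s) : splits Q z"
   using True tq ends_z by (auto simp: splits_def triv qpath_eq_iff)
  have "(\<one>\<^bsub>R\<^esub> \<star> f) z = \<one>\<^bsub>R\<^esub> ?t \<otimes>\<^bsub>K\<^esub> f z"
   unfolding ops(4)
  proof (rule finsum_splits_single[OF t(1)])
   show "\<one>\<^bsub>R\<^esub> p \<otimes>\<^bsub>K\<^esub> f q : car K" for p q using closed[OF one_in] closed[OF f] by simp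
   fix p q assume pq: "(p, q) : splits Q z" "(p, q) ~= (?t, z)"
   have "\<not> (p : qpaths Q & parrows p = [])"
   proof
    assume a: "p : qpaths Q & parrows p = []"
    then have "p = ?t & q = z" using pq(1) ends[of p] by (auto simp: splits_def qpath_eq_iff triv)
    then show False using pq(2) by simp
   qed
   then show "\<one>\<^bsub>R\<^esub> p \<otimes>\<^bsub>K\<^esub> f q = \<zero>\<^bsub>K\<^esub>" using o0 closed[OF f] by simp
  qed
  moreover have "(f \<star> \<one>\<^bsub>R\<^esub>) z = f z \<otimes>\<^bsub>K\<^esub> \<one>\<^bsub>R\<^esub> ?s"
   unfolding ops(4)
  proof (rule finsum_splits_single[OF t(2)])
   show "f p \<otimes>\<^bsub>K\<^esub> \<one>\<^bsub>R\<^esub> q : car K" for p q using closed[OF one_in] closed[OF f] by simp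
   fix p q assume pq: "(p, q) : splits Q z" "(p, q) ~= (z, ?s)"
   have "\<not> (q : qpaths Q & parrows q = [])"
   proof
    assume a: "q : qpaths Q & parrows q = []"
    then have "q = ?s & p = z" using pq(1) ends[of q] by (auto simp: splits_def qpath_eq_iff triv)
    then show False using pq(2) by simp
   qed
   then show "f p \<otimes>\<^bsub>K\<^esub> \<one>\<^bsub>R\<^esub> q = \<zero>\<^bsub>K\<^esub>" using o0 closed[OF f] by simp
  qed
  ultimately show ?thesis using o[OF tq[OF ends_z(2)] triv(3)] o[OF tq[OF ends_z(1)] triv(3)] closed[OF f, of z] by simp
 qed
 then show "\<one>\<^bsub>R\<^esub> \<star> f = f" "f \<star> \<one>\<^bsub>R\<^esub> = f" by auto
qed

text \<open>Both sides are sums over the factorisations of z into three paths. Double sums are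
  merged into sums over dependent pairs and matched by rebracketing.\<close>

lemma mult_assoc:
 assumes f: "f : car R" and g: "g : car R" and h: "h : car R"
 shows "(f \<star> g) \<star> h = f \<star> (g \<star> h)"
proof (rule ext)
 fix z
 note cl = closed[OF f] closed[OF g] closed[OF h]
 let ?S1 = "Sigma (splits Q z) (%(p, c). splits Q p)" and ?S2 = "Sigma (splits Q z) (%(a, m). splits Q m)"
 let ?r = "%((a, m), (b, c)). ((path_comp a b, c), (a, b))"
 let ?F = "%((p, c), (a, b)). f a \<otimes>\<^bsub>K\<^esub> g b \<otimes>\<^bsub>K\<^esub> h c"
 have "((f \<star> g) \<star> h) z
   = finsum K (%x. finsum K (%y. ?F (x, y)) ((%(p, c). splits Q p) x)) (splits Q z)"
  unfolding ops(4)
 proof (rule K.finsum_cong')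
  fix x assume "x : splits Q z"
  obtain p c where x: "x = (p, c)" by (cases x)
  have "finsum K (%(p, q). f p \<otimes>\<^bsub>K\<^esub> g q) (splits Q p) \<otimes>\<^bsub>K\<^esub> h c
   = finsum K (%y. ?F ((p, c), y)) (splits Q p)"
   by (subst K.finsum_ldistr[OF finite_splits]) (auto simp: cl split_beta intro!: K.finsum_cong')
  then show "(%(p, q). finsum K (%(p, q). f p \<otimes>\<^bsub>K\<^esub> g q) (splits Q p) \<otimes>\<^bsub>K\<^esub> h q) x
   = finsum K (%y. ?F (x, y)) ((%(p, c). splits Q p) x)"
   unfolding x by simp
 qed (auto simp: cl split_beta intro!: K.finsum_closed)
 also have "\<dots> = finsum K (%(x, y). ?F (x, y)) ?S1"
  by (rule K.finsum_Sigma) (auto simp: finite_splits cl)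
 \<comment> \<open>?S1 records the intermediate product of the left two factors and ?S2 that of the
   right two; each is computable from the triple, so ?r merely changes the bracketing.\<close>
 also have "?S1 = ?r ` ?S2"
 proof (rule equalityI; rule subsetI)
  fix x assume "x : ?S1"
  then obtain p c a b where x: "x = ((p, c), (a, b))" and s: "(p, c) : splits Q z" "(a, b) : splits Q p" by auto
  have "((a, path_comp b c), (b, c)) : ?S2"
   using s by (auto simp: splits_def path_comp_in_qpaths path_comp_assoc)
  moreover have "x = ?r ((a, path_comp b c), (b, c))" using x s by (auto simp: splits_def)
  ultimately show "x : ?r ` ?S2" by (rule rev_image_eqI)
 next
  fix x assume "x : ?r ` ?S2"
  then obtain a m b c where x: "x = ((path_comp a b, c), (a, b))" and s: "(a, m) : splits Q z" "(b, c) : splits Q m" by auto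
  show "x : ?S1" using x s by (auto simp: splits_def path_comp_in_qpaths path_comp_assoc)
 qed
 also have "finsum K (%(x, y). ?F (x, y)) (?r ` ?S2) = finsum K (%x. (%(x, y). ?F (x, y)) (?r x)) ?S2"
  by (rule K.finsum_reindex) (auto simp: cl inj_on_def splits_def)
 also have "\<dots> = finsum K (%(x, y). (%((a, m), (b, c)). f a \<otimes>\<^bsub>K\<^esub> (g b \<otimes>\<^bsub>K\<^esub> h c)) (x, y)) ?S2"
  by (rule K.finsum_cong') (auto simp: cl K.m_assoc)
 also have "\<dots> = finsum K (%x. finsum K (%y. (%((a, m), (b, c)). f a \<otimes>\<^bsub>K\<^esub> (g b \<otimes>\<^bsub>K\<^esub> h c)) (x, y)) ((%(a, m). splits Q m) x)) (splits Q z)"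
  by (rule K.finsum_Sigma[symmetric]) (auto simp: finite_splits cl)
 also have "\<dots> = (f \<star> (g \<star> h)) z"
  unfolding ops(4)
 proof (rule K.finsum_cong')
  fix x assume "x : splits Q z"
  obtain a m where x: "x = (a, m)" by (cases x)
  have "finsum K (%y. (%((a, m), (b, c)). f a \<otimes>\<^bsub>K\<^esub> (g b \<otimes>\<^bsub>K\<^esub> h c)) ((a, m), y)) (splits Q m)
   = f a \<otimes>\<^bsub>K\<^esub> finsum K (%(p, q). g p \<otimes>\<^bsub>K\<^esub> h q) (splits Q m)"
   by (subst K.finsum_rdistr[OF finite_splits]) (auto simp: cl split_beta intro!: K.finsum_cong')
  then show "finsum K (%y. (%((a, m), (b, c)). f a \<otimes>\<^bsub>K\<^esub> (g b \<otimes>\<^bsub>K\<^esub> h c)) (x, y)) ((%(a, m). splits Q m) x)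
   = (%(p, q). f p \<otimes>\<^bsub>K\<^esub> finsum K (%(p, q). g p \<otimes>\<^bsub>K\<^esub> h q) (splits Q q)) x"
   unfolding x by simp
 qed (auto simp: cl split_beta intro!: K.finsum_closed)
 finally show "((f \<star> g) \<star> h) z = (f \<star> (g \<star> h)) z" .
qed

lemma mult_smult:
 assumes c: "c : car K" and f: "f : car R" and g: "g : car R"
 shows "(c \<bullet> f) \<star> g = c \<bullet> (f \<star> g)" "f \<star> (c \<bullet> g) = c \<bullet> (f \<star> g)"
proof -
 note cl = closed[OF f] closed[OF g] c
 have "((c \<bullet> f) \<star> g) z = (c \<bullet> (f \<star> g)) z & (f \<star> (c \<bullet> g)) z = (c \<bullet> (f \<star> g)) z" for z
  unfolding ops(3,4)
  by (subst (1 2) K.finsum_rdistr[OF finite_splits])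
   (auto simp: cl split_beta K.m_assoc K.m_lcomm intro!: K.finsum_cong')
 then show "(c \<bullet> f) \<star> g = c \<bullet> (f \<star> g)" "f \<star> (c \<bullet> g) = c \<bullet> (f \<star> g)" by auto
qed

lemma distrib:
 assumes f: "f : car R" and g: "g : car R" and h: "h : car R"
 shows "(f \<oplus>\<^bsub>R\<^esub> g) \<star> h = f \<star> h \<oplus>\<^bsub>R\<^esub> g \<star> h" "h \<star> (f \<oplus>\<^bsub>R\<^esub> g) = h \<star> f \<oplus>\<^bsub>R\<^esub> h \<star> g"
proof -
 note cl = closed[OF f] closed[OF g] closed[OF h]
 have "((f \<oplus>\<^bsub>R\<^esub> g) \<star> h) z = (f \<star> h \<oplus>\<^bsub>R\<^esub> g \<star> h) z" for z
 proof -
  have "((f \<oplus>\<^bsub>R\<^esub> g) \<star> h) z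
    = finsum K (%x. (%(p, q). f p \<otimes>\<^bsub>K\<^esub> h q) x \<oplus>\<^bsub>K\<^esub> (%(p, q). g p \<otimes>\<^bsub>K\<^esub> h q) x) (splits Q z)"
   unfolding ops(1,4) by (rule K.finsum_cong') (auto simp: cl K.l_distr)
  also have "\<dots> = (f \<star> h \<oplus>\<^bsub>R\<^esub> g \<star> h) z" unfolding ops(1,4) by (rule K.finsum_addf) (auto simp: cl)
  finally show ?thesis .
 qed
 moreover have "(h \<star> (f \<oplus>\<^bsub>R\<^esub> g)) z = (h \<star> f \<oplus>\<^bsub>R\<^esub> h \<star> g) z" for z
 proof -
  have "(h \<star> (f \<oplus>\<^bsub>R\<^esub> g)) z
    = finsum K (%x. (%(p, q). h p \<otimes>\<^bsub>K\<^esub> f q) x \<oplus>\<^bsub>K\<^esub> (%(p, q). h p \<otimes>\<^bsub>K\<^esub> g q) x) (splits Q z)"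
   unfolding ops(1,4) by (rule K.finsum_cong') (auto simp: cl K.r_distr)
  also have "\<dots> = (h \<star> f \<oplus>\<^bsub>R\<^esub> h \<star> g) z" unfolding ops(1,4) by (rule K.finsum_addf) (auto simp: cl)
  finally show ?thesis .
 qed
 ultimately show "(f \<oplus>\<^bsub>R\<^esub> g) \<star> h = f \<star> h \<oplus>\<^bsub>R\<^esub> g \<star> h" "h \<star> (f \<oplus>\<^bsub>R\<^esub> g) = h \<star> f \<oplus>\<^bsub>R\<^esub> h \<star> g" by auto
qed

lemma ring_path_algebra: "ring R"
proof (rule ringI)
 show "abelian_group R"
 proof (rule abelian_groupI)
  fix f assume f: "f : car R"
  have m: "(%p. \<ominus>\<^bsub>K\<^esub> f p) : car R"
  proof -
   have "{p. \<ominus>\<^bsub>K\<^esub> f p ~= \<zero>\<^bsub>K\<^esub>} <= {p. f p ~= \<zero>\<^bsub>K\<^esub>}" by auto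
   then show ?thesis using f by (auto simp: carrier_iff intro: finite_subset)
  qed
  show "EX g:car R. g \<oplus>\<^bsub>R\<^esub> f = \<zero>\<^bsub>R\<^esub>" by (rule bexI[OF _ m]) (simp add: ops closed[OF f] K.l_neg)
 next
  show "\<zero>\<^bsub>R\<^esub> : car R" by (simp add: carrier_iff ops)
 qed (simp_all only: ops(1,2) closed add_in[unfolded ops(1)] K.a_ac K.l_zero)
 show "monoid R" by (rule monoidI) (simp_all add: mult_in one_in mult_assoc one_mult)
qed (simp_all add: distrib)

end

sublocale quiver_path_algebra \<subseteq> R: ring "path_algebra K Q" by (rule ring_path_algebra)

lemma abelian_group_cong:
 assumes "abelian_group V" "car W = car V" "add W = add V" "zero W = zero V"
 shows "abelian_group W"
proof -
 interpret V: abelian_group V by (rule assms(1))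
 note eq = assms(2-4)
 show ?thesis
 proof (rule abelian_groupI)
  show "EX y:car W. y \<oplus>\<^bsub>W\<^esub> x = \<zero>\<^bsub>W\<^esub>" if "x : car W" for x
  proof -
   have x: "x : car V" using that by (simp add: eq)
   show ?thesis unfolding eq by (rule bexI[OF _ V.a_inv_closed[OF x]]) (rule V.l_neg[OF x])
  qed
 qed (simp_all add: eq V.a_ac)
qed

lemma fin_dim_space_cong:
 assumes V: "fin_dim_space K V" and eq: "car W = car V" "add W = add V" "zero W = zero V"
  "!!c x. c : car K ==> x : car V ==> c \<odot>\<^bsub>W\<^esub> x = c \<odot>\<^bsub>V\<^esub> x"
 shows "fin_dim_space K W"
proof -
 interpret V: vectorspace K V by (rule fdsD(1)[OF V])
 have "abelian_group W"
  by (rule abelian_group_cong[of V]) (use V.module_axioms eq in \<open>simp_all add: Module.module_def\<close>)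
 then have "Module.module K W"
  by (intro Module.module.intro V.R.is_cring Module.module_axioms.intro)
   (simp_all add: eq V.smult_l_distr V.smult_r_distr V.smult_assoc1)
 then have W: "vectorspace K W" unfolding vectorspace_def using V.field_axioms by simp
 have "(%x. x) : module_hom K V W" by (rule homI) (simp_all add: eq)
 from fin_dim_space_surj[OF V W this] show ?thesis by (simp add: eq(1))
qed

context quiver_path_algebra
begin

lemma scalar_one:
 assumes "c : car K" "x : car R"
 shows "c \<bullet> x = (c \<bullet> \<one>\<^bsub>R\<^esub>) \<star> x" "(c \<bullet> \<one>\<^bsub>R\<^esub>) \<star> x = x \<star> (c \<bullet> \<one>\<^bsub>R\<^esub>)"
 using mult_smult[OF assms(1) one_in assms(2)] mult_smult[OF assms one_in] assms one_mult by simp_all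

text \<open>All operations of the quotient are expressed through representatives in R, so that the
  later calculations can take place in the path algebra.\<close>

lemma quot_ops:
 assumes I: "ideal I R"
 shows "ring (quot_algebra R I)"
  and "!!X. X : car (quot_algebra R I) ==> EX x:car R. X = I +>\<^bsub>R\<^esub> x"
  and "!!x. x : car R ==> I +>\<^bsub>R\<^esub> x : car (quot_algebra R I)"
  and "!!x y. x : car R ==> y : car R ==>
   (I +>\<^bsub>R\<^esub> x) \<otimes>\<^bsub>quot_algebra R I\<^esub> (I +>\<^bsub>R\<^esub> y) = I +>\<^bsub>R\<^esub> (x \<star> y)"
  and "!!x y. x : car R ==> y : car R ==>
   (I +>\<^bsub>R\<^esub> x) \<oplus>\<^bsub>quot_algebra R I\<^esub> (I +>\<^bsub>R\<^esub> y) = I +>\<^bsub>R\<^esub> (x \<oplus>\<^bsub>R\<^esub> y)"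
  and "\<one>\<^bsub>quot_algebra R I\<^esub> = I +>\<^bsub>R\<^esub> \<one>\<^bsub>R\<^esub>" and "\<zero>\<^bsub>quot_algebra R I\<^esub> = I +>\<^bsub>R\<^esub> \<zero>\<^bsub>R\<^esub>"
  and "!!c x. c : car K ==> x : car R ==> c \<odot>\<^bsub>quot_algebra R I\<^esub> (I +>\<^bsub>R\<^esub> x) = I +>\<^bsub>R\<^esub> (c \<bullet> x)"
proof -
 let ?A = "quot_algebra R I"
 interpret I: ideal I R by (rule I)
 interpret QI: ring "R Quot I" by (rule I.quotient_is_ring)
 have f: "car ?A = car (R Quot I)" "mult ?A = mult (R Quot I)" "one ?A = one (R Quot I)" "zero ?A = zero (R Quot I)" "add ?A = add (R Quot I)"
  by (simp_all add: quot_algebra_def)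
 show "ring ?A"
 proof (rule ringI)
  show "abelian_group ?A"
   by (rule abelian_group_cong[of "R Quot I"]) (simp_all add: f QI.abelian_group_axioms)
  show "monoid ?A" by (rule monoidI) (simp_all add: f QI.m_assoc)
 qed (simp_all add: f QI.l_distr QI.r_distr)
 show "!!X. X : car ?A ==> EX x:car R. X = I +>\<^bsub>R\<^esub> x"
  unfolding f FactRing_def A_RCOSETS_def' by auto
 show "\<zero>\<^bsub>?A\<^esub> = I +>\<^bsub>R\<^esub> \<zero>\<^bsub>R\<^esub>" using R.a_coset_add_zero[OF I.a_subset] by (simp add: f FactRing_def)
 show "!!x. x : car R ==> I +>\<^bsub>R\<^esub> x : car ?A" unfolding f FactRing_def A_RCOSETS_def' by auto
 note sm = scalar_one
 have s1: "c \<bullet> \<one>\<^bsub>R\<^esub> : car R" if "c : car K" for c by (rule smult_in[OF that one_in])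
 show "!!x y. x : car R ==> y : car R ==> (I +>\<^bsub>R\<^esub> x) \<otimes>\<^bsub>?A\<^esub> (I +>\<^bsub>R\<^esub> y) = I +>\<^bsub>R\<^esub> (x \<star> y)"
  using I.rcoset_mult_add by (simp add: quot_algebra_def FactRing_def)
 show "!!x y. x : car R ==> y : car R ==> (I +>\<^bsub>R\<^esub> x) \<oplus>\<^bsub>?A\<^esub> (I +>\<^bsub>R\<^esub> y) = I +>\<^bsub>R\<^esub> (x \<oplus>\<^bsub>R\<^esub> y)"
  using I.a_rcos_sum by (simp add: quot_algebra_def FactRing_def)
 show "\<one>\<^bsub>?A\<^esub> = I +>\<^bsub>R\<^esub> \<one>\<^bsub>R\<^esub>" by (simp add: quot_algebra_def FactRing_def)
 \<comment> \<open>Representatives of a coset differ by some i in I, and c i = (c 1) i stays in the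
   ideal, so scaling is independent of the representative.\<close>
 have smul: "c \<odot>\<^bsub>?A\<^esub> (I +>\<^bsub>R\<^esub> x) = I +>\<^bsub>R\<^esub> (c \<bullet> x)" if c: "c : car K" and x: "x : car R" for c x
 proof -
  have "I +>\<^bsub>R\<^esub> (c \<bullet> y) = I +>\<^bsub>R\<^esub> (c \<bullet> x)" if y: "y : I +>\<^bsub>R\<^esub> x" for y
  proof -
   obtain i where i: "i : I" "y = i \<oplus>\<^bsub>R\<^esub> x" using y unfolding a_r_coset_def' by auto
   have ic: "i : car R" using i(1) I.a_subset by auto
   have "c \<bullet> y = (c \<bullet> \<one>\<^bsub>R\<^esub>) \<star> i \<oplus>\<^bsub>R\<^esub> c \<bullet> x"
    using sm(1)[OF c, of y] sm(1)[OF c x] i(2) R.r_distr[OF ic x s1[OF c]] ic x by simp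
   moreover have "(c \<bullet> \<one>\<^bsub>R\<^esub>) \<star> i : I" by (rule I.I_l_closed[OF i(1) s1[OF c]])
   ultimately have "c \<bullet> y : I +>\<^bsub>R\<^esub> (c \<bullet> x)" unfolding a_r_coset_def' by auto
   then show ?thesis
    using R.a_repr_independence[OF _ smult_in[OF c x] I.a_subgroup] by simp
  qed
  then have "(\<Union>y\<in>I +>\<^bsub>R\<^esub> x. I +>\<^bsub>R\<^esub> (c \<bullet> y)) = (\<Union>y\<in>I +>\<^bsub>R\<^esub> x. I +>\<^bsub>R\<^esub> (c \<bullet> x))" by (rule SUP_cong[OF refl])
  moreover have "x : I +>\<^bsub>R\<^esub> x" by (rule I.a_rcos_self[OF x])
  then have "(\<Union>y\<in>I +>\<^bsub>R\<^esub> x. I +>\<^bsub>R\<^esub> (c \<bullet> x)) = I +>\<^bsub>R\<^esub> (c \<bullet> x)" by blast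
  moreover have "c \<odot>\<^bsub>?A\<^esub> (I +>\<^bsub>R\<^esub> x) = (\<Union>y\<in>I +>\<^bsub>R\<^esub> x. I +>\<^bsub>R\<^esub> (c \<bullet> y))" by (simp add: quot_algebra_def)
  ultimately show ?thesis by simp
 qed
 show "!!c x. c : car K ==> x : car R ==> c \<odot>\<^bsub>?A\<^esub> (I +>\<^bsub>R\<^esub> x) = I +>\<^bsub>R\<^esub> (c \<bullet> x)" by (rule smul)
qed

lemma kalg_quot_algebra:
 assumes I: "ideal I R" and fd: "fin_dim_space K (quot_algebra R I)"
 shows "kalg K (quot_algebra R I)"
proof -
 let ?A = "quot_algebra R I"
 note ringA = quot_ops(1)[OF I] and ex = quot_ops(2)[OF I] and cc = quot_ops(3)[OF I]
  and cm = quot_ops(4)[OF I] and ca = quot_ops(5)[OF I] and c1 = quot_ops(6)[OF I]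
  and smul = quot_ops(8)[OF I] and sm = scalar_one
 have s1: "c \<bullet> \<one>\<^bsub>R\<^esub> : car R" if "c : car K" for c by (rule smult_in[OF that one_in])
 have sA: "c \<odot>\<^bsub>?A\<^esub> \<one>\<^bsub>?A\<^esub> = I +>\<^bsub>R\<^esub> (c \<bullet> \<one>\<^bsub>R\<^esub>)" if "c : car K" for c unfolding c1 by (rule smul[OF that one_in])
 show "kalg K ?A"
 proof (rule kalg.intro)
  show "field K" by (rule K.field_axioms)
  show "ring ?A" by (rule ringA)
  show "c \<odot>\<^bsub>?A\<^esub> \<one>\<^bsub>?A\<^esub> : car ?A" if "c : car K" for c unfolding sA[OF that] by (rule cc[OF s1[OF that]])
  show "(c \<oplus>\<^bsub>K\<^esub> d) \<odot>\<^bsub>?A\<^esub> \<one>\<^bsub>?A\<^esub> = c \<odot>\<^bsub>?A\<^esub> \<one>\<^bsub>?A\<^esub> \<oplus>\<^bsub>?A\<^esub> d \<odot>\<^bsub>?A\<^esub> \<one>\<^bsub>?A\<^esub>" if "c : car K" "d : car K" for c d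
  proof -
   have "(c \<oplus>\<^bsub>K\<^esub> d) \<bullet> \<one>\<^bsub>R\<^esub> = c \<bullet> \<one>\<^bsub>R\<^esub> \<oplus>\<^bsub>R\<^esub> d \<bullet> \<one>\<^bsub>R\<^esub>"
    unfolding ops(1,3) using that closed[OF one_in] by (simp add: K.l_distr)
   then show ?thesis using that by (simp add: sA ca s1)
  qed
  show "(c \<otimes>\<^bsub>K\<^esub> d) \<odot>\<^bsub>?A\<^esub> \<one>\<^bsub>?A\<^esub> = (c \<odot>\<^bsub>?A\<^esub> \<one>\<^bsub>?A\<^esub>) \<otimes>\<^bsub>?A\<^esub> (d \<odot>\<^bsub>?A\<^esub> \<one>\<^bsub>?A\<^esub>)" if "c : car K" "d : car K" for c d
  proof -
   have "(c \<otimes>\<^bsub>K\<^esub> d) \<bullet> \<one>\<^bsub>R\<^esub> = c \<bullet> (d \<bullet> \<one>\<^bsub>R\<^esub>)"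
    unfolding ops(3) using that closed[OF one_in] by (simp add: K.m_assoc)
   then show ?thesis using that by (simp add: sA cm s1 sm(1)[OF that(1) s1[OF that(2)]])
  qed
  show "\<one>\<^bsub>K\<^esub> \<odot>\<^bsub>?A\<^esub> \<one>\<^bsub>?A\<^esub> = \<one>\<^bsub>?A\<^esub>"
  proof -
   have "\<one>\<^bsub>K\<^esub> \<bullet> \<one>\<^bsub>R\<^esub> = \<one>\<^bsub>R\<^esub>" unfolding ops(3) using closed[OF one_in] by simp
   then show ?thesis unfolding sA[OF K.one_closed] by (simp only: c1)
  qed
  show "(c \<odot>\<^bsub>?A\<^esub> \<one>\<^bsub>?A\<^esub>) \<otimes>\<^bsub>?A\<^esub> a = a \<otimes>\<^bsub>?A\<^esub> (c \<odot>\<^bsub>?A\<^esub> \<one>\<^bsub>?A\<^esub>)" if c: "c : car K" and a: "a : car ?A" for c a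
  proof -
   obtain x where x: "x : car R" "a = I +>\<^bsub>R\<^esub> x" using ex[OF a] by blast
   show ?thesis unfolding x(2) sA[OF c] cm[OF s1[OF c] x(1)] cm[OF x(1) s1[OF c]] sm(2)[OF c x(1)] ..
  qed
  show "fin_dim_space K (restrict_scalars ?A (regular_module ?A))"
  proof (rule fin_dim_space_cong[OF fd])
   fix c X assume c: "c : car K" and "X : car ?A"
   then obtain x where x: "x : car R" "X = I +>\<^bsub>R\<^esub> x" using ex by blast
   show "c \<odot>\<^bsub>restrict_scalars ?A (regular_module ?A)\<^esub> X = c \<odot>\<^bsub>?A\<^esub> X"
    unfolding restrict_scalars_simps regular_module_simps x(2) sA[OF c] cm[OF s1[OF c] x(1)] smul[OF c x(1)] sm(1)[OF c x(1), symmetric] ..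
  qed (simp_all add: restrict_scalars_def regular_module_def)
 qed
qed

end

lemma quiver_algebra_kalg:
 assumes K: "field K" and A: "quiver_algebra K A"
 shows "kalg K A"
proof -
 obtain Q \<rho> where Q: "fin_digraph Q" "\<rho> <= quiver_relations K Q"
  and A': "A = quot_algebra (path_algebra K Q) (genideal (path_algebra K Q) \<rho>)" and fd: "fin_dim_space K A"
  using A unfolding quiver_algebra_def by blast
 interpret P: quiver_path_algebra K Q by (intro quiver_path_algebra.intro K Q)
 have "ideal (genideal (path_algebra K Q) \<rho>) (path_algebra K Q)"
  by (rule P.R.genideal_ideal) (use Q(2) in \<open>auto simp: quiver_relations_def\<close>)
 then show ?thesis using P.kalg_quot_algebra fd A' by blast
qed

section \<open>Simple modules of algebras with square-zero radical\<close>

context kalg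
begin

text \<open>The hypotheses say that \<open>N\<close> is a square-zero ideal and that the \<open>e v\<close> split \<open>A / N\<close> into copies of \<open>K\<close>;
  the simple modules are then the one-dimensional modules given by the characters \<open>ch v\<close>.\<close>

lemma simple_characters:
 fixes e :: "'v => 'a"
 assumes finV: "finite V" and e: "!!v. v : V ==> e v : car A"
  and ch: "!!v b. v : V ==> b : car A ==> ch v b : car K"
   "!!v b c. v : V ==> b : car A ==> c : car A ==> ch v (b \<oplus>\<^bsub>A\<^esub> c) = ch v b \<oplus>\<^bsub>K\<^esub> ch v c"
   "!!v b c. v : V ==> b : car A ==> c : car A ==> ch v (b \<cdot> c) = ch v b \<otimes>\<^bsub>K\<^esub> ch v c"
   "!!v c. v : V ==> c : car K ==> ch v (sc c) = c"
   "!!u v. u : V ==> v : V ==> ch u (e v) = (if u = v then \<one>\<^bsub>K\<^esub> else \<zero>\<^bsub>K\<^esub>)"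
  and N: "N <= car A" "!!b r. b : car A ==> r : N ==> b \<cdot> r : N & r \<cdot> b : N"
   "!!r s. r : N ==> s : N ==> r \<cdot> s = \<zero>\<^bsub>A\<^esub>"
  and eN: "!!v b. v : V ==> b : car A ==> EX r:N. b \<cdot> e v = (sc (ch v b)) \<cdot> e v \<oplus>\<^bsub>A\<^esub> r"
  and gen: "!!(M :: ('k, 'a) smod) y. lmod M ==> y : car M ==>
   (!!v. v : V ==> e v \<odot>\<^bsub>M\<^esub> y = \<zero>\<^bsub>M\<^esub>) ==> y = \<zero>\<^bsub>M\<^esub>"
 shows "num_simples K A = card V"
proof -
 \<comment> \<open>P v is the type of a simple module: it contains a common eigenvector of A whose
   eigenvalues form the character of v.\<close>
 define P where "P v M \<longleftrightarrow> (EX z:car M. z ~= \<zero>\<^bsub>M\<^esub> & (ALL b:car A. b \<odot>\<^bsub>M\<^esub> z = (sc (ch v b)) \<odot>\<^bsub>M\<^esub> z))"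
  for v and M :: "('k, 'a) smod"
 let ?S = "{S :: ('k, 'a) smod. simple_module K A S}"
 let ?r = "{(M, N). M : ?S & N : ?S & mod_iso A M N}"
 have fS: "fdm S" and lS: "lmod S" and nz: "car S ~= {\<zero>\<^bsub>S\<^esub>}" if "simple_module K A S" for S :: "('k, 'a) smod"
  using that fdD(1) by (auto simp: simple_module_def)
 have exP: "EX v:V. P v S" if S: "simple_module K A S" for S
 proof -
  interpret S: left_module A S by (rule lS[OF S])
  \<comment> \<open>The vectors killed by N form a submodule, which is nonzero because N has square
    zero. By simplicity N annihilates all of S.\<close>
  let ?U = "{y : car S. ALL r:N. r \<odot>\<^bsub>S\<^esub> y = \<zero>\<^bsub>S\<^esub>}"
  have Nc: "r : car A" if "r : N" for r using N(1) that by blast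
  have subU: "submod A S ?U"
  proof (rule submodI[OF lS[OF S]])
   show "b \<odot>\<^bsub>S\<^esub> y : ?U" if "b : car A" "y : ?U" for b y
   proof -
    have "r \<odot>\<^bsub>S\<^esub> (b \<odot>\<^bsub>S\<^esub> y) = \<zero>\<^bsub>S\<^esub>" if r: "r : N" for r
    proof -
     have "(r \<cdot> b) \<odot>\<^bsub>S\<^esub> y = \<zero>\<^bsub>S\<^esub>" using N(2)[OF \<open>b : car A\<close> r] \<open>y : ?U\<close> by simp
     then show ?thesis using S.smult_assoc1[OF Nc[OF r] \<open>b : car A\<close>, of y] \<open>y : ?U\<close> by simp
    qed
    then show ?thesis using that S.smult_closed by simp
   qed
   show "x \<oplus>\<^bsub>S\<^esub> y : ?U" if "x : ?U" "y : ?U" for x y using that by (simp add: S.smult_r_distr Nc)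
   show "\<zero>\<^bsub>S\<^esub> : ?U" by (simp add: S.smult_zero_right Nc)
  qed auto
  obtain y where y: "y : car S" "y ~= \<zero>\<^bsub>S\<^esub>" using nz[OF S] S.M.zero_closed by blast
  have "?U ~= {\<zero>\<^bsub>S\<^esub>}"
  proof (cases "y : ?U")
   case True
   then show ?thesis using y(2) by blast
  next
   case False
   then obtain r where r: "r : N" "r \<odot>\<^bsub>S\<^esub> y ~= \<zero>\<^bsub>S\<^esub>" using y(1) by blast
   have "s \<odot>\<^bsub>S\<^esub> (r \<odot>\<^bsub>S\<^esub> y) = \<zero>\<^bsub>S\<^esub>" if s: "s : N" for s
    using S.smult_assoc1[OF Nc[OF s] Nc[OF r(1)] y(1)] N(3)[OF s r(1)] S.smult_zero_left[OF y(1)] by simp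
   then have "r \<odot>\<^bsub>S\<^esub> y : ?U" using S.smult_closed[OF Nc[OF r(1)] y(1)] by simp
   then show ?thesis using r(2) by blast
  qed
  then have U: "?U = car S" using S subU unfolding simple_module_def by blast
  obtain v where v: "v : V" "e v \<odot>\<^bsub>S\<^esub> y ~= \<zero>\<^bsub>S\<^esub>" using gen[OF lS[OF S] y(1)] y(2) by blast
  \<comment> \<open>Modulo N, which acts as zero, b e_v is a scalar multiple of e_v, so e_v y is an
    eigenvector.\<close>
  let ?z = "e v \<odot>\<^bsub>S\<^esub> y"
  have z: "?z : car S" by (rule S.smult_closed[OF e[OF v(1)] y(1)])
  have "b \<odot>\<^bsub>S\<^esub> ?z = (sc (ch v b)) \<odot>\<^bsub>S\<^esub> ?z" if b: "b : car A" for b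
  proof -
   obtain r where r: "r : N" "b \<cdot> e v = (sc (ch v b)) \<cdot> e v \<oplus>\<^bsub>A\<^esub> r" using eN[OF v(1) b] by blast
   have c: "ch v b \<odot>\<^bsub>A\<^esub> \<one>\<^bsub>A\<^esub> : car A" by (rule scal_closed[OF ch(1)[OF v(1) b]])
   have "r \<odot>\<^bsub>S\<^esub> y = \<zero>\<^bsub>S\<^esub>" using U y(1) r(1) by blast
   then have "(b \<cdot> e v) \<odot>\<^bsub>S\<^esub> y = ((sc (ch v b)) \<cdot> e v) \<odot>\<^bsub>S\<^esub> y"
    unfolding r(2) using S.smult_l_distr[OF A.m_closed[OF c e[OF v(1)]] Nc[OF r(1)] y(1)]
     S.smult_closed[OF A.m_closed[OF c e[OF v(1)]] y(1)] by simp
   then show ?thesis using S.smult_assoc1[OF b e[OF v(1)] y(1)] S.smult_assoc1[OF c e[OF v(1)] y(1)] by simp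
  qed
  then show ?thesis using v z unfolding P_def by blast
 qed
 have scalar_zero: "c = \<zero>\<^bsub>K\<^esub>"
  if M: "lmod M" and c: "c : car K" and z: "z : car M" "z ~= \<zero>\<^bsub>M\<^esub>" "(sc c) \<odot>\<^bsub>M\<^esub> z = \<zero>\<^bsub>M\<^esub>"
  for c z and M :: "('k, 'a) smod"
 proof (rule ccontr)
  interpret M: left_module A M by (rule M)
  assume "c ~= \<zero>\<^bsub>K\<^esub>"
  then have u: "inv\<^bsub>K\<^esub> c : car K" "inv\<^bsub>K\<^esub> c \<otimes>\<^bsub>K\<^esub> c = \<one>\<^bsub>K\<^esub>" using c K.field_Units by (auto intro: K.Units_inv_closed K.Units_l_inv)
  have "z = (sc (inv\<^bsub>K\<^esub> c)) \<odot>\<^bsub>M\<^esub> ((sc c) \<odot>\<^bsub>M\<^esub> z)"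
   using M.smult_assoc1[OF scal_closed[OF u(1)] scal_closed[OF c] z(1)] scal_mult[OF u(1) c] u(2) scal_one M.smult_one[OF z(1)] by simp
  then show False using z(2,3) M.smult_zero_right[OF scal_closed[OF u(1)]] by simp
 qed
 \<comment> \<open>The eigenvectors z and z' have the same annihilator, the kernel of the character,
   so b z |-> b z' is well defined and bijective.\<close>
 have isoP: "mod_iso A S S'" if S: "simple_module K A S" and S': "simple_module K A S'" and v: "v : V" and PS: "P v S" and PS': "P v S'" for S S' v
 proof -
  interpret S: left_module A S by (rule lS[OF S])
  interpret S': left_module A S' by (rule lS[OF S'])
  obtain z where z: "z : car S" "z ~= \<zero>\<^bsub>S\<^esub>" "ALL b:car A. b \<odot>\<^bsub>S\<^esub> z = (sc (ch v b)) \<odot>\<^bsub>S\<^esub> z" using PS unfolding P_def by blast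
  obtain z' where z': "z' : car S'" "z' ~= \<zero>\<^bsub>S'\<^esub>" "ALL b:car A. b \<odot>\<^bsub>S'\<^esub> z' = (sc (ch v b)) \<odot>\<^bsub>S'\<^esub> z'" using PS' unfolding P_def by blast
  have act: "(%b. b \<odot>\<^bsub>M\<^esub> z) : Hom (regm) M" if "lmod M" "z : car M" for M :: "('k, 'a) smod" and z
  proof -
   interpret M: left_module A M by (rule that(1))
   show ?thesis by (rule homI) (simp_all add: M.smult_closed M.smult_l_distr M.smult_assoc1 that(2))
  qed
  have im: "(%b. b \<odot>\<^bsub>M\<^esub> z) ` car (regm) = car M"
   if M: "simple_module K A M" and z: "z : car M" "z ~= \<zero>\<^bsub>M\<^esub>" for M :: "('k, 'a) smod" and z
  proof -
   interpret M: left_module A M by (rule lS[OF M])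
   have "submod A M ((%b. b \<odot>\<^bsub>M\<^esub> z) ` car (regm))"
    by (rule submod_image[OF left_module_regular lS[OF M] act[OF lS[OF M] z(1)] submod_carrier[OF left_module_regular]])
   moreover have "z : (%b. b \<odot>\<^bsub>M\<^esub> z) ` car (regm)"
    by (rule image_eqI[of _ _ "\<one>\<^bsub>A\<^esub>"]) (simp_all add: M.smult_one z(1))
   ultimately show ?thesis using M z(2) unfolding simple_module_def by blast
  qed
  have ker: "b \<odot>\<^bsub>S\<^esub> z = \<zero>\<^bsub>S\<^esub> \<longleftrightarrow> b \<odot>\<^bsub>S'\<^esub> z' = \<zero>\<^bsub>S'\<^esub>" if b: "b : car A" for b
  proof -
   have zero: "(sc (\<zero>\<^bsub>K\<^esub>)) = \<zero>\<^bsub>A\<^esub>"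
    using scal_add[OF K.zero_closed K.zero_closed] scal_closed[OF K.zero_closed] by simp
   have "b \<odot>\<^bsub>S\<^esub> z = \<zero>\<^bsub>S\<^esub> \<longleftrightarrow> ch v b = \<zero>\<^bsub>K\<^esub>"
    using z(3) b scalar_zero[OF lS[OF S] ch(1)[OF v b] z(1,2)] zero S.smult_zero_left[OF z(1)] by auto
   moreover have "b \<odot>\<^bsub>S'\<^esub> z' = \<zero>\<^bsub>S'\<^esub> \<longleftrightarrow> ch v b = \<zero>\<^bsub>K\<^esub>"
    using z'(3) b scalar_zero[OF lS[OF S'] ch(1)[OF v b] z'(1,2)] zero S'.smult_zero_left[OF z'(1)] by auto
   ultimately show ?thesis by blast
  qed
  obtain k where k: "k : Hom S S'" "!!b. b : car (regm) ==> k (b \<odot>\<^bsub>S\<^esub> z) = b \<odot>\<^bsub>S'\<^esub> z'"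
  proof (rule hom_factor[OF left_module_regular lS[OF S] lS[OF S'] act[OF lS[OF S] z(1)] im[OF S z(1,2)] act[OF lS[OF S'] z'(1)]])
   show "b \<odot>\<^bsub>S'\<^esub> z' = \<zero>\<^bsub>S'\<^esub>" if "b : car (regm)" "b \<odot>\<^bsub>S\<^esub> z = \<zero>\<^bsub>S\<^esub>" for b using ker that by simp
  qed (rule that)
  have "k ` car S = car S'"
  proof (rule equalityI)
   show "k ` car S <= car S'" using homD(1)[OF k(1)] by (rule image_subsetI)
   show "car S' <= k ` car S"
   proof
    fix y assume "y : car S'"
    then obtain b where b: "b : car A" "y = b \<odot>\<^bsub>S'\<^esub> z'" using im[OF S' z'(1,2)] by auto
    have "y = k (b \<odot>\<^bsub>S\<^esub> z)" using k(2) b by simp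
    then show "y : k ` car S" using S.smult_closed[OF b(1) z(1)] by (rule image_eqI)
   qed
  qed
  moreover have "inj_on k (car S)"
   unfolding inj_on_hom_iff[OF lS[OF S] lS[OF S'] k(1)]
  proof (intro ballI impI)
   fix x assume x: "x : car S" "k x = \<zero>\<^bsub>S'\<^esub>"
   obtain b where b: "b : car A" "x = b \<odot>\<^bsub>S\<^esub> z" using x(1) im[OF S z(1,2)] by auto
   show "x = \<zero>\<^bsub>S\<^esub>" using ker[OF b(1)] k(2) b x(2) by simp
  qed
  ultimately show ?thesis by (intro mod_isoI[OF lS[OF S] k(1)]) (simp add: bij_betw_def)
 qed
 \<comment> \<open>The simple module of type v is the quotient of the regular module by the kernel
   of the character, moved to a standard copy.\<close>
 have exS: "EX S. simple_module K A S & P v S" if v: "v : V" for v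
 proof -
  let ?I = "{b : car A. ch v b = \<zero>\<^bsub>K\<^esub>}"
  have chi0: "ch v \<zero>\<^bsub>A\<^esub> = \<zero>\<^bsub>K\<^esub>"
   using ch(2)[OF v A.zero_closed A.zero_closed] ch(1)[OF v A.zero_closed] by (simp add: K.add.l_cancel_one')
  have I: "submod A (regm) ?I"
   by (rule submodI[OF left_module_regular]) (auto simp: ch(1,2,3)[OF v] chi0)
  obtain N :: "('a, 'a) module" and q where N: "fdm N" "q : Hom (regm) N"
   "q ` car (regm) = car N" "ker_of (regm) N q = ?I"
   by (rule quotient_exists[OF fd_regular I]) (rule that)
  obtain S :: "('k, 'a) smod" and f where S: "fdm S" "f : Hom N S" "bij_betw f (car N) (car S)"
   by (rule std_copy[OF N(1)]) (rule that)
  let ?p = "%b. f (q b)"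
  note lS' = fdD(1)[OF S(1)] and lN = fdD(1)[OF N(1)]
  interpret S: left_module A S by (rule lS')
  have p: "?p : Hom (regm) S" by (rule hcomp[OF N(2) S(2)])
  have psurj: "EX b:car A. y = ?p b" if y: "y : car S" for y
  proof -
   have "y : f ` car N" using S(3) y by (simp add: bij_betw_def)
   then obtain x where x: "x : car N" "y = f x" by blast
   have "x : q ` car A" using N(3) x(1) by simp
   then obtain b where "b : car A" "x = q b" by blast
   then show ?thesis using x(2) by blast
  qed
  have pker: "?p b = \<zero>\<^bsub>S\<^esub> \<longleftrightarrow> ch v b = \<zero>\<^bsub>K\<^esub>" if b: "b : car A" for b
  proof -
   interpret N: left_module A N by (rule lN)
   have "?p b = \<zero>\<^bsub>S\<^esub> \<longleftrightarrow> q b = \<zero>\<^bsub>N\<^esub>"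
    using inj_onD[OF bij_betw_imp_inj_on[OF S(3)], of "q b" "\<zero>\<^bsub>N\<^esub>"] N.hom_zero[OF lS' S(2)] homD(1)[OF N(2), of b] b by auto
   also have "\<dots> \<longleftrightarrow> b : ?I" unfolding N(4)[symmetric] using b by simp
   finally show ?thesis using b by simp
  qed
  have chi1: "ch v \<one>\<^bsub>A\<^esub> = \<one>\<^bsub>K\<^esub>" using ch(4)[OF v K.one_closed] scal_one by simp
  let ?z = "?p \<one>\<^bsub>A\<^esub>"
  have z: "?z : car S" "?z ~= \<zero>\<^bsub>S\<^esub>" using homD(1)[OF p, of "\<one>\<^bsub>A\<^esub>"] pker[OF A.one_closed] chi1 by simp_all
  have pb: "?p b = b \<odot>\<^bsub>S\<^esub> ?z" if "b : car A" for b using homD(3)[OF p that, of "\<one>\<^bsub>A\<^esub>"] that by simp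
  have act: "b \<odot>\<^bsub>S\<^esub> ?z = (sc (ch v b)) \<odot>\<^bsub>S\<^esub> ?z" if b: "b : car A" for b
  proof -
   let ?c = "ch v b \<odot>\<^bsub>A\<^esub> \<one>\<^bsub>A\<^esub>"
   note cK = ch(1)[OF v b]
   have c: "?c : car A" by (rule scal_closed[OF cK])
   \<comment> \<open>Subtracting the scalar ch v b from b gives an element in the kernel of the
     character, so b and the scalar have the same image under ?p.\<close>
   obtain n where n: "n = b \<ominus>\<^bsub>A\<^esub> ?c" "n : car A" using b c by simp
   have bn: "b = n \<oplus>\<^bsub>A\<^esub> ?c" unfolding n(1) using b c by (simp add: a_minus_def A.a_assoc A.l_neg)
   have "ch v b = ch v n \<oplus>\<^bsub>K\<^esub> ch v b" using ch(2)[OF v n(2) c] ch(4)[OF v cK] bn by simp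
   then have "ch v n = \<zero>\<^bsub>K\<^esub>" using cK ch(1)[OF v n(2)] by (metis K.add.r_cancel_one')
   then have "?p n = \<zero>\<^bsub>S\<^esub>" using pker[OF n(2)] by simp
   moreover have "?p b = ?p n \<oplus>\<^bsub>S\<^esub> ?p ?c" using homD(2)[OF p, of n ?c] n(2) c bn by simp
   ultimately have "?p b = ?p ?c" using homD(1)[OF p, of ?c] c by simp
   then show ?thesis using pb[OF b] pb[OF c] by simp
  qed
  have "simple_module K A S" unfolding simple_module_def
  proof (intro conjI allI impI S(1))
   show "car S ~= {\<zero>\<^bsub>S\<^esub>}" using z by blast
   fix U assume U: "submod A S U"
   note Ud = subD[OF U]
   show "U = {\<zero>\<^bsub>S\<^esub>} \<or> U = car S"
   proof (cases "EX y:U. y ~= \<zero>\<^bsub>S\<^esub>")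
    case False
    then show ?thesis using Ud(2) by blast
   next
    case True
    then obtain y where y: "y : U" "y ~= \<zero>\<^bsub>S\<^esub>" by blast
    then obtain b where b: "b : car A" "y = ?p b" using psurj Ud(1) by blast
    have cn: "ch v b ~= \<zero>\<^bsub>K\<^esub>" using pker[OF b(1)] b(2) y(2) by simp
    then have u: "inv\<^bsub>K\<^esub> ch v b : car K" "inv\<^bsub>K\<^esub> ch v b \<otimes>\<^bsub>K\<^esub> ch v b = \<one>\<^bsub>K\<^esub>"
     using ch(1)[OF v b(1)] K.field_Units by (auto intro: K.Units_inv_closed K.Units_l_inv)
    have "y = (sc (ch v b)) \<odot>\<^bsub>S\<^esub> ?z" using b pb[OF b(1)] act[OF b(1)] by simp
    then have "(sc (inv\<^bsub>K\<^esub> ch v b)) \<odot>\<^bsub>S\<^esub> y = ?z"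
     using S.smult_assoc1[OF scal_closed[OF u(1)] scal_closed[OF ch(1)[OF v b(1)]] z(1)]
      scal_mult[OF u(1) ch(1)[OF v b(1)]] u(2) scal_one S.smult_one[OF z(1)] by simp
    then have zU: "?z : U" using Ud(4)[OF scal_closed[OF u(1)] y(1)] by simp
    have "car S <= U"
    proof
     fix x assume "x : car S"
     then obtain b where b: "b : car A" "x = ?p b" using psurj by blast
     show "x : U" using Ud(4)[OF b(1) zU] pb[OF b(1)] b(2) by simp
    qed
    then show ?thesis using submod_subset[OF U] by blast
   qed
  qed
  then show ?thesis using z act unfolding P_def by blast
 qed
 \<comment> \<open>The image of z is a scalar multiple of z', which e_v fixes; but e_v kills z,
   because the character of u vanishes at e_v. So an isomorphism would send z to zero.\<close>
 have uniq: "u = v" if u: "u : V" and v: "v : V" and Pu: "P u S" and Pv: "P v S'" and S: "simple_module K A S" and S': "simple_module K A S'"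
  and iso: "mod_iso A S S'" for u v S S'
 proof (rule ccontr)
  assume ne: "u ~= v"
  interpret S: left_module A S by (rule lS[OF S])
  interpret S': left_module A S' by (rule lS[OF S'])
  have zero: "(sc (\<zero>\<^bsub>K\<^esub>)) = \<zero>\<^bsub>A\<^esub>"
   using scal_add[OF K.zero_closed K.zero_closed] scal_closed[OF K.zero_closed] by simp
  obtain f where f: "f : Hom S S'" "bij_betw f (car S) (car S')" by (rule mod_isoE[OF iso])
  obtain z where z: "z : car S" "z ~= \<zero>\<^bsub>S\<^esub>" "ALL b:car A. b \<odot>\<^bsub>S\<^esub> z = (sc (ch u b)) \<odot>\<^bsub>S\<^esub> z" using Pu unfolding P_def by blast
  obtain z' where z': "z' : car S'" "z' ~= \<zero>\<^bsub>S'\<^esub>" "ALL b:car A. b \<odot>\<^bsub>S'\<^esub> z' = (sc (ch v b)) \<odot>\<^bsub>S'\<^esub> z'" using Pv unfolding P_def by blast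
  let ?W = "{y : car S'. e v \<odot>\<^bsub>S'\<^esub> y = y & (ALL b:car A. b \<odot>\<^bsub>S'\<^esub> y = (sc (ch v b)) \<odot>\<^bsub>S'\<^esub> y)}"
  let ?B = "(%b. b \<odot>\<^bsub>S'\<^esub> z') ` car (regm)"
  have hom: "(%b. b \<odot>\<^bsub>S'\<^esub> z') : Hom (regm) S'"
   by (rule homI) (simp_all add: S'.smult_closed S'.smult_l_distr S'.smult_assoc1 z'(1))
  have "submod A S' ?B"
   by (rule submod_image[OF left_module_regular lS[OF S'] hom submod_carrier[OF left_module_regular]])
  moreover have "z' : ?B" by (rule image_eqI[of _ _ "\<one>\<^bsub>A\<^esub>"]) (simp_all add: S'.smult_one z'(1))
  ultimately have "?B = car S'" using S' z'(2) unfolding simple_module_def by blast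
  then obtain c where c: "c : car A" "f z = c \<odot>\<^bsub>S'\<^esub> z'" using homD(1)[OF f(1) z(1)] by auto
  have ev: "e v \<odot>\<^bsub>S'\<^esub> z' = z'" using z'(3) e[OF v] ch(5)[OF v v] scal_one S'.smult_one[OF z'(1)] by simp
  have eu: "e v \<odot>\<^bsub>S\<^esub> z = \<zero>\<^bsub>S\<^esub>" using z(3) e[OF v] ch(5)[OF u v] ne zero S.smult_zero_left[OF z(1)] by simp
  let ?c = "ch v c \<odot>\<^bsub>A\<^esub> \<one>\<^bsub>A\<^esub>"
  have cA: "?c : car A" by (rule scal_closed[OF ch(1)[OF v c(1)]])
  have fz: "f z = ?c \<odot>\<^bsub>S'\<^esub> z'" using c z'(3) by simp
  have "e v \<odot>\<^bsub>S'\<^esub> f z = ?c \<odot>\<^bsub>S'\<^esub> (e v \<odot>\<^bsub>S'\<^esub> z')"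
   unfolding fz using S'.smult_assoc1[OF e[OF v] cA z'(1)] S'.smult_assoc1[OF cA e[OF v] z'(1)] scal_central[OF ch(1)[OF v c(1)] e[OF v]] by simp
  then have "e v \<odot>\<^bsub>S'\<^esub> f z = f z" using ev fz by simp
  moreover have "e v \<odot>\<^bsub>S'\<^esub> f z = \<zero>\<^bsub>S'\<^esub>" using homD(3)[OF f(1) e[OF v] z(1)] eu S.hom_zero[OF lS[OF S'] f(1)] by simp
  ultimately have "f z = f \<zero>\<^bsub>S\<^esub>" using S.hom_zero[OF lS[OF S'] f(1)] by simp
  then show False using inj_onD[OF bij_betw_imp_inj_on[OF f(2)] _ z(1) S.M.zero_closed] z(2) by blast
 qed
 have "ALL v:V. EX S. simple_module K A S & P v S" by (intro ballI exS)
 from bchoice[OF this] obtain s where s: "!!v. v : V ==> simple_module K A (s v)" "!!v. v : V ==> P v (s v)" by blast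
 have "bij_betw (%v. ?r `` {s v}) V (?S // ?r)"
  unfolding bij_betw_def
 proof
  have refl: "mod_iso A S S" if "simple_module K A S" for S :: "('k, 'a) smod"
   by (rule mod_isoI[OF lS[OF that] hom_id[OF lS[OF that]]]) (simp add: bij_betw_def)
  show "inj_on (%v. ?r `` {s v}) V"
  proof (rule inj_onI)
   fix u v assume u: "u : V" and v: "v : V" and eq: "?r `` {s u} = ?r `` {s v}"
   have "s v : ?r `` {s v}" using s(1)[OF v] refl[OF s(1)[OF v]] by simp
   then have "mod_iso A (s u) (s v)" unfolding eq[symmetric] by simp
   then show "u = v" by (rule uniq[OF u v s(2)[OF u] s(2)[OF v] s(1)[OF u] s(1)[OF v]])
  qed
  show "(%v. ?r `` {s v}) ` V = ?S // ?r"
  proof (rule equalityI)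
   show "(%v. ?r `` {s v}) ` V <= ?S // ?r" by (rule image_subsetI, rule quotientI) (simp add: s(1))
   show "?S // ?r <= (%v. ?r `` {s v}) ` V"
   proof
    fix C assume "C : ?S // ?r"
    then obtain S where S': "S : ?S" and CS: "C = ?r `` {S}" by (rule quotientE)
    have S: "simple_module K A S" using S' by simp
    obtain v where v: "v : V" "P v S" using exP[OF S] by blast
    have a: "mod_iso A S (s v)" "mod_iso A (s v) S"
     using isoP[OF S s(1)[OF v(1)] v(1) v(2) s(2)[OF v(1)]] isoP[OF s(1)[OF v(1)] S v(1) s(2)[OF v(1)] v(2)] by auto
    have "mod_iso A S N \<longleftrightarrow> mod_iso A (s v) N" for N :: "('k, 'a) smod"
     using mod_iso_trans[OF lS[OF S] a(1), of N] mod_iso_trans[OF lS[OF s(1)[OF v(1)]] a(2), of N] by blast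
    then have eq: "?r `` {S} = ?r `` {s v}" using S s(1)[OF v(1)] by simp
    show "C : (%v. ?r `` {s v}) ` V" by (rule image_eqI[where x = v]) (rule trans[OF CS eq], rule v(1))
   qed
  qed
 qed
 then show ?thesis unfolding num_simples_def iso_classes_def by (simp add: bij_betw_same_card)
qed


text \<open>L is the largest proper submodule of P. Then f(L) is proper in M and contains every
  proper submodule, so two proper submodules cannot add up to M.\<close>

lemma indecomposable_quotient_of_local:
 fixes P :: "('a, 'p) module" and M :: "('a, 'm) module"
 assumes P: "lmod P" and L: "submod A P L" "L ~= car P"
  and max: "!!U. submod A P U ==> U <= L \<or> U = car P"
  and M: "fdm M" "car M ~= {\<zero>\<^bsub>M\<^esub>}"
  and f: "f : Hom P M" and surj: "f ` car P = car M"
 shows "indec M"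
proof -
 note lM = fdD(1)[OF M(1)]
 interpret P: left_module A P by (rule P)
 interpret M: left_module A M by (rule lM)
 have sub: "U <= f ` L" if U: "submod A M U" "U ~= car M" for U
 proof -
  have "submod A P {x : car P. f x : U}" by (rule submod_vimage[OF P lM f U(1)])
  moreover have "{x : car P. f x : U} ~= car P"
  proof
   assume "{x : car P. f x : U} = car P"
   then have "car M <= U" unfolding surj[symmetric] by blast
   then show False using U submod_subset[OF U(1)] by blast
  qed
  ultimately have "{x : car P. f x : U} <= L" using max by blast
  then show ?thesis using submod_subset[OF U(1)] unfolding surj[symmetric] by blast
 qed
 have fL: "f ` L ~= car M"
 proof
  assume eq: "f ` L = car M"
  have "submod A P {x : car P. f x : {\<zero>\<^bsub>M\<^esub>}}" by (rule submod_vimage[OF P lM f submod_zero[OF lM]])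
  moreover have "{x : car P. f x : {\<zero>\<^bsub>M\<^esub>}} ~= car P"
   using M(2) M.M.zero_closed unfolding surj[symmetric] by blast
  ultimately have ker: "{x : car P. f x : {\<zero>\<^bsub>M\<^esub>}} <= L" using max by blast
  have "car P <= L"
  proof
   fix x assume x: "x : car P"
   obtain l where l: "l : L" "f x = f l" using homD(1)[OF f x] unfolding eq[symmetric] by blast
   have lP: "l : car P" by (rule subD(1)[OF L(1) l(1)])
   have "f (x \<ominus>\<^bsub>P\<^esub> l) = \<zero>\<^bsub>M\<^esub>"
    using P.hom_minus[OF lM f x lP] l(2) homD(1)[OF f lP] by (simp add: M.M.minus_eq_zero_iff)
   then have "x \<ominus>\<^bsub>P\<^esub> l : L" using ker x lP by blast
   then have "(x \<ominus>\<^bsub>P\<^esub> l) \<oplus>\<^bsub>P\<^esub> l : L" using subD(3)[OF L(1)] l(1) by blast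
   then show "x : L" using P.M.minus_add_cancel[OF x lP] by simp
  qed
  then show False using L submod_subset[OF L(1)] by blast
 qed
 show ?thesis unfolding indecomposable_def
 proof (intro conjI allI impI M)
  fix U V assume "internal_direct_sum A M U V"
  then have U: "submod A M U" and V: "submod A M V" and UV: "U <+>\<^bsub>M\<^esub> V = car M" "U \<inter> V = {\<zero>\<^bsub>M\<^esub>}"
   by (simp_all add: internal_direct_sum_def)
  have "U = car M \<or> V = car M"
  proof (rule ccontr)
   assume "\<not> ?thesis"
   then have "U <= f ` L" "V <= f ` L" using sub U V by blast+
   moreover have sfL: "submod A M (f ` L)" by (rule submod_image[OF P lM f L(1)])
   then have "x : f ` L" if "x : car M" for x
   proof -
    have "x : U <+>\<^bsub>M\<^esub> V" using that UV(1) by simp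
    then obtain u v where "u : U" "v : V" "x = u \<oplus>\<^bsub>M\<^esub> v" unfolding mem_set_add by blast
    then show ?thesis using subD(3)[OF sfL, of u v] \<open>U <= f ` L\<close> \<open>V <= f ` L\<close> by blast
   qed
   ultimately have "car M <= f ` L" by blast
   then show False using fL submod_subset[OF \<open>submod A M (f ` L)\<close>] by blast
  qed
  then show "U = {\<zero>\<^bsub>M\<^esub>} \<or> V = {\<zero>\<^bsub>M\<^esub>}" using UV(2) submod_subset[OF U] submod_subset[OF V] by blast
 qed
qed

lemma biprod_pair:
 assumes M: "!!k. k : {i, j} ==> lmod (M k)" and ne: "i ~= j"
 obtains i1 i2 p1 p2 where "biprod (direct_sum {i, j} M) (M i) (M j) i1 i2 p1 p2"
proof -
 let ?I = "{i, j}"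
 have l: "lmod (M i)" "lmod (M j)" using M by simp_all
 interpret Mi: left_module A "M i" by (rule l(1))
 interpret Mj: left_module A "M j" by (rule l(2))
 have inc: "(%x. \<lambda>k\<in>?I. (if k = a then (%x. x) else (%x. \<zero>\<^bsub>M k\<^esub>)) x) : Hom (M a) (direct_sum ?I M)" if a: "a : ?I" for a
 proof (rule hom_direct_sum[OF M M[OF a]])
  fix k assume k: "k : ?I"
  show "(if k = a then (%x. x) else (%x. \<zero>\<^bsub>M k\<^esub>)) : Hom (M a) (M k)"
  proof (cases "k = a")
   case True
   then show ?thesis using hom_id[OF M[OF a]] by simp
  next
   case False
   have "(%x. \<zero>\<^bsub>M k\<^esub>) : Hom (M a) (M k)" by (rule hom_zero_map[OF M[OF k]])
   then show ?thesis using False by simp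
  qed
 qed
 have dec: "(\<lambda>k\<in>?I. (\<lambda>k\<in>?I. (if k = i then (%x. x) else (%x. \<zero>\<^bsub>M k\<^esub>)) (s i)) k
   \<oplus>\<^bsub>M k\<^esub> (\<lambda>k\<in>?I. (if k = j then (%x. x) else (%x. \<zero>\<^bsub>M k\<^esub>)) (s j)) k) = s"
  if s: "s : car (direct_sum ?I M)" for s
 proof (rule extensionalityI[of _ ?I])
  show "s : extensional ?I" using s by (simp add: PiE_def)
  have s': "s i : car (M i)" "s j : car (M j)" using s by auto
  fix k assume "k : ?I"
  then consider "k = i" | "k = j" by blast
  then show "(\<lambda>k\<in>?I. (\<lambda>k\<in>?I. (if k = i then (%x. x) else (%x. \<zero>\<^bsub>M k\<^esub>)) (s i)) k
   \<oplus>\<^bsub>M k\<^esub> (\<lambda>k\<in>?I. (if k = j then (%x. x) else (%x. \<zero>\<^bsub>M k\<^esub>)) (s j)) k) k = s k"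
   using s' ne by cases auto
 qed auto
 show ?thesis
 proof (rule that)
  show "biprod (direct_sum ?I M) (M i) (M j)
   (%x. \<lambda>k\<in>?I. (if k = i then (%x. x) else (%x. \<zero>\<^bsub>M k\<^esub>)) x)
   (%x. \<lambda>k\<in>?I. (if k = j then (%x. x) else (%x. \<zero>\<^bsub>M k\<^esub>)) x) (%x. x i) (%x. x j)"
   unfolding biprod_def
  proof (intro conjI)
   show "lmod (direct_sum ?I M)" by (rule left_module_direct_sum) (rule M)
   show "(%x. \<lambda>k\<in>?I. (if k = i then (%x. x) else (%x. \<zero>\<^bsub>M k\<^esub>)) x) : Hom (M i) (direct_sum ?I M)" by (rule inc) simp
   show "(%x. \<lambda>k\<in>?I. (if k = j then (%x. x) else (%x. \<zero>\<^bsub>M k\<^esub>)) x) : Hom (M j) (direct_sum ?I M)" by (rule inc) simp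
   show "(%x. x i) : Hom (direct_sum ?I M) (M i)" "(%x. x j) : Hom (direct_sum ?I M) (M j)"
    by (rule hom_component, simp)+
   show "ALL s:car (direct_sum ?I M). (\<lambda>k\<in>?I. (if k = i then (%x. x) else (%x. \<zero>\<^bsub>M k\<^esub>)) (s i))
     \<oplus>\<^bsub>direct_sum ?I M\<^esub> (\<lambda>k\<in>?I. (if k = j then (%x. x) else (%x. \<zero>\<^bsub>M k\<^esub>)) (s j)) = s"
    unfolding direct_sum_simps(3) by (rule ballI) (rule dec)
  qed (use l ne in auto)
 qed
qed

text \<open>\<open>tau_rigid\<close> refers to a selected minimal presentation; the lifting property
  moves to it from any presentation, with T viewed as a summand of itself.\<close>

lemma tau_rigidI:
 fixes T :: "('a, 't) module" and P1 P0 :: "('a, 'p) module"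
 assumes p: "presents P1 d P0 e T" and l: "lifts d P1 P0 T"
 shows "tau_rigid K A T"
proof -
 note fT = presD2(1)[OF p]
 obtain Q1 Q0 :: "('k, 'a) smod" and d' e' where q: "presents Q1 d' Q0 e' T"
  "superfluous A Q0 (ker_of Q0 T e')" "superfluous A Q1 (ker_of Q1 Q0 d')" "tau_rigid K A T \<longleftrightarrow> lifts d' Q1 Q0 T"
  by (rule tau_rigid_iff_lifts[OF fT]) (rule that)
 have "lifts d' Q1 Q0 T" by (rule lifts_summand[OF p l q(1-3) hom_id hom_id]) (simp_all add: fdD(1)[OF fT])
 then show ?thesis using q(4) by blast
qed

text \<open>A projective summand of T is added to P0 only and P1 is unchanged. Maps from P1 that
  extend over P0 extend over the larger module by composing with the projection.\<close>

lemma presents_add_projective: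
 fixes P1 P0 Q :: "('k, 'a) smod" and M :: "('a, 'm) module" and T :: "('a, 't) module"
 assumes p: "presents P1 d P0 e M" and Q: "proj Q" and b: "biprod T M Q i1 i2 p1 p2"
 obtains P' :: "('k, 'a) smod" and d' e' where "presents P1 d' P' e' T"
  "!!N :: ('a, 't) module. lifts d P1 P0 N ==> lifts d' P1 P' N"
proof -
 note pd = presD[OF p] and bd = biprodD[OF b]
 obtain P' :: "('k, 'a) smod" and j1 j2 q1 q2 where P': "fdm P'" and c: "biprod P' P0 Q j1 j2 q1 q2"
  by (rule std_biprod[OF projD(1)[OF pd(2)] projD(1)[OF Q]]) (rule that)
 note cd = biprodD[OF c]
 interpret T: left_module A T by (rule bd(1))
 interpret M: left_module A M by (rule bd(2))
 interpret Q: left_module A Q by (rule bd(3))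
 interpret P0: left_module A P0 by (rule cd(2))
 interpret P': left_module A P' by (rule cd(1))
 let ?e = "%x. i1 (e (q1 x)) \<oplus>\<^bsub>T\<^esub> i2 (q2 x)"
 have e: "?e : Hom P' T"
  by (rule hom_add[OF bd(1) hcomp[OF hcomp[OF cd(6) pd(4)] bd(4)] hcomp[OF cd(7) bd(5)]])
 have d: "(%x. j1 (d x)) : Hom P1 P'" by (rule hcomp[OF pd(6) cd(4)])
 note cl = homD(1)[OF pd(4)] homD(1)[OF bd(4)] homD(1)[OF bd(5)] homD(1)[OF cd(6)] homD(1)[OF cd(7)]
 have comp: "p1 (?e x) = e (q1 x)" "p2 (?e x) = q2 x" if x: "x : car P'" for x
  using x homD(2)[OF bd(6), of "i1 (e (q1 x))" "i2 (q2 x)"] homD(2)[OF bd(7), of "i1 (e (q1 x))" "i2 (q2 x)"]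
   bd(8,9)[of "e (q1 x)"] bd(10,11)[of "q2 x"] by (simp_all add: cl)
 have "presents P1 (%x. j1 (d x)) P' ?e T" unfolding presents_def
 proof (intro conjI pd(1) bd(1) e d)
  show "proj P'" by (rule projective_biprod[OF c pd(2) Q])
  show "?e ` car P' = car T"
  proof (rule equalityI)
   show "?e ` car P' <= car T" using homD(1)[OF e] by (rule image_subsetI)
   show "car T <= ?e ` car P'"
   proof
    fix t assume t: "t : car T"
    note t1 = homD(1)[OF bd(6) t] and t2 = homD(1)[OF bd(7) t]
    obtain y where y: "y : car P0" "p1 t = e y" using t1 unfolding pd(5)[symmetric] by blast
    let ?x = "j1 y \<oplus>\<^bsub>P'\<^esub> j2 (p2 t)"
    note jy = homD(1)[OF cd(4) y(1)] and jt = homD(1)[OF cd(5) t2]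
    have x: "?x : car P'" using jy jt by simp
    have "q1 ?x = y" "q2 ?x = p2 t"
     using homD(2)[OF cd(6) jy jt] homD(2)[OF cd(7) jy jt] cd(8,9)[OF y(1)] cd(10,11)[OF t2] y(1) t2 by simp_all
    then have "t = ?e ?x" using bd(12)[OF t] y(2) by simp
    then show "t : ?e ` car P'" using x by (rule image_eqI)
   qed
  qed
  show "(%x. j1 (d x)) ` car P1 = ker_of P' T ?e"
  proof (rule equalityI; rule subsetI)
   fix z assume "z : (%x. j1 (d x)) ` car P1"
   then obtain x where x: "x : car P1" "z = j1 (d x)" by blast
   note dx = homD(1)[OF pd(6) x(1)]
   have "?e z = \<zero>\<^bsub>T\<^esub>"
    using x(2) cd(8,9)[OF dx] presD2(2)[OF p x(1)] M.hom_zero[OF bd(1) bd(4)] Q.hom_zero[OF bd(1) bd(5)] by simp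
   then show "z : ker_of P' T ?e" using homD(1)[OF d x(1)] x(2) by simp
  next
   fix z assume "z : ker_of P' T ?e"
   then have z: "z : car P'" "?e z = \<zero>\<^bsub>T\<^esub>" by auto
   have "e (q1 z) = \<zero>\<^bsub>M\<^esub>" "q2 z = \<zero>\<^bsub>Q\<^esub>"
    using comp[OF z(1)] z(2) T.hom_zero[OF bd(2) bd(6)] T.hom_zero[OF bd(3) bd(7)] by simp_all
   then obtain x where x: "x : car P1" "q1 z = d x" using presD2(3)[OF p homD(1)[OF cd(6) z(1)]] by blast
   have "z = j1 (d x)"
    using cd(12)[OF z(1)] x(2) \<open>q2 z = \<zero>\<^bsub>Q\<^esub>\<close> Q.hom_zero[OF cd(1) cd(5)] homD(1)[OF d x(1)] by simp
   then show "z : (%x. j1 (d x)) ` car P1" using x(1) by (rule image_eqI)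
  qed
 qed
 moreover have "lifts (%x. j1 (d x)) P1 P' N" if l: "lifts d P1 P0 N" for N :: "('a, 't) module"
  unfolding lifts_def
 proof
  fix g assume g: "g : Hom P1 N"
  obtain h where h: "h : Hom P0 N" "!!x. x : car P1 ==> h (d x) = g x" by (rule liftsE[OF l g]) (rule that)
  show "EX h:Hom P' N. ALL x:car P1. h (j1 (d x)) = g x"
   by (rule bexI[OF ballI hcomp[OF cd(6) h(1)]]) (simp add: cd(8) homD(1)[OF pd(6)] h(2))
 qed
 ultimately show ?thesis by (rule that)
qed

lemma presents_projective:
 fixes P :: "('a, 'p) module" and N :: "('a, 'n) module"
 assumes P: "proj P" and N: "lmod N"
 shows "presents (P(|carrier := {\<zero>\<^bsub>P\<^esub>}|)) (%x. x) P (%x. x) P" "lifts (%x. x) (P(|carrier := {\<zero>\<^bsub>P\<^esub>}|)) P N"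
proof -
 note lP = projD(2)[OF P]
 interpret P: left_module A P by (rule lP)
 have lZ: "lmod (P(|carrier := {\<zero>\<^bsub>P\<^esub>}|))" by (rule left_module_sub[OF lP submod_zero[OF lP]])
 interpret Z: left_module A "P(|carrier := {\<zero>\<^bsub>P\<^esub>}|)" by (rule lZ)
 have "proj (P(|carrier := {\<zero>\<^bsub>P\<^esub>}|))" by (rule projective_zero[OF lZ]) simp
 then show "presents (P(|carrier := {\<zero>\<^bsub>P\<^esub>}|)) (%x. x) P (%x. x) P"
  unfolding presents_def using P lP hom_id[OF lP] hom_from_sub[OF hom_id[OF lP], of "{\<zero>\<^bsub>P\<^esub>}"] P.M.zero_closed by auto
 show "lifts (%x. x) (P(|carrier := {\<zero>\<^bsub>P\<^esub>}|)) P N"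
  unfolding lifts_def
 proof
  fix g assume g: "g : Hom (P(|carrier := {\<zero>\<^bsub>P\<^esub>}|)) N"
  show "EX h:Hom P N. ALL x:car (P(|carrier := {\<zero>\<^bsub>P\<^esub>}|)). h x = g x"
   by (rule bexI[OF ballI hom_zero_map[OF N]]) (use Z.hom_zero[OF N g] in simp)
 qed
qed

lemma annihilates_iso:
 assumes N: "lmod N" and a: "a : car A" and iso: "mod_iso A M N"
  and z: "!!x. x : car M ==> a \<odot>\<^bsub>M\<^esub> x = \<zero>\<^bsub>M\<^esub>" and M: "lmod M" and y: "y : car N"
 shows "a \<odot>\<^bsub>N\<^esub> y = \<zero>\<^bsub>N\<^esub>"
proof -
 interpret M: left_module A M by (rule M)
 obtain f where f: "f : Hom M N" "bij_betw f (car M) (car N)" by (rule mod_isoE[OF iso])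
 have "y : f ` car M" using f(2) y by (simp add: bij_betw_def)
 then obtain x where x: "x : car M" "y = f x" by blast
 show ?thesis using homD(3)[OF f(1) a x(1)] z[OF x(1)] x(2) M.hom_zero[OF N f(1)] by simp
qed

lemma zero_annihilates:
 assumes X: "!!i. i : I ==> lmod (X i)"
 shows "a : annihilator A (direct_sum I X) \<longleftrightarrow> a : car A & (ALL i:I. ALL x:car (X i). a \<odot>\<^bsub>X i\<^esub> x = \<zero>\<^bsub>X i\<^esub>)"
proof
 assume a: "a : annihilator A (direct_sum I X)"
 show "a : car A & (ALL i:I. ALL x:car (X i). a \<odot>\<^bsub>X i\<^esub> x = \<zero>\<^bsub>X i\<^esub>)"
 proof (intro conjI ballI)
  show "a : car A" using a by (simp add: annihilator_def)
  fix i x assume i: "i : I" and x: "x : car (X i)"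
  obtain u where u: "u : Hom (X i) (direct_sum I X)" "!!x. x : car (X i) ==> u x i = x"
   by (rule summand_direct_sum[OF X i]) (assumption, rule that)
  have "a \<odot>\<^bsub>direct_sum I X\<^esub> u x = \<zero>\<^bsub>direct_sum I X\<^esub>"
   using a homD(1)[OF u(1) x] unfolding annihilator_def by blast
  then have "(a \<odot>\<^bsub>direct_sum I X\<^esub> u x) i = \<zero>\<^bsub>direct_sum I X\<^esub> i" by simp
  then show "a \<odot>\<^bsub>X i\<^esub> x = \<zero>\<^bsub>X i\<^esub>" using i u(2)[OF x] by simp
 qed
next
 assume a: "a : car A & (ALL i:I. ALL x:car (X i). a \<odot>\<^bsub>X i\<^esub> x = \<zero>\<^bsub>X i\<^esub>)"
 have "a \<odot>\<^bsub>direct_sum I X\<^esub> x = \<zero>\<^bsub>direct_sum I X\<^esub>" if x: "x : car (direct_sum I X)" for x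
  unfolding direct_sum_simps by (rule restrict_ext) (use a x in auto)
 then show "a : annihilator A (direct_sum I X)" using a by (simp add: annihilator_def del: direct_sum_simps)
qed

text \<open>There is one simple module, with N = 0 and the scalar itself as character, so the family
  has a single nonzero member. A nonzero scalar is invertible and cannot kill a nonzero
  vector.\<close>

lemma faithful_of_scalars:
 assumes sc: "!!a. a : car A ==> EX c:car K. a = c \<odot>\<^bsub>A\<^esub> \<one>\<^bsub>A\<^esub>" and nz: "\<one>\<^bsub>A\<^esub> ~= \<zero>\<^bsub>A\<^esub>"
  and fam: "tau_tilting_family K A X"
 shows "faithful A (total_sum K A X)"
proof -
 define ch where "ch b = (THE c. c : car K & b = c \<odot>\<^bsub>A\<^esub> \<one>\<^bsub>A\<^esub>)" for b
 have z0: "\<zero>\<^bsub>K\<^esub> \<odot>\<^bsub>A\<^esub> \<one>\<^bsub>A\<^esub> = \<zero>\<^bsub>A\<^esub>"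
  using scal_add[OF K.zero_closed K.zero_closed] scal_closed[OF K.zero_closed] by simp
 have un: "EX d:car K. (sc d) \<cdot> (sc c) = \<one>\<^bsub>A\<^esub>" if c: "c : car K" "c ~= \<zero>\<^bsub>K\<^esub>" for c
 proof -
  have u: "inv\<^bsub>K\<^esub> c : car K" "inv\<^bsub>K\<^esub> c \<otimes>\<^bsub>K\<^esub> c = \<one>\<^bsub>K\<^esub>" using c K.field_Units by auto
  show ?thesis by (rule bexI[OF _ u(1)]) (simp add: scal_mult[OF u(1) c(1), symmetric] u(2) scal_one)
 qed
 have inj0: "c = \<zero>\<^bsub>K\<^esub>" if "c : car K" "c \<odot>\<^bsub>A\<^esub> \<one>\<^bsub>A\<^esub> = \<zero>\<^bsub>A\<^esub>" for c
 proof (rule ccontr)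
  assume "c ~= \<zero>\<^bsub>K\<^esub>"
  from un[OF that(1) this] obtain d where d: "d : car K" "(sc d) \<cdot> (sc c) = \<one>\<^bsub>A\<^esub>" by blast
  then show False using that(2) nz scal_closed[OF d(1)] by simp
 qed
 have inj: "c = d" if "c : car K" "d : car K" "c \<odot>\<^bsub>A\<^esub> \<one>\<^bsub>A\<^esub> = d \<odot>\<^bsub>A\<^esub> \<one>\<^bsub>A\<^esub>" for c d
 proof -
  have e: "c = (c \<ominus>\<^bsub>K\<^esub> d) \<oplus>\<^bsub>K\<^esub> d" using that(1,2) by (simp add: a_minus_def K.a_assoc K.l_neg)
  have m: "c \<ominus>\<^bsub>K\<^esub> d : car K" using that by simp
  have "d \<odot>\<^bsub>A\<^esub> \<one>\<^bsub>A\<^esub> = (c \<ominus>\<^bsub>K\<^esub> d) \<odot>\<^bsub>A\<^esub> \<one>\<^bsub>A\<^esub> \<oplus>\<^bsub>A\<^esub> d \<odot>\<^bsub>A\<^esub> \<one>\<^bsub>A\<^esub>" using scal_add[OF m that(2)] e[symmetric] that(3) by simp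
  then have "(c \<ominus>\<^bsub>K\<^esub> d) \<odot>\<^bsub>A\<^esub> \<one>\<^bsub>A\<^esub> = \<zero>\<^bsub>A\<^esub>"
   using A.add.r_cancel_one'[OF scal_closed[OF that(2)] scal_closed[OF m]] by simp
  then have "c \<ominus>\<^bsub>K\<^esub> d = \<zero>\<^bsub>K\<^esub>" by (rule inj0[OF m])
  then show ?thesis using e that(2) by simp
 qed
 have chi: "ch (sc c) = c" if "c : car K" for c
  unfolding ch_def by (rule the_equality) (use that inj in auto)
 have n1: "num_simples K A = card {()}"
 proof (rule simple_characters[where e = "%_. \<one>\<^bsub>A\<^esub>" and ch = "%_. ch" and N = "{\<zero>\<^bsub>A\<^esub>}"])
  show "ch b : car K" if "b : car A" for b using sc[OF that] chi by auto
  show "ch (b \<oplus>\<^bsub>A\<^esub> c) = ch b \<oplus>\<^bsub>K\<^esub> ch c" if b: "b : car A" and c: "c : car A" for b c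
  proof -
   obtain p q where "p : car K" "q : car K" "b = p \<odot>\<^bsub>A\<^esub> \<one>\<^bsub>A\<^esub>" "c = q \<odot>\<^bsub>A\<^esub> \<one>\<^bsub>A\<^esub>" using sc[OF b] sc[OF c] by blast
   then show ?thesis using chi[of "p \<oplus>\<^bsub>K\<^esub> q"] chi[of p] chi[of q] by (simp add: scal_add)
  qed
  show "ch (b \<cdot> c) = ch b \<otimes>\<^bsub>K\<^esub> ch c" if b: "b : car A" and c: "c : car A" for b c
  proof -
   obtain p q where "p : car K" "q : car K" "b = p \<odot>\<^bsub>A\<^esub> \<one>\<^bsub>A\<^esub>" "c = q \<odot>\<^bsub>A\<^esub> \<one>\<^bsub>A\<^esub>" using sc[OF b] sc[OF c] by blast
   then show ?thesis using chi[of "p \<otimes>\<^bsub>K\<^esub> q"] chi[of p] chi[of q] by (simp add: scal_mult)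
  qed
  show "ch (sc c) = c" if "c : car K" for c by (rule chi[OF that])
  show "ch \<one>\<^bsub>A\<^esub> = (if u = v then \<one>\<^bsub>K\<^esub> else \<zero>\<^bsub>K\<^esub>)" for u v :: unit using chi[OF K.one_closed] scal_one by simp
  show "EX r:{\<zero>\<^bsub>A\<^esub>}. b \<cdot> \<one>\<^bsub>A\<^esub> = (sc (ch b)) \<cdot> \<one>\<^bsub>A\<^esub> \<oplus>\<^bsub>A\<^esub> r" if b: "b : car A" for b
  proof -
   obtain p where p: "p : car K" "b = p \<odot>\<^bsub>A\<^esub> \<one>\<^bsub>A\<^esub>" using sc[OF b] by blast
   show ?thesis using p scal_closed[OF p(1)] by (simp add: chi)
  qed
  show "y = \<zero>\<^bsub>M\<^esub>" if M: "lmod M" and y: "y : car M" and h: "!!v. v : {()} ==> \<one>\<^bsub>A\<^esub> \<odot>\<^bsub>M\<^esub> y = \<zero>\<^bsub>M\<^esub>" for M :: "('k, 'a) smod" and y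
   using left_module.smult_one[OF M y] h by simp
 qed simp_all
 then have I: "{1..num_simples K A} = {1::nat}" by simp
 have X1: "indec (X 1)" using fam n1 by (simp add: tau_tilting_family_def)
 note lX = indecD(2)[OF X1]
 interpret X: left_module A "X 1" by (rule lX)
 obtain x where x: "x : car (X 1)" "x ~= \<zero>\<^bsub>X 1\<^esub>" using X1 X.M.zero_closed unfolding indecomposable_def by blast
 have lI: "lmod (X i)" if "i : {1::nat}" for i using that lX by simp
 have ann: "a : annihilator A (direct_sum {1::nat} X) \<longleftrightarrow> a : car A & (ALL i:{1}. ALL x:car (X i). a \<odot>\<^bsub>X i\<^esub> x = \<zero>\<^bsub>X i\<^esub>)" for a
  by (rule zero_annihilates) (rule lI)
 show ?thesis unfolding faithful_def total_sum_def I
 proof (rule equalityI; rule subsetI)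
  fix a assume "a : annihilator A (direct_sum {1} X)"
  then have a: "a : car A" "a \<odot>\<^bsub>X 1\<^esub> x = \<zero>\<^bsub>X 1\<^esub>" using ann x(1) by auto
  obtain c where c: "c : car K" "a = c \<odot>\<^bsub>A\<^esub> \<one>\<^bsub>A\<^esub>" using sc[OF a(1)] by blast
  have "c = \<zero>\<^bsub>K\<^esub>"
  proof (rule ccontr)
   assume "c ~= \<zero>\<^bsub>K\<^esub>"
   from un[OF c(1) this] obtain d where d: "d : car K" "(sc d) \<cdot> (sc c) = \<one>\<^bsub>A\<^esub>" by blast
   have "(sc d) \<odot>\<^bsub>X 1\<^esub> (a \<odot>\<^bsub>X 1\<^esub> x) = x"
    using X.smult_assoc1[OF scal_closed[OF d(1)] a(1) x(1)] d(2) c(2) X.smult_one[OF x(1)] by (simp only:)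
   then show False unfolding a(2) X.smult_zero_right[OF scal_closed[OF d(1)]] using x(2) by simp
  qed
  then show "a : {\<zero>\<^bsub>A\<^esub>}" using c(2) z0 by simp
 next
  fix a assume "a : {\<zero>\<^bsub>A\<^esub>}"
  then have "a = \<zero>\<^bsub>A\<^esub>" by simp
  moreover have "ALL i:{1::nat}. ALL x:car (X i). \<zero>\<^bsub>A\<^esub> \<odot>\<^bsub>X i\<^esub> x = \<zero>\<^bsub>X i\<^esub>" using X.smult_zero_left by simp
  ultimately show "a : annihilator A (direct_sum {1} X)" using ann[THEN iffD2, OF conjI[OF A.zero_closed]] by blast
 qed
qed

end

section \<open>The quiver with one arrow and one loop\<close>

text \<open>The quotient of the path algebra of the quiver with an arrow from 1 to 2 and a loop at 2 by all paths of
  length two: \<open>el p q r w\<close> is \<open>p e1 + q e2 + r a + w x\<close> with the arrow \<open>a\<close> and the loop \<open>x\<close>.\<close>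

locale loop_arrow_algebra = kalg K A for K :: "'k ring" and A :: "('k, 'a) module" +
 fixes el :: "'k => 'k => 'k => 'k => 'a"
 assumes el_closed: "p : car K ==> q : car K ==> r : car K ==> w : car K ==> el p q r w : car A"
  and el_cases: "b : car A ==> EX p:car K. EX q:car K. EX r:car K. EX w:car K. b = el p q r w"
  and el_inj: "el p q r w = el p' q' r' w' ==> {p, q, r, w, p', q', r', w'} <= car K ==>
   p = p' & q = q' & r = r' & w = w'"
  and el_add: "{p, q, r, w, p', q', r', w'} <= car K ==>
   el p q r w \<oplus>\<^bsub>A\<^esub> el p' q' r' w' = el (p \<oplus>\<^bsub>K\<^esub> p') (q \<oplus>\<^bsub>K\<^esub> q') (r \<oplus>\<^bsub>K\<^esub> r') (w \<oplus>\<^bsub>K\<^esub> w')"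
  and el_mult: "{p, q, r, w, p', q', r', w'} <= car K ==>
   el p q r w \<otimes>\<^bsub>A\<^esub> el p' q' r' w' = el (p \<otimes>\<^bsub>K\<^esub> p') (q \<otimes>\<^bsub>K\<^esub> q')
    (q \<otimes>\<^bsub>K\<^esub> r' \<oplus>\<^bsub>K\<^esub> r \<otimes>\<^bsub>K\<^esub> p') (q \<otimes>\<^bsub>K\<^esub> w' \<oplus>\<^bsub>K\<^esub> w \<otimes>\<^bsub>K\<^esub> q')"
  and el_scal: "c : car K ==> c \<odot>\<^bsub>A\<^esub> \<one>\<^bsub>A\<^esub> = el c c \<zero>\<^bsub>K\<^esub> \<zero>\<^bsub>K\<^esub>"
begin

abbreviation "z \<equiv> \<zero>\<^bsub>K\<^esub>"
abbreviation "o1 \<equiv> \<one>\<^bsub>K\<^esub>"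
abbreviation "e1 \<equiv> el o1 z z z"
abbreviation "e2 \<equiv> el z o1 z z"
abbreviation "arr \<equiv> el z z o1 z"
abbreviation "lp \<equiv> el z z z o1"

lemma elE:
 assumes "b : car A"
 obtains p q r w where "p : car K" "q : car K" "r : car K" "w : car K" "b = el p q r w"
 using el_cases[OF assms] by blast

lemma el_eq_iff: "{p, q, r, w, p', q', r', w'} <= car K ==>
  el p q r w = el p' q' r' w' \<longleftrightarrow> p = p' & q = q' & r = r' & w = w'"
proof
 assume S: "{p, q, r, w, p', q', r', w'} <= car K" and e: "el p q r w = el p' q' r' w'"
 show "p = p' & q = q' & r = r' & w = w'" by (rule el_inj[OF e S])
qed simp

lemma el_zero: "\<zero>\<^bsub>A\<^esub> = el z z z z"
proof -
 have "el z z z z \<oplus>\<^bsub>A\<^esub> el z z z z = el z z z z" by (simp add: el_add)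
 then show ?thesis using el_closed[of z z z z] by simp
qed

lemma el_one: "\<one>\<^bsub>A\<^esub> = el o1 o1 z z" using el_scal[OF K.one_closed] scal_one by simp

lemmas el_simps = el_closed el_add el_mult el_zero el_eq_iff

lemma units: "e1 : car A" "e2 : car A" "arr : car A" "lp : car A" "e1 \<cdot> e1 = e1" "e2 \<cdot> e2 = e2"
 by (simp_all add: el_simps)

text \<open>Products are read from right to left, so \<open>A e1\<close> is spanned by the paths
  that start at 1: the trivial one and the arrow. Likewise \<open>A e2\<close> is spanned by the
  trivial path at 2 and the loop.\<close>

lemma P1_iff: "b : car (left_ideal e1) \<longleftrightarrow> (EX s:car K. EX t:car K. b = el s z t z)"
proof
 assume "b : car (left_ideal e1)"
 then have b: "b : car A" "b \<cdot> e1 = b" by auto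
 obtain p q r w where e: "p : car K" "q : car K" "r : car K" "w : car K" "b = el p q r w" by (rule elE[OF b(1)])
 then have "el p z r z = b" using b(2) by (simp add: el_mult)
 then show "EX s:car K. EX t:car K. b = el s z t z" using e by blast
qed (auto simp: el_simps)

lemma P2_iff: "b : car (left_ideal e2) \<longleftrightarrow> (EX s:car K. EX t:car K. b = el z s z t)"
proof
 assume "b : car (left_ideal e2)"
 then have b: "b : car A" "b \<cdot> e2 = b" by auto
 obtain p q r w where e: "p : car K" "q : car K" "r : car K" "w : car K" "b = el p q r w" by (rule elE[OF b(1)])
 then have "el z q z w = b" using b(2) by (simp add: el_mult)
 then show "EX s:car K. EX t:car K. b = el z s z t" using e by blast
qed (auto simp: el_simps)

lemma field_inverse: "s : car K ==> s ~= z ==> EX i:car K. i \<otimes>\<^bsub>K\<^esub> s = o1"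
proof -
 assume "s : car K" "s ~= z"
 then have "s : Units K" using K.field_Units by simp
 then show ?thesis using K.Units_l_inv K.Units_inv_closed by blast
qed

text \<open>L1 and L2 are the radicals of the two indecomposable projectives. Both are
  one-dimensional, and on both an element acts through its e2 coefficient.\<close>

definition "L1 = {el z z t z | t. t : car K}"
definition "L2 = {el z z z t | t. t : car K}"

lemma e1_notin_L1: "e1 \<notin> L1"
proof
 assume "e1 : L1"
 then obtain t where t: "t : car K" "e1 = el z z t z" unfolding L1_def by blast
 then show False using t(1) by (simp add: el_eq_iff)
qed

lemma e2_notin_L2: "e2 \<notin> L2"
proof
 assume "e2 : L2"
 then obtain t where t: "t : car K" "e2 = el z z z t" unfolding L2_def by blast
 then show False using t(1) by (simp add: el_eq_iff)
qed

lemma local_P1: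
 shows "submod A (left_ideal e1) L1" "L1 ~= car (left_ideal e1)"
  "submod A (left_ideal e1) U ==> U <= L1 \<or> U = car (left_ideal e1)"
proof -
 let ?P = "left_ideal e1"
 note lP = fdD(1)[OF fd_left_ideal[OF units(1)]]
 show "submod A ?P L1"
 proof (rule submodI[OF lP])
  show "L1 <= car ?P" using P1_iff unfolding L1_def by blast
  have "\<zero>\<^bsub>?P\<^esub> = el z z z z" by (simp add: el_zero)
  then show "\<zero>\<^bsub>?P\<^esub> : L1" unfolding L1_def using K.zero_closed by blast
  show "x \<oplus>\<^bsub>?P\<^esub> y : L1" if xy: "x : L1" "y : L1" for x y
  proof -
   obtain s t where "s : car K" "t : car K" "x = el z z s z" "y = el z z t z" using xy unfolding L1_def by blast
   then have "x \<oplus>\<^bsub>?P\<^esub> y = el z z (s \<oplus>\<^bsub>K\<^esub> t) z" "s \<oplus>\<^bsub>K\<^esub> t : car K" by (simp_all add: el_add)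
   then show ?thesis unfolding L1_def by blast
  qed
  show "b \<odot>\<^bsub>?P\<^esub> x : L1" if b: "b : car A" and x: "x : L1" for b x
  proof -
   obtain p q r w where e: "p : car K" "q : car K" "r : car K" "w : car K" "b = el p q r w" by (rule elE[OF b])
   obtain t where "t : car K" "x = el z z t z" using x unfolding L1_def by blast
   then have "b \<odot>\<^bsub>?P\<^esub> x = el z z (q \<otimes>\<^bsub>K\<^esub> t) z" "q \<otimes>\<^bsub>K\<^esub> t : car K" using e by (simp_all add: el_mult)
   then show ?thesis unfolding L1_def by blast
  qed
 qed
 note e1_notin_L1
 moreover have "e1 : car ?P" using units by simp
 ultimately show "L1 ~= car ?P" by blast
 assume U: "submod A ?P U"
 show "U <= L1 \<or> U = car ?P"
 proof (rule disjCI)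
  assume ne: "U ~= car ?P"
  show "U <= L1"
  proof
   fix u assume u: "u : U"
   then obtain s t where st: "s : car K" "t : car K" "u = el s z t z" using subD(1)[OF U u] P1_iff by blast
   have "s = z"
   proof (rule ccontr)
    assume "s ~= z"
    then obtain i where i: "i : car K" "i \<otimes>\<^bsub>K\<^esub> s = o1" using field_inverse st(1) by blast
    \<comment> \<open>Left multiplication by i e1 erases the arrow part and normalises the e1 part
      to 1.\<close>
    have "el i z z z \<odot>\<^bsub>?P\<^esub> u : U" by (rule subD(4)[OF U _ u]) (simp add: el_closed i(1))
    then have eU: "e1 : U" using st i by (simp add: el_mult)
    have "b : U" if b: "b : car ?P" for b
     using subD(4)[OF U _ eU, of b] b by simp
    then show False using ne submod_subset[OF U] by blast
   qed
   then show "u : L1" using st unfolding L1_def by blast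
  qed
 qed
qed

lemma local_P2:
 shows "submod A (left_ideal e2) L2" "L2 ~= car (left_ideal e2)"
  "submod A (left_ideal e2) U ==> U <= L2 \<or> U = car (left_ideal e2)"
proof -
 let ?P = "left_ideal e2"
 note lP = fdD(1)[OF fd_left_ideal[OF units(2)]]
 show "submod A ?P L2"
 proof (rule submodI[OF lP])
  show "L2 <= car ?P" using P2_iff unfolding L2_def by blast
  have "\<zero>\<^bsub>?P\<^esub> = el z z z z" by (simp add: el_zero)
  then show "\<zero>\<^bsub>?P\<^esub> : L2" unfolding L2_def using K.zero_closed by blast
  show "x \<oplus>\<^bsub>?P\<^esub> y : L2" if xy: "x : L2" "y : L2" for x y
  proof -
   obtain s t where "s : car K" "t : car K" "x = el z z z s" "y = el z z z t" using xy unfolding L2_def by blast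
   then have "x \<oplus>\<^bsub>?P\<^esub> y = el z z z (s \<oplus>\<^bsub>K\<^esub> t)" "s \<oplus>\<^bsub>K\<^esub> t : car K" by (simp_all add: el_add)
   then show ?thesis unfolding L2_def by blast
  qed
  show "b \<odot>\<^bsub>?P\<^esub> x : L2" if b: "b : car A" and x: "x : L2" for b x
  proof -
   obtain p q r w where e: "p : car K" "q : car K" "r : car K" "w : car K" "b = el p q r w" by (rule elE[OF b])
   obtain t where "t : car K" "x = el z z z t" using x unfolding L2_def by blast
   then have "b \<odot>\<^bsub>?P\<^esub> x = el z z z (q \<otimes>\<^bsub>K\<^esub> t)" "q \<otimes>\<^bsub>K\<^esub> t : car K" using e by (simp_all add: el_mult)
   then show ?thesis unfolding L2_def by blast
  qed
 qed
 note e2_notin_L2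
 moreover have "e2 : car ?P" using units by simp
 ultimately show "L2 ~= car ?P" by blast
 assume U: "submod A ?P U"
 show "U <= L2 \<or> U = car ?P"
 proof (rule disjCI)
  assume ne: "U ~= car ?P"
  show "U <= L2"
  proof
   fix u assume u: "u : U"
   then obtain s t where st: "s : car K" "t : car K" "u = el z s z t" using subD(1)[OF U u] P2_iff by blast
   have "s = z"
   proof (rule ccontr)
    assume "s ~= z"
    then obtain i where i: "i : car K" "i \<otimes>\<^bsub>K\<^esub> s = o1" using field_inverse st(1) by blast
    \<comment> \<open>Since the loop squares to zero, i e2 + w x with w = - i t i is the inverse of
      s e2 + t x in the algebra spanned by e2 and the loop x.\<close>
    let ?w = "\<ominus>\<^bsub>K\<^esub> (i \<otimes>\<^bsub>K\<^esub> t \<otimes>\<^bsub>K\<^esub> i)"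
    have w: "?w : car K" using i st by simp
    have "i \<otimes>\<^bsub>K\<^esub> t \<oplus>\<^bsub>K\<^esub> ?w \<otimes>\<^bsub>K\<^esub> s = i \<otimes>\<^bsub>K\<^esub> t \<oplus>\<^bsub>K\<^esub> \<ominus>\<^bsub>K\<^esub> (i \<otimes>\<^bsub>K\<^esub> t \<otimes>\<^bsub>K\<^esub> (i \<otimes>\<^bsub>K\<^esub> s))"
     using i(1) st by (simp add: K.l_minus K.m_assoc)
    also have "\<dots> = z" using i st by (simp add: K.r_neg)
    finally have wz: "i \<otimes>\<^bsub>K\<^esub> t \<oplus>\<^bsub>K\<^esub> ?w \<otimes>\<^bsub>K\<^esub> s = z" .
    have "el z i z ?w \<odot>\<^bsub>?P\<^esub> u : U" by (rule subD(4)[OF U _ u]) (use el_closed i(1) w in simp)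
    moreover have "el z i z ?w \<odot>\<^bsub>?P\<^esub> u = e2"
     unfolding st(3) using st(1,2) i w by (simp add: el_mult wz)
    ultimately have eU: "e2 : U" by simp
    have "b : U" if b: "b : car ?P" for b
     using subD(4)[OF U _ eU, of b] b by simp
    then show False using ne submod_subset[OF U] by blast
   qed
   then show "u : L2" using st unfolding L2_def by blast
  qed
 qed
qed

text \<open>The square-zero ideal is spanned by the arrow and the loop, and the two characters read
  off the coefficients of e1 and e2; \<open>True\<close> stands for vertex 1.\<close>

lemma num_simples_eq: "num_simples K A = 2"
proof -
 define Pco where "Pco b t \<longleftrightarrow> fst t : car K & fst (snd t) : car K & fst (snd (snd t)) : car K
  & snd (snd (snd t)) : car K & b = el (fst t) (fst (snd t)) (fst (snd (snd t))) (snd (snd (snd t)))" for b t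
 define co where "co b = (SOME t. Pco b t)" for b
 have co: "co (el p q r w) = (p, q, r, w)" if "{p, q, r, w} <= car K" for p q r w
 proof -
  have "Pco (el p q r w) (p, q, r, w)" using that by (simp add: Pco_def)
  then have P: "Pco (el p q r w) (co (el p q r w))" unfolding co_def by (rule someI)
  obtain p' q' r' w' where c: "co (el p q r w) = (p', q', r', w')" by (cases "co (el p q r w)")
  have e: "el p q r w = el p' q' r' w'" and S: "{p, q, r, w, p', q', r', w'} <= car K"
   using P that unfolding c Pco_def by simp_all
  show ?thesis unfolding c using el_inj[OF e S] by simp
 qed
 define ch where "ch v b = (if v then fst (co b) else fst (snd (co b)))" for v b
 let ?N = "{el z z r w | r w. r : car K & w : car K}"
 have "num_simples K A = card (UNIV :: bool set)"
 proof (rule simple_characters[where e = "%v. if v then e1 else e2" and ch = ch and N = ?N])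
  show "(if v then e1 else e2) : car A" for v using units by simp
  show "ch v b : car K" if b: "b : car A" for v b
   by (rule elE[OF b]) (simp add: ch_def co)
  show "ch v (b \<oplus>\<^bsub>A\<^esub> c) = ch v b \<oplus>\<^bsub>K\<^esub> ch v c" if b: "b : car A" and c: "c : car A" for v b c
   by (rule elE[OF b], rule elE[OF c]) (simp add: ch_def co el_add)
  show "ch v (b \<cdot> c) = ch v b \<otimes>\<^bsub>K\<^esub> ch v c" if b: "b : car A" and c: "c : car A" for v b c
   by (rule elE[OF b], rule elE[OF c]) (simp add: ch_def co el_mult)
  show "ch v (sc c) = c" if "c : car K" for v c using that by (simp add: ch_def co el_scal)
  show "ch u (if v then e1 else e2) = (if u = v then \<one>\<^bsub>K\<^esub> else \<zero>\<^bsub>K\<^esub>)" for u v by (simp add: ch_def co)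
  show "?N <= car A" using el_closed by auto
  show "b \<cdot> n : ?N & n \<cdot> b : ?N" if b: "b : car A" and n: "n : ?N" for b n
  proof -
   obtain p q r w where e: "p : car K" "q : car K" "r : car K" "w : car K" "b = el p q r w" by (rule elE[OF b])
   obtain r' w' where n': "r' : car K" "w' : car K" "n = el z z r' w'" using n by blast
   have "b \<cdot> n = el z z (q \<otimes>\<^bsub>K\<^esub> r') (q \<otimes>\<^bsub>K\<^esub> w')" "n \<cdot> b = el z z (r' \<otimes>\<^bsub>K\<^esub> p) (w' \<otimes>\<^bsub>K\<^esub> q)"
    using e n' by (simp_all add: el_mult)
   then show ?thesis using e n' by blast
  qed
  show "n \<cdot> m = \<zero>\<^bsub>A\<^esub>" if n: "n : ?N" and m: "m : ?N" for n m
  proof -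
   obtain r w r' w' where "r : car K" "w : car K" "n = el z z r w" "r' : car K" "w' : car K" "m = el z z r' w'" using n m by blast
   then show ?thesis by (simp add: el_mult el_zero)
  qed
  show "EX n:?N. b \<cdot> (if v then e1 else e2) = (sc (ch v b)) \<cdot> (if v then e1 else e2) \<oplus>\<^bsub>A\<^esub> n" if b: "b : car A" for v b
  proof -
   obtain p q r w where e: "p : car K" "q : car K" "r : car K" "w : car K" "b = el p q r w" by (rule elE[OF b])
   show ?thesis
   proof (cases v)
    case True
    have "el z z r z : ?N" using e by blast
    then show ?thesis by (rule bexI[rotated]) (use e True in \<open>simp add: ch_def co el_scal el_mult el_add\<close>)
   next
    case False
    have "el z z z w : ?N" using e by blast
    then show ?thesis by (rule bexI[rotated]) (use e False in \<open>simp add: ch_def co el_scal el_mult el_add\<close>)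
   qed
  qed
  show "y = \<zero>\<^bsub>M\<^esub>" if M: "lmod M" and y: "y : car M" and h: "!!v. v : UNIV ==> (if v then e1 else e2) \<odot>\<^bsub>M\<^esub> y = \<zero>\<^bsub>M\<^esub>"
   for M :: "('k, 'a) smod" and y
  proof -
   interpret M: left_module A M by (rule M)
   have "e1 \<odot>\<^bsub>M\<^esub> y = \<zero>\<^bsub>M\<^esub>" "e2 \<odot>\<^bsub>M\<^esub> y = \<zero>\<^bsub>M\<^esub>" using h[of True] h[of False] by simp_all
   moreover have "\<one>\<^bsub>A\<^esub> = e1 \<oplus>\<^bsub>A\<^esub> e2" by (simp add: el_one el_add)
   ultimately show ?thesis using M.smult_l_distr[OF units(1,2) y] M.smult_one[OF y] by simp
  qed
 qed simp_all
 then show ?thesis by simp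
qed

text \<open>Here S is P_1 modulo its radical, the simple module at 1. The matching is the identity:
  the first summands coincide, and P_2 is linked to S by Ext^1(S, P_2), which is nonzero. The
  presentation P_2 -> P_1 of S kills the loop, and so does Y.\<close>

theorem ext_matched_not_faithful:
 "EX X Y. tau_tilting_family K A X & tau_tilting_family K A Y & ext_matched K A X Y
  & faithful A (total_sum K A X) & \<not> faithful A (total_sum K A Y)"
proof -
 let ?P1 = "left_ideal e1" and ?P2 = "left_ideal e2"
 note fP = fd_left_ideal[OF units(1)] fd_left_ideal[OF units(2)]
 note lP = fP[THEN fdD(1)]
 note pP = projective_left_ideal[OF units(1,5)] projective_left_ideal[OF units(2,6)]
 obtain X1 :: "('k, 'a) smod" and f1 where X1: "fdm X1" "f1 : Hom ?P1 X1" "bij_betw f1 (car ?P1) (car X1)"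
  by (rule std_copy[OF fP(1)]) (rule that)
 obtain X2 :: "('k, 'a) smod" and f2 where X2: "fdm X2" "f2 : Hom ?P2 X2" "bij_betw f2 (car ?P2) (car X2)"
  by (rule std_copy[OF fP(2)]) (rule that)
 note lX1 = fdD(1)[OF X1(1)] and lX2 = fdD(1)[OF X2(1)]
 have pX1: "proj X1" by (rule projective_iso[OF pP(1) lX1 X1(2,3)])
 have pX2: "proj X2" by (rule projective_iso[OF pP(2) lX2 X2(2,3)])
 interpret P1: left_module A ?P1 by (rule lP(1))
 interpret P2: left_module A ?P2 by (rule lP(2))
 interpret X1: left_module A X1 by (rule lX1)
 interpret X2: left_module A X2 by (rule lX2)
 have s1: "f1 ` car ?P1 = car X1" and i1: "inj_on f1 (car ?P1)" using X1(3) by (simp_all add: bij_betw_def)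
 have s2: "f2 ` car ?P2 = car X2" and i2: "inj_on f2 (car ?P2)" using X2(3) by (simp_all add: bij_betw_def)
 have sub: "submod A X1 (f1 ` L1)" by (rule submod_image[OF lP(1) lX1 X1(2) local_P1(1)])
 obtain S :: "('k, 'a) smod" and q where S: "fdm S" "q : Hom X1 S" "q ` car X1 = car S" and kq: "ker_of X1 S q = f1 ` L1"
  by (rule quotient_exists[OF X1(1) sub]) (rule that)
 note lS = fdD(1)[OF S(1)]
 interpret S: left_module A S by (rule lS)
 let ?g = "%b. q (f1 b)"
 have g: "?g : Hom ?P1 S" by (rule hcomp[OF X1(2) S(2)])
 have "?g ` car ?P1 = q ` (f1 ` car ?P1)" by (rule image_image[symmetric])
 then have gsurj: "?g ` car ?P1 = car S" by (simp only: s1 S(3))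
 have L1P: "L1 <= car ?P1" by (rule submod_subset[OF local_P1(1)])
 have kg: "?g b = \<zero>\<^bsub>S\<^esub> \<longleftrightarrow> b : L1" if b: "b : car ?P1" for b
 proof -
  have "?g b = \<zero>\<^bsub>S\<^esub> \<longleftrightarrow> f1 b : f1 ` L1" unfolding kq[symmetric] using homD(1)[OF X1(2) b] by simp
  also have "\<dots> \<longleftrightarrow> b : L1" using inj_on_image_mem_iff[OF i1 b L1P] .
  finally show ?thesis .
 qed
 have e1P: "e1 : car ?P1" and e2P: "e2 : car ?P2" using units by simp_all
 note e1L = e1_notin_L1
 have nzS: "car S ~= {\<zero>\<^bsub>S\<^esub>}" using homD(1)[OF g e1P] kg[OF e1P] e1L by auto
 have nz1: "car X1 ~= {\<zero>\<^bsub>X1\<^esub>}"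
  using homD(1)[OF X1(2) e1P] nzS S(3) X1.hom_zero[OF lS S(2)] by auto
 have e2nz: "e2 ~= \<zero>\<^bsub>A\<^esub>" and arrnz: "arr ~= \<zero>\<^bsub>A\<^esub>" and lpnz: "lp ~= \<zero>\<^bsub>A\<^esub>" by (simp_all add: el_zero el_eq_iff)
 have f2z: "b = \<zero>\<^bsub>A\<^esub>" if "b : car ?P2" "f2 b = \<zero>\<^bsub>X2\<^esub>" for b
  using inj_onD[OF i2, of b "\<zero>\<^bsub>?P2\<^esub>"] that P2.hom_zero[OF lX2 X2(2)] P2.M.zero_closed by simp
 have f1z: "b = \<zero>\<^bsub>A\<^esub>" if "b : car ?P1" "f1 b = \<zero>\<^bsub>X1\<^esub>" for b
  using inj_onD[OF i1, of b "\<zero>\<^bsub>?P1\<^esub>"] that P1.hom_zero[OF lX1 X1(2)] P1.M.zero_closed by simp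
 have nz2: "car X2 ~= {\<zero>\<^bsub>X2\<^esub>}" using homD(1)[OF X2(2) e2P] f2z[OF e2P] e2nz by auto
 have ind1: "indec X1"
  by (rule indecomposable_quotient_of_local[OF lP(1) local_P1(1,2) _ X1(1) nz1 X1(2) s1]) (rule local_P1(3))
 have ind2: "indec X2"
  by (rule indecomposable_quotient_of_local[OF lP(2) local_P2(1,2) _ X2(1) nz2 X2(2) s2]) (rule local_P2(3))
 have indS: "indec S"
  by (rule indecomposable_quotient_of_local[OF lP(1) local_P1(1,2) _ S(1) nzS g gsurj]) (rule local_P1(3))
 \<comment> \<open>The arrow annihilates P_2 and S but not P_1. Annihilation is invariant under
   isomorphism, which gives the non-isomorphisms needed in both families.\<close>
 have arr2: "arr \<odot>\<^bsub>X2\<^esub> x = \<zero>\<^bsub>X2\<^esub>" if x: "x : car X2" for x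
 proof -
  obtain b where b: "b : car ?P2" "x = f2 b" using x unfolding s2[symmetric] by blast
  obtain s t where st: "s : car K" "t : car K" "b = el z s z t" using b(1) P2_iff by blast
  have "arr \<odot>\<^bsub>?P2\<^esub> b = \<zero>\<^bsub>?P2\<^esub>" using st by (simp add: el_mult el_zero)
  then show ?thesis using homD(3)[OF X2(2) units(3) b(1)] b(2) P2.hom_zero[OF lX2 X2(2)] by simp
 qed
 have arrS: "arr \<odot>\<^bsub>S\<^esub> x = \<zero>\<^bsub>S\<^esub>" if x: "x : car S" for x
 proof -
  obtain b where b: "b : car ?P1" "x = ?g b" using x unfolding gsurj[symmetric] by blast
  obtain s t where st: "s : car K" "t : car K" "b = el s z t z" using b(1) P1_iff by blast
  have "arr \<odot>\<^bsub>?P1\<^esub> b = el z z s z" using st by (simp add: el_mult)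
  then have "arr \<odot>\<^bsub>?P1\<^esub> b : L1" using st unfolding L1_def by blast
  then have "?g (arr \<odot>\<^bsub>?P1\<^esub> b) = \<zero>\<^bsub>S\<^esub>" using kg L1P by blast
  then show ?thesis using homD(3)[OF g units(3) b(1)] b(2) by simp
 qed
 have e2S: "e2 \<odot>\<^bsub>S\<^esub> x = \<zero>\<^bsub>S\<^esub>" if x: "x : car S" for x
 proof -
  obtain b where b: "b : car ?P1" "x = ?g b" using x unfolding gsurj[symmetric] by blast
  obtain s t where st: "s : car K" "t : car K" "b = el s z t z" using b(1) P1_iff by blast
  have "e2 \<odot>\<^bsub>?P1\<^esub> b = el z z t z" using st by (simp add: el_mult)
  then have "e2 \<odot>\<^bsub>?P1\<^esub> b : L1" using st unfolding L1_def by blast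
  then have "?g (e2 \<odot>\<^bsub>?P1\<^esub> b) = \<zero>\<^bsub>S\<^esub>" using kg L1P by blast
  then show ?thesis using homD(3)[OF g units(2) b(1)] b(2) by simp
 qed
 have lp1: "lp \<odot>\<^bsub>X1\<^esub> x = \<zero>\<^bsub>X1\<^esub>" if x: "x : car X1" for x
 proof -
  obtain b where b: "b : car ?P1" "x = f1 b" using x unfolding s1[symmetric] by blast
  obtain s t where st: "s : car K" "t : car K" "b = el s z t z" using b(1) P1_iff by blast
  have "lp \<odot>\<^bsub>?P1\<^esub> b = \<zero>\<^bsub>?P1\<^esub>" using st by (simp add: el_mult el_zero)
  then show ?thesis using homD(3)[OF X1(2) units(4) b(1)] b(2) P1.hom_zero[OF lX1 X1(2)] by simp
 qed
 have arr1: "arr \<odot>\<^bsub>X1\<^esub> f1 e1 ~= \<zero>\<^bsub>X1\<^esub>"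
 proof
  assume a: "arr \<odot>\<^bsub>X1\<^esub> f1 e1 = \<zero>\<^bsub>X1\<^esub>"
  have ae: "arr \<cdot> e1 = arr" by (simp add: el_mult)
  have "f1 arr = \<zero>\<^bsub>X1\<^esub>" using homD(3)[OF X1(2) units(3) e1P] a ae by simp
  moreover have "arr : car ?P1" using units(3) ae by simp
  ultimately show False using f1z arrnz by blast
 qed
 have ni2: "\<not> mod_iso A X2 X1" "\<not> mod_iso A S X1"
  using annihilates_iso[OF lX1 units(3) _ arr2 lX2 homD(1)[OF X1(2) e1P]]
   annihilates_iso[OF lX1 units(3) _ arrS lS homD(1)[OF X1(2) e1P]] arr1 by blast+
 have ni1: "\<not> mod_iso A X1 X2" "\<not> mod_iso A X1 S" using mod_iso_sym[OF lX1 lX2] mod_iso_sym[OF lX1 lS] ni2 by blast+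
 \<comment> \<open>Right multiplication by the arrow, moved to the standard copies; its image is the
   radical of P_1.\<close>
 let ?d = "%m. f1 (inv_into (car ?P2) f2 m \<cdot> arr)"
 have dP: "(%b. b \<cdot> arr) : Hom ?P2 ?P1"
 proof (rule homI)
  fix b assume b: "b : car ?P2"
  have ae: "arr \<cdot> e1 = arr" by (simp add: el_mult)
  have "b : car A" using b by simp
  from A.m_assoc[OF this units(3,1)] have "b \<cdot> arr \<cdot> e1 = b \<cdot> arr" unfolding ae .
  then show "b \<cdot> arr : car ?P1" using A.m_closed[OF \<open>b : car A\<close> units(3)] by simp
 qed (use units in \<open>auto simp: A.l_distr A.m_assoc\<close>)
 have d: "?d : Hom X2 X1" by (rule hcomp[OF hcomp[OF hom_inv_into[OF lP(2) X2(2,3)] dP] X1(2)])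
 have df: "?d (f2 b) = f1 (b \<cdot> arr)" if "b : car ?P2" for b by (simp only: inv_into_f_f[OF i2 that])
 have prS: "presents X2 ?d X1 q S" unfolding presents_def
 proof (intro conjI pX2 pX1 lS S(2,3) d)
  show "?d ` car X2 = ker_of X1 S q" unfolding kq
  proof (rule equalityI; rule subsetI)
   fix y assume "y : ?d ` car X2"
   then obtain b where b: "b : car ?P2" "y = ?d (f2 b)" unfolding s2[symmetric] by blast
   obtain s t where st: "s : car K" "t : car K" "b = el z s z t" using b(1) P2_iff by blast
   have "b \<cdot> arr = el z z s z" using st by (simp add: el_mult)
   then have "b \<cdot> arr : L1" using st unfolding L1_def by blast
   then show "y : f1 ` L1" unfolding b(2) df[OF b(1)] by (rule imageI)
  next
   fix y assume "y : f1 ` L1"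
   then obtain t where t: "t : car K" "y = f1 (el z z t z)" unfolding L1_def by blast
   have b: "el z t z z : car ?P2" using P2_iff t(1) by blast
   have "el z t z z \<cdot> arr = el z z t z" using t(1) by (simp add: el_mult)
   then have "y = ?d (f2 (el z t z z))" using t(2) df[OF b] by simp
   then show "y : ?d ` car X2" using homD(1)[OF X2(2) b] by (rule image_eqI)
  qed
 qed
 have act2: "h (f2 b) = b \<odot>\<^bsub>M\<^esub> h (f2 e2)" if h: "h : Hom X2 M" and b: "b : car ?P2" for h b and M :: "('k, 'a) smod"
 proof -
  have "f2 b = b \<odot>\<^bsub>X2\<^esub> f2 e2" using homD(3)[OF X2(2) _ e2P, of b] b by simp
  then show ?thesis using homD(3)[OF h _ homD(1)[OF X2(2) e2P], of b] b by simp
 qed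
 \<comment> \<open>A map from P_2 to P_1 is determined by the image of e2, a vector fixed by e2 and
   hence a multiple c of the arrow. So the map is c times ?d, and multiplication by the central
   scalar c extends it.\<close>
 have l1: "lifts ?d X2 X1 X1" unfolding lifts_def
 proof
  fix h assume h: "h : Hom X2 X1"
  note m = homD(1)[OF h homD(1)[OF X2(2) e2P]]
  obtain v where v: "v : car ?P1" "h (f2 e2) = f1 v" using m unfolding s1[symmetric] by blast
  obtain s c where sc: "s : car K" "c : car K" "v = el s z c z" using v(1) P1_iff by blast
  have "e2 \<odot>\<^bsub>X1\<^esub> f1 v = f1 v" using act2[OF h e2P] v(2) by simp
  then have "f1 (e2 \<odot>\<^bsub>?P1\<^esub> v) = f1 v" using homD(3)[OF X1(2) units(2) v(1)] by simp
  then have "e2 \<odot>\<^bsub>?P1\<^esub> v = v" using inj_onD[OF i1] P1.smult_closed[OF units(2) v(1)] v(1) by blast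
  then have vc: "v = el z z c z" using sc by (simp add: el_mult)
  let ?c = "c \<odot>\<^bsub>A\<^esub> \<one>\<^bsub>A\<^esub>"
  note cA = scal_closed[OF sc(2)]
  have k: "(%m. ?c \<odot>\<^bsub>X1\<^esub> m) : Hom X1 X1"
  proof (rule homI)
   fix a m assume "a : car A" "m : car X1"
   then show "?c \<odot>\<^bsub>X1\<^esub> (a \<odot>\<^bsub>X1\<^esub> m) = a \<odot>\<^bsub>X1\<^esub> (?c \<odot>\<^bsub>X1\<^esub> m)"
    by (simp add: X1.smult_assoc1[symmetric] cA scal_central[OF sc(2)])
  qed (simp_all add: cA X1.smult_closed X1.smult_r_distr)
  show "EX k:Hom X1 X1. ALL x:car X2. k (?d x) = h x"
  proof (rule bexI[OF ballI k])
   fix x assume "x : car X2"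
   then obtain b where b: "b : car ?P2" "x = f2 b" unfolding s2[symmetric] by blast
   obtain s t where st: "s : car K" "t : car K" "b = el z s z t" using b(1) P2_iff by blast
   have bA: "b : car A" using b(1) by simp
   note ba = homD(1)[OF dP b(1)]
   have "?c \<odot>\<^bsub>X1\<^esub> ?d x = f1 (?c \<odot>\<^bsub>?P1\<^esub> (b \<cdot> arr))"
    unfolding b(2) df[OF b(1)] by (rule homD(3)[OF X1(2) cA ba, symmetric])
   also have "?c \<odot>\<^bsub>?P1\<^esub> (b \<cdot> arr) = b \<odot>\<^bsub>?P1\<^esub> v"
    unfolding vc st(3) el_scal[OF sc(2)] using st(1,2) sc(2) by (simp add: el_mult K.m_comm)
   also have "f1 (b \<odot>\<^bsub>?P1\<^esub> v) = h x" using homD(3)[OF X1(2) bA v(1)] act2[OF h b(1)] b(2) v(2) by simp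
   finally show "?c \<odot>\<^bsub>X1\<^esub> ?d x = h x" .
  qed
 qed
 \<comment> \<open>e2 kills S, so every map from P_2 to S is zero and the zero map extends
   it.\<close>
 have lS': "lifts ?d X2 X1 S" unfolding lifts_def
 proof
  fix h assume h: "h : Hom X2 S"
  note m = homD(1)[OF h homD(1)[OF X2(2) e2P]]
  have w: "h (f2 e2) = \<zero>\<^bsub>S\<^esub>" using act2[OF h e2P] e2S[OF m] by simp
  have hz: "h x = \<zero>\<^bsub>S\<^esub>" if x: "x : car X2" for x
  proof -
   obtain b where b: "b : car ?P2" "x = f2 b" using x unfolding s2[symmetric] by blast
   then show ?thesis using act2[OF h b(1)] w S.smult_zero_right[of b] by simp
  qed
  show "EX k:Hom X1 S. ALL x:car X2. k (?d x) = h x"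
   by (rule bexI[OF ballI hom_zero_map[OF lS]]) (simp add: hz)
 qed
 define X Y where "X i = (if i = 1 then X1 else X2)" and "Y i = (if i = 1 then X1 else S)" for i :: nat
 have XY: "X 1 = X1" "X 2 = X2" "Y 1 = X1" "Y 2 = S" by (simp_all add: X_def Y_def)
 have I: "{1..num_simples K A} = {1, 2}" by (auto simp: num_simples_eq)
 have I2: "{2, 1} = {1, 2 :: nat}" by auto
 have lXi: "lmod (X i)" for i using lX1 lX2 by (simp add: X_def)
 have lYi: "lmod (Y i)" for i using lX1 lS by (simp add: Y_def)
 obtain a1 a2 a3 a4 where bX: "biprod (direct_sum {2, 1} X) (X 2) (X 1) a1 a2 a3 a4"
  by (rule biprod_pair[of "2 :: nat" 1 X]) (rule lXi, simp, rule that)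
 obtain b1 b2 b3 b4 where bY: "biprod (direct_sum {2, 1} Y) (Y 2) (Y 1) b1 b2 b3 b4"
  by (rule biprod_pair[of "2 :: nat" 1 Y]) (rule lYi, simp, rule that)
 have tX: "tau_rigid K A (direct_sum {1, 2} X)"
 proof -
  have "proj (direct_sum {1, 2} X)"
   using projective_biprod[OF bX] pX1 pX2 unfolding XY I2 by blast
  note p = presents_projective[OF this left_module_direct_sum[OF lXi]]
  show ?thesis by (rule tau_rigidI[OF p])
 qed
 \<comment> \<open>The presentation of S with P_1 added in degree zero presents Y; both summands
   have the lifting property for ?d.\<close>
 have tY: "tau_rigid K A (direct_sum {1, 2} Y)"
 proof -
  have lY': "lifts ?d X2 X1 (direct_sum {2, 1} Y)"
   by (rule lifts_biprod[OF bY]) (simp_all only: XY l1 lS')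
  obtain P' :: "('k, 'a) smod" and d' e' where p: "presents X2 d' P' e' (direct_sum {2, 1} Y)"
   and l: "lifts d' X2 P' (direct_sum {2, 1} Y)"
  proof (rule presents_add_projective[OF prS pX1 bY[unfolded XY]])
   fix P' :: "('k, 'a) smod" and d' e'
   assume a: "presents X2 d' P' e' (direct_sum {2, 1} Y)" "!!N :: ('a, nat => nat => 'k) module. lifts ?d X2 X1 N ==> lifts d' X2 P' N"
   show thesis by (rule that[OF a(1) a(2)[OF lY']])
  qed
  show ?thesis using tau_rigidI[OF p l] unfolding I2 .
 qed
 have famI: "tau_tilting_family K A Z"
  if i: "indec (Z 1)" "indec (Z 2)" and n: "\<not> mod_iso A (Z 1) (Z 2)" "\<not> mod_iso A (Z 2) (Z 1)"
   and t: "tau_rigid K A (direct_sum {1, 2} Z)" for Z :: "nat => ('k, 'a) smod"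
 proof -
  have lT: "lmod (direct_sum {1, 2} Z)" using t fdD(1) unfolding tau_rigid_def by blast
  have r: "mod_iso A (direct_sum {1, 2} Z) (direct_sum {1, 2} Z)"
   by (rule mod_isoI[OF lT hom_id[OF lT]]) (simp add: bij_betw_def)
  show ?thesis unfolding tau_tilting_family_def tau_tilting_def total_sum_def I
   by (intro conjI exI[of _ Z] t r) (use i n in auto)
 qed
 have famX: "tau_tilting_family K A X" by (rule famI) (simp_all only: XY ind1 ind2 ni1 ni2 not_False_eq_True tX)
 have famY: "tau_tilting_family K A Y" by (rule famI) (simp_all only: XY ind1 indS ni1 ni2 not_False_eq_True tY)
 have ext: "\<not> Ext1_zero K A S X2"
 proof
  assume E: "Ext1_zero K A S X2"
  \<comment> \<open>The map from the radical of P_1 to P_2 that sends t times the arrow to t times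
    the loop; \<open>THE\<close> recovers t from the element.\<close>
  let ?G = "%y. f2 (THE b. EX t:car K. y = el z z t z & b = el z z z t)"
  have G: "?G (el z z t z) = f2 (el z z z t)" if t: "t : car K" for t
  proof -
   have "(THE b. EX t':car K. el z z t z = el z z t' z & b = el z z z t') = el z z z t"
    by (rule the_equality) (use t in \<open>auto simp: el_eq_iff\<close>)
   then show ?thesis by simp
  qed
  have cP2: "el z z z t : car ?P2" if "t : car K" for t using P2_iff that by blast
  have "?G : Hom (?P1(|carrier := L1|)) X2"
  proof (rule homI)
   fix y assume "y : car (?P1(|carrier := L1|))"
   then obtain t where t: "t : car K" "y = el z z t z" unfolding L1_def by auto
   show "?G y : car X2" unfolding t(2) G[OF t(1)] by (rule homD(1)[OF X2(2) cP2[OF t(1)]])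
   fix y' assume "y' : car (?P1(|carrier := L1|))"
   then obtain t' where t': "t' : car K" "y' = el z z t' z" unfolding L1_def by auto
   have s: "t \<oplus>\<^bsub>K\<^esub> t' : car K" using t t' by simp
   have "y \<oplus>\<^bsub>?P1(|carrier := L1|)\<^esub> y' = el z z (t \<oplus>\<^bsub>K\<^esub> t') z" using t t' by (simp add: el_add)
   moreover have "el z z z t \<oplus>\<^bsub>?P2\<^esub> el z z z t' = el z z z (t \<oplus>\<^bsub>K\<^esub> t')" using t t' by (simp add: el_add)
   ultimately show "?G (y \<oplus>\<^bsub>?P1(|carrier := L1|)\<^esub> y') = ?G y \<oplus>\<^bsub>X2\<^esub> ?G y'"
    unfolding t(2) t'(2) G[OF t(1)] G[OF t'(1)] using homD(2)[OF X2(2) cP2[OF t(1)] cP2[OF t'(1)]] G[OF s] by (simp only:)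
  next
   fix b y assume b: "b : car A" and "y : car (?P1(|carrier := L1|))"
   then obtain t where t: "t : car K" "y = el z z t z" unfolding L1_def by auto
   obtain p q r w where e: "p : car K" "q : car K" "r : car K" "w : car K" "b = el p q r w" by (rule elE[OF b])
   have s: "q \<otimes>\<^bsub>K\<^esub> t : car K" using t e by simp
   have "b \<odot>\<^bsub>?P1(|carrier := L1|)\<^esub> y = el z z (q \<otimes>\<^bsub>K\<^esub> t) z" using t e by (simp add: el_mult)
   moreover have "b \<odot>\<^bsub>?P2\<^esub> el z z z t = el z z z (q \<otimes>\<^bsub>K\<^esub> t)" using t e by (simp add: el_mult)
   ultimately show "?G (b \<odot>\<^bsub>?P1(|carrier := L1|)\<^esub> y) = b \<odot>\<^bsub>X2\<^esub> ?G y"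
    unfolding t(2) G[OF t(1)] using homD(3)[OF X2(2) b cP2[OF t(1)]] G[OF s] by (simp only:)
  qed
  moreover have "ker_of ?P1 S ?g = L1" using kg L1P by blast
  ultimately have Gh: "?G : Hom (?P1(|carrier := ker_of ?P1 S ?g|)) X2" by (simp only:)
  obtain k where k: "k : Hom ?P1 X2" "!!x. x : car ?P1 ==> ?g x = \<zero>\<^bsub>S\<^esub> ==> k x = ?G x"
   by (rule Ext1_zero_extend[OF S(1) lX2 E pP(1) g gsurj Gh]) (rule that)
  \<comment> \<open>An extension k to P_1 would send arr = arr e1 to arr k(e1), which is zero as the
    arrow kills P_2; but on the radical it has to send arr to the loop.\<close>
  have arrL: "arr : L1" unfolding L1_def by blast
  have aP: "arr : car ?P1" using arrL L1P by blast
  have "k arr = f2 lp" using k(2)[OF aP] kg[OF aP] arrL G[OF K.one_closed] by simp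
  moreover have "arr = arr \<odot>\<^bsub>?P1\<^esub> e1" by (simp add: el_mult)
  then have "k arr = arr \<odot>\<^bsub>X2\<^esub> k e1" using homD(3)[OF k(1) units(3) e1P] by simp
  then have "k arr = \<zero>\<^bsub>X2\<^esub>" using arr2[OF homD(1)[OF k(1) e1P]] by simp
  ultimately show False using f2z[OF cP2[OF K.one_closed]] lpnz by simp
 qed
 have matched: "ext_matched K A X Y" unfolding ext_matched_def I
 proof (intro exI[of _ id] conjI permutes_id ballI)
  have r: "mod_iso A X1 X1" by (rule mod_isoI[OF lX1 hom_id[OF lX1]]) (simp add: bij_betw_def)
  fix i :: nat assume "i : {1, 2}"
  then show "mod_iso A (X i) (Y (id i)) \<or> \<not> Ext1_zero K A (X i) (Y (id i)) \<or> \<not> Ext1_zero K A (Y (id i)) (X i)"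
   using r ext XY by auto
 qed
 have fX: "faithful A (total_sum K A X)" unfolding faithful_def total_sum_def I
 proof (rule equalityI; rule subsetI)
  fix b assume "b : annihilator A (direct_sum {1, 2} X)"
  then have b: "b : car A" "!!x. x : car X1 ==> b \<odot>\<^bsub>X1\<^esub> x = \<zero>\<^bsub>X1\<^esub>" "!!x. x : car X2 ==> b \<odot>\<^bsub>X2\<^esub> x = \<zero>\<^bsub>X2\<^esub>"
   unfolding zero_annihilates[OF lXi] using XY by auto
  have "f1 (b \<odot>\<^bsub>?P1\<^esub> e1) = \<zero>\<^bsub>X1\<^esub>" using homD(3)[OF X1(2) b(1) e1P] b(2)[OF homD(1)[OF X1(2) e1P]] by (simp only:)
  then have "b \<odot>\<^bsub>?P1\<^esub> e1 = \<zero>\<^bsub>A\<^esub>" by (rule f1z[OF P1.smult_closed[OF b(1) e1P]])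
  moreover have "f2 (b \<odot>\<^bsub>?P2\<^esub> e2) = \<zero>\<^bsub>X2\<^esub>" using homD(3)[OF X2(2) b(1) e2P] b(3)[OF homD(1)[OF X2(2) e2P]] by (simp only:)
  then have "b \<odot>\<^bsub>?P2\<^esub> e2 = \<zero>\<^bsub>A\<^esub>" by (rule f2z[OF P2.smult_closed[OF b(1) e2P]])
  moreover have "\<one>\<^bsub>A\<^esub> = e1 \<oplus>\<^bsub>A\<^esub> e2" by (simp add: el_one el_add)
  then have "b = b \<cdot> e1 \<oplus>\<^bsub>A\<^esub> b \<cdot> e2" using A.r_one[OF b(1)] A.r_distr[OF units(1,2) b(1)] by (simp only:)
  ultimately show "b : {\<zero>\<^bsub>A\<^esub>}" by simp
 next
  fix b assume "b : {\<zero>\<^bsub>A\<^esub>}"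
  then show "b : annihilator A (direct_sum {1, 2} X)" unfolding zero_annihilates[OF lXi] using XY by simp
 qed
 \<comment> \<open>The loop kills e1, and it kills the arrow as a path of length two; so it
   annihilates P_1 and its quotient S.\<close>
 have "lp \<odot>\<^bsub>S\<^esub> x = \<zero>\<^bsub>S\<^esub>" if x: "x : car S" for x
 proof -
  obtain y where y: "y : car X1" "x = q y" using x unfolding S(3)[symmetric] by blast
  show ?thesis using homD(3)[OF S(2) units(4) y(1)] lp1[OF y(1)] X1.hom_zero[OF lS S(2)] y(2) by simp
 qed
 then have "lp : annihilator A (direct_sum {1, 2} Y)" unfolding zero_annihilates[OF lYi] using XY lp1 units(4) by simp
 then have "\<not> faithful A (total_sum K A Y)" using lpnz unfolding faithful_def total_sum_def I by blast
 then show ?thesis using famX famY matched fX by blast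
qed

end

section \<open>Truncating the path algebra at paths of length two\<close>

context quiver_path_algebra
begin

definition "J = genideal R (quiver_relations K Q)"

lemma ideal_J: "ideal J R"
 unfolding J_def by (rule R.genideal_ideal) (auto simp: quiver_relations_def)

text \<open>Factors of a path are not longer than the path, so elements supported in lengths at
  least two form an ideal. Conversely each such element is a sum of scalar multiples of single
  paths, and each of these is a relation by itself.\<close>

lemma J_eq: "J = {x : car R. ALL p. length (parrows p) \<le> 1 --> x p = \<zero>\<^bsub>K\<^esub>}" (is "_ = ?I")
proof (rule equalityI)
 have prod: "x \<star> a : ?I & a \<star> x : ?I" if a: "a : ?I" and x: "x : car R" for a x
 proof -
  have aR: "a : car R" using a by simp
  have s: "length (parrows p) \<le> length (parrows w) & length (parrows q) \<le> length (parrows w)" if "(p, q) : splits Q w" for p q w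
   using that by (auto simp: splits_def)
  have "(x \<star> a) w = \<zero>\<^bsub>K\<^esub> & (a \<star> x) w = \<zero>\<^bsub>K\<^esub>" if w: "length (parrows w) \<le> 1" for w
  proof -
   have 0: "a p = \<zero>\<^bsub>K\<^esub> & a q = \<zero>\<^bsub>K\<^esub>" if "(p, q) : splits Q w" for p q
   proof -
    have "length (parrows p) \<le> 1" "length (parrows q) \<le> 1" using s[OF that] w by linarith+
    then show ?thesis using a by blast
   qed
   have "(%(p, q). x p \<otimes>\<^bsub>K\<^esub> a q) t = \<zero>\<^bsub>K\<^esub> & (%(p, q). a p \<otimes>\<^bsub>K\<^esub> x q) t = \<zero>\<^bsub>K\<^esub>" if "t : splits Q w" for t
    using 0[of "fst t" "snd t"] that closed[OF x] by (simp add: split_beta)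
   then show ?thesis unfolding ops(4) by (intro conjI K.add.finprod_one_eqI) blast+
  qed
  then show ?thesis using mult_in[OF x aR] mult_in[OF aR x] by simp
 qed
 have "ideal ?I R"
 proof (rule idealI[OF ring_path_algebra])
  show "subgroup ?I (add_monoid R)"
  proof (rule group.subgroupI[OF R.a_group])
   have "\<zero>\<^bsub>R\<^esub> : ?I" by (simp add: R.zero_closed[unfolded ops(2)] ops(2))
   then show "?I ~= {}" by blast
   fix a assume a: "a : ?I"
   have "\<ominus>\<^bsub>R\<^esub> a : ?I"
   proof -
    have aR: "a : car R" using a by simp
    have "(\<ominus>\<^bsub>R\<^esub> a) p = \<zero>\<^bsub>K\<^esub>" if "a p = \<zero>\<^bsub>K\<^esub>" for p
    proof -
     have "(\<ominus>\<^bsub>R\<^esub> a \<oplus>\<^bsub>R\<^esub> a) p = \<zero>\<^bsub>K\<^esub>" unfolding R.l_neg[OF aR] ops(2) ..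
     then show ?thesis using that closed[OF R.a_inv_closed[OF aR]] by (simp add: ops(1))
    qed
    then show ?thesis using a R.a_inv_closed[OF aR] by simp
   qed
   then show "inv\<^bsub>add_monoid R\<^esub> a : ?I" by (simp add: a_inv_def)
   fix b assume b: "b : ?I"
   have "a \<oplus>\<^bsub>R\<^esub> b : ?I" using add_in[of a b] a b by (simp add: ops(1))
   then show "a \<otimes>\<^bsub>add_monoid R\<^esub> b : ?I" by simp
  qed auto
 qed (use prod in blast)+
 moreover have "quiver_relations K Q <= ?I"
 proof
  fix r assume r: "r : quiver_relations K Q"
  then obtain u v where uv: "!!p. r p ~= \<zero>\<^bsub>K\<^esub> ==> 2 \<le> length (parrows p)" unfolding quiver_relations_def by blast
  have "r p = \<zero>\<^bsub>K\<^esub>" if "length (parrows p) \<le> 1" for p using uv[of p] that by linarith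
  then show "r : ?I" using r unfolding quiver_relations_def by blast
 qed
 ultimately show "J <= ?I" unfolding J_def by (rule R.genideal_minimal)
next
 interpret J: ideal J R by (rule ideal_J)
 have *: "x : J" if "finite S" "x : ?I" "{p. x p ~= \<zero>\<^bsub>K\<^esub>} <= S" for S x
  using that
 proof (induction S arbitrary: x)
  case empty
  then have "x = \<zero>\<^bsub>R\<^esub>" unfolding ops(2) by auto
  then show ?case by simp
 next
  case (insert p S)
  note xR = CollectD[OF insert.prems(1), THEN conjunct1] and x0 = CollectD[OF insert.prems(1), THEN conjunct2]
  let ?m = "%q. if q = p then x p else \<zero>\<^bsub>K\<^esub>" and ?y = "%q. if q = p then \<zero>\<^bsub>K\<^esub> else x q"
  have mR: "?m : car R" unfolding carrier_iff
   using closed[OF xR] outside[OF xR] finite_subset[of "{q. ?m q ~= \<zero>\<^bsub>K\<^esub>}" "{p}"] by auto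
  have "{q. ?y q ~= \<zero>\<^bsub>K\<^esub>} <= {q. x q ~= \<zero>\<^bsub>K\<^esub>}" by auto
  moreover have "finite {q. x q ~= \<zero>\<^bsub>K\<^esub>}" using xR unfolding carrier_iff by blast
  ultimately have "finite {q. ?y q ~= \<zero>\<^bsub>K\<^esub>}" by (rule finite_subset)
  then have yR: "?y : car R" unfolding carrier_iff using closed[OF xR] outside[OF xR] by auto
  have "?y : J"
  proof (rule insert.IH)
   show "?y : ?I" using yR x0 by simp
   show "{q. ?y q ~= \<zero>\<^bsub>K\<^esub>} <= S" using insert.prems(2) by auto
  qed
  moreover have "?m : quiver_relations K Q"
  proof -
   have "psource q = psource p & ptarget q = ptarget p & 2 \<le> length (parrows q)" if "?m q ~= \<zero>\<^bsub>K\<^esub>" for q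
   proof -
    have "q = p" "x p ~= \<zero>\<^bsub>K\<^esub>" using that by (auto split: if_splits)
    moreover have "\<not> length (parrows p) \<le> 1" using x0 \<open>x p ~= \<zero>\<^bsub>K\<^esub>\<close> by blast
    ultimately show ?thesis by auto
   qed
   then show ?thesis unfolding quiver_relations_def using mR by blast
  qed
  then have "?m : J" unfolding J_def using R.genideal_self[of "quiver_relations K Q"] by (auto simp: quiver_relations_def)
  ultimately have "?m \<oplus>\<^bsub>R\<^esub> ?y : J" by simp
  moreover have "?m \<oplus>\<^bsub>R\<^esub> ?y = x" unfolding ops(1) by (rule ext) (simp add: closed[OF xR])
  ultimately show ?case by simp
 qed
 show "?I <= J"
 proof
  fix x assume x: "x : ?I"
  then have "finite {p. x p ~= \<zero>\<^bsub>K\<^esub>}" using carrier_iff by blast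
  then show "x : J" by (rule *[OF _ x]) simp
 qed
qed

lemma coset_eq_iff:
 assumes f: "f : car R" and g: "g : car R"
 shows "J +>\<^bsub>R\<^esub> f = J +>\<^bsub>R\<^esub> g \<longleftrightarrow> (ALL p:qpaths Q. length (parrows p) \<le> 1 --> f p = g p)"
proof
 interpret J: ideal J R by (rule ideal_J)
 assume "J +>\<^bsub>R\<^esub> f = J +>\<^bsub>R\<^esub> g"
 then have "f : J +>\<^bsub>R\<^esub> g" using J.a_rcos_self[OF f] by simp
 then obtain j where j: "j : J" "f = j \<oplus>\<^bsub>R\<^esub> g" unfolding a_r_coset_def' by blast
 show "ALL p:qpaths Q. length (parrows p) \<le> 1 --> f p = g p"
 proof (intro ballI impI)
  fix p :: "('v, 'e) qpath" assume "length (parrows p) \<le> 1"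
  then have "j p = \<zero>\<^bsub>K\<^esub>" using j(1) unfolding J_eq by blast
  then show "f p = g p" unfolding j(2) ops(1) using closed[OF g] by simp
 qed
next
 interpret J: ideal J R by (rule ideal_J)
 assume eq: "ALL p:qpaths Q. length (parrows p) \<le> 1 --> f p = g p"
 let ?j = "f \<ominus>\<^bsub>R\<^esub> g"
 have jR: "?j : car R" using f g by simp
 have fj: "f = ?j \<oplus>\<^bsub>R\<^esub> g" using f g by (simp add: a_minus_def R.a_assoc R.l_neg)
 have "?j p = \<zero>\<^bsub>K\<^esub>" if "length (parrows p) \<le> 1" for p
 proof -
  have A: "f p = g p" using eq that outside[OF f, of p] outside[OF g, of p] by (cases "p : qpaths Q") simp_all
  have B: "f p = ?j p \<oplus>\<^bsub>K\<^esub> g p" using fun_cong[OF fj, of p] unfolding ops(1) .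
  have "?j p \<oplus>\<^bsub>K\<^esub> g p = g p" using B[symmetric] A by (rule trans)
  then show ?thesis using K.add.r_cancel_one[OF closed[OF g] closed[OF jR], of p p] by simp
 qed
 then have "?j : J" unfolding J_eq using jR by blast
 then have "f : J +>\<^bsub>R\<^esub> g" unfolding a_r_coset_def' using fj by blast
 then show "J +>\<^bsub>R\<^esub> f = J +>\<^bsub>R\<^esub> g" using R.a_repr_independence[OF _ g J.a_subgroup] by simp
qed

lemma vectorspace_quot_algebra:
 assumes I: "ideal I R"
 shows "vectorspace K (quot_algebra R I)"
proof -
 let ?A = "quot_algebra R I"
 note o = quot_ops[OF I]
 interpret A: ring ?A by (rule o(1))
 have "Module.module K ?A"
 proof (intro Module.module.intro K.is_cring A.abelian_group_axioms Module.module_axioms.intro)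
  fix c d X Y
  show "c \<odot>\<^bsub>?A\<^esub> X : car ?A" if c: "c : car K" and X: "X : car ?A"
  proof -
   obtain x where x: "x : car R" "X = I +>\<^bsub>R\<^esub> x" using o(2)[OF X] by blast
   show ?thesis unfolding x(2) o(8)[OF c x(1)] by (rule o(3)[OF smult_in[OF c x(1)]])
  qed
  show "(c \<oplus>\<^bsub>K\<^esub> d) \<odot>\<^bsub>?A\<^esub> X = c \<odot>\<^bsub>?A\<^esub> X \<oplus>\<^bsub>?A\<^esub> d \<odot>\<^bsub>?A\<^esub> X" if c: "c : car K" "d : car K" and X: "X : car ?A"
  proof -
   obtain x where x: "x : car R" "X = I +>\<^bsub>R\<^esub> x" using o(2)[OF X] by blast
   have "(c \<oplus>\<^bsub>K\<^esub> d) \<bullet> x = c \<bullet> x \<oplus>\<^bsub>R\<^esub> d \<bullet> x" unfolding ops(1,3) using c closed[OF x(1)] by (simp add: K.l_distr)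
   then show ?thesis
    unfolding x(2) o(8)[OF K.a_closed[OF c] x(1)] o(8)[OF c(1) x(1)] o(8)[OF c(2) x(1)] o(5)[OF smult_in[OF c(1) x(1)] smult_in[OF c(2) x(1)]]
    by (simp only:)
  qed
  show "c \<odot>\<^bsub>?A\<^esub> (X \<oplus>\<^bsub>?A\<^esub> Y) = c \<odot>\<^bsub>?A\<^esub> X \<oplus>\<^bsub>?A\<^esub> c \<odot>\<^bsub>?A\<^esub> Y" if c: "c : car K" and X: "X : car ?A" and Y: "Y : car ?A"
  proof -
   obtain x y where x: "x : car R" "X = I +>\<^bsub>R\<^esub> x" and y: "y : car R" "Y = I +>\<^bsub>R\<^esub> y" using o(2)[OF X] o(2)[OF Y] by blast
   have "c \<bullet> (x \<oplus>\<^bsub>R\<^esub> y) = c \<bullet> x \<oplus>\<^bsub>R\<^esub> c \<bullet> y" unfolding ops(1,3) using c closed[OF x(1)] closed[OF y(1)] by (simp add: K.r_distr)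
   then show ?thesis
    unfolding x(2) y(2) o(5)[OF x(1) y(1)] o(8)[OF c add_in[OF x(1) y(1)]] o(8)[OF c x(1)] o(8)[OF c y(1)]
     o(5)[OF smult_in[OF c x(1)] smult_in[OF c y(1)]]
    by (simp only:)
  qed
  show "(c \<otimes>\<^bsub>K\<^esub> d) \<odot>\<^bsub>?A\<^esub> X = c \<odot>\<^bsub>?A\<^esub> (d \<odot>\<^bsub>?A\<^esub> X)" if c: "c : car K" "d : car K" and X: "X : car ?A"
  proof -
   obtain x where x: "x : car R" "X = I +>\<^bsub>R\<^esub> x" using o(2)[OF X] by blast
   have "(c \<otimes>\<^bsub>K\<^esub> d) \<bullet> x = c \<bullet> (d \<bullet> x)" unfolding ops(3) using c closed[OF x(1)] by (simp add: K.m_assoc)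
   then show ?thesis
    unfolding x(2) o(8)[OF K.m_closed[OF c] x(1)] o(8)[OF c(2) x(1)] o(8)[OF c(1) smult_in[OF c(2) x(1)]] by (simp only:)
  qed
  show "\<one>\<^bsub>K\<^esub> \<odot>\<^bsub>?A\<^esub> X = X" if X: "X : car ?A"
  proof -
   obtain x where x: "x : car R" "X = I +>\<^bsub>R\<^esub> x" using o(2)[OF X] by blast
   have "\<one>\<^bsub>K\<^esub> \<bullet> x = x" unfolding ops(3) using closed[OF x(1)] by simp
   then show ?thesis unfolding x(2) o(8)[OF K.one_closed x(1)] by (simp only:)
  qed
 qed
 then show ?thesis unfolding vectorspace_def using K.field_axioms by simp
qed

lemma short_path:
 assumes p: "p : qpaths Q" "length (parrows p) \<le> 1"
 shows "p : (%v. (v, [], v)) ` verts Q \<union> (%a. (tail Q a, [a], head Q a)) ` arcs Q"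
proof (cases "parrows p")
   case Nil
   then show ?thesis using p(1) trivial_path by blast
  next
   case (Cons a l)
   then have l: "parrows p = [a]" using p(2) by simp
   then have "a : arcs Q" "psource p = tail Q a" "ptarget p = head Q a" using p(1) by (auto simp: qpaths_iff pre_digraph.cas.simps)
   then have "p = (tail Q a, [a], head Q a)" using l by (cases p) (simp add: psource_def ptarget_def parrows_def)
   then show ?thesis using \<open>a : arcs Q\<close> by blast
  qed

text \<open>The classes of the trivial paths and the arrows span the quotient: a coset does not
  change when longer paths are dropped from a representative.\<close>

lemma fin_dim_quot_algebra: "fin_dim_space K (quot_algebra R J)"
proof -
 let ?A = "quot_algebra R J"
 note o = quot_ops[OF ideal_J]
 interpret V: vectorspace K ?A by (rule vectorspace_quot_algebra[OF ideal_J])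
 let ?S = "{p : qpaths Q. length (parrows p) \<le> 1}"
 define \<delta> where "\<delta> p = (%q. if q = p then \<one>\<^bsub>K\<^esub> else \<zero>\<^bsub>K\<^esub>)" for p :: "('v, 'e) qpath"
 have "?S <= (%v. (v, [], v)) ` verts Q \<union> (%a. (tail Q a, [a], head Q a)) ` arcs Q" using short_path by blast
 then have finS: "finite ?S" by (rule finite_subset) simp
 have dR: "\<delta> p : car R" if "p : qpaths Q" for p
  unfolding carrier_iff using that finite_subset[of "{q. \<delta> p q ~= \<zero>\<^bsub>K\<^esub>}" "{p}"] by (auto simp: \<delta>_def)
 let ?B = "(%p. J +>\<^bsub>R\<^esub> \<delta> p) ` ?S"
 have B: "?B <= car ?A" using o(3) dR by blast
 have sp: "LinearCombinations.submodule K (V.span ?B) ?A" by (rule V.span_is_submodule[OF B])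
 note spD = sp[unfolded LinearCombinations.submodule_def]
 have *: "J +>\<^bsub>R\<^esub> f : V.span ?B" if "finite S" "S <= ?S" "f : car R" "{p. f p ~= \<zero>\<^bsub>K\<^esub>} <= S" for S f
  using that
 proof (induction S arbitrary: f)
  case empty
  then have "f = \<zero>\<^bsub>R\<^esub>" unfolding ops(2) by auto
  then have "J +>\<^bsub>R\<^esub> f = \<zero>\<^bsub>?A\<^esub>" using o(7) by simp
  then show ?case using spD by simp
 next
  case (insert p S)
  note fR = insert.prems(2)
  have pQ: "p : ?S" using insert.prems(1) by blast
  let ?y = "%q. if q = p then \<zero>\<^bsub>K\<^esub> else f q"
  have "{q. ?y q ~= \<zero>\<^bsub>K\<^esub>} <= {q. f q ~= \<zero>\<^bsub>K\<^esub>}" by auto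
  moreover have "finite {q. f q ~= \<zero>\<^bsub>K\<^esub>}" using fR unfolding carrier_iff by blast
  ultimately have "finite {q. ?y q ~= \<zero>\<^bsub>K\<^esub>}" by (rule finite_subset)
  then have yR: "?y : car R" unfolding carrier_iff using closed[OF fR] outside[OF fR] by auto
  have y: "J +>\<^bsub>R\<^esub> ?y : V.span ?B"
   by (rule insert.IH) (use insert.prems yR in auto)
  have fp: "f p : car K" by (rule closed[OF fR])
  have d: "J +>\<^bsub>R\<^esub> \<delta> p : V.span ?B" using V.in_own_span[OF B] pQ by blast
  have dp: "\<delta> p : car R" using dR pQ by blast
  have "f = f p \<bullet> \<delta> p \<oplus>\<^bsub>R\<^esub> ?y" unfolding ops(1,3) \<delta>_def by (rule ext) (simp add: closed[OF fR])
  then have "J +>\<^bsub>R\<^esub> f = J +>\<^bsub>R\<^esub> (f p \<bullet> \<delta> p \<oplus>\<^bsub>R\<^esub> ?y)" by (rule arg_cong)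
  also have "\<dots> = f p \<odot>\<^bsub>?A\<^esub> (J +>\<^bsub>R\<^esub> \<delta> p) \<oplus>\<^bsub>?A\<^esub> (J +>\<^bsub>R\<^esub> ?y)"
   unfolding o(8)[OF fp dp] by (rule o(5)[OF smult_in[OF fp dp] yR, symmetric])
  finally show ?case using spD fp d y by simp
 qed
 have "car ?A <= V.span ?B"
 proof
  fix X assume "X : car ?A"
  then obtain f where f: "f : car R" "X = J +>\<^bsub>R\<^esub> f" using o(2) by blast
  let ?g = "%p. if length (parrows p) \<le> 1 then f p else \<zero>\<^bsub>K\<^esub>"
  have "{q. ?g q ~= \<zero>\<^bsub>K\<^esub>} <= {q. f q ~= \<zero>\<^bsub>K\<^esub>}" by auto
  moreover have "finite {q. f q ~= \<zero>\<^bsub>K\<^esub>}" using f(1) unfolding carrier_iff by blast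
  ultimately have "finite {q. ?g q ~= \<zero>\<^bsub>K\<^esub>}" by (rule finite_subset)
  then have gR: "?g : car R" unfolding carrier_iff using closed[OF f(1)] outside[OF f(1)] by auto
  have "X = J +>\<^bsub>R\<^esub> ?g" unfolding f(2) coset_eq_iff[OF f(1) gR] by simp
  moreover have "{p. ?g p ~= \<zero>\<^bsub>K\<^esub>} <= ?S" using outside[OF f(1)] by (auto split: if_splits)
  ultimately show "X : V.span ?B" using *[OF finS subset_refl gR] by simp
 qed
 then have "V.span ?B = car ?A" using V.span_is_subset2[OF B] by blast
 then have "V.fin_dim" unfolding V.fin_dim_def using finS B by (intro exI[of _ ?B]) simp
 then show ?thesis unfolding fin_dim_space_def using V.vectorspace_axioms by simp
qed

lemma quiver_algebra_J: "verts Q ~= {} ==> quiver_algebra K (quot_algebra R J)"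
 unfolding quiver_algebra_def
 by (intro exI[of _ Q] exI[of _ "quiver_relations K Q"] conjI)
  (simp_all add: Q.fin_digraph_axioms fin_dim_quot_algebra J_def[symmetric])

lemma mult_vertex:
 assumes f: "f : car R" and g: "g : car R" and v: "v : verts Q"
 shows "(f \<star> g) (v, [], v) = f (v, [], v) \<otimes>\<^bsub>K\<^esub> g (v, [], v)"
proof -
 let ?v = "(v, [], v)"
 have q: "?v : qpaths Q" using v trivial_path by blast
 have "(p, q) : splits Q ?v \<longleftrightarrow> p = ?v & q = ?v" for p q
  using q by (auto simp: splits_def qpath_eq_iff qpaths_iff pre_digraph.cas.simps) (auto simp: psource_def ptarget_def parrows_def)
 note iff = this
 have "splits Q ?v = {(?v, ?v)}"
 proof (rule Set.set_eqI)
  fix x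
  show "x : splits Q ?v \<longleftrightarrow> x : {(?v, ?v)}" using iff[of "fst x" "snd x"] by (cases x) simp
 qed
 then show ?thesis unfolding ops(4) using closed[OF f] closed[OF g] by simp
qed

text \<open>A path of length one factors in two ways only, with the trivial path at its target on
  the left or the one at its source on the right. These are the two terms in the arrow and loop
  coordinates of \<open>el_mult\<close>.\<close>

lemma mult_arrow:
 assumes f: "f : car R" and g: "g : car R" and a: "a : arcs Q"
 shows "(f \<star> g) (tail Q a, [a], head Q a) = f (head Q a, [], head Q a) \<otimes>\<^bsub>K\<^esub> g (tail Q a, [a], head Q a)
  \<oplus>\<^bsub>K\<^esub> f (tail Q a, [a], head Q a) \<otimes>\<^bsub>K\<^esub> g (tail Q a, [], tail Q a)"
proof -
 let ?z = "(tail Q a, [a], head Q a)" and ?t = "(head Q a, [], head Q a)" and ?s = "(tail Q a, [], tail Q a)"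
 have sel: "psource (u, l, w) = u" "parrows (u, l, w) = l" "ptarget (u, l, w) = w" for u w :: 'v and l :: "'e list"
  by (simp_all add: psource_def ptarget_def parrows_def)
 have q: "?z : qpaths Q" "?t : qpaths Q" "?s : qpaths Q" using a by (simp_all add: qpaths_iff sel pre_digraph.cas.simps)
 have "(p, q) : splits Q ?z \<longleftrightarrow> (p, q) = (?t, ?z) \<or> (p, q) = (?z, ?s)" for p q
 proof
  assume s: "(p, q) : splits Q ?z"
  then have e: "psource q = tail Q a" "parrows q @ parrows p = [a]" "ptarget p = head Q a" "ptarget q = psource p" "p : qpaths Q" "q : qpaths Q"
   by (auto simp: splits_def path_comp_def)
  from e(2) consider "parrows q = []" "parrows p = [a]" | "parrows q = [a]" "parrows p = []" by (auto simp: append_eq_Cons_conv)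
  then show "(p, q) = (?t, ?z) \<or> (p, q) = (?z, ?s)"
  proof cases
   case 1
   then have "ptarget q = tail Q a" using e by (simp add: qpaths_iff pre_digraph.cas.simps)
   then show ?thesis using 1 e by (simp add: qpath_eq_iff sel)
  next
   case 2
   then have "psource p = head Q a" using e by (simp add: qpaths_iff pre_digraph.cas.simps)
   then show ?thesis using 2 e by (simp add: qpath_eq_iff sel)
  qed
 next
  assume "(p, q) = (?t, ?z) \<or> (p, q) = (?z, ?s)"
  then show "(p, q) : splits Q ?z"
  proof
   assume "(p, q) = (?t, ?z)"
   then show ?thesis using q by (simp add: splits_def path_comp_def sel)
  next
   assume "(p, q) = (?z, ?s)"
   then show ?thesis using q by (simp add: splits_def path_comp_def sel)
  qed
 qed
 note iff = this
 have S: "splits Q ?z = {(?t, ?z), (?z, ?s)}"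
 proof (rule Set.set_eqI)
  fix x
  show "x : splits Q ?z \<longleftrightarrow> x : {(?t, ?z), (?z, ?s)}" using iff[of "fst x" "snd x"] by (cases x) simp
 qed
 have ne: "(?t, ?z) \<notin> {(?z, ?s)}" by simp
 show ?thesis unfolding ops(4) S using closed[OF f] closed[OF g] by (simp add: K.finsum_insert[OF _ ne])
qed

end

text \<open>Edge 0 runs from 1 to 2 and edge 1 is the loop at 2; both have head 2.\<close>

definition loop_arrow_quiver :: "(nat, nat) pre_digraph" where
 "loop_arrow_quiver = (|verts = {1, 2}, arcs = {0, 1}, tail = (%a. if a = 0 then 1 else 2), head = (%_. 2)|)"

definition point_quiver :: "(nat, nat) pre_digraph" where
 "point_quiver = (|verts = {1}, arcs = {}, tail = (%_. 1), head = (%_. 1)|)"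

lemma loop_arrow_quiver_simps [simp]:
 "verts loop_arrow_quiver = {1, 2}" "arcs loop_arrow_quiver = {0, 1}"
 "tail loop_arrow_quiver = (%a. if a = 0 then 1 else 2)" "head loop_arrow_quiver = (%_. 2)"
 by (simp_all add: loop_arrow_quiver_def)

lemma point_quiver_simps [simp]: "verts point_quiver = {1}" "arcs point_quiver = {}"
 by (simp_all add: point_quiver_def)

lemma fin_digraph_loop_arrow: "fin_digraph loop_arrow_quiver"
 by unfold_locales auto

lemma fin_digraph_point: "fin_digraph point_quiver"
 by unfold_locales auto

lemma loop_arrow_example:
 fixes K :: "'k ring"
 assumes K: "field K"
 shows "\<exists>(A :: ('k, nat, nat) qalgebra) el. quiver_algebra K A & loop_arrow_algebra K A el"
proof -
 interpret P: quiver_path_algebra K loop_arrow_quiver by (intro quiver_path_algebra.intro K fin_digraph_loop_arrow)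
 let ?Q = loop_arrow_quiver
 let ?R = "path_algebra K ?Q"
 let ?A = "quot_algebra ?R P.J"
 define v1 v2 pa px :: "(nat, nat) qpath" where "v1 = (1, [], 1)" and "v2 = (2, [], 2)" and "pa = (1, [0], 2)" and "px = (2, [1], 2)"
 note defs = v1_def v2_def pa_def px_def
 have dist: "v1 ~= v2" "v1 ~= pa" "v1 ~= px" "v2 ~= pa" "v2 ~= px" "pa ~= px"
  "v2 ~= v1" "pa ~= v1" "px ~= v1" "pa ~= v2" "px ~= v2" "px ~= pa" by (simp_all add: defs)
 have inQ: "v1 : qpaths ?Q" "v2 : qpaths ?Q" "pa : qpaths ?Q" "px : qpaths ?Q"
  by (simp_all add: defs qpaths_iff psource_def ptarget_def parrows_def pre_digraph.cas.simps)
 have len: "length (parrows v1) \<le> 1" "length (parrows v2) \<le> 1" "length (parrows pa) \<le> 1" "length (parrows px) \<le> 1"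
  by (simp_all add: defs parrows_def)
 have short: "x = v1 \<or> x = v2 \<or> x = pa \<or> x = px" if "x : qpaths ?Q" "length (parrows x) \<le> 1" for x
  using P.short_path[OF that] by (auto simp: defs)
 have eq: "P.J +>\<^bsub>?R\<^esub> f = P.J +>\<^bsub>?R\<^esub> g \<longleftrightarrow> f v1 = g v1 & f v2 = g v2 & f pa = g pa & f px = g px"
  if f: "f : car ?R" and g: "g : car ?R" for f g
 proof
  assume "P.J +>\<^bsub>?R\<^esub> f = P.J +>\<^bsub>?R\<^esub> g"
  then have h: "ALL p:qpaths ?Q. length (parrows p) \<le> 1 --> f p = g p" using P.coset_eq_iff[OF f g] by (rule iffD1[rotated])
  show "f v1 = g v1 & f v2 = g v2 & f pa = g pa & f px = g px"
   using h[rule_format, OF inQ(1) len(1)] h[rule_format, OF inQ(2) len(2)] h[rule_format, OF inQ(3) len(3)] h[rule_format, OF inQ(4) len(4)] by simp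
 next
  assume h: "f v1 = g v1 & f v2 = g v2 & f pa = g pa & f px = g px"
  have "ALL p:qpaths ?Q. length (parrows p) \<le> 1 --> f p = g p"
  proof (intro ballI impI)
   fix p assume "p : qpaths ?Q" "length (parrows p) \<le> 1"
   from short[OF this] show "f p = g p" using h by (elim disjE) simp_all
  qed
  then show "P.J +>\<^bsub>?R\<^esub> f = P.J +>\<^bsub>?R\<^esub> g" using P.coset_eq_iff[OF f g] by (rule iffD2[rotated])
 qed
 \<comment> \<open>F lists the coefficients on the four paths of length at most one and vanishes
   elsewhere; by \<open>eq\<close> its cosets are exactly the elements of the quotient, each
   once.\<close>
 define F where "F p q r w = (%x. if x = v1 then p else if x = v2 then q else if x = pa then r else if x = px then w else \<zero>\<^bsub>K\<^esub>)" for p q r w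
 have FR: "F p q r w : car ?R" if "p : car K" "q : car K" "r : car K" "w : car K" for p q r w
  unfolding P.carrier_iff
 proof (intro conjI allI impI)
  show "F p q r w x : car K" for x using \<open>p : car K\<close> \<open>q : car K\<close> \<open>r : car K\<close> \<open>w : car K\<close> by (simp only: F_def split: if_split) simp
  have "{x. F p q r w x ~= \<zero>\<^bsub>K\<^esub>} <= {v1, v2, pa, px}" by (auto simp only: F_def split: if_splits)
  then show "finite {x. F p q r w x ~= \<zero>\<^bsub>K\<^esub>}" by (rule finite_subset) simp
  fix x assume "x \<notin> qpaths ?Q"
  then have "x ~= v1" "x ~= v2" "x ~= pa" "x ~= px" using inQ by blast+
  then show "F p q r w x = \<zero>\<^bsub>K\<^esub>" by (simp only: F_def if_False)
 qed
 have Fv: "F p q r w v1 = p" "F p q r w v2 = q" "F p q r w pa = r" "F p q r w px = w" for p q r w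
  by (simp_all add: F_def dist)
 note o = P.quot_ops[OF P.ideal_J]
 have qa: "quiver_algebra K ?A" by (rule P.quiver_algebra_J) simp
 interpret A: kalg K ?A by (rule quiver_algebra_kalg[OF K qa])
 have vert: "(f \<otimes>\<^bsub>?R\<^esub> g) v1 = f v1 \<otimes>\<^bsub>K\<^esub> g v1" "(f \<otimes>\<^bsub>?R\<^esub> g) v2 = f v2 \<otimes>\<^bsub>K\<^esub> g v2"
  "(f \<otimes>\<^bsub>?R\<^esub> g) pa = f v2 \<otimes>\<^bsub>K\<^esub> g pa \<oplus>\<^bsub>K\<^esub> f pa \<otimes>\<^bsub>K\<^esub> g v1"
  "(f \<otimes>\<^bsub>?R\<^esub> g) px = f v2 \<otimes>\<^bsub>K\<^esub> g px \<oplus>\<^bsub>K\<^esub> f px \<otimes>\<^bsub>K\<^esub> g v2"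
  if f: "f : car ?R" and g: "g : car ?R" for f g
  using P.mult_vertex[OF f g, of 1] P.mult_vertex[OF f g, of 2] P.mult_arrow[OF f g, of 0] P.mult_arrow[OF f g, of 1]
  by (simp_all add: defs)
 have "loop_arrow_algebra K ?A (%p q r w. P.J +>\<^bsub>?R\<^esub> F p q r w)"
 proof (intro loop_arrow_algebra.intro A.kalg_axioms loop_arrow_algebra_axioms.intro)
  fix p q r w assume "p : car K" "q : car K" "r : car K" "w : car K"
  then show "P.J +>\<^bsub>?R\<^esub> F p q r w : car ?A" by (intro o(3) FR)
 next
  fix b assume "b : car ?A"
  then obtain f where f: "f : car ?R" "b = P.J +>\<^bsub>?R\<^esub> f" using o(2) by blast
  note c = P.closed[OF f(1)]
  have "b = P.J +>\<^bsub>?R\<^esub> F (f v1) (f v2) (f pa) (f px)" unfolding f(2) eq[OF f(1) FR[OF c c c c]] by (simp add: Fv)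
  then show "EX p:car K. EX q:car K. EX r:car K. EX w:car K. b = P.J +>\<^bsub>?R\<^esub> F p q r w"
   using c by blast
 next
  fix p q r w p' q' r' w' assume e: "P.J +>\<^bsub>?R\<^esub> F p q r w = P.J +>\<^bsub>?R\<^esub> F p' q' r' w'" and s: "{p, q, r, w, p', q', r', w'} <= car K"
  have "F p q r w : car ?R" "F p' q' r' w' : car ?R" using s by (simp_all add: FR)
  from eq[OF this] show "p = p' & q = q' & r = r' & w = w'" using e by (simp add: Fv)
 next
  fix p q r w p' q' r' w' assume s: "{p, q, r, w, p', q', r', w'} <= car K"
  have c: "F p q r w : car ?R" "F p' q' r' w' : car ?R" using s by (simp_all add: FR)
  have d: "F (p \<oplus>\<^bsub>K\<^esub> p') (q \<oplus>\<^bsub>K\<^esub> q') (r \<oplus>\<^bsub>K\<^esub> r') (w \<oplus>\<^bsub>K\<^esub> w') : car ?R" using s by (simp add: FR)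
  show "(P.J +>\<^bsub>?R\<^esub> F p q r w) \<oplus>\<^bsub>?A\<^esub> (P.J +>\<^bsub>?R\<^esub> F p' q' r' w')
    = P.J +>\<^bsub>?R\<^esub> F (p \<oplus>\<^bsub>K\<^esub> p') (q \<oplus>\<^bsub>K\<^esub> q') (r \<oplus>\<^bsub>K\<^esub> r') (w \<oplus>\<^bsub>K\<^esub> w')"
   unfolding o(5)[OF c] eq[OF P.add_in[OF c] d] by (simp add: P.ops(1) Fv)
  have d: "F (p \<otimes>\<^bsub>K\<^esub> p') (q \<otimes>\<^bsub>K\<^esub> q') (q \<otimes>\<^bsub>K\<^esub> r' \<oplus>\<^bsub>K\<^esub> r \<otimes>\<^bsub>K\<^esub> p') (q \<otimes>\<^bsub>K\<^esub> w' \<oplus>\<^bsub>K\<^esub> w \<otimes>\<^bsub>K\<^esub> q') : car ?R"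
   using s by (simp add: FR)
  show "(P.J +>\<^bsub>?R\<^esub> F p q r w) \<otimes>\<^bsub>?A\<^esub> (P.J +>\<^bsub>?R\<^esub> F p' q' r' w')
    = P.J +>\<^bsub>?R\<^esub> F (p \<otimes>\<^bsub>K\<^esub> p') (q \<otimes>\<^bsub>K\<^esub> q') (q \<otimes>\<^bsub>K\<^esub> r' \<oplus>\<^bsub>K\<^esub> r \<otimes>\<^bsub>K\<^esub> p') (q \<otimes>\<^bsub>K\<^esub> w' \<oplus>\<^bsub>K\<^esub> w \<otimes>\<^bsub>K\<^esub> q')"
   unfolding o(4)[OF c] eq[OF P.mult_in[OF c] d] by (simp add: vert[OF c] Fv)
 next
  fix c assume c: "c : car K"
  note z = P.K.zero_closed
  have one: "\<one>\<^bsub>?R\<^esub> v1 = \<one>\<^bsub>K\<^esub>" "\<one>\<^bsub>?R\<^esub> v2 = \<one>\<^bsub>K\<^esub>" "\<one>\<^bsub>?R\<^esub> pa = \<zero>\<^bsub>K\<^esub>" "\<one>\<^bsub>?R\<^esub> px = \<zero>\<^bsub>K\<^esub>"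
   using inQ by (simp_all add: P.ops(5) defs parrows_def)
  show "c \<odot>\<^bsub>?A\<^esub> \<one>\<^bsub>?A\<^esub> = P.J +>\<^bsub>?R\<^esub> F c c \<zero>\<^bsub>K\<^esub> \<zero>\<^bsub>K\<^esub>"
   unfolding o(6) o(8)[OF c P.one_in] eq[OF P.smult_in[OF c P.one_in] FR[OF c c z z]]
   using c by (simp add: P.ops(3) one Fv)
 qed
 then show ?thesis using qa by blast
qed

text \<open>The only path is the trivial one, so J is the zero ideal and the quotient is K itself.
  Writing it as a quotient by J lets it share the general facts about truncation.\<close>

lemma scalar_example:
 fixes K :: "'k ring"
 assumes K: "field K"
 shows "\<exists>A :: ('k, nat, nat) qalgebra. quiver_algebra K A & kalg K A & \<one>\<^bsub>A\<^esub> ~= \<zero>\<^bsub>A\<^esub>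
  & (ALL a:car A. EX c:car K. a = c \<odot>\<^bsub>A\<^esub> \<one>\<^bsub>A\<^esub>)"
proof -
 interpret P: quiver_path_algebra K point_quiver by (intro quiver_path_algebra.intro K fin_digraph_point)
 let ?R = "path_algebra K point_quiver"
 let ?A = "quot_algebra ?R P.J"
 note o = P.quot_ops[OF P.ideal_J]
 define v1 :: "(nat, nat) qpath" where "v1 = (1, [], 1)"
 have v1: "v1 : qpaths point_quiver" "length (parrows v1) \<le> 1" "parrows v1 = []"
  by (simp_all add: v1_def qpaths_iff psource_def ptarget_def parrows_def pre_digraph.cas.simps)
 have short: "x = v1" if "x : qpaths point_quiver" "length (parrows x) \<le> 1" for x
  using P.short_path[OF that] by (simp add: v1_def)
 have eq: "P.J +>\<^bsub>?R\<^esub> f = P.J +>\<^bsub>?R\<^esub> g \<longleftrightarrow> f v1 = g v1" if f: "f : car ?R" and g: "g : car ?R" for f g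
 proof
  assume "P.J +>\<^bsub>?R\<^esub> f = P.J +>\<^bsub>?R\<^esub> g"
  then have h: "ALL p:qpaths point_quiver. length (parrows p) \<le> 1 --> f p = g p" using P.coset_eq_iff[OF f g] by (rule iffD1[rotated])
  show "f v1 = g v1" by (rule h[rule_format, OF v1(1,2)])
 next
  assume h: "f v1 = g v1"
  have "ALL p:qpaths point_quiver. length (parrows p) \<le> 1 --> f p = g p"
  proof (intro ballI impI)
   fix p assume "p : qpaths point_quiver" "length (parrows p) \<le> 1"
   from short[OF this] show "f p = g p" using h by simp
  qed
  then show "P.J +>\<^bsub>?R\<^esub> f = P.J +>\<^bsub>?R\<^esub> g" using P.coset_eq_iff[OF f g] by (rule iffD2[rotated])
 qed
 have one: "\<one>\<^bsub>?R\<^esub> v1 = \<one>\<^bsub>K\<^esub>" using v1 by (simp add: P.ops(5))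
 have "\<one>\<^bsub>?A\<^esub> ~= \<zero>\<^bsub>?A\<^esub>" unfolding o(6,7) eq[OF P.one_in P.R.zero_closed] one by (simp add: P.ops(2))
 moreover have "EX c:car K. a = c \<odot>\<^bsub>?A\<^esub> \<one>\<^bsub>?A\<^esub>" if a: "a : car ?A" for a
 proof -
  obtain f where f: "f : car ?R" "a = P.J +>\<^bsub>?R\<^esub> f" using o(2)[OF a] by blast
  note c = P.closed[OF f(1), of v1]
  have "a = f v1 \<odot>\<^bsub>?A\<^esub> \<one>\<^bsub>?A\<^esub>"
   unfolding f(2) o(6) o(8)[OF c P.one_in] eq[OF f(1) P.smult_in[OF c P.one_in]] using c by (simp add: P.ops(3) one)
  then show ?thesis using c by blast
 qed
 moreover have qa: "quiver_algebra K ?A" by (rule P.quiver_algebra_J) simp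
 ultimately show ?thesis using quiver_algebra_kalg[OF K qa] by blast
qed


theorem theorem2p5:
  fixes K :: "'k ring"
  assumes "field K"
  shows
    \<comment> \<open>(i)\<close>
    "(\<forall>(A :: ('k, 'v, 'e) qalgebra) X Y.
        quiver_algebra K A \<and> tau_tilting_family K A X \<and> tau_tilting_family K A Y \<longrightarrow>
          (faithful A (total_sum K A X) \<and> faithful A (total_sum K A Y) \<longrightarrow> ext_matched K A X Y)
        \<and> (tilting K A (total_sum K A X) \<and> tilting K A (total_sum K A Y) \<longrightarrow> ext_matched K A X Y))
    \<and> \<comment> \<open>(ii)\<close>
     (\<exists>(A :: ('k, nat, nat) qalgebra) X Y.
        quiver_algebra K A \<and> tau_tilting_family K A X \<and> tau_tilting_family K A Y
        \<and> ext_matched K A X Y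
        \<and> faithful A (total_sum K A X) \<and> \<not> faithful A (total_sum K A Y))
    \<and> \<comment> \<open>(iii)\<close>
     (\<exists>A :: ('k, nat, nat) qalgebra.
        quiver_algebra K A
        \<and> (\<forall>X Y. tau_tilting_family K A X \<and> tau_tilting_family K A Y \<and> ext_matched K A X Y \<longrightarrow>
             faithful A (total_sum K A X) \<and> faithful A (total_sum K A Y)))"
proof (intro conjI allI impI)
 fix A :: "('k, 'v, 'e) qalgebra" and X Y
 assume a: "quiver_algebra K A \<and> tau_tilting_family K A X \<and> tau_tilting_family K A Y"
 then have A: "kalg K A" and X: "tau_tilting_family K A X" and Y: "tau_tilting_family K A Y"
  using quiver_algebra_kalg[OF assms] by blast+
 note m = kalg.ext_matched_of_faithful_or_tilting[OF A X Y]
 show "ext_matched K A X Y" if "faithful A (total_sum K A X) \<and> faithful A (total_sum K A Y)"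
  using m that by blast
 show "ext_matched K A X Y" if "tilting K A (total_sum K A X) \<and> tilting K A (total_sum K A Y)"
  using m that by blast
next
 obtain A :: "('k, nat, nat) qalgebra" and el where A: "quiver_algebra K A" "loop_arrow_algebra K A el"
  using loop_arrow_example[OF assms] by blast
 from loop_arrow_algebra.ext_matched_not_faithful[OF A(2)] A(1)
 show "\<exists>(A :: ('k, nat, nat) qalgebra) X Y.
    quiver_algebra K A \<and> tau_tilting_family K A X \<and> tau_tilting_family K A Y
    \<and> ext_matched K A X Y
    \<and> faithful A (total_sum K A X) \<and> \<not> faithful A (total_sum K A Y)" by blast
next
 obtain A :: "('k, nat, nat) qalgebra" where A: "quiver_algebra K A" "kalg K A" "\<one>\<^bsub>A\<^esub> \<noteq> \<zero>\<^bsub>A\<^esub>"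
  "\<forall>a\<in>carrier A. \<exists>c\<in>carrier K. a = c \<odot>\<^bsub>A\<^esub> \<one>\<^bsub>A\<^esub>"
  using scalar_example[OF assms] by blast
 have "faithful A (total_sum K A X)" if "tau_tilting_family K A X" for X
  by (rule kalg.faithful_of_scalars[OF A(2) _ A(3) that]) (rule bspec[OF A(4)])
 then show "\<exists>A :: ('k, nat, nat) qalgebra.
    quiver_algebra K A
    \<and> (\<forall>X Y. tau_tilting_family K A X \<and> tau_tilting_family K A Y \<and> ext_matched K A X Y \<longrightarrow>
      faithful A (total_sum K A X) \<and> faithful A (total_sum K A Y))"
  using A(1) by (intro exI[of _ A]) simp
qed

end
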